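(* Let $d\ge 1$, let $\alpha\in(0,1)$, let $p>1$ be a real number, and let $r:(0,\infty)\to\mathbb{R}$ be a bounded Borel function. Let $T$ be the linear operator $$Tf(x)=\int_0^\infty t\, r(t)\int_{|h|<t^{2/\alpha}}\big[-(Q_t\tau_{h/2}-Q_t\tau_{-h/2})^2\big](f)(x)\,\frac{dh}{|h|^{d+\alpha}}\,dt ,\qquad x\in\mathbb{R}^d,$$ defined for $f\in C_c^\infty(\mathbb{R}^d)$, where $(Q_t)_{t>0}$ is the semigroup associated with $\alpha$ and $\tau_h$ denotes translation, both as defined in the context. Then $T$ is a bounded operator on $L^p(\mathbb{R}^d)$.
   Context: For $\alpha\in(0,2)$, $p(s,x,y)$ ($s>0$, $x,y\in\mathbb{R}^d$) denotes the transition density of the rotationally symmetric $\alpha$-stable process $Y$ on $\mathbb{R}^d$, i.e. the Lévy process with characteristic function $\mathbb{E}(e^{i\xi\cdot Y_s})=e^{-s|\xi|^\alpha}$ (started at $0$); thus $p(s,x,y)=p(s,x-y,0)$. Its semigroup is $P_sf(x)=\int_{\mathbb{R}^d} f(y)\,p(s,x,y)\,dy$. For $t>0$ let $\mu_t$ be the probability measure on $(0,\infty)$ $$\mu_t(ds)=\frac{t}{2\sqrt{\pi}}\,e^{-t^2/(4s)}s^{-3/2}\,ds,$$ and define $Q_tf=\int_0^\infty P_sf\,\mu_t(ds)$. Then $Q_t$ is convolution with the probability density $q_t(x)=\int_0^\infty p(s,x,0)\,\mu_t(ds)$, whose Fourier transform is $\widehat{q_t}(\xi)=e^{-t|\xi|^{\alpha/2}}$.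 The translation operator is $\tau_hf(x)=f(x+h)$. The square in the definition of $T$ is composition of operators; since $Q_t$ is a semigroup commuting with translations, writing $f_t=Q_tf$, $$\big[-(Q_t\tau_{h/2}-Q_t\tau_{-h/2})^2\big](f)(x)=2f_{2t}(x)-f_{2t}(x+h)-f_{2t}(x-h).$$ For $\alpha\in(0,1)$ and $f\in C_c^\infty(\mathbb{R}^d)$ (smooth compactly supported functions) the integral defining $Tf(x)$ converges absolutely for every $x$. "Bounded operator on $L^p(\mathbb{R}^d)$" means that there is a finite constant $C$ (not depending on $f$) such that $\|Tf\|_p\le C\|f\|_p$ for all $f\in C_c^\infty(\mathbb{R}^d)$, so that $T$ extends to a bounded linear operator on $L^p(\mathbb{R}^d)$. *)

theory Defs
  imports "HOL-Probability.Probability"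
begin

definition cadlag :: "(real \<Rightarrow> 'a::topological_space) \<Rightarrow> bool" where
  "cadlag w \<longleftrightarrow>
     (\<forall>t\<ge>0. (w \<longlongrightarrow> w t) (at_right t)) \<and>
     (\<forall>t>0. \<exists>l. (w \<longlongrightarrow> l) (at_left t))"

text \<open>A process is a family indexed by all reals of which only the times \<open>t \<ge> 0\<close> matter.\<close>

definition levy_process ::
    "'w measure \<Rightarrow> (real \<Rightarrow> 'w \<Rightarrow> 'a::euclidean_space) \<Rightarrow> bool" where
  "levy_process M Y \<longleftrightarrow>
     prob_space M \<and>
     (\<forall>t\<ge>0. Y t \<in> borel_measurable M) \<and>
     (AE \<omega> in M. Y 0 \<omega> = 0) \<and>
     (\<forall>(n::nat) t. 0 \<le> t 0 \<longrightarrow> (\<forall>i<n. t i \<le> t (Suc i)) \<longrightarrow>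
        prob_space.indep_vars M (\<lambda>_. borel) (\<lambda>i \<omega>. Y (t (Suc i)) \<omega> - Y (t i) \<omega>) {..<n}) \<and>
     (\<forall>s t. 0 \<le> s \<longrightarrow> s \<le> t \<longrightarrow>
        distr M borel (\<lambda>\<omega>. Y t \<omega> - Y s \<omega>) = distr M borel (Y (t - s))) \<and>
     (\<forall>t\<ge>0. \<forall>\<epsilon>>0.
        ((\<lambda>s. measure M {\<omega> \<in> space M. dist (Y s \<omega>) (Y t \<omega>) > \<epsilon>}) \<longlongrightarrow> 0) (at t within {0..})) \<and>
     (AE \<omega> in M. cadlag (\<lambda>t. Y t \<omega>))"

definition isotropic_stable_process ::
    "real \<Rightarrow> 'w measure \<Rightarrow> (real \<Rightarrow> 'w \<Rightarrow> 'a::euclidean_space) \<Rightarrow> bool" where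
  "isotropic_stable_process \<alpha> M Y \<longleftrightarrow>
     levy_process M Y \<and>
     (\<forall>s\<ge>0. \<forall>\<xi>. prob_space.expectation M (\<lambda>\<omega>. iexp (\<xi> \<bullet> Y s \<omega>))
        = complex_of_real (exp (- s * norm \<xi> powr \<alpha>)))"

text \<open>Under the law of the process started at \<open>x\<close>, the position at time \<open>s\<close> is \<open>x + Y s\<close>.
  The density \<open>u s x\<close> is determined only up to null sets; the semigroup below does not
  depend on the version.\<close>

definition transition_density ::
    "'w measure \<Rightarrow> (real \<Rightarrow> 'w \<Rightarrow> 'a::euclidean_space) \<Rightarrow> (real \<Rightarrow> 'a \<Rightarrow> 'a \<Rightarrow> real) \<Rightarrow> bool" where
  "transition_density M Y u \<longleftrightarrow>
     (\<forall>s>0. \<forall>x. (\<forall>y. 0 \<le> u s x y) \<and>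
        distributed M lborel (\<lambda>\<omega>. x + Y s \<omega>) (\<lambda>y. ennreal (u s x y)))"

definition heat_semigroup ::
    "(real \<Rightarrow> 'a::euclidean_space \<Rightarrow> 'a \<Rightarrow> real) \<Rightarrow> real \<Rightarrow> ('a \<Rightarrow> complex) \<Rightarrow> 'a \<Rightarrow> complex" where
  "heat_semigroup u s f x = (\<integral>y. f y * complex_of_real (u s x y) \<partial>lborel)"

text \<open>A measure on the whole real line that is concentrated on \<open>{0<..}\<close>.\<close>

definition subordinator_measure :: "real \<Rightarrow> real measure" where
  "subordinator_measure t = density lborel (\<lambda>s. ennreal (indicator {0<..} s *
     (t / (2 * sqrt pi) * exp (- (t\<^sup>2) / (4 * s)) * s powr (- 3 / 2))))"

text \<open>Although \<open>{..0}\<close> is a null set of the measure, the integral is restricted to \<open>{0<..}\<close>: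
  nothing is known about \<open>u s\<close> for \<open>s \<le> 0\<close>, not even measurability in \<open>s\<close>.\<close>

definition Q_semigroup ::
    "(real \<Rightarrow> 'a::euclidean_space \<Rightarrow> 'a \<Rightarrow> real) \<Rightarrow> real \<Rightarrow> ('a \<Rightarrow> complex) \<Rightarrow> 'a \<Rightarrow> complex" where
  "Q_semigroup u t f x =
     set_lebesgue_integral (subordinator_measure t) {0<..} (\<lambda>s. heat_semigroup u s f x)"

definition translation :: "'a::euclidean_space \<Rightarrow> ('a \<Rightarrow> complex) \<Rightarrow> 'a \<Rightarrow> complex" where
  "translation h f x = f (x + h)"

definition Q_difference ::
    "(real \<Rightarrow> 'a::euclidean_space \<Rightarrow> 'a \<Rightarrow> real) \<Rightarrow> real \<Rightarrow> 'a \<Rightarrow> ('a \<Rightarrow> complex) \<Rightarrow> 'a \<Rightarrow> complex" where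
  "Q_difference u t h f x =
     Q_semigroup u t (translation (h /\<^sub>R 2) f) x - Q_semigroup u t (translation (- (h /\<^sub>R 2)) f) x"

definition T_op ::
    "real \<Rightarrow> (real \<Rightarrow> 'a::euclidean_space \<Rightarrow> 'a \<Rightarrow> real) \<Rightarrow> (real \<Rightarrow> real) \<Rightarrow> ('a \<Rightarrow> complex) \<Rightarrow> 'a \<Rightarrow> complex" where
  "T_op \<alpha> u r f x =
     set_lebesgue_integral lborel {0<..} (\<lambda>t. complex_of_real (t * r t) *
       set_lebesgue_integral lborel {h. norm h < t powr (2 / \<alpha>)} (\<lambda>h.
         (- ((Q_difference u t h ^^ 2) f x)) / complex_of_real (norm h powr (real DIM('a) + \<alpha>))))"

primrec C_k :: "nat \<Rightarrow> ('a::euclidean_space \<Rightarrow> complex) \<Rightarrow> bool" where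
  "C_k 0 f \<longleftrightarrow> continuous_on UNIV f"
| "C_k (Suc k) f \<longleftrightarrow> (\<forall>x. f differentiable (at x)) \<and>
     (\<forall>v. C_k k (\<lambda>x. frechet_derivative f (at x) v))"

definition C_c_infinity :: "('a::euclidean_space \<Rightarrow> complex) set" where
  "C_c_infinity = {f. (\<forall>k. C_k k f) \<and> compact (closure {x. f x \<noteq> 0})}"

definition in_Lp :: "real \<Rightarrow> ('a::euclidean_space \<Rightarrow> complex) \<Rightarrow> bool" where
  "in_Lp p f \<longleftrightarrow> f \<in> borel_measurable lborel \<and> integrable lborel (\<lambda>x. norm (f x) powr p)"

definition Lp_norm :: "real \<Rightarrow> ('a::euclidean_space \<Rightarrow> complex) \<Rightarrow> real" where
  "Lp_norm p f = (\<integral>x. norm (f x) powr p \<partial>lborel) powr (1 / p)"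

definition bounded_on_Lp ::
    "real \<Rightarrow> (('a::euclidean_space \<Rightarrow> complex) \<Rightarrow> 'a \<Rightarrow> complex) \<Rightarrow> bool" where
  "bounded_on_Lp p T \<longleftrightarrow>
     (\<exists>C. \<forall>f\<in>C_c_infinity. in_Lp p (T f) \<and> Lp_norm p (T f) \<le> C * Lp_norm p f)"

end

(* By self-similarity Q_t is convolution with the dilate by R = t^(2/alpha) of one probability
   density q. Substituting h = R k turns T into the integral of r(t)/t times the averages of
   f(x + R z) against a single kernel psi(z), which is integrable with mean zero, has a finite
   absolute moment of some positive order and is Hoelder continuous for translations in L^1. The last two
   properties are what is needed for the truncations of T to have uniformly bounded Fourier
   multipliers and to satisfy Hoermander's condition uniformly, so Calderon-Zygmund theory
   (weak type (1,1), interpolation with L^2, duality) and Fatou's lemma give the bound.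

   The translation regularity is obtained without any formula for the stable density p: the
   square p * p is a dilate of p, and its second difference is the square of the first
   difference of p. This gives a recursion which improves mere L^1-continuity of translations to
   Hoelder continuity of every order g < 1. Any g > alpha makes the singularity |k|^(-d-alpha)
   integrable, because alpha < 1. *)
theory Submission imports Defs
begin

section \<open>Convolution and translation in $L^1$\<close>

text \<open>All kernel estimates are integrated ones: the stable density is known only through its
  characteristic function, so pointwise kernel bounds are out of reach. Regularity is therefore
  measured by L^1 translations and decay by a fractional moment. With mean zero, they bound the
  multiplier and the Hoermander integral of the dilate at scale s by a constant times min(v, 1/v)^e,
  where v is s |xi| or |y| / s. This is integrable for ds/s, so the constants do not see the
  truncation. The square of the difference is used as follows. For each k the kernel is a
  convolution square D * D with D of L^1 norm O(|k|^g). Under a translation by h one factor supplies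
  |h|^g, and the other keeps the |k|^g that compensates |k|^(-d-\<alpha>). The subordinator has
  moments of order below 1/2 only, which limits the moments of q obtained from it to orders below
  \<alpha>/2. Calderon-Zygmund theory is run only on bounded, continuous, integrable functions:
  continuity takes the place of Lebesgue differentiation, and Gaussian averages take the place of
  Fourier inversion.\<close>

lemma nn_integral_lborel_affine:
  fixes f :: "'a::euclidean_space \<Rightarrow> ennreal"
  assumes [measurable]: "f \<in> borel_measurable borel" and "c \<noteq> 0"
  shows "(\<integral>\<^sup>+x. f (a + c *\<^sub>R x) \<partial>lborel) = ennreal (1 / \<bar>c\<bar> ^ DIM('a)) * (\<integral>\<^sup>+x. f x \<partial>lborel)"
proof -
  have "(\<integral>\<^sup>+x. f x \<partial>lborel) = ennreal (\<bar>c\<bar> ^ DIM('a)) * (\<integral>\<^sup>+x. f (a + c *\<^sub>R x) \<partial>lborel)"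
    by (subst lborel_affine[OF assms(2), of a])
       (simp add: nn_integral_density nn_integral_distr nn_integral_cmult)
  moreover have "ennreal (1 / \<bar>c\<bar> ^ DIM('a)) * ennreal (\<bar>c\<bar> ^ DIM('a)) = 1"
    using assms(2) by (simp flip: ennreal_mult ennreal_1)
  ultimately show ?thesis
    by (simp flip: mult.assoc)
qed

lemma integrable_lborel_affine:
  fixes f :: "'a::euclidean_space \<Rightarrow> 'b::{banach, second_countable_topology}"
  assumes f: "integrable lborel f" and c: "c \<noteq> 0"
  shows "integrable lborel (\<lambda>x. f (a + c *\<^sub>R x))"
proof -
  have [measurable]: "f \<in> borel_measurable borel" using f by auto
  show ?thesis
    using f unfolding integrable_iff_bounded
    by (subst nn_integral_lborel_affine[where f = "\<lambda>x. ennreal (norm (f x))"])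
       (auto simp: c ennreal_mult_less_top)
qed

lemma lborel_integral_affine:
  fixes f :: "'a::euclidean_space \<Rightarrow> 'b::{banach, second_countable_topology}"
  assumes [measurable]: "f \<in> borel_measurable borel" and c: "c \<noteq> 0"
  shows "(\<integral>x. f (a + c *\<^sub>R x) \<partial>lborel) = (1 / \<bar>c\<bar> ^ DIM('a)) *\<^sub>R (\<integral>x. f x \<partial>lborel)"
proof -
  have "(\<integral>x. f x \<partial>lborel) = (\<bar>c\<bar> ^ DIM('a)) *\<^sub>R (\<integral>x. f (a + c *\<^sub>R x) \<partial>lborel)"
    by (subst lborel_affine[OF c, of a]) (simp add: integral_density integral_distr)
  thus ?thesis using c by simp
qed

lemma nn_integral_lborel_translate:
  fixes f :: "'a::euclidean_space \<Rightarrow> ennreal"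
  assumes [measurable]: "f \<in> borel_measurable borel"
  shows "(\<integral>\<^sup>+x. f (a + x) \<partial>lborel) = (\<integral>\<^sup>+x. f x \<partial>lborel)"
    and "(\<integral>\<^sup>+x. f (x + a) \<partial>lborel) = (\<integral>\<^sup>+x. f x \<partial>lborel)"
    and "(\<integral>\<^sup>+x. f (x - a) \<partial>lborel) = (\<integral>\<^sup>+x. f x \<partial>lborel)"
    and "(\<integral>\<^sup>+x. f (a - x) \<partial>lborel) = (\<integral>\<^sup>+x. f x \<partial>lborel)"
    and "(\<integral>\<^sup>+x. f (- x) \<partial>lborel) = (\<integral>\<^sup>+x. f x \<partial>lborel)"
  using nn_integral_lborel_affine[of f 1 a] nn_integral_lborel_affine[of f 1 "-a"]
    nn_integral_lborel_affine[of f "-1" a] nn_integral_lborel_affine[of f "-1" 0]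
  by (simp_all add: add.commute)

lemma lborel_integral_translate:
  fixes f :: "'a::euclidean_space \<Rightarrow> 'b::{banach, second_countable_topology}"
  assumes [measurable]: "f \<in> borel_measurable borel"
  shows "(\<integral>x. f (a + x) \<partial>lborel) = (\<integral>x. f x \<partial>lborel)"
    and "(\<integral>x. f (x + a) \<partial>lborel) = (\<integral>x. f x \<partial>lborel)"
    and "(\<integral>x. f (x - a) \<partial>lborel) = (\<integral>x. f x \<partial>lborel)"
    and "(\<integral>x. f (a - x) \<partial>lborel) = (\<integral>x. f x \<partial>lborel)"
    and "(\<integral>x. f (- x) \<partial>lborel) = (\<integral>x. f x \<partial>lborel)"
  using lborel_integral_affine[of f 1 a] lborel_integral_affine[of f 1 "-a"]
    lborel_integral_affine[of f "-1" a] lborel_integral_affine[of f "-1" 0]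
  by (simp_all add: add.commute)

lemma integrable_lborel_translate:
  fixes f :: "'a::euclidean_space \<Rightarrow> 'b::{banach, second_countable_topology}"
  assumes "integrable lborel f"
  shows "integrable lborel (\<lambda>x. f (a + x))" "integrable lborel (\<lambda>x. f (x + a))"
    "integrable lborel (\<lambda>x. f (x - a))" "integrable lborel (\<lambda>x. f (a - x))"
    "integrable lborel (\<lambda>x. f (- x))"
  using integrable_lborel_affine[OF assms, of 1 a] integrable_lborel_affine[OF assms, of 1 "-a"]
    integrable_lborel_affine[OF assms, of "-1" a] integrable_lborel_affine[OF assms, of "-1" 0]
  by (simp_all add: add.commute)

section \<open>Fubini's theorem and integral bounds for Lebesgue measure\<close>

lemma nn_integral_lborel_fubini:
  fixes f :: "'a::euclidean_space \<Rightarrow> 'b::euclidean_space \<Rightarrow> ennreal"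
  assumes [measurable]: "case_prod f \<in> borel_measurable (borel \<Otimes>\<^sub>M borel)"
  shows "(\<integral>\<^sup>+x. \<integral>\<^sup>+y. f x y \<partial>lborel \<partial>lborel) = (\<integral>\<^sup>+y. \<integral>\<^sup>+x. f x y \<partial>lborel \<partial>lborel)"
  by (rule lborel_pair.Fubini'[symmetric]) simp

lemma integrable_lborel_prod:
  fixes f :: "'a::euclidean_space \<Rightarrow> 'b::euclidean_space \<Rightarrow> 'c::{banach, second_countable_topology}"
  assumes [measurable]: "case_prod f \<in> borel_measurable (borel \<Otimes>\<^sub>M borel)"
    and fin: "(\<integral>\<^sup>+x. \<integral>\<^sup>+y. norm (f x y) \<partial>lborel \<partial>lborel) < \<infinity>"
  shows "integrable (lborel \<Otimes>\<^sub>M lborel) (case_prod f)"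
proof (rule integrableI_bounded)
  have "(\<integral>\<^sup>+z. norm (case_prod f z) \<partial>(lborel \<Otimes>\<^sub>M lborel)) = (\<integral>\<^sup>+x. \<integral>\<^sup>+y. norm (f x y) \<partial>lborel \<partial>lborel)"
    by (subst lborel.nn_integral_fst[symmetric]) simp_all
  with fin show "(\<integral>\<^sup>+z. norm (case_prod f z) \<partial>(lborel \<Otimes>\<^sub>M lborel)) < \<infinity>" by simp
qed simp

lemma integral_lborel_fubini:
  fixes f :: "'a::euclidean_space \<Rightarrow> 'b::euclidean_space \<Rightarrow> 'c::{banach, second_countable_topology}"
  assumes [measurable]: "case_prod f \<in> borel_measurable (borel \<Otimes>\<^sub>M borel)"
    and fin: "(\<integral>\<^sup>+x. \<integral>\<^sup>+y. norm (f x y) \<partial>lborel \<partial>lborel) < \<infinity>"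
  shows "(\<integral>x. \<integral>y. f x y \<partial>lborel \<partial>lborel) = (\<integral>y. \<integral>x. f x y \<partial>lborel \<partial>lborel)"
  using lborel_pair.Fubini_integral[OF integrable_lborel_prod[OF assms]] by simp

text \<open>No integrability is assumed, because a Bochner integral that does not exist has the
  value 0. This is what lets the later estimates start without integrability checks.\<close>

lemma norm_integral_le_nn_integral:
  fixes f :: "'a \<Rightarrow> 'b::{banach, second_countable_topology}"
  shows "ennreal (norm (\<integral>x. f x \<partial>M)) \<le> (\<integral>\<^sup>+x. norm (f x) \<partial>M)"
proof (cases "integrable M f")
  case True
  then show ?thesis
    using integral_norm_bound_ennreal by blast
qed (simp add: not_integrable_integral_eq)

text \<open>With values in \<open>ennreal\<close>, the triangle and Young inequalities need only
  measurability, and integrability becomes finiteness.\<close>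

definition l1norm :: "('a::euclidean_space \<Rightarrow> complex) \<Rightarrow> ennreal" where
  "l1norm f = (\<integral>\<^sup>+x. norm (f x) \<partial>lborel)"

text \<open>For two integrable functions the integral may diverge on a null set, where the value is
  0; identities between such convolutions are therefore stated almost everywhere. If one factor is
  bounded, the integral converges at every point.\<close>

definition conv :: "('a::euclidean_space \<Rightarrow> complex) \<Rightarrow> ('a \<Rightarrow> complex) \<Rightarrow> 'a \<Rightarrow> complex" where
  "conv f g x = (\<integral>y. f (x - y) * g y \<partial>lborel)"

lemma integrable_iff_l1norm:
  "integrable lborel f \<longleftrightarrow> f \<in> borel_measurable borel \<and> l1norm f < \<infinity>"
  by (simp add: integrable_iff_bounded l1norm_def)

lemma l1norm_integrable: "integrable lborel f \<Longrightarrow> l1norm f = ennreal (\<integral>x. norm (f x) \<partial>lborel)"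
  unfolding l1norm_def by (rule nn_integral_eq_integral) auto

lemma l1norm_add_le:
  assumes [measurable]: "f \<in> borel_measurable borel" "g \<in> borel_measurable borel"
  shows "l1norm (\<lambda>x. f x + g x) \<le> l1norm f + l1norm g"
  unfolding l1norm_def
  by (subst nn_integral_add[symmetric])
     (auto intro!: nn_integral_mono simp: norm_triangle_ineq simp flip: ennreal_plus)

lemma l1norm_diff_le:
  assumes [measurable]: "f \<in> borel_measurable borel" "g \<in> borel_measurable borel"
  shows "l1norm (\<lambda>x. f x - g x) \<le> l1norm f + l1norm g"
  unfolding l1norm_def
  by (subst nn_integral_add[symmetric])
     (auto intro!: nn_integral_mono simp: norm_triangle_ineq4 simp flip: ennreal_plus)

lemma l1norm_translate:
  assumes [measurable]: "f \<in> borel_measurable borel"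
  shows "l1norm (\<lambda>x. f (x + a)) = l1norm f" "l1norm (\<lambda>x. f (x - a)) = l1norm f"
  unfolding l1norm_def
  using nn_integral_lborel_translate(2,3)[of "\<lambda>x. ennreal (norm (f x))" a] by simp_all

lemma conv_measurable [measurable]:
  assumes [measurable]: "f \<in> borel_measurable borel" "g \<in> borel_measurable borel"
  shows "conv f g \<in> borel_measurable borel"
  unfolding conv_def[abs_def] by measurable

lemma conv_commute:
  assumes [measurable]: "f \<in> borel_measurable borel" "g \<in> borel_measurable borel"
  shows "conv f g x = conv g f x"
  unfolding conv_def
  using lborel_integral_translate(4)[of "\<lambda>y. f (x - y) * g y" x] by (simp add: mult.commute)

lemma l1norm_conv_le:
  assumes [measurable]: "f \<in> borel_measurable borel" "g \<in> borel_measurable borel"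
  shows "l1norm (conv f g) \<le> l1norm f * l1norm g"
proof -
  have "l1norm (conv f g) \<le> (\<integral>\<^sup>+x. \<integral>\<^sup>+y. ennreal (norm (f (x - y))) * ennreal (norm (g y)) \<partial>lborel \<partial>lborel)"
    unfolding l1norm_def conv_def
    by (intro nn_integral_mono order_trans[OF norm_integral_le_nn_integral])
       (simp add: norm_mult ennreal_mult)
  also have "\<dots> = (\<integral>\<^sup>+y. \<integral>\<^sup>+x. ennreal (norm (f (x - y))) * ennreal (norm (g y)) \<partial>lborel \<partial>lborel)"
    by (rule nn_integral_lborel_fubini) measurable
  also have "\<dots> = l1norm f * l1norm g"
    by (simp add: nn_integral_multc nn_integral_lborel_translate(3)[of "\<lambda>x. ennreal (norm (f x))"]
        l1norm_def nn_integral_cmult)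
  finally show ?thesis .
qed

lemma conv_prod_fin:
  fixes f g :: "'a::euclidean_space \<Rightarrow> complex"
  assumes "integrable lborel f" "integrable lborel g"
  shows "(\<integral>\<^sup>+x. \<integral>\<^sup>+y. norm (f (x - y) * g y) \<partial>lborel \<partial>lborel) < \<infinity>"
proof -
  have [measurable]: "f \<in> borel_measurable borel" "g \<in> borel_measurable borel" using assms by auto
  have "(\<integral>\<^sup>+x. \<integral>\<^sup>+y. norm (f (x - y) * g y) \<partial>lborel \<partial>lborel)
    = (\<integral>\<^sup>+y. \<integral>\<^sup>+x. ennreal (norm (f (x - y))) * ennreal (norm (g y)) \<partial>lborel \<partial>lborel)"
    by (subst nn_integral_lborel_fubini) (simp_all add: norm_mult ennreal_mult)
  also have "\<dots> = l1norm f * l1norm g"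
    by (simp add: nn_integral_multc nn_integral_lborel_translate(3)[of "\<lambda>x. ennreal (norm (f x))"]
        l1norm_def nn_integral_cmult)
  finally show ?thesis using assms by (simp add: integrable_iff_l1norm ennreal_mult_less_top)
qed

lemma integrable_conv:
  assumes "integrable lborel f" "integrable lborel g"
  shows "integrable lborel (conv f g)"
proof -
  have [measurable]: "f \<in> borel_measurable borel" "g \<in> borel_measurable borel" using assms by auto
  show ?thesis using l1norm_conv_le[of f g] assms
    by (auto simp: integrable_iff_l1norm ennreal_mult_less_top intro: le_less_trans)
qed

lemma integrable_mult_bounded:
  fixes f g :: "'a::euclidean_space \<Rightarrow> complex"
  assumes f: "integrable lborel f" and [measurable]: "g \<in> borel_measurable borel"
    and b: "\<And>x. norm (g x) \<le> M"
  shows "integrable lborel (\<lambda>x. f x * g x)" "integrable lborel (\<lambda>x. g x * f x)"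
proof -
  have [measurable]: "f \<in> borel_measurable borel" using f by auto
  have "integrable lborel (\<lambda>x. M * norm (f x))" using f by simp
  then show 1: "integrable lborel (\<lambda>x. f x * g x)"
  proof (rule Bochner_Integration.integrable_bound)
    show "AE x in lborel. norm (f x * g x) \<le> norm (M * norm (f x))"
    proof (intro AE_I2)
      fix x :: 'a
      have "norm (f x) * norm (g x) \<le> norm (f x) * M" by (intro mult_left_mono b) auto
      also have "\<dots> \<le> norm (M * norm (f x))" by (simp add: abs_mult mult_right_mono mult.commute)
      finally show "norm (f x * g x) \<le> norm (M * norm (f x))" by (simp add: norm_mult)
    qed
  qed simp
  then show "integrable lborel (\<lambda>x. g x * f x)" by (simp add: mult.commute)
qed

lemma conv_bound:
  assumes f: "integrable lborel f" and b: "\<And>x. norm (g x) \<le> M"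
  shows "norm (conv f g x) \<le> M * (\<integral>x. norm (f x) \<partial>lborel)"
proof -
  have M: "M \<ge> 0" using b[of undefined] norm_ge_zero order_trans by blast
  have [measurable]: "f \<in> borel_measurable borel" using f by auto
  have "ennreal (norm (conv f g x)) \<le> (\<integral>\<^sup>+y. norm (f (x - y) * g y) \<partial>lborel)"
    unfolding conv_def by (rule norm_integral_le_nn_integral)
  also have "\<dots> \<le> (\<integral>\<^sup>+y. ennreal M * ennreal (norm (f (x - y))) \<partial>lborel)"
    using b M by (intro nn_integral_mono)
      (simp add: norm_mult mult.commute[of M] mult_left_mono flip: ennreal_mult)
  also have "\<dots> = ennreal M * l1norm f"
    by (simp add: nn_integral_cmult nn_integral_lborel_translate(4)[of "\<lambda>x. ennreal (norm (f x))"] l1norm_def)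
  also have "\<dots> = ennreal (M * (\<integral>x. norm (f x) \<partial>lborel))"
    using f M by (simp add: l1norm_integrable ennreal_mult)
  finally show ?thesis
    using M by (subst (asm) ennreal_le_iff) auto
qed

lemma continuous_on_conv:
  assumes f: "integrable lborel f" and b: "\<And>x. norm (g x) \<le> M" and c: "continuous_on UNIV g"
  shows "continuous_on UNIV (conv f g)"
proof -
  have [measurable]: "f \<in> borel_measurable borel" "g \<in> borel_measurable borel"
    using f c by (auto intro: borel_measurable_continuous_onI)
  have eq: "conv f g = (\<lambda>x. \<integral>y. g (x - y) * f y \<partial>lborel)"
    using conv_commute[of f g] by (auto simp: conv_def)
  have "(\<lambda>n. conv f g (X n)) \<longlonglongrightarrow> conv f g x" if X: "X \<longlonglongrightarrow> x" for X x
    unfolding eq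
  proof (rule integral_dominated_convergence)
    show "integrable lborel (\<lambda>y. M * norm (f y))" using f by simp
    show "AE y in lborel. norm (g (X n - y) * f y) \<le> M * norm (f y)" for n
      using b by (simp add: norm_mult mult_right_mono)
    show "AE y in lborel. (\<lambda>n. g (X n - y) * f y) \<longlonglongrightarrow> g (x - y) * f y"
    proof (intro AE_I2 tendsto_mult tendsto_const)
      fix y :: 'a
      have "isCont g (x - y)" using c continuous_on_eq_continuous_at by blast
      then show "(\<lambda>n. g (X n - y)) \<longlonglongrightarrow> g (x - y)"
        by (rule isCont_tendsto_compose) (intro tendsto_intros X)
    qed
  qed auto
  then have "isCont (conv f g) x" for x
    unfolding continuous_at_sequentially by (auto simp: o_def)
  then show ?thesis by (simp add: continuous_on_eq_continuous_at)
qed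

text \<open>Outer regularity gives an open \<open>U\<close> around \<open>A\<close> with small
  excess. A point of \<open>A\<close> that leaves \<open>A\<close> under the shift either lands in
  \<open>U - A\<close> or leaves \<open>U\<close>. In the second case it lies in \<open>B n\<close>,
  the part of \<open>A\<close> close to the complement of \<open>U\<close>; these parts decrease to
  the empty set.\<close>

lemma l1norm_translation_continuous_indicator:
  fixes A :: "'a::euclidean_space set"
  assumes A [measurable]: "A \<in> sets borel" and fin: "emeasure lborel A < \<infinity>" and e: "e > (0::real)"
  shows "\<exists>d>0. \<forall>h. norm h < d \<longrightarrow>
    (\<integral>\<^sup>+x. indicator A x * indicator (- A) (x + h) \<partial>lborel) \<le> ennreal e"
proof -
  obtain U where U: "open U" "A \<subseteq> U" and Ue: "emeasure lborel (U - A) < ennreal (e/2)"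
    using outer_regular_lborel[OF A, of "e/2"] e by auto
  define B where "B n = A \<inter> (\<Union>z\<in>-U. ball z (1 / Suc n))" for n
  have "(\<Union>z\<in>-U. ball z (1 / Suc n)) \<in> sets borel" for n by (intro borel_open) auto
  then have [measurable]: "B n \<in> sets borel" for n
    unfolding B_def by (rule sets.Int[OF A])
  have [measurable]: "U \<in> sets borel" by (rule borel_open[OF U(1)])
  have "(\<Inter>n. B n) = {}"
  proof (rule ccontr)
    assume "(\<Inter>n. B n) \<noteq> {}"
    then obtain x where x: "\<And>n. x \<in> B n" by auto
    then have "x \<in> U" using U by (auto simp: B_def)
    then obtain r where r: "r > 0" "ball x r \<subseteq> U" using U(1) open_contains_ball by blast
    obtain n where "1 / Suc n < r" using r(1) nat_approx_posE by (metis of_nat_Suc)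
    moreover obtain z where "z \<notin> U" "dist z x < 1 / Suc n" using x[of n] by (auto simp: B_def)
    ultimately show False using r(2) by (auto simp: subset_eq dist_commute)
  qed
  moreover have "(\<lambda>n. emeasure lborel (B n)) \<longlonglongrightarrow> emeasure lborel (\<Inter>n. B n)"
  proof (rule Lim_emeasure_decseq)
    show "decseq B"
    proof (rule decseq_SucI)
      fix n
      have "1 / real (Suc (Suc n)) \<le> 1 / real (Suc n)" by (intro divide_left_mono) auto
      then show "B (Suc n) \<le> B n" unfolding B_def by (fastforce simp del: of_nat_Suc)
    qed
    show "emeasure lborel (B n) \<noteq> \<infinity>" for n
      using fin emeasure_mono[of "B n" A lborel] by (auto simp: B_def top_unique)
  qed auto
  ultimately have "(\<lambda>n. emeasure lborel (B n)) \<longlonglongrightarrow> 0" by simp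
  then have "\<forall>\<^sub>F n in sequentially. emeasure lborel (B n) < ennreal (e/2)"
    using e by (intro order_tendstoD) auto
  then obtain n where n: "emeasure lborel (B n) < ennreal (e/2)"
    by (auto simp: eventually_sequentially)
  show ?thesis
  proof (intro exI[of _ "1 / Suc n"] conjI allI impI)
    fix h :: 'a assume h: "norm h < 1 / Suc n"
    have "(\<integral>\<^sup>+x. indicator A x * indicator (- A) (x + h) \<partial>lborel)
      \<le> (\<integral>\<^sup>+x. indicator (B n) x + indicator (U - A) (x + h) \<partial>lborel)"
    proof (rule nn_integral_mono)
      fix x
      show "indicator A x * indicator (- A) (x + h) \<le> (indicator (B n) x + indicator (U - A) (x + h) :: ennreal)"
      proof (cases "x \<in> A \<and> x + h \<notin> U")
        case True
        then have "x \<in> B n" using h by (auto simp: B_def dist_norm intro!: bexI[of _ "x + h"])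
        then show ?thesis by (auto simp: indicator_def)
      qed (auto simp: indicator_def)
    qed
    also have "\<dots> = emeasure lborel (B n) + emeasure lborel (U - A)"
      by (simp add: nn_integral_add nn_integral_lborel_translate(2)[of "indicator (U - A)"])
    also have "\<dots> \<le> ennreal (e/2) + ennreal (e/2)"
      using n Ue by (intro add_mono) auto
    also have "\<dots> = ennreal e" using e by (simp flip: ennreal_plus)
    finally show "(\<integral>\<^sup>+x. indicator A x * indicator (- A) (x + h) \<partial>lborel) \<le> ennreal e" .
  qed simp
qed

text \<open>Induction over integrable functions: the property holds for multiples of indicators and
  survives sums and dominated limits, since translation is an isometry of L^1.\<close>

lemma l1norm_translation_continuous_eps:
  fixes f :: "'a::euclidean_space \<Rightarrow> complex"
  assumes "integrable lborel f"
  shows "\<forall>e>0. \<exists>d>0. \<forall>h. norm h < d \<longrightarrow> l1norm (\<lambda>x. f (x + h) - f x) \<le> ennreal e"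
  using assms
proof induction
  case (base A c)
  then have [measurable]: "A \<in> sets borel" by simp
  show ?case
  proof (intro allI impI)
    fix e :: real assume e: "e > 0"
    let ?J = "\<lambda>h. \<integral>\<^sup>+x. indicator A x * indicator (- A) (x + h) \<partial>lborel"
    \<comment> \<open>The factor 2 accounts for points entering and points leaving \<open>A\<close>;
      adding 1 covers \<open>c = 0\<close>.\<close>
    define e' where "e' = e / (2 * (norm c + 1))"
    have e': "e' > 0" using e by (auto simp: e'_def intro!: divide_pos_pos add_nonneg_pos)
    obtain d where d: "d > 0" and dJ: "\<And>h. norm h < d \<Longrightarrow> ?J h \<le> ennreal e'"
      using l1norm_translation_continuous_indicator[of A e'] base e' by auto
    show "\<exists>d>0. \<forall>h. norm h < d \<longrightarrow> l1norm (\<lambda>x. indicat_real A (x + h) *\<^sub>R c - indicat_real A x *\<^sub>R c) \<le> ennreal e"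
    proof (intro exI[of _ d] conjI allI impI d)
      fix h :: 'a assume h: "norm h < d"
      have "l1norm (\<lambda>x. indicat_real A (x + h) *\<^sub>R c - indicat_real A x *\<^sub>R c)
        \<le> (\<integral>\<^sup>+x. ennreal (norm c) * (indicator A x * indicator (- A) (x + h) + indicator A (x + h) * indicator (- A) x) \<partial>lborel)"
        unfolding l1norm_def by (intro nn_integral_mono) (auto simp: indicator_def)
      also have "\<dots> = ennreal (norm c) * (?J h + ?J (- h))"
        using nn_integral_lborel_translate(2)[of "\<lambda>x. indicator A x * indicator (- A) (x - h)" h]
        by (simp add: nn_integral_cmult nn_integral_add)
      also have "\<dots> \<le> ennreal (norm c) * (ennreal e' + ennreal e')"
        using h by (intro mult_left_mono add_mono dJ) auto
      also have "\<dots> = ennreal (norm c * (2 * e'))"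
        using e' by (simp add: ennreal_mult flip: ennreal_plus)
      also have "\<dots> \<le> ennreal e"
      proof (rule ennreal_leI)
        have "k * (2 * (e / (2 * (k + 1)))) \<le> e" if "k \<ge> 0" for k :: real
        proof -
          have "k * (2 * (e / (2 * (k + 1)))) = k / (k + 1) * e" using that by (simp add: divide_simps)
          also have "\<dots> \<le> 1 * e" using that e by (intro mult_right_mono) auto
          finally show ?thesis by simp
        qed
        from this[of "norm c"] show "norm c * (2 * e') \<le> e" unfolding e'_def by simp
      qed
      finally show "l1norm (\<lambda>x. indicat_real A (x + h) *\<^sub>R c - indicat_real A x *\<^sub>R c) \<le> ennreal e" .
    qed
  qed
next
  case (add f g)
  then have [measurable]: "f \<in> borel_measurable borel" "g \<in> borel_measurable borel" by auto
  show ?case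
  proof (intro allI impI)
    fix e :: real assume e: "e > 0"
    then have e2: "e / 2 > 0" by simp
    obtain d1 where d1: "d1 > 0"
      and 1: "\<And>h. norm h < d1 \<Longrightarrow> l1norm (\<lambda>x. f (x + h) - f x) \<le> ennreal (e/2)"
      using add.IH(1) e2 by blast
    obtain d2 where d2: "d2 > 0"
      and 2: "\<And>h. norm h < d2 \<Longrightarrow> l1norm (\<lambda>x. g (x + h) - g x) \<le> ennreal (e/2)"
      using add.IH(2) e2 by blast
    show "\<exists>d>0. \<forall>h. norm h < d \<longrightarrow> l1norm (\<lambda>x. f (x + h) + g (x + h) - (f x + g x)) \<le> ennreal e"
    proof (intro exI[of _ "min d1 d2"] conjI allI impI)
      fix h :: 'a assume h: "norm h < min d1 d2"
      have "l1norm (\<lambda>x. f (x + h) + g (x + h) - (f x + g x))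
        \<le> l1norm (\<lambda>x. f (x + h) - f x) + l1norm (\<lambda>x. g (x + h) - g x)"
        using l1norm_add_le[of "\<lambda>x. f (x + h) - f x" "\<lambda>x. g (x + h) - g x"]
        by (simp add: algebra_simps)
      also have "\<dots> \<le> ennreal (e/2) + ennreal (e/2)" using h by (intro add_mono 1 2) auto
      also have "\<dots> = ennreal e" using e by (simp flip: ennreal_plus)
      finally show "l1norm (\<lambda>x. f (x + h) + g (x + h) - (f x + g x)) \<le> ennreal e" .
    qed (use d1 d2 in auto)
  qed
next
  case (lim f s)
  then have [measurable]: "f \<in> borel_measurable borel" "\<And>i. s i \<in> borel_measurable borel" by auto
  show ?case
  proof (intro allI impI)
    fix e :: real assume e: "e > 0"
    have "(\<lambda>i. \<integral>\<^sup>+x. norm (f x - s i x) \<partial>lborel) \<longlonglongrightarrow> 0"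
    proof (rule nn_integral_dominated_convergence_norm[where w = "\<lambda>x. 2 * norm (f x)"])
      show "(\<integral>\<^sup>+x. ennreal (2 * norm (f x)) \<partial>lborel) < \<infinity>"
        using integrable_norm[OF \<open>integrable lborel f\<close>]
        by (simp add: ennreal_mult nn_integral_cmult ennreal_mult_less_top integrable_iff_bounded)
    qed (use lim in auto)
    then have "\<forall>\<^sub>F i in sequentially. (\<integral>\<^sup>+x. norm (f x - s i x) \<partial>lborel) < ennreal (e/4)"
      using e by (intro order_tendstoD) auto
    then obtain i where i: "l1norm (\<lambda>x. f x - s i x) < ennreal (e/4)"
      by (auto simp: eventually_sequentially l1norm_def)
    have e2: "e / 2 > 0" using e by simp
    obtain d where d: "d > 0"
      and 1: "\<And>h. norm h < d \<Longrightarrow> l1norm (\<lambda>x. s i (x + h) - s i x) \<le> ennreal (e/2)"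
      using lim.IH e2 by blast
    show "\<exists>d>0. \<forall>h. norm h < d \<longrightarrow> l1norm (\<lambda>x. f (x + h) - f x) \<le> ennreal e"
    proof (intro exI[of _ d] conjI allI impI d)
      fix h :: 'a assume h: "norm h < d"
      have "l1norm (\<lambda>x. f (x + h) - f x)
        = l1norm (\<lambda>x. ((f (x + h) - s i (x + h)) - (f x - s i x)) + (s i (x + h) - s i x))"
        by (simp add: algebra_simps)
      also have "\<dots> \<le> l1norm (\<lambda>x. (f (x + h) - s i (x + h)) - (f x - s i x)) + l1norm (\<lambda>x. s i (x + h) - s i x)"
        by (rule l1norm_add_le) measurable
      also have "l1norm (\<lambda>x. (f (x + h) - s i (x + h)) - (f x - s i x))
        \<le> l1norm (\<lambda>x. f (x + h) - s i (x + h)) + l1norm (\<lambda>x. f x - s i x)"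
        by (rule l1norm_diff_le) measurable
      also have "l1norm (\<lambda>x. f (x + h) - s i (x + h)) = l1norm (\<lambda>x. f x - s i x)"
        using l1norm_translate(1)[of "\<lambda>x. f x - s i x" h] by simp
      also have "l1norm (\<lambda>x. f x - s i x) + l1norm (\<lambda>x. f x - s i x) + l1norm (\<lambda>x. s i (x + h) - s i x)
        \<le> ennreal (e/4) + ennreal (e/4) + ennreal (e/2)"
        using i h by (intro add_mono 1) auto
      also have "\<dots> = ennreal e" using e by (simp flip: ennreal_plus)
      finally show "l1norm (\<lambda>x. f (x + h) - f x) \<le> ennreal e"
        by (simp add: add_right_mono)
    qed
  qed
qed

text \<open>Stated for \<open>nhds 0\<close>, not for \<open>at 0\<close>, so that it composes with
  sequences of shifts that may equal 0.\<close>

lemma l1norm_translation_continuous: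
  fixes f :: "'a::euclidean_space \<Rightarrow> complex"
  assumes f: "integrable lborel f"
  shows "((\<lambda>h. l1norm (\<lambda>x. f (x + h) - f x)) \<longlongrightarrow> 0) (nhds 0)"
proof (rule order_tendstoI)
  fix a :: ennreal assume "0 < a"
  then obtain b where b: "0 < b" "b < a" using dense by blast
  define e where "e = enn2real b"
  have "b < top" using b(2) by (rule less_le_trans) simp
  then have e: "0 < e" "ennreal e < a"
    using b by (simp_all add: e_def enn2real_positive_iff)
  obtain d where "d > 0" "\<And>h. norm h < d \<Longrightarrow> l1norm (\<lambda>x. f (x + h) - f x) \<le> ennreal e"
    using l1norm_translation_continuous_eps[OF f] e by metis
  then show "\<forall>\<^sub>F h in nhds 0. l1norm (\<lambda>x. f (x + h) - f x) < a"
    unfolding eventually_nhds_metric using e(2) le_less_trans by (auto intro!: exI[of _ d])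
qed simp

section \<open>Fourier transform\<close>

text \<open>The convention of characteristic functions: positive sign and no normalization. Hence
  the transform of a density is literally the expectation in
  \<open>isotropic_stable_process\<close>, and Plancherel's formula carries the factor (2
  pi)^d.\<close>

definition FT :: "('a::euclidean_space \<Rightarrow> complex) \<Rightarrow> 'a \<Rightarrow> complex" where
  "FT f \<xi> = (\<integral>x. iexp (\<xi> \<bullet> x) * f x \<partial>lborel)"

lemma FT_measurable [measurable]:
  assumes [measurable]: "f \<in> borel_measurable borel"
  shows "FT f \<in> borel_measurable borel"
  unfolding FT_def[abs_def] by measurable

lemma integrable_iexp_mult:
  assumes "integrable lborel f"
  shows "integrable lborel (\<lambda>x. iexp (\<xi> \<bullet> x) * f x)"
  by (rule integrable_mult_bounded(2)[OF assms, of _ 1]) auto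

lemma norm_FT_le: "ennreal (norm (FT f \<xi>)) \<le> l1norm f"
  unfolding FT_def l1norm_def
  by (rule order_trans[OF norm_integral_le_nn_integral]) (simp add: norm_mult)

lemma FT_translate:
  assumes [measurable]: "f \<in> borel_measurable borel"
  shows "FT (\<lambda>x. f (x + h)) \<xi> = iexp (- (\<xi> \<bullet> h)) * FT f \<xi>"
proof -
  have "FT (\<lambda>x. f (x + h)) \<xi> = (\<integral>x. iexp (\<xi> \<bullet> (x - h)) * f x \<partial>lborel)"
    unfolding FT_def
    using lborel_integral_translate(2)[of "\<lambda>x. iexp (\<xi> \<bullet> (x - h)) * f x" h] by simp
  also have "\<dots> = (\<integral>x. iexp (- (\<xi> \<bullet> h)) * (iexp (\<xi> \<bullet> x) * f x) \<partial>lborel)"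
    by (simp add: inner_diff_right algebra_simps exp_diff exp_minus field_simps)
  finally show ?thesis by (simp add: FT_def)
qed

lemma FT_scale:
  fixes f :: "'a::euclidean_space \<Rightarrow> complex"
  assumes [measurable]: "f \<in> borel_measurable borel" and s: "s \<noteq> 0"
  shows "FT (\<lambda>x. f (s *\<^sub>R x)) \<xi> = (1 / \<bar>s\<bar> ^ DIM('a)) *\<^sub>R FT f (\<xi> /\<^sub>R s)"
proof -
  have "(\<integral>x. iexp ((\<xi> /\<^sub>R s) \<bullet> (0 + s *\<^sub>R x)) * f (0 + s *\<^sub>R x) \<partial>lborel)
      = (1 / \<bar>s\<bar> ^ DIM('a)) *\<^sub>R FT f (\<xi> /\<^sub>R s)"
    unfolding FT_def by (rule lborel_integral_affine) (use s in auto)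
  moreover have "(\<xi> /\<^sub>R s) \<bullet> (0 + s *\<^sub>R x) = \<xi> \<bullet> x" for x using s by simp
  ultimately show ?thesis unfolding FT_def by (simp only: add_0)
qed

lemma FT_diff:
  assumes "integrable lborel f" "integrable lborel g"
  shows "FT (\<lambda>x. f x - g x) \<xi> = FT f \<xi> - FT g \<xi>"
  unfolding FT_def right_diff_distrib
  by (intro Bochner_Integration.integral_diff integrable_iexp_mult assms)

lemma FT_conv:
  assumes f: "integrable lborel f" and g: "integrable lborel g"
  shows "FT (conv f g) \<xi> = FT f \<xi> * FT g \<xi>"
proof -
  have [measurable]: "f \<in> borel_measurable borel" "g \<in> borel_measurable borel" using f g by auto
  have "FT (conv f g) \<xi> = (\<integral>x. \<integral>y. iexp (\<xi> \<bullet> x) * (f (x - y) * g y) \<partial>lborel \<partial>lborel)"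
    unfolding FT_def conv_def by simp
  also have "\<dots> = (\<integral>y. \<integral>x. iexp (\<xi> \<bullet> x) * (f (x - y) * g y) \<partial>lborel \<partial>lborel)"
    by (rule integral_lborel_fubini) (use conv_prod_fin[OF f g] in \<open>auto simp: norm_mult\<close>)
  also have "\<dots> = (\<integral>y. FT f \<xi> * (iexp (\<xi> \<bullet> y) * g y) \<partial>lborel)"
  proof (rule Bochner_Integration.integral_cong[OF refl])
    fix y
    have "(\<integral>x. iexp (\<xi> \<bullet> x) * (f (x - y) * g y) \<partial>lborel) = FT (\<lambda>x. f (x + (-y))) \<xi> * g y"
      by (simp add: FT_def flip: mult.assoc)
    then show "(\<integral>x. iexp (\<xi> \<bullet> x) * (f (x - y) * g y) \<partial>lborel) = FT f \<xi> * (iexp (\<xi> \<bullet> y) * g y)"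
      by (subst (asm) FT_translate) auto
  qed
  also have "\<dots> = FT f \<xi> * FT g \<xi>" by (simp add: FT_def)
  finally show ?thesis .
qed

text \<open>Fubini, since the exponential is symmetric in its two arguments. With a modulated
  Gaussian for \<open>g\<close> this is the only form of Fourier inversion used.\<close>

lemma FT_multiplication:
  assumes f: "integrable lborel f" and g: "integrable lborel g"
  shows "(\<integral>\<xi>. FT f \<xi> * g \<xi> \<partial>lborel) = (\<integral>x. f x * FT g x \<partial>lborel)"
proof -
  have [measurable]: "f \<in> borel_measurable borel" "g \<in> borel_measurable borel" using f g by auto
  have "(\<integral>\<xi>. FT f \<xi> * g \<xi> \<partial>lborel) = (\<integral>\<xi>. \<integral>x. iexp (\<xi> \<bullet> x) * f x * g \<xi> \<partial>lborel \<partial>lborel)"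
    unfolding FT_def by simp
  also have "\<dots> = (\<integral>x. \<integral>\<xi>. iexp (\<xi> \<bullet> x) * f x * g \<xi> \<partial>lborel \<partial>lborel)"
  proof (rule integral_lborel_fubini)
    have "(\<integral>\<^sup>+\<xi>. \<integral>\<^sup>+x. norm (iexp (\<xi> \<bullet> x) * f x * g \<xi>) \<partial>lborel \<partial>lborel) = l1norm f * l1norm g"
      by (simp add: norm_mult ennreal_mult nn_integral_multc nn_integral_cmult l1norm_def)
    also have "\<dots> < \<infinity>" using f g by (simp add: integrable_iff_l1norm ennreal_mult_less_top)
    finally show "(\<integral>\<^sup>+\<xi>. \<integral>\<^sup>+x. norm (iexp (\<xi> \<bullet> x) * f x * g \<xi>) \<partial>lborel \<partial>lborel) < \<infinity>" .
  qed measurable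
  also have "\<dots> = (\<integral>x. f x * FT g x \<partial>lborel)"
    unfolding FT_def by (simp add: inner_commute mult.assoc mult.left_commute)
  finally show ?thesis .
qed

section \<open>Gaussian averages, uniqueness of the Fourier transform and Plancherel's
  formula\<close>

definition gauss :: "'a::euclidean_space \<Rightarrow> real" where
  "gauss x = exp (- (norm x)\<^sup>2 / 2)"

lemma gauss_measurable [measurable]: "gauss \<in> borel_measurable borel"
  unfolding gauss_def[abs_def] by measurable

lemma gauss_pos: "gauss x > 0" and gauss_le_1: "gauss x \<le> 1" and gauss_0: "gauss 0 = 1"
  by (auto simp: gauss_def)

text \<open>A rescaled reading of the characteristic function of the standard normal
  distribution.\<close>

lemma iexp_gauss_1d:
  "integrable lborel (\<lambda>x. iexp (t * x) * complex_of_real (exp (- x\<^sup>2 / 2)))"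
  "(\<integral>x. iexp (t * x) * complex_of_real (exp (- x\<^sup>2 / 2)) \<partial>lborel)
    = complex_of_real (sqrt (2 * pi) * exp (- t\<^sup>2 / 2))"
proof -
  have "integrable lborel (\<lambda>x. sqrt (2 * pi) * std_normal_density x)"
    by (intro integrable_mult_right integrable_normal_density) simp
  then have i: "integrable lborel (\<lambda>x. complex_of_real (exp (- x\<^sup>2 / 2)))"
    by (intro integrable_of_real) (simp add: std_normal_density_def)
  show "integrable lborel (\<lambda>x. iexp (t * x) * complex_of_real (exp (- x\<^sup>2 / 2)))"
    using integrable_iexp_mult[OF i, of t] by simp
  have "complex_of_real (exp (- t\<^sup>2 / 2)) = char std_normal_distribution t"
    by (simp add: char_std_normal_distribution)
  also have "\<dots> = (\<integral>x. std_normal_density x *\<^sub>R iexp (t * x) \<partial>lborel)"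
    unfolding char_def by (subst integral_density) auto
  also have "\<dots> = (\<integral>x. (iexp (t * x) * complex_of_real (exp (- x\<^sup>2 / 2))) / complex_of_real (sqrt (2 * pi)) \<partial>lborel)"
    by (intro Bochner_Integration.integral_cong) (auto simp: std_normal_density_def scaleR_conv_of_real)
  also have "\<dots> = (\<integral>x. iexp (t * x) * complex_of_real (exp (- x\<^sup>2 / 2)) \<partial>lborel) / complex_of_real (sqrt (2 * pi))"
    by simp
  finally show "(\<integral>x. iexp (t * x) * complex_of_real (exp (- x\<^sup>2 / 2)) \<partial>lborel)
    = complex_of_real (sqrt (2 * pi) * exp (- t\<^sup>2 / 2))"
    by (simp add: field_simps)
qed

lemma norm_power2_Basis: "(norm (x::'a::euclidean_space))\<^sup>2 = (\<Sum>b\<in>Basis. (x \<bullet> b)\<^sup>2)"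
  unfolding power2_norm_eq_inner by (subst euclidean_inner) (simp add: power2_eq_square)

lemma FT_gauss:
  fixes \<xi> :: "'a::euclidean_space"
  shows "integrable lborel (\<lambda>x::'a. complex_of_real (gauss x))"
    and "FT (\<lambda>x. complex_of_real (gauss x)) \<xi> = complex_of_real (sqrt (2 * pi) ^ DIM('a) * gauss \<xi>)"
proof -
  interpret product_sigma_finite "\<lambda>_::'a. lborel::real measure" by standard
  have eq: "iexp (\<xi> \<bullet> x) * complex_of_real (gauss x)
      = (\<Prod>b\<in>Basis. iexp ((\<xi> \<bullet> b) * (x \<bullet> b)) * complex_of_real (exp (- (x \<bullet> b)\<^sup>2 / 2)))" for \<xi> x :: 'a
  proof -
    have "gauss x = (\<Prod>b\<in>Basis. exp (- (x \<bullet> b)\<^sup>2 / 2))"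
      by (simp add: gauss_def norm_power2_Basis sum_divide_distrib exp_sum flip: sum_negf)
    moreover have "iexp (\<xi> \<bullet> x) = (\<Prod>b\<in>Basis. iexp ((\<xi> \<bullet> b) * (x \<bullet> b)))"
      by (simp add: euclidean_inner[of \<xi> x] sum_distrib_left exp_sum)
    ultimately show ?thesis by (simp only: of_real_prod prod.distrib)
  qed
  have int: "integrable lborel (\<lambda>x. iexp (\<xi> \<bullet> x) * complex_of_real (gauss x))" for \<xi> :: 'a
  proof -
    have "integrable (\<Pi>\<^sub>M b\<in>Basis. lborel) (\<lambda>f. \<Prod>b\<in>Basis. iexp ((\<xi> \<bullet> b) * f b) * complex_of_real (exp (- (f b)\<^sup>2 / 2)))"
      by (intro product_integrable_prod finite_Basis iexp_gauss_1d(1))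
    then show ?thesis
      unfolding eq by (subst lborel_eq, subst integrable_distr_eq) (auto simp: inner_sum_left_Basis cong: prod.cong)
  qed
  show "integrable lborel (\<lambda>x::'a. complex_of_real (gauss x))" using int[of 0] by simp
  have "FT (\<lambda>x. complex_of_real (gauss x)) \<xi>
    = (\<integral>f. (\<Prod>b\<in>Basis. iexp ((\<xi> \<bullet> b) * f b) * complex_of_real (exp (- (f b)\<^sup>2 / 2))) \<partial>(\<Pi>\<^sub>M b\<in>Basis. lborel))"
    unfolding FT_def eq by (subst lborel_eq, subst integral_distr) (auto simp: inner_sum_left_Basis)
  also have "\<dots> = (\<Prod>b\<in>Basis. \<integral>x. iexp ((\<xi> \<bullet> b) * x) * complex_of_real (exp (- x\<^sup>2 / 2)) \<partial>lborel)"
    by (rule product_integral_prod) (rule finite_Basis, rule iexp_gauss_1d(1))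
  also have "\<dots> = complex_of_real (sqrt (2 * pi) ^ DIM('a) * gauss \<xi>)"
    by (simp only: iexp_gauss_1d of_real_prod[symmetric])
       (simp add: gauss_def norm_power2_Basis prod.distrib exp_sum sum_divide_distrib flip: sum_negf)
  finally show "FT (\<lambda>x. complex_of_real (gauss x)) \<xi> = complex_of_real (sqrt (2 * pi) ^ DIM('a) * gauss \<xi>)" .
qed

lemma gauss_integral: "(\<integral>x. complex_of_real (gauss (x::'a::euclidean_space)) \<partial>lborel) = complex_of_real (sqrt (2 * pi) ^ DIM('a))"
  using FT_gauss(2)[of "0::'a"] by (simp add: FT_def gauss_0)

lemma gauss_integrable: "integrable lborel (gauss :: 'a::euclidean_space \<Rightarrow> real)"
  using FT_gauss(1) by (simp add: complex_of_real_integrable_eq)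

text \<open>The multiplication formula for a Gaussian of width 1/s modulated by \<open>a\<close>,
  whose transform is a Gaussian of width s centred at \<open>a\<close>. It expresses Gaussian
  averages of \<open>f\<close> through \<open>FT f\<close> and serves uniqueness, Plancherel's
  formula and the tail of the stable density.\<close>

lemma gauss_smoothing:
  fixes f :: "'a::euclidean_space \<Rightarrow> complex"
  assumes f: "integrable lborel f" and s: "s > 0"
  shows "(\<integral>\<xi>. FT f \<xi> * (iexp (- (\<xi> \<bullet> a)) * complex_of_real (gauss (s *\<^sub>R \<xi>))) \<partial>lborel)
    = complex_of_real (sqrt (2 * pi) ^ DIM('a)) * (\<integral>x. f (a + s *\<^sub>R x) * complex_of_real (gauss x) \<partial>lborel)"
proof -
  have [measurable]: "f \<in> borel_measurable borel" using f by auto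
  define g where "g \<xi> = iexp (- (\<xi> \<bullet> a)) * complex_of_real (gauss (s *\<^sub>R \<xi>))" for \<xi> :: 'a
  let ?G = "\<lambda>\<xi>::'a. complex_of_real (gauss \<xi>)"
  have "integrable lborel (\<lambda>\<xi>::'a. ?G (s *\<^sub>R \<xi>))"
    using integrable_lborel_affine[OF FT_gauss(1), of s 0] s by simp
  then have g: "integrable lborel g"
    unfolding g_def by (rule integrable_mult_bounded(2)[where M = 1]) (auto simp: inner_commute)
  have FTg: "FT g x = complex_of_real (sqrt (2 * pi) ^ DIM('a) / s ^ DIM('a) * gauss ((x - a) /\<^sub>R s))" for x
  proof -
    have "FT g x = FT (\<lambda>\<xi>. ?G (s *\<^sub>R \<xi>)) (x - a)"
    proof -
      have "iexp (x \<bullet> \<xi>) * (iexp (- (\<xi> \<bullet> a)) * z) = iexp ((x - a) \<bullet> \<xi>) * z" for \<xi> z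
        by (simp add: inner_diff_left inner_commute[of a] exp_diff exp_minus right_diff_distrib field_simps)
      then show ?thesis unfolding FT_def g_def by (intro Bochner_Integration.integral_cong refl)
    qed
    also have "\<dots> = (1 / s ^ DIM('a)) *\<^sub>R FT ?G ((x - a) /\<^sub>R s)"
      using s by (subst FT_scale) auto
    finally show ?thesis by (simp only: FT_gauss) (simp add: scaleR_conv_of_real)
  qed
  define F where "F x = f x * FT g x" for x
  have [measurable]: "F \<in> borel_measurable borel"
    using g unfolding F_def by (auto intro!: borel_measurable_times FT_measurable)
  have "(\<integral>\<xi>. FT f \<xi> * g \<xi> \<partial>lborel) = (\<integral>x. F x \<partial>lborel)"
    unfolding F_def by (rule FT_multiplication[OF f g])
  also have "\<dots> = complex_of_real (s ^ DIM('a)) * (\<integral>x. F (a + s *\<^sub>R x) \<partial>lborel)"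
    using s by (subst lborel_integral_affine) (auto simp: scaleR_conv_of_real)
  also have "(\<integral>x. F (a + s *\<^sub>R x) \<partial>lborel)
    = (\<integral>x. complex_of_real (sqrt (2 * pi) ^ DIM('a) / s ^ DIM('a)) * (f (a + s *\<^sub>R x) * complex_of_real (gauss x)) \<partial>lborel)"
    unfolding F_def FTg using s by (intro Bochner_Integration.integral_cong refl) simp
  also have "\<dots> = complex_of_real (sqrt (2 * pi) ^ DIM('a) / s ^ DIM('a)) * (\<integral>x. f (a + s *\<^sub>R x) * complex_of_real (gauss x) \<partial>lborel)"
    by (rule integral_mult_right_zero)
  finally show ?thesis using s unfolding g_def by simp
qed

text \<open>By \<open>gauss_smoothing\<close> every Gaussian average of \<open>f\<close> vanishes.
  As the width shrinks, these averages tend to \<open>c\<close> times \<open>f\<close> in L^1, by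
  continuity of translations and dominated convergence.\<close>

lemma FT_eq_0_imp:
  fixes f :: "'a::euclidean_space \<Rightarrow> complex"
  assumes f: "integrable lborel f" and 0: "\<And>\<xi>. FT f \<xi> = 0"
  shows "l1norm f = 0"
proof -
  have [measurable]: "f \<in> borel_measurable borel" using f by auto
  define c where "c = sqrt (2 * pi) ^ DIM('a)"
  have c: "c > 0" by (simp add: c_def)
  define s where "s n = 1 / real (Suc n)" for n
  have s: "s n > 0" for n by (simp add: s_def)
  have slim: "s \<longlonglongrightarrow> 0" unfolding s_def by (rule LIMSEQ_inverse_real_of_nat[unfolded inverse_eq_divide])
  let ?R = "\<lambda>n. \<integral>\<^sup>+x. ennreal (gauss x) * l1norm (\<lambda>a. f (a + s n *\<^sub>R x) - f a) \<partial>lborel"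
  have [measurable]: "(\<lambda>x. l1norm (\<lambda>a. f (a + s n *\<^sub>R x) - f a)) \<in> borel_measurable borel" for n
    unfolding l1norm_def by measurable
  have le: "ennreal c * l1norm f \<le> ?R n" for n
  proof -
    have z: "(\<integral>x. f (a + s n *\<^sub>R x) * complex_of_real (gauss x) \<partial>lborel) = 0" for a
      using gauss_smoothing[OF f s, of a n] c by (simp add: 0 c_def)
    have "ennreal c * l1norm f = (\<integral>\<^sup>+a. ennreal (norm (complex_of_real c * f a)) \<partial>lborel)"
      using c by (simp add: l1norm_def norm_mult ennreal_mult nn_integral_cmult)
    also have "\<dots> = (\<integral>\<^sup>+a. ennreal (norm (\<integral>x. (f (a + s n *\<^sub>R x) - f a) * complex_of_real (gauss x) \<partial>lborel)) \<partial>lborel)"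
    proof (intro nn_integral_cong)
      fix a
      have "integrable lborel (\<lambda>x. f (a + s n *\<^sub>R x) * complex_of_real (gauss x))"
        by (rule integrable_mult_bounded(1)[where M = 1])
          (use integrable_lborel_affine[OF f] s in \<open>auto simp: less_imp_le[OF gauss_pos] gauss_le_1 less_imp_neq[symmetric]\<close>)
      then have "(\<integral>x. (f (a + s n *\<^sub>R x) - f a) * complex_of_real (gauss x) \<partial>lborel) = 0 - f a * complex_of_real c"
        unfolding left_diff_distrib
        by (subst Bochner_Integration.integral_diff) (auto simp: z c_def FT_gauss(1) gauss_integral simp del: integral_complex_of_real integral_of_real)
      then show "ennreal (norm (complex_of_real c * f a)) = ennreal (norm (\<integral>x. (f (a + s n *\<^sub>R x) - f a) * complex_of_real (gauss x) \<partial>lborel))"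
        by (simp add: norm_mult mult.commute)
    qed
    also have "\<dots> \<le> (\<integral>\<^sup>+a. \<integral>\<^sup>+x. ennreal (gauss x) * ennreal (norm (f (a + s n *\<^sub>R x) - f a)) \<partial>lborel \<partial>lborel)"
      by (intro nn_integral_mono order_trans[OF norm_integral_le_nn_integral])
        (auto simp: norm_mult less_imp_le[OF gauss_pos] ennreal_mult'[symmetric] mult.commute)
    also have "\<dots> = (\<integral>\<^sup>+x. \<integral>\<^sup>+a. ennreal (gauss x) * ennreal (norm (f (a + s n *\<^sub>R x) - f a)) \<partial>lborel \<partial>lborel)"
      by (rule nn_integral_lborel_fubini) measurable
    also have "\<dots> = ?R n" by (simp add: nn_integral_cmult l1norm_def)
    finally show ?thesis .
  qed
  have "?R \<longlonglongrightarrow> (\<integral>\<^sup>+(x::'a). 0 \<partial>lborel)"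
  proof (rule nn_integral_dominated_convergence[where w = "\<lambda>x. ennreal (gauss x) * (2 * l1norm f)"])
    have "l1norm f < \<infinity>" using f integrable_iff_l1norm by blast
    moreover have "(\<integral>\<^sup>+(x::'a). ennreal (gauss x) \<partial>lborel) < \<infinity>"
      using gauss_integrable by (simp add: integrable_iff_bounded less_imp_le[OF gauss_pos])
    ultimately show "(\<integral>\<^sup>+(x::'a). ennreal (gauss x) * (2 * l1norm f) \<partial>lborel) < \<infinity>"
      by (simp add: nn_integral_multc ennreal_mult_less_top)
    show "AE x in lborel. ennreal (gauss x) * l1norm (\<lambda>a. f (a + s n *\<^sub>R x) - f a) \<le> ennreal (gauss x) * (2 * l1norm f)" for n
    proof (intro AE_I2 mult_left_mono)
      fix x :: 'a
      show "l1norm (\<lambda>a. f (a + s n *\<^sub>R x) - f a) \<le> 2 * l1norm f"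
        using l1norm_diff_le[of "\<lambda>a. f (a + s n *\<^sub>R x)" f] by (simp add: l1norm_translate mult_2)
    qed auto
    show "AE x in lborel. (\<lambda>n. ennreal (gauss x) * l1norm (\<lambda>a. f (a + s n *\<^sub>R x) - f a)) \<longlonglongrightarrow> 0"
    proof (intro AE_I2)
      fix x :: 'a
      have "(\<lambda>n. s n *\<^sub>R x) \<longlonglongrightarrow> 0 *\<^sub>R x" by (intro tendsto_intros slim)
      then have "(\<lambda>n. l1norm (\<lambda>a. f (a + s n *\<^sub>R x) - f a)) \<longlonglongrightarrow> 0"
        using filterlim_compose[OF l1norm_translation_continuous[OF f]] by simp
      then have "(\<lambda>n. ennreal (gauss x) * l1norm (\<lambda>a. f (a + s n *\<^sub>R x) - f a)) \<longlonglongrightarrow> ennreal (gauss x) * 0"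
        by (intro tendsto_mult_ennreal tendsto_const) auto
      then show "(\<lambda>n. ennreal (gauss x) * l1norm (\<lambda>a. f (a + s n *\<^sub>R x) - f a)) \<longlonglongrightarrow> 0" by simp
    qed
  qed measurable
  then have "ennreal c * l1norm f \<le> 0"
    by (intro LIMSEQ_le_const[of ?R]) (auto intro: le)
  then show ?thesis using c by simp
qed

text \<open>Here the bounded factor need not be continuous, unlike in
  \<open>continuous_on_conv\<close>; the continuity comes from the translations of the integrable
  factor. Plancherel's formula needs this case.\<close>

lemma conv_tendsto_0:
  assumes f: "integrable lborel f" and g [measurable]: "g \<in> borel_measurable borel"
    and b: "\<And>x. norm (g x) \<le> M" and X: "X \<longlonglongrightarrow> 0"
  shows "(\<lambda>n. conv f g (X n)) \<longlonglongrightarrow> conv f g 0"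
proof -
  have [measurable]: "f \<in> borel_measurable borel" using f by auto
  have M: "M \<ge> 0" using b[of undefined] norm_ge_zero order_trans by blast
  have int: "integrable lborel (\<lambda>y. f (a - y) * g y)" for a
    by (rule integrable_mult_bounded(1)[OF integrable_lborel_translate(4)[OF f] g b])
  have le: "ennreal (norm (conv f g h - conv f g 0)) \<le> ennreal M * l1norm (\<lambda>x. f (x + h) - f x)" for h
  proof -
    have "conv f g h - conv f g 0 = (\<integral>y. (f (h - y) - f (- y)) * g y \<partial>lborel)"
      using Bochner_Integration.integral_diff[OF int[of h] int[of 0]]
      by (simp add: conv_def left_diff_distrib)
    then have "ennreal (norm (conv f g h - conv f g 0)) \<le> (\<integral>\<^sup>+y. norm ((f (h - y) - f (- y)) * g y) \<partial>lborel)"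
      by (simp only: norm_integral_le_nn_integral)
    also have "\<dots> \<le> (\<integral>\<^sup>+y. ennreal M * ennreal (norm (f (- y + h) - f (- y))) \<partial>lborel)"
      using M b by (intro nn_integral_mono) (auto simp: norm_mult mult.commute[of M] mult_left_mono simp flip: ennreal_mult)
    also have "\<dots> = ennreal M * l1norm (\<lambda>x. f (x + h) - f x)"
      using nn_integral_lborel_translate(5)[of "\<lambda>y. ennreal (norm (f (y + h) - f y))"]
      by (simp add: nn_integral_cmult l1norm_def)
    finally show ?thesis .
  qed
  have "(\<lambda>n. ennreal M * l1norm (\<lambda>x. f (x + X n) - f x)) \<longlonglongrightarrow> ennreal M * 0"
    by (rule tendsto_mult_ennreal[OF tendsto_const filterlim_compose[OF l1norm_translation_continuous[OF f] X]]) auto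
  then have lim0: "(\<lambda>n. ennreal M * l1norm (\<lambda>x. f (x + X n) - f x)) \<longlonglongrightarrow> 0" by simp
  have "(\<lambda>n. ennreal (norm (conv f g (X n) - conv f g 0))) \<longlonglongrightarrow> ennreal 0"
    unfolding ennreal_0 by (rule tendsto_sandwich[OF _ _ tendsto_const lim0]) (auto intro: always_eventually le)
  then have "(\<lambda>n. norm (conv f g (X n) - conv f g 0)) \<longlonglongrightarrow> 0"
    by (subst (asm) tendsto_ennreal_iff) auto
  then show ?thesis
    by (rule LIM_zero_cancel[OF tendsto_norm_zero_cancel])
qed

text \<open>The convolution \<open>F\<close> of \<open>f\<close> with its reflected conjugate has
  the transform |FT f|^2 and the value of the integral of |f|^2 at 0. Evaluating \<open>F\<close> at
  0 would be inversion, and \<open>FT F\<close> is not yet known to be integrable, so the Gaussian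
  width tends to 0 instead: monotone convergence on the Fourier side, continuity of \<open>F\<close>
  at 0 on the other. Boundedness of \<open>f\<close> makes \<open>F\<close> a convergent integral at
  every point.\<close>

lemma plancherel:
  fixes f :: "'a::euclidean_space \<Rightarrow> complex"
  assumes f: "integrable lborel f" and b: "\<And>x. norm (f x) \<le> M"
  shows "(\<integral>\<^sup>+\<xi>. ennreal ((norm (FT f \<xi>))\<^sup>2) \<partial>lborel)
    = ennreal ((2 * pi) ^ DIM('a)) * (\<integral>\<^sup>+x. ennreal ((norm (f x))\<^sup>2) \<partial>lborel)"
proof -
  have [measurable]: "f \<in> borel_measurable borel" using f by auto
  define c where "c = sqrt (2 * pi) ^ DIM('a)"
  have c: "c > 0" by (simp add: c_def)
  have c2: "c * c = (2 * pi) ^ DIM('a)" unfolding c_def by (subst power_mult_distrib[symmetric]) simp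
  define g where "g x = cnj (f (- x))" for x
  have g: "integrable lborel g" unfolding g_def by (intro integrable_cnj integrable_lborel_translate(5) f)
  then have [measurable]: "g \<in> borel_measurable borel" by auto
  have gb: "norm (g x) \<le> M" for x using b by (simp add: g_def)
  define F where "F = conv f g"
  have F: "integrable lborel F" unfolding F_def by (rule integrable_conv[OF f g])
  then have [measurable]: "F \<in> borel_measurable borel" by auto
  have cnj_meas: "cnj \<in> borel_measurable borel"
    by (intro borel_measurable_continuous_onI continuous_intros)
  have FTg: "FT g \<xi> = cnj (FT f \<xi>)" for \<xi>
  proof -
    have "FT g \<xi> = (\<integral>x. cnj (iexp (\<xi> \<bullet> x) * f x) \<partial>lborel)"
      unfolding FT_def g_def
      using lborel_integral_translate(5)[of "\<lambda>x. cnj (iexp (\<xi> \<bullet> x) * f x)", OF measurable_compose[OF _ cnj_meas]]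
      by (simp add: exp_cnj)
    then show ?thesis by (simp only: FT_def Bochner_Integration.integral_cnj)
  qed
  have FTF: "FT F \<xi> = complex_of_real ((norm (FT f \<xi>))\<^sup>2)" for \<xi>
    by (simp only: F_def FT_conv[OF f g] FTg complex_norm_square)
  have F0: "F 0 = complex_of_real (\<integral>x. (norm (f x))\<^sup>2 \<partial>lborel)"
  proof -
    have "F 0 = (\<integral>x. complex_of_real ((norm (f (- x)))\<^sup>2) \<partial>lborel)"
      by (simp only: F_def conv_def g_def complex_norm_square diff_0)
    also have "\<dots> = complex_of_real (\<integral>x. (norm (f (- x)))\<^sup>2 \<partial>lborel)"
      by (rule integral_complex_of_real)
    also have "(\<integral>x. (norm (f (- x)))\<^sup>2 \<partial>lborel) = (\<integral>x. (norm (f x))\<^sup>2 \<partial>lborel)"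
      by (rule lborel_integral_translate(5)[of "\<lambda>x. (norm (f x))\<^sup>2"]) simp
    finally show ?thesis .
  qed
  define s where "s n = 1 / real (Suc n)" for n
  have s: "s n > 0" for n by (simp add: s_def)
  have slim: "s \<longlonglongrightarrow> 0" unfolding s_def by (rule LIMSEQ_inverse_real_of_nat[unfolded inverse_eq_divide])
  define L where "L n = (\<integral>\<xi>. (norm (FT f \<xi>))\<^sup>2 * gauss (s n *\<^sub>R \<xi>) \<partial>lborel)" for n
  have Fb: "norm (F x) \<le> M * (\<integral>x. norm (f x) \<partial>lborel)" for x
    unfolding F_def by (rule conv_bound[OF f gb])
  have L: "complex_of_real (L n) = complex_of_real c * (\<integral>x. F (s n *\<^sub>R x) * complex_of_real (gauss x) \<partial>lborel)" for n
  proof -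
    have "complex_of_real (L n) = (\<integral>\<xi>. complex_of_real ((norm (FT f \<xi>))\<^sup>2 * gauss (s n *\<^sub>R \<xi>)) \<partial>lborel)"
      unfolding L_def by (rule integral_complex_of_real[symmetric])
    also have "\<dots> = (\<integral>\<xi>. FT F \<xi> * (iexp (- (\<xi> \<bullet> 0)) * complex_of_real (gauss (s n *\<^sub>R \<xi>))) \<partial>lborel)"
      unfolding FTF of_real_mult by simp
    finally show ?thesis
      using gauss_smoothing[OF F s, of 0 n] by (simp only: c_def add_0)
  qed
  have "(\<lambda>n. \<integral>x. F (s n *\<^sub>R x) * complex_of_real (gauss x) \<partial>lborel) \<longlonglongrightarrow> (\<integral>x. F 0 * complex_of_real (gauss (x::'a)) \<partial>lborel)"
  proof (rule integral_dominated_convergence)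
    show "integrable lborel (\<lambda>x::'a. (M * (\<integral>x. norm (f x) \<partial>lborel)) * gauss x)"
      by (intro integrable_mult_right gauss_integrable)
    show "AE x in lborel. norm (F (s n *\<^sub>R x) * complex_of_real (gauss x)) \<le> M * (\<integral>x. norm (f x) \<partial>lborel) * gauss x" for n
      using Fb by (auto simp: norm_mult less_imp_le[OF gauss_pos] intro!: mult_right_mono)
    show "AE x in lborel. (\<lambda>n. F (s n *\<^sub>R x) * complex_of_real (gauss x)) \<longlonglongrightarrow> F 0 * complex_of_real (gauss x)"
    proof (intro AE_I2 tendsto_mult tendsto_const)
      fix x :: 'a
      have "(\<lambda>n. s n *\<^sub>R x) \<longlonglongrightarrow> 0 *\<^sub>R x" by (intro tendsto_intros slim)
      then show "(\<lambda>n. F (s n *\<^sub>R x)) \<longlonglongrightarrow> F 0"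
        unfolding F_def by (intro conv_tendsto_0[OF f _ gb]) auto
    qed
  qed measurable
  then have "(\<lambda>n. complex_of_real (L n)) \<longlonglongrightarrow> complex_of_real c * (F 0 * complex_of_real c)"
    unfolding L integral_mult_right_zero gauss_integral c_def[symmetric]
    by (rule tendsto_mult[OF tendsto_const])
  then have "L \<longlonglongrightarrow> c * ((\<integral>x. (norm (f x))\<^sup>2 \<partial>lborel) * c)"
    unfolding F0 of_real_mult[symmetric] tendsto_of_real_iff .
  then have Llim: "L \<longlonglongrightarrow> c * c * (\<integral>x. (norm (f x))\<^sup>2 \<partial>lborel)"
    by (simp add: ac_simps)
  have Leq: "ennreal (L n) = (\<integral>\<^sup>+\<xi>. ennreal ((norm (FT f \<xi>))\<^sup>2 * gauss (s n *\<^sub>R \<xi>)) \<partial>lborel)" for n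
    unfolding L_def
  proof (rule nn_integral_eq_integral[symmetric])
    have gi: "integrable lborel (\<lambda>x::'a. gauss (s n *\<^sub>R x))"
      using integrable_lborel_affine[OF gauss_integrable, of "s n" 0] s[of n] by simp
    have "norm (FT f \<xi>) \<le> (\<integral>x. norm (f x) \<partial>lborel)" for \<xi>
      using norm_FT_le[of f \<xi>] f by (simp add: l1norm_integrable)
    then have 2: "(norm (FT f \<xi>))\<^sup>2 \<le> (\<integral>x. norm (f x) \<partial>lborel)\<^sup>2" for \<xi>
      by (intro power_mono) auto
    show "integrable lborel (\<lambda>\<xi>. (norm (FT f \<xi>))\<^sup>2 * gauss (s n *\<^sub>R \<xi>))"
      by (rule Bochner_Integration.integrable_bound[OF integrable_mult_right[OF gi, of "(\<integral>x. norm (f x) \<partial>lborel)\<^sup>2"]])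
        (use 2 in \<open>auto simp: abs_mult less_imp_le[OF gauss_pos] intro!: mult_right_mono\<close>)
  qed (auto simp: less_imp_le[OF gauss_pos])
  have "(\<lambda>n. \<integral>\<^sup>+\<xi>. ennreal ((norm (FT f \<xi>))\<^sup>2 * gauss (s n *\<^sub>R \<xi>)) \<partial>lborel) \<longlonglongrightarrow> (\<integral>\<^sup>+\<xi>. ennreal ((norm (FT f \<xi>))\<^sup>2) \<partial>lborel)"
  proof (rule nn_integral_LIMSEQ)
    show "incseq (\<lambda>n \<xi>. ennreal ((norm (FT f \<xi>))\<^sup>2 * gauss (s n *\<^sub>R \<xi>)))"
    proof (intro incseq_SucI le_funI ennreal_leI mult_left_mono)
      fix n and \<xi> :: 'a
      have "s (Suc n) \<le> s n" unfolding s_def by (intro divide_left_mono) auto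
      then have "norm (s (Suc n) *\<^sub>R \<xi>) \<le> norm (s n *\<^sub>R \<xi>)"
        using s[of n] s[of "Suc n"] by (auto intro!: mult_right_mono)
      then have "(norm (s (Suc n) *\<^sub>R \<xi>))\<^sup>2 \<le> (norm (s n *\<^sub>R \<xi>))\<^sup>2" by (rule power_mono) simp
      then show "gauss (s n *\<^sub>R \<xi>) \<le> gauss (s (Suc n) *\<^sub>R \<xi>)" unfolding gauss_def exp_le_cancel_iff by linarith
    qed simp
    show "(\<lambda>n. ennreal ((norm (FT f \<xi>))\<^sup>2 * gauss (s n *\<^sub>R \<xi>))) \<longlonglongrightarrow> ennreal ((norm (FT f \<xi>))\<^sup>2)" for \<xi>
    proof (rule tendsto_ennrealI)
      have "(\<lambda>n. (norm (FT f \<xi>))\<^sup>2 * exp (- (norm (s n *\<^sub>R \<xi>))\<^sup>2 / 2)) \<longlonglongrightarrow> (norm (FT f \<xi>))\<^sup>2 * exp (- (norm (0 *\<^sub>R \<xi>))\<^sup>2 / 2)"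
        by (intro tendsto_intros slim) simp
      then show "(\<lambda>n. (norm (FT f \<xi>))\<^sup>2 * gauss (s n *\<^sub>R \<xi>)) \<longlonglongrightarrow> (norm (FT f \<xi>))\<^sup>2" by (simp add: gauss_def)
    qed
  qed measurable
  moreover have "(\<lambda>n. \<integral>\<^sup>+\<xi>. ennreal ((norm (FT f \<xi>))\<^sup>2 * gauss (s n *\<^sub>R \<xi>)) \<partial>lborel) \<longlonglongrightarrow> ennreal (c * c * (\<integral>x. (norm (f x))\<^sup>2 \<partial>lborel))"
    unfolding Leq[symmetric] by (rule tendsto_ennrealI[OF Llim])
  ultimately have "(\<integral>\<^sup>+\<xi>. ennreal ((norm (FT f \<xi>))\<^sup>2) \<partial>lborel) = ennreal (c * c * (\<integral>x. (norm (f x))\<^sup>2 \<partial>lborel))"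
    by (rule LIMSEQ_unique)
  also have "\<dots> = ennreal (c * c) * ennreal (\<integral>x. (norm (f x))\<^sup>2 \<partial>lborel)"
    using c by (intro ennreal_mult) auto
  also have "ennreal (\<integral>x. (norm (f x))\<^sup>2 \<partial>lborel) = (\<integral>\<^sup>+x. ennreal ((norm (f x))\<^sup>2) \<partial>lborel)"
  proof (rule nn_integral_eq_integral[symmetric])
    have "integrable lborel (\<lambda>x. M * norm (f x))" using f by simp
    then show "integrable lborel (\<lambda>x. (norm (f x))\<^sup>2)"
    proof (rule Bochner_Integration.integrable_bound)
      show "AE x in lborel. norm ((norm (f x))\<^sup>2) \<le> norm (M * norm (f x))"
      proof (intro AE_I2)
        fix x
        have "norm (f x) * norm (f x) \<le> M * norm (f x)" by (intro mult_right_mono b) auto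
        then show "norm ((norm (f x))\<^sup>2) \<le> norm (M * norm (f x))" by (simp add: power2_eq_square)
      qed
    qed simp
  qed simp
  finally show ?thesis by (simp add: c2)
qed

section \<open>Calderon--Zygmund decomposition\<close>

text \<open>The lower corner of the half-open grid cube of side \<open>s\<close> that contains
  \<open>x\<close>. It serves as the label of that cube: cubes are fibres of a Borel function, so no
  family of sets has to be indexed or summed over.\<close>

definition corner :: "real \<Rightarrow> 'a::euclidean_space \<Rightarrow> 'a" where
  "corner s x = (\<Sum>b\<in>Basis. (of_int \<lfloor>x \<bullet> b / s\<rfloor> * s) *\<^sub>R b)"

lemma corner_measurable [measurable]: "corner s \<in> borel_measurable borel"
  unfolding corner_def[abs_def] by measurable

lemma corner_inner: "b \<in> Basis \<Longrightarrow> corner s x \<bullet> b = of_int \<lfloor>x \<bullet> b / s\<rfloor> * s"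
  by (simp add: corner_def inner_sum_left_Basis)

lemma corner_eq_iff:
  assumes "s > 0"
  shows "corner s x = corner s y \<longleftrightarrow> (\<forall>b\<in>Basis. \<lfloor>x \<bullet> b / s\<rfloor> = \<lfloor>y \<bullet> b / s\<rfloor>)"
  using assms by (auto simp: euclidean_eq_iff[of "corner s x"] corner_inner)

text \<open>Dyadic nesting: floor(u/2) depends only on floor(u).\<close>

lemma corner_double:
  assumes s: "s > 0" and eq: "corner s x = corner s y"
  shows "corner (2 * s) x = corner (2 * s) y"
proof -
  have "\<lfloor>x \<bullet> b / (2 * s)\<rfloor> = \<lfloor>y \<bullet> b / (2 * s)\<rfloor>" if "b \<in> Basis" for b
  proof -
    have "\<lfloor>u / (2 * s)\<rfloor> = \<lfloor>u / s\<rfloor> div 2" for u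
      using floor_divide_real_eq_div[of 2 "u / s"] by (simp add: mult.commute)
    then show ?thesis using eq that by (simp add: corner_eq_iff[OF s])
  qed
  then show ?thesis using s by (simp add: corner_eq_iff)
qed

lemma corner_dyadic_mono:
  assumes s: "s > 0" and eq: "corner (s / 2 ^ n) x = corner (s / 2 ^ n) y" and "m \<le> n"
  shows "corner (s / 2 ^ m) x = corner (s / 2 ^ m) y"
  using assms(3) eq
proof (induction n rule: dec_induct)
  case (step n)
  have "corner (2 * (s / 2 ^ Suc n)) x = corner (2 * (s / 2 ^ Suc n)) y"
    by (rule corner_double) (use s step in auto)
  then show ?case using step by simp
qed

lemma corner_bounds:
  assumes s: "s > 0" and b: "b \<in> Basis"
  shows "corner s x \<bullet> b \<le> x \<bullet> b" "x \<bullet> b < corner s x \<bullet> b + s"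
proof -
  have "of_int \<lfloor>x \<bullet> b / s\<rfloor> \<le> x \<bullet> b / s" "x \<bullet> b / s < of_int \<lfloor>x \<bullet> b / s\<rfloor> + 1" by linarith+
  then show "corner s x \<bullet> b \<le> x \<bullet> b" "x \<bullet> b < corner s x \<bullet> b + s"
    by (simp_all only: corner_inner[OF b] pos_le_divide_eq[OF s] pos_divide_less_eq[OF s] distrib_right mult_1_left)
qed

lemma corner_dist:
  fixes x y :: "'a::euclidean_space" and s :: real
  assumes s: "s > 0" and eq: "corner s x = corner s y"
  shows "norm (x - y) \<le> DIM('a) * s"
proof -
  have "norm (x - y) \<le> (\<Sum>b\<in>Basis. \<bar>(x - y) \<bullet> b\<bar>)" by (rule norm_le_l1)
  also have "\<dots> \<le> (\<Sum>b\<in>(Basis::'a set). s)"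
  proof (rule sum_mono)
    fix b :: 'a assume b: "b \<in> Basis"
    show "\<bar>(x - y) \<bullet> b\<bar> \<le> s"
      using corner_bounds[OF s b, of x] corner_bounds[OF s b, of y] eq by (simp add: inner_diff_left)
  qed
  finally show ?thesis by simp
qed

lemma corner_box:
  assumes s: "s > 0" and y: "y \<in> box (corner s x) (corner s x + s *\<^sub>R One)"
  shows "corner s y = corner s x"
proof -
  have "\<lfloor>y \<bullet> b / s\<rfloor> = \<lfloor>x \<bullet> b / s\<rfloor>" if b: "b \<in> Basis" for b
  proof -
    have "corner s x \<bullet> b < y \<bullet> b" "y \<bullet> b < corner s x \<bullet> b + s"
      using y b by (auto simp: mem_box inner_add_left)
    then have "of_int \<lfloor>x \<bullet> b / s\<rfloor> \<le> y \<bullet> b / s" "y \<bullet> b / s < of_int \<lfloor>x \<bullet> b / s\<rfloor> + 1"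
      using s by (simp_all add: corner_inner[OF b] field_simps)
    then show ?thesis by (rule floor_unique)
  qed
  then show ?thesis using s by (simp add: corner_eq_iff)
qed

lemma emeasure_box_cube:
  fixes c :: "'a::euclidean_space"
  assumes "s \<ge> 0"
  shows "emeasure lborel (box c (c + s *\<^sub>R One)) = ennreal (s ^ DIM('a))"
    "emeasure lborel (cbox c (c + s *\<^sub>R One)) = ennreal (s ^ DIM('a))"
  using assms by (simp_all add: emeasure_lborel_box_eq emeasure_lborel_cbox_eq inner_add_left)

text \<open>The half-open cube lies between an open and a closed box of the same measure, so its
  faces need no separate treatment.\<close>

lemma emeasure_cube:
  fixes x :: "'a::euclidean_space"
  assumes s: "s > 0"
  shows "emeasure lborel {y. corner s y = corner s x} = ennreal (s ^ DIM('a))"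
proof (rule antisym)
  have "{y. corner s y = corner s x} \<subseteq> cbox (corner s x) (corner s x + s *\<^sub>R One)"
  proof
    fix y assume "y \<in> {y. corner s y = corner s x}"
    then show "y \<in> cbox (corner s x) (corner s x + s *\<^sub>R One)"
      using corner_bounds[OF s, of _ y] by (auto simp: mem_box inner_add_left less_imp_le)
  qed
  from emeasure_mono[OF this, of lborel] s
  show "emeasure lborel {y. corner s y = corner s x} \<le> ennreal (s ^ DIM('a))"
    by (simp add: emeasure_box_cube)
  have "box (corner s x) (corner s x + s *\<^sub>R One) \<subseteq> {y. corner s y = corner s x}"
    using corner_box[OF s] by auto
  moreover have "{y. corner s y = corner s x} \<in> sets lborel" by measurable
  ultimately have "emeasure lborel (box (corner s x) (corner s x + s *\<^sub>R One)) \<le> emeasure lborel {y. corner s y = corner s x}"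
    by (rule emeasure_mono)
  then show "ennreal (s ^ DIM('a)) \<le> emeasure lborel {y. corner s y = corner s x}"
    using s by (simp add: emeasure_box_cube)
qed

lemma emeasure_ball_le:
  fixes c :: "'a::euclidean_space"
  assumes "r \<ge> 0"
  shows "emeasure lborel (ball c r) \<le> ennreal ((2 * r) ^ DIM('a))"
proof -
  have "ball c r \<subseteq> cbox (c - r *\<^sub>R One) ((c - r *\<^sub>R One) + (2 * r) *\<^sub>R One)"
  proof
    fix x assume "x \<in> ball c r"
    then have "\<bar>(x - c) \<bullet> b\<bar> \<le> r" if "b \<in> Basis" for b
      using Basis_le_norm[OF that, of "x - c"] by (simp add: dist_norm norm_minus_commute)
    then show "x \<in> cbox (c - r *\<^sub>R One) ((c - r *\<^sub>R One) + (2 * r) *\<^sub>R One)"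
      by (fastforce simp: mem_box inner_diff_left inner_add_left abs_le_iff)
  qed
  from emeasure_mono[OF this, of lborel] show ?thesis
    using assms by (simp only: emeasure_box_cube) (simp add: emeasure_box_cube)
qed

text \<open>Fixed data for the decomposition of \<open>f\<close> at height \<open>lam\<close>. The
  assumption \<open>large\<close> makes the coarsest cubes so big that the mean of |f| over none of
  them exceeds \<open>lam\<close>; hence every selected cube has a parent that was not
  selected.\<close>

locale calderon_zygmund =
  fixes f :: "'a::euclidean_space \<Rightarrow> complex" and lam s0 M :: real
  assumes lam: "lam > 0" and s0: "s0 > 0"
    and f_int: "integrable lborel f" and f_cont: "continuous_on UNIV f"
    and f_bound: "\<And>x. norm (f x) \<le> M"
    and large: "l1norm f \<le> ennreal (lam * s0 ^ DIM('a))"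
begin

definition side :: "nat \<Rightarrow> real" where "side n = s0 / 2 ^ n"

definition mass :: "nat \<Rightarrow> 'a \<Rightarrow> ennreal" where
  "mass n x = (\<integral>\<^sup>+z. (if corner (side n) z = corner (side n) x then ennreal (norm (f z)) else 0) \<partial>lborel)"

text \<open>The mean of |f| over the generation-\<open>n\<close> cube of \<open>x\<close> exceeds
  \<open>lam\<close>, multiplied out to avoid a division in \<open>ennreal\<close>.\<close>

definition stop :: "nat \<Rightarrow> 'a \<Rightarrow> bool" where
  "stop n x \<longleftrightarrow> ennreal (lam * side n ^ DIM('a)) < mass n x"

definition bad :: "'a \<Rightarrow> bool" where "bad x \<longleftrightarrow> (\<exists>n. stop n x)"

text \<open>The first stopping generation picks out the maximal cube. The value is unspecified at
  points that are not \<open>bad\<close>, so its relevant uses are guarded by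
  \<open>bad\<close>.\<close>

definition level :: "'a \<Rightarrow> nat" where "level x = (LEAST n. stop n x)"

definition same :: "'a \<Rightarrow> 'a \<Rightarrow> bool" where
  "same y z \<longleftrightarrow> bad y \<and> bad z \<and> level y = level z \<and> corner (side (level y)) y = corner (side (level z)) z"

text \<open>Averaging over the stopping cube of the point is integration against this symmetric Markov kernel on the
  bad set; the bad part \<open>f - good_part\<close> is then handled by one double integral over pairs
  of points in a common cube, instead of a sum over cubes.\<close>

definition kern :: "'a \<Rightarrow> 'a \<Rightarrow> real" where
  "kern y z = (if same y z then 1 / side (level y) ^ DIM('a) else 0)"

definition good_part :: "'a \<Rightarrow> complex" where
  "good_part x = (if bad x then \<integral>z. complex_of_real (kern x z) * f z \<partial>lborel else f x)"

lemma side_pos [simp]: "side n > 0" using s0 by (simp add: side_def)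

lemma side_nonneg [simp]: "side n \<ge> 0" using side_pos less_imp_le by blast

lemma f_meas [measurable]: "f \<in> borel_measurable borel" using f_int by auto

lemma stop_meas [measurable]: "Measurable.pred borel (stop n)"
  unfolding stop_def[abs_def] mass_def by measurable

lemma bad_meas [measurable]: "Measurable.pred borel bad"
  unfolding bad_def[abs_def] by measurable

lemma level_meas [measurable]: "level \<in> measurable borel (count_space UNIV)"
  unfolding level_def[abs_def] by measurable

lemma stopping_corner_meas [measurable]: "(\<lambda>x. corner (side (level x)) x) \<in> borel_measurable borel"
  by (rule measurable_compose_countable[OF _ level_meas]) measurable

lemma same_meas [measurable]: "Measurable.pred (borel \<Otimes>\<^sub>M borel) (\<lambda>(y, z). same y z)"
proof -
  let ?c = "\<lambda>x. corner (side (level x)) x"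
  have m: "(\<lambda>p. ?c (fst p)) \<in> borel_measurable (borel \<Otimes>\<^sub>M borel)"
    "(\<lambda>p. ?c (snd p)) \<in> borel_measurable (borel \<Otimes>\<^sub>M borel)"
    by (rule measurable_compose[OF measurable_fst stopping_corner_meas],
        rule measurable_compose[OF measurable_snd stopping_corner_meas])
  define B where "B = (\<lambda>p. ?c (fst p) = ?c (snd p))"
  have B: "Measurable.pred (borel \<Otimes>\<^sub>M borel) (\<lambda>p. B p)"
    unfolding pred_def B_def by (rule measurable_equality_set[OF m])
  have [measurable]: "Measurable.pred (borel \<Otimes>\<^sub>M borel) (\<lambda>p. bad (fst p))"
    "Measurable.pred (borel \<Otimes>\<^sub>M borel) (\<lambda>p. bad (snd p))"
    by (rule measurable_compose[OF measurable_fst bad_meas], rule measurable_compose[OF measurable_snd bad_meas])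
  have "(\<lambda>x. real (level x)) \<in> borel_measurable borel" by (rule measurable_compose[OF level_meas]) simp
  then have "(\<lambda>p. real (level (fst p))) \<in> borel_measurable (borel \<Otimes>\<^sub>M borel)"
    "(\<lambda>p. real (level (snd p))) \<in> borel_measurable (borel \<Otimes>\<^sub>M borel)"
    by (rule measurable_compose[OF measurable_fst], rule measurable_compose[OF measurable_snd])
  from measurable_equality_set[OF this]
  have [measurable]: "Measurable.pred (borel \<Otimes>\<^sub>M borel) (\<lambda>p. level (fst p) = level (snd p))"
    by (simp add: pred_def)
  have "Measurable.pred (borel \<Otimes>\<^sub>M borel) (\<lambda>p. bad (fst p) \<and> bad (snd p) \<and> level (fst p) = level (snd p))"
    by measurable
  from pred_intros_logic(3)[OF this B] show ?thesis
    unfolding same_def case_prod_beta B_def by (simp add: conj_assoc)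
qed

lemma kern_meas [measurable]: "(\<lambda>(y, z). kern y z) \<in> borel_measurable (borel \<Otimes>\<^sub>M borel)"
  unfolding kern_def case_prod_beta by measurable

lemma same_sym: "same y z \<longleftrightarrow> same z y" by (auto simp: same_def)

lemma kern_sym: "kern y z = kern z y"
  using same_sym[of y z] by (auto simp: kern_def same_def)

lemma kern_nonneg [simp]: "kern y z \<ge> 0" by (simp add: kern_def)

lemma kern_eq_0: "\<not> bad y \<Longrightarrow> kern y z = 0" by (simp add: kern_def same_def)

lemma corner_side_mono:
  "corner (side n) x = corner (side n) y \<Longrightarrow> m \<le> n \<Longrightarrow> corner (side m) x = corner (side m) y"
  unfolding side_def by (rule corner_dyadic_mono[OF s0])

lemma stop_cong: "corner (side n) x = corner (side n) y \<Longrightarrow> stop n x = stop n y"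
  by (simp add: stop_def mass_def)

lemma stop_level: "bad x \<Longrightarrow> stop (level x) x"
  unfolding bad_def level_def by (metis LeastI)

text \<open>Points in one cube of generation \<open>level y\<close> also share all coarser cubes, so
  they pass the same stopping tests up to that generation and stop there together.\<close>

lemma same_eq:
  assumes "bad y"
  shows "same y z \<longleftrightarrow> corner (side (level y)) z = corner (side (level y)) y"
proof
  assume eq: "corner (side (level y)) z = corner (side (level y)) y"
  have st: "stop m z = stop m y" if "m \<le> level y" for m
    using corner_side_mono[OF eq that] by (rule stop_cong)
  then have sz: "stop (level y) z" using stop_level[OF assms] by simp
  moreover have "level z = level y"
    unfolding level_def[of z]
  proof (rule Least_equality[where P = "\<lambda>n. stop n z", OF sz])
    fix m assume "stop m z"
    then show "level y \<le> m"
      using st[of m] Least_le[of "\<lambda>n. stop n y" m] unfolding level_def[of y] by linarith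
  qed
  ultimately show "same y z" using assms eq by (auto simp: same_def bad_def)
qed (auto simp: same_def)

lemma nn_integral_kern:
  assumes "bad y"
  shows "(\<integral>\<^sup>+z. ennreal (kern y z) \<partial>lborel) = 1"
proof -
  have "(\<integral>\<^sup>+z. ennreal (kern y z) \<partial>lborel)
    = (\<integral>\<^sup>+z. ennreal (1 / side (level y) ^ DIM('a)) * indicator {z. corner (side (level y)) z = corner (side (level y)) y} z \<partial>lborel)"
    using assms by (intro nn_integral_cong) (auto simp: kern_def same_eq indicator_def)
  also have "\<dots> = ennreal (1 / side (level y) ^ DIM('a)) * ennreal (side (level y) ^ DIM('a))"
    by (subst nn_integral_cmult_indicator) (simp_all add: emeasure_cube)
  also have "\<dots> = 1"
    by (subst ennreal_mult[symmetric]) (auto simp: less_imp_neq[OF side_pos, symmetric])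
  finally show ?thesis .
qed

lemma nn_integral_kern_f:
  assumes "bad y"
  shows "(\<integral>\<^sup>+z. ennreal (kern y z) * ennreal (norm (f z)) \<partial>lborel)
    = ennreal (1 / side (level y) ^ DIM('a)) * mass (level y) y"
proof -
  have "(\<integral>\<^sup>+z. ennreal (kern y z) * ennreal (norm (f z)) \<partial>lborel)
    = (\<integral>\<^sup>+z. ennreal (1 / side (level y) ^ DIM('a)) *
        (if corner (side (level y)) z = corner (side (level y)) y then ennreal (norm (f z)) else 0) \<partial>lborel)"
    using assms by (intro nn_integral_cong) (auto simp: kern_def same_eq)
  also have "\<dots> = ennreal (1 / side (level y) ^ DIM('a)) * mass (level y) y"
    unfolding mass_def by (rule nn_integral_cmult) measurable
  finally show ?thesis .
qed

text \<open>By symmetry \<open>kern\<close> also has mass 1 in its first variable, so averaging over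
  stopping cubes preserves the total mass of |f| on the bad set.\<close>

lemma nn_integral_kern_f_swap:
  "(\<integral>\<^sup>+y. \<integral>\<^sup>+z. ennreal (kern y z) * ennreal (norm (f z)) \<partial>lborel \<partial>lborel)
    = (\<integral>\<^sup>+z. indicator {z. bad z} z * ennreal (norm (f z)) \<partial>lborel)"
proof -
  have "(\<integral>\<^sup>+y. \<integral>\<^sup>+z. ennreal (kern y z) * ennreal (norm (f z)) \<partial>lborel \<partial>lborel)
    = (\<integral>\<^sup>+z. \<integral>\<^sup>+y. ennreal (kern y z) * ennreal (norm (f z)) \<partial>lborel \<partial>lborel)"
    by (rule nn_integral_lborel_fubini) measurable
  also have "\<dots> = (\<integral>\<^sup>+z. indicator {z. bad z} z * ennreal (norm (f z)) \<partial>lborel)"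
  proof (intro nn_integral_cong)
    fix z
    have "(\<integral>\<^sup>+y. ennreal (kern y z) * ennreal (norm (f z)) \<partial>lborel) = (\<integral>\<^sup>+y. ennreal (kern z y) \<partial>lborel) * ennreal (norm (f z))"
      unfolding kern_sym[of _ z] by (rule nn_integral_multc) measurable
    then show "(\<integral>\<^sup>+y. ennreal (kern y z) * ennreal (norm (f z)) \<partial>lborel) = indicator {z. bad z} z * ennreal (norm (f z))"
      by (cases "bad z") (simp_all add: nn_integral_kern kern_eq_0)
  qed
  finally show ?thesis .
qed

lemma good_meas [measurable]: "good_part \<in> borel_measurable borel"
  unfolding good_part_def[abs_def] by measurable

text \<open>If |f x| exceeded \<open>lam\<close>, then by continuity |f| would stay above some
  \<open>l\<close> larger than \<open>lam\<close> on a small dyadic cube around \<open>x\<close>,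
  and that cube would stop. This stands in for the Lebesgue differentiation theorem.\<close>

lemma not_bad_bound:
  assumes "\<not> bad x"
  shows "norm (f x) \<le> lam"
proof (rule ccontr)
  assume "\<not> norm (f x) \<le> lam"
  then obtain l where l: "lam < l" "l < norm (f x)" using dense[of lam "norm (f x)"] by auto
  have "isCont (\<lambda>x. norm (f x)) x"
    using f_cont by (auto simp: continuous_on_eq_continuous_at intro: continuous_intros)
  then have "\<forall>\<^sub>F z in nhds x. l < norm (f z)"
    using l(2) order_tendstoD(1) tendsto_at_iff_tendsto_nhds unfolding isCont_def by blast
  then obtain e where e: "e > 0" "\<And>z. dist z x < e \<Longrightarrow> l < norm (f z)"
    by (auto simp: eventually_nhds_metric)
  have "(\<lambda>n. DIM('a) * side n) \<longlonglongrightarrow> real DIM('a) * 0"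
    unfolding side_def by (intro tendsto_mult tendsto_const LIMSEQ_divide_realpow_zero) auto
  then have "\<forall>\<^sub>F n in sequentially. DIM('a) * side n < e"
    using e(1) by (intro order_tendstoD) auto
  then obtain n where n: "DIM('a) * side n < e" by (auto simp: eventually_sequentially)
  have "ennreal (lam * side n ^ DIM('a)) < ennreal (l * side n ^ DIM('a))"
    using l lam by (intro ennreal_lessI mult_strict_right_mono mult_pos_pos zero_less_power) auto
  also have "\<dots> = (\<integral>\<^sup>+z. ennreal l * indicator {z. corner (side n) z = corner (side n) x} z \<partial>lborel)"
    using l lam by (subst nn_integral_cmult_indicator) (simp_all add: emeasure_cube ennreal_mult)
  also have "\<dots> \<le> mass n x"
    unfolding mass_def
  proof (intro nn_integral_mono)
    fix z
    have "l < norm (f z)" if "corner (side n) z = corner (side n) x"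
      using corner_dist[OF side_pos that] n by (intro e(2)) (simp add: dist_norm)
    then show "ennreal l * indicator {z. corner (side n) z = corner (side n) x} z
        \<le> (if corner (side n) z = corner (side n) x then ennreal (norm (f z)) else 0)"
      by (auto simp: less_imp_le ennreal_leI)
  qed
  finally show False using assms by (auto simp: bad_def stop_def)
qed

text \<open>The parent cube did not stop, and its volume is 2^d times that of the stopping cube. A
  parent exists because \<open>large\<close> rules out stopping at generation 0.\<close>

lemma mass_bound:
  assumes "bad x"
  shows "mass (level x) x \<le> ennreal (2 ^ DIM('a) * lam * side (level x) ^ DIM('a))"
proof -
  have "\<not> stop 0 x"
  proof -
    have "mass 0 x \<le> l1norm f" unfolding mass_def l1norm_def by (intro nn_integral_mono) auto
    then show ?thesis using large by (simp add: stop_def side_def not_less)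
  qed
  with stop_level[OF assms] have "level x \<noteq> 0" by (cases "level x") auto
  then obtain m where m: "level x = Suc m" using not0_implies_Suc by blast
  then have "\<not> stop m x" using not_less_Least[of m "\<lambda>n. stop n x"] unfolding level_def by simp
  then have "mass m x \<le> ennreal (lam * side m ^ DIM('a))" by (simp add: stop_def not_less)
  moreover have "mass (Suc m) x \<le> mass m x"
    unfolding mass_def by (intro nn_integral_mono) (auto dest: corner_side_mono[of "Suc m" _ x m])
  moreover have "lam * side m ^ DIM('a) = 2 ^ DIM('a) * lam * side (Suc m) ^ DIM('a)"
    by (simp add: side_def power_divide power_mult_distrib)
  ultimately show ?thesis unfolding m by simp
qed

lemma nn_integral_kern_f_bound:
  assumes "bad x"
  shows "(\<integral>\<^sup>+z. ennreal (kern x z) * ennreal (norm (f z)) \<partial>lborel) \<le> ennreal (2 ^ DIM('a) * lam)"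
proof -
  have "(\<integral>\<^sup>+z. ennreal (kern x z) * ennreal (norm (f z)) \<partial>lborel)
    \<le> ennreal (1 / side (level x) ^ DIM('a)) * ennreal (2 ^ DIM('a) * lam * side (level x) ^ DIM('a))"
    unfolding nn_integral_kern_f[OF assms] by (intro mult_left_mono mass_bound assms) simp
  also have "\<dots> = ennreal (2 ^ DIM('a) * lam)"
    using lam by (subst ennreal_mult[symmetric]) (auto simp: less_imp_neq[OF side_pos, symmetric])
  finally show ?thesis .
qed

lemma norm_good_le:
  "ennreal (norm (good_part x)) \<le> (if bad x then \<integral>\<^sup>+z. ennreal (kern x z) * ennreal (norm (f z)) \<partial>lborel else norm (f x))"
  unfolding good_part_def
  using norm_integral_le_nn_integral[of lborel "\<lambda>z. complex_of_real (kern x z) * f z"]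
  by (simp add: norm_mult ennreal_mult)

lemma good_bound: "norm (good_part x) \<le> 2 ^ DIM('a) * lam"
proof (cases "bad x")
  case True
  then have "ennreal (norm (good_part x)) \<le> ennreal (2 ^ DIM('a) * lam)"
    using order_trans[OF norm_good_le[of x]] nn_integral_kern_f_bound[OF True] by simp
  then show ?thesis using lam by (subst (asm) ennreal_le_iff) auto
next
  case False
  have "lam * 1 \<le> lam * 2 ^ DIM('a)" using lam by (intro mult_left_mono) auto
  then show ?thesis using not_bad_bound[OF False] False by (simp add: good_part_def mult.commute)
qed

lemma l1norm_good: "l1norm good_part \<le> l1norm f"
proof -
  have "l1norm good_part \<le> (\<integral>\<^sup>+x. (\<integral>\<^sup>+z. ennreal (kern x z) * ennreal (norm (f z)) \<partial>lborel)
      + indicator {z. \<not> bad z} x * ennreal (norm (f x)) \<partial>lborel)"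
    unfolding l1norm_def
    by (intro nn_integral_mono order_trans[OF norm_good_le]) (auto simp: indicator_def)
  also have "\<dots> = (\<integral>\<^sup>+z. indicator {z. bad z} z * ennreal (norm (f z)) \<partial>lborel)
      + (\<integral>\<^sup>+z. indicator {z. \<not> bad z} z * ennreal (norm (f z)) \<partial>lborel)"
    by (subst nn_integral_add) (simp_all add: nn_integral_kern_f_swap)
  also have "\<dots> = l1norm f"
    unfolding l1norm_def
    by (subst nn_integral_add[symmetric]) (auto intro!: nn_integral_cong simp: indicator_def)
  finally show ?thesis .
qed

lemma good_integrable: "integrable lborel good_part"
  using l1norm_good f_int by (auto simp: integrable_iff_l1norm intro: le_less_trans)

text \<open>At a bad point the mean of |f| over the stopping cube is more than \<open>lam\<close>;
  integrating over the bad set returns at most the norm of \<open>f\<close>, by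
  \<open>nn_integral_kern_f_swap\<close>.\<close>

lemma emeasure_bad: "ennreal lam * emeasure lborel {x. bad x} \<le> l1norm f"
proof -
  have "ennreal lam * emeasure lborel {x. bad x} = (\<integral>\<^sup>+y. ennreal lam * indicator {x. bad x} y \<partial>lborel)"
    by (subst nn_integral_cmult_indicator) simp_all
  also have "\<dots> \<le> (\<integral>\<^sup>+y. \<integral>\<^sup>+z. ennreal (kern y z) * ennreal (norm (f z)) \<partial>lborel \<partial>lborel)"
  proof (intro nn_integral_mono)
    fix y
    have "ennreal lam \<le> (\<integral>\<^sup>+z. ennreal (kern y z) * ennreal (norm (f z)) \<partial>lborel)" if "bad y"
    proof -
      have "ennreal lam = ennreal (1 / side (level y) ^ DIM('a)) * ennreal (lam * side (level y) ^ DIM('a))"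
        using lam by (subst ennreal_mult[symmetric]) (auto simp: less_imp_neq[OF side_pos, symmetric])
      also have "\<dots> \<le> ennreal (1 / side (level y) ^ DIM('a)) * mass (level y) y"
        using stop_level[OF that] by (intro mult_left_mono) (auto simp: stop_def)
      finally show ?thesis by (simp add: nn_integral_kern_f[OF that])
    qed
    then show "ennreal lam * indicator {x. bad x} y \<le> (\<integral>\<^sup>+z. ennreal (kern y z) * ennreal (norm (f z)) \<partial>lborel)"
      by (cases "bad y") auto
  qed
  also have "\<dots> \<le> l1norm f"
    unfolding nn_integral_kern_f_swap l1norm_def by (intro nn_integral_mono) (auto simp: indicator_def)
  finally show ?thesis .
qed

text \<open>Balls around bad points instead of dilated cubes: the union is open, hence Borel. As two
  points of a cube are at distance at most d times its side (\<open>corner_dist\<close>), the radius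
  is twice that bound, which is the separation that Hoermander's condition asks for.\<close>

definition enlarged :: "'a set" where
  "enlarged = (\<Union>y\<in>{y. bad y}. ball y (2 * DIM('a) * side (level y)))"

lemma enlarged_meas [measurable]: "enlarged \<in> sets borel"
  unfolding enlarged_def by (intro borel_open open_UN) auto

text \<open>A covering estimate by double integration. From a point \<open>x\<close> of the enlarged
  set a whole stopping cube lies within 3 d times its side, so the weight \<open>?w x y\<close>
  integrates to at least 1 in \<open>y\<close>. For fixed \<open>y\<close> its integral in
  \<open>x\<close> is the volume of a ball divided by that of a cube, at most (6 d)^d.\<close>

lemma emeasure_enlarged:
  "emeasure lborel enlarged \<le> ennreal ((6 * DIM('a)) ^ DIM('a)) * emeasure lborel {x. bad x}"
proof -
  let ?d = "real DIM('a)"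
  let ?w = "\<lambda>x y. if bad y \<and> dist y x < 3 * ?d * side (level y) then ennreal (1 / side (level y) ^ DIM('a)) else 0"
  have "emeasure lborel enlarged = (\<integral>\<^sup>+x. indicator enlarged x \<partial>lborel)" by simp
  also have "\<dots> \<le> (\<integral>\<^sup>+x. \<integral>\<^sup>+y. ?w x y \<partial>lborel \<partial>lborel)"
  proof (intro nn_integral_mono)
    fix x
    show "indicator enlarged x \<le> (\<integral>\<^sup>+y. ?w x y \<partial>lborel)"
    proof (cases "x \<in> enlarged")
      case True
      then obtain y0 where y0: "bad y0" "dist y0 x < 2 * ?d * side (level y0)" by (auto simp: enlarged_def)
      have "1 = (\<integral>\<^sup>+y. ennreal (kern y0 y) \<partial>lborel)" using nn_integral_kern[OF y0(1)] by simp
      also have "\<dots> \<le> (\<integral>\<^sup>+y. ?w x y \<partial>lborel)"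
      proof (intro nn_integral_mono)
        fix y
        have "bad y \<and> level y = level y0 \<and> dist y x < 3 * ?d * side (level y)" if "same y0 y"
        proof -
          have "norm (y - y0) \<le> ?d * side (level y0)"
            using that by (intro corner_dist) (auto simp: same_def)
          moreover have "dist y x \<le> dist y y0 + dist y0 x" by (rule dist_triangle)
          ultimately show ?thesis using that y0 by (auto simp: same_def dist_norm)
        qed
        then show "ennreal (kern y0 y) \<le> ?w x y" by (auto simp: kern_def)
      qed
      finally show ?thesis using True by simp
    qed simp
  qed
  also have "\<dots> = (\<integral>\<^sup>+y. \<integral>\<^sup>+x. ?w x y \<partial>lborel \<partial>lborel)"
    by (rule nn_integral_lborel_fubini) measurable
  also have "\<dots> \<le> (\<integral>\<^sup>+y. ennreal ((6 * ?d) ^ DIM('a)) * indicator {x. bad x} y \<partial>lborel)"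
  proof (intro nn_integral_mono)
    fix y
    show "(\<integral>\<^sup>+x. ?w x y \<partial>lborel) \<le> ennreal ((6 * ?d) ^ DIM('a)) * indicator {x. bad x} y"
    proof (cases "bad y")
      case True
      let ?s = "side (level y)"
      have "(\<integral>\<^sup>+x. ?w x y \<partial>lborel) = (\<integral>\<^sup>+x. ennreal (1 / ?s ^ DIM('a)) * indicator (ball y (3 * ?d * ?s)) x \<partial>lborel)"
        using True by (intro nn_integral_cong) (auto simp: indicator_def)
      also have "\<dots> = ennreal (1 / ?s ^ DIM('a)) * emeasure lborel (ball y (3 * ?d * ?s))"
        by (subst nn_integral_cmult_indicator) auto
      also have "\<dots> \<le> ennreal (1 / ?s ^ DIM('a)) * ennreal ((2 * (3 * ?d * ?s)) ^ DIM('a))"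
        by (intro mult_left_mono emeasure_ball_le) auto
      also have "\<dots> = ennreal ((6 * ?d) ^ DIM('a))"
        by (subst ennreal_mult[symmetric])
           (auto simp: power_mult_distrib less_imp_neq[OF side_pos, symmetric] simp flip: mult.assoc)
      finally show ?thesis using True by simp
    qed simp
  qed
  also have "\<dots> = ennreal ((6 * ?d) ^ DIM('a)) * emeasure lborel {x. bad x}"
    by (subst nn_integral_cmult_indicator) simp_all
  finally show ?thesis by simp
qed

end

text \<open>Integrability makes the convolution an honest integral, but its size is not recorded:
  the bounds derived from this definition may depend only on \<open>A\<close>, \<open>B\<close>, the
  exponent and the dimension, as needed for a family of truncations.\<close>

definition cz_kernel :: "real \<Rightarrow> real \<Rightarrow> ('a::euclidean_space \<Rightarrow> complex) \<Rightarrow> bool" where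
  "cz_kernel A B K \<longleftrightarrow> integrable lborel K \<and> (\<forall>\<xi>. norm (FT K \<xi>) \<le> A) \<and>
    (\<forall>y. (\<integral>\<^sup>+x. (if 2 * norm y \<le> norm x then ennreal (norm (K (x - y) - K x)) else 0) \<partial>lborel) \<le> ennreal B)"

text \<open>Plancherel's formula on both sides of the pointwise multiplier bound; the powers of 2 pi
  cancel.\<close>

lemma conv_L2_bound:
  fixes K g :: "'a::euclidean_space \<Rightarrow> complex"
  assumes K: "integrable lborel K" and A: "\<And>\<xi>. norm (FT K \<xi>) \<le> A"
    and g: "integrable lborel g" and M: "\<And>x. norm (g x) \<le> M"
  shows "(\<integral>\<^sup>+x. ennreal ((norm (conv K g x))\<^sup>2) \<partial>lborel) \<le> ennreal (A\<^sup>2) * (\<integral>\<^sup>+x. ennreal ((norm (g x))\<^sup>2) \<partial>lborel)"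
proof -
  have [measurable]: "g \<in> borel_measurable borel" using g by auto
  let ?c = "ennreal ((2 * pi) ^ DIM('a))"
  have "?c * (\<integral>\<^sup>+x. ennreal ((norm (conv K g x))\<^sup>2) \<partial>lborel) = (\<integral>\<^sup>+\<xi>. ennreal ((norm (FT (conv K g) \<xi>))\<^sup>2) \<partial>lborel)"
    by (rule plancherel[symmetric]) (rule integrable_conv[OF K g], rule conv_bound[OF K M])
  also have "\<dots> \<le> (\<integral>\<^sup>+\<xi>. ennreal (A\<^sup>2) * ennreal ((norm (FT g \<xi>))\<^sup>2) \<partial>lborel)"
    using A by (intro nn_integral_mono)
      (auto simp: FT_conv[OF K g] norm_mult power_mult_distrib power_mono intro!: mult_right_mono ennreal_leI simp flip: ennreal_mult)
  also have "\<dots> = ennreal (A\<^sup>2) * (?c * (\<integral>\<^sup>+x. ennreal ((norm (g x))\<^sup>2) \<partial>lborel))"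
    using plancherel[OF g M] by (simp add: nn_integral_cmult)
  finally have "?c * (\<integral>\<^sup>+x. ennreal ((norm (conv K g x))\<^sup>2) \<partial>lborel) \<le> ?c * (ennreal (A\<^sup>2) * (\<integral>\<^sup>+x. ennreal ((norm (g x))\<^sup>2) \<partial>lborel))"
    by (simp only: mult.left_commute)
  moreover have "?c \<noteq> 0" "?c \<noteq> top" by (auto simp: not_le)
  ultimately show ?thesis using ennreal_mult_le_mult_iff by blast
qed

section \<open>Cancellation: the bad part away from the enlarged set\<close>

context calderon_zygmund
begin

text \<open>Since \<open>kern\<close> has mass 1 in \<open>y\<close>, the integral of
  \<open>H1\<close> over \<open>y\<close> gives K(x - z) f z on the bad set, while integrating
  \<open>H2\<close> over \<open>z\<close> gives K(x - y) times the average of \<open>f\<close>.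
  Exchanging the order in \<open>H2\<close> puts both under one integral and exposes the difference
  of \<open>K\<close>. Absolute convergence at every \<open>x\<close> comes from the bound
  \<open>M\<close> on \<open>f\<close> for \<open>H1\<close> and from the bound on the averages for
  \<open>H2\<close>.\<close>

lemma bad_part_conv_le:
  assumes K: "integrable lborel K"
  shows "ennreal (norm (conv K f x - conv K good_part x))
    \<le> (\<integral>\<^sup>+z. \<integral>\<^sup>+y. ennreal (norm (K (x - z) - K (x - y))) * (ennreal (kern y z) * ennreal (norm (f z))) \<partial>lborel \<partial>lborel)"
proof -
  have [measurable]: "K \<in> borel_measurable borel" using K by auto
  have M: "M \<ge> 0" using f_bound[of undefined] norm_ge_zero order_trans by blast
  define H1 where "H1 y z = K (x - z) * complex_of_real (kern y z) * f z" for y z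
  define H2 where "H2 y z = K (x - y) * complex_of_real (kern y z) * f z" for y z
  have [measurable]: "case_prod H1 \<in> borel_measurable (borel \<Otimes>\<^sub>M borel)"
    "case_prod H2 \<in> borel_measurable (borel \<Otimes>\<^sub>M borel)"
    "(\<lambda>(y, z). H1 z y) \<in> borel_measurable (borel \<Otimes>\<^sub>M borel)"
    unfolding H1_def H2_def by measurable
  have Kx: "(\<integral>\<^sup>+y. ennreal (norm (K (x - y))) \<partial>lborel) < \<infinity>"
    using integrable_lborel_translate(4)[OF K, of x] by (simp add: integrable_iff_bounded)
  have int1: "(\<integral>\<^sup>+z. \<integral>\<^sup>+y. norm (H1 y z) \<partial>lborel \<partial>lborel) < \<infinity>"
  proof -
    have "(\<integral>\<^sup>+z. \<integral>\<^sup>+y. norm (H1 y z) \<partial>lborel \<partial>lborel) \<le> (\<integral>\<^sup>+z. ennreal M * ennreal (norm (K (x - z))) \<partial>lborel)"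
    proof (intro nn_integral_mono)
      fix z
      have "(\<integral>\<^sup>+y. norm (H1 y z) \<partial>lborel) = (\<integral>\<^sup>+y. ennreal (norm (K (x - z)) * norm (f z)) * ennreal (kern z y) \<partial>lborel)"
        unfolding H1_def kern_sym[of _ z] by (intro nn_integral_cong) (simp add: norm_mult ac_simps flip: ennreal_mult)
      also have "\<dots> = ennreal (norm (K (x - z)) * norm (f z)) * (\<integral>\<^sup>+y. ennreal (kern z y) \<partial>lborel)"
        by (rule nn_integral_cmult) measurable
      also have "\<dots> \<le> ennreal (norm (K (x - z)) * norm (f z)) * 1"
        by (intro mult_left_mono) (cases "bad z"; simp add: nn_integral_kern kern_eq_0)+
      also have "\<dots> \<le> ennreal (norm (K (x - z)) * M)"
        using f_bound[of z] by (auto intro!: ennreal_leI mult_left_mono)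
      also have "\<dots> = ennreal M * ennreal (norm (K (x - z)))"
        using M by (simp add: mult.commute ennreal_mult)
      finally show "(\<integral>\<^sup>+y. norm (H1 y z) \<partial>lborel) \<le> ennreal M * ennreal (norm (K (x - z)))" .
    qed
    also have "\<dots> < \<infinity>" using Kx by (simp add: nn_integral_cmult ennreal_mult_less_top)
    finally show ?thesis .
  qed
  have int2: "(\<integral>\<^sup>+y. \<integral>\<^sup>+z. norm (H2 y z) \<partial>lborel \<partial>lborel) < \<infinity>"
  proof -
    have "(\<integral>\<^sup>+y. \<integral>\<^sup>+z. norm (H2 y z) \<partial>lborel \<partial>lborel) \<le> (\<integral>\<^sup>+y. ennreal (2 ^ DIM('a) * lam) * ennreal (norm (K (x - y))) \<partial>lborel)"
    proof (intro nn_integral_mono)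
      fix y
      have "(\<integral>\<^sup>+z. norm (H2 y z) \<partial>lborel) = (\<integral>\<^sup>+z. ennreal (norm (K (x - y))) * (ennreal (kern y z) * ennreal (norm (f z))) \<partial>lborel)"
        unfolding H2_def by (intro nn_integral_cong) (simp add: norm_mult ac_simps flip: ennreal_mult)
      also have "\<dots> = ennreal (norm (K (x - y))) * (\<integral>\<^sup>+z. ennreal (kern y z) * ennreal (norm (f z)) \<partial>lborel)"
        by (rule nn_integral_cmult) measurable
      also have "\<dots> \<le> ennreal (norm (K (x - y))) * ennreal (2 ^ DIM('a) * lam)"
        using nn_integral_kern_f_bound[of y] by (intro mult_left_mono) (cases "bad y"; simp add: kern_eq_0)+
      finally show "(\<integral>\<^sup>+z. norm (H2 y z) \<partial>lborel) \<le> ennreal (2 ^ DIM('a) * lam) * ennreal (norm (K (x - y)))"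
        by (simp add: mult.commute)
    qed
    also have "\<dots> < \<infinity>" using Kx by (simp add: nn_integral_cmult ennreal_mult_less_top)
    finally show ?thesis .
  qed
  have int2': "(\<integral>\<^sup>+z. \<integral>\<^sup>+y. norm (H2 y z) \<partial>lborel \<partial>lborel) < \<infinity>"
    using int2 by (subst nn_integral_lborel_fubini) (simp_all add: case_prod_beta')
  have P1: "integrable (lborel \<Otimes>\<^sub>M lborel) (\<lambda>(z, y). H1 y z)"
    by (rule integrable_lborel_prod[OF _ int1]) measurable
  have P2: "integrable (lborel \<Otimes>\<^sub>M lborel) (\<lambda>(z, y). H2 y z)"
    by (rule integrable_lborel_prod[OF _ int2']) measurable
  have ker1: "(\<integral>y. complex_of_real (kern y z) \<partial>lborel) = (if bad z then 1 else 0)" for z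
  proof (cases "bad z")
    case True
    have "integral\<^sup>L lborel (\<lambda>y. kern z y) = enn2real (\<integral>\<^sup>+y. ennreal (kern z y) \<partial>lborel)"
      by (rule integral_eq_nn_integral) auto
    then show ?thesis using True by (simp add: nn_integral_kern kern_sym[of _ z])
  qed (simp add: kern_eq_0 kern_sym[of _ z])
  define F where "F y = (\<integral>z. H2 y z \<partial>lborel)" for y
  have F: "F y = K (x - y) * (\<integral>z. complex_of_real (kern y z) * f z \<partial>lborel)" for y
    unfolding F_def H2_def by (simp add: mult.assoc)
  have if1: "integrable lborel (\<lambda>z. K (x - z) * f z)"
    by (rule integrable_mult_bounded(1)[OF integrable_lborel_translate(4)[OF K] f_meas f_bound])
  have ig: "integrable lborel (\<lambda>z. K (x - z) * good_part z)"
    by (rule integrable_mult_bounded(1)[OF integrable_lborel_translate(4)[OF K] good_meas good_bound])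
  have eq1: "(\<integral>y. H1 y z \<partial>lborel) = (if bad z then K (x - z) * f z else 0)" for z
    unfolding H1_def using ker1[of z] by (simp del: integral_complex_of_real Bochner_Integration.integral_complex_of_real)
  have iF: "integrable lborel F"
    unfolding F_def using lborel_pair.integrable_fst'[OF integrable_lborel_prod[OF _ int2]] by simp
  have eq2: "K (x - z) * f z - K (x - z) * good_part z = (\<integral>y. H1 y z \<partial>lborel) - F z" for z
    unfolding eq1 F good_part_def by (simp add: kern_eq_0)
  have i1: "integrable lborel (\<lambda>z. \<integral>y. H1 y z \<partial>lborel)"
    using lborel_pair.integrable_fst'[OF P1] by simp
  have "conv K f x - conv K good_part x = (\<integral>z. (\<integral>y. H1 y z \<partial>lborel) - F z \<partial>lborel)"
    unfolding conv_def Bochner_Integration.integral_diff[OF if1 ig, symmetric] eq2 ..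
  also have "\<dots> = (\<integral>z. \<integral>y. H1 y z \<partial>lborel \<partial>lborel) - (\<integral>y. \<integral>z. H2 y z \<partial>lborel \<partial>lborel)"
    unfolding Bochner_Integration.integral_diff[OF i1 iF] by (simp only: F_def[abs_def])
  also have "(\<integral>y. \<integral>z. H2 y z \<partial>lborel \<partial>lborel) = (\<integral>z. \<integral>y. H2 y z \<partial>lborel \<partial>lborel)"
    by (rule integral_lborel_fubini[OF _ int2]) measurable
  also have "(\<integral>z. \<integral>y. H1 y z \<partial>lborel \<partial>lborel) - (\<integral>z. \<integral>y. H2 y z \<partial>lborel \<partial>lborel)
    = (\<integral>p. (case p of (z, y) \<Rightarrow> H1 y z) - (case p of (z, y) \<Rightarrow> H2 y z) \<partial>(lborel \<Otimes>\<^sub>M lborel))"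
    using lborel_pair.integral_fst'[OF P1] lborel_pair.integral_fst'[OF P2]
    unfolding Bochner_Integration.integral_diff[OF P1 P2] by simp
  finally have "ennreal (norm (conv K f x - conv K good_part x))
      \<le> (\<integral>\<^sup>+p. norm ((case p of (z, y) \<Rightarrow> H1 y z) - (case p of (z, y) \<Rightarrow> H2 y z)) \<partial>(lborel \<Otimes>\<^sub>M lborel))"
    by (simp only: norm_integral_le_nn_integral)
  also have "\<dots> = (\<integral>\<^sup>+z. \<integral>\<^sup>+y. norm (H1 y z - H2 y z) \<partial>lborel \<partial>lborel)"
    by (subst lborel.nn_integral_fst[symmetric]) (simp_all add: case_prod_beta')
  also have "\<dots> = (\<integral>\<^sup>+z. \<integral>\<^sup>+y. ennreal (norm (K (x - z) - K (x - y))) * (ennreal (kern y z) * ennreal (norm (f z))) \<partial>lborel \<partial>lborel)"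
  proof (intro nn_integral_cong)
    fix z y
    have "H1 y z - H2 y z = (K (x - z) - K (x - y)) * (complex_of_real (kern y z) * f z)"
      by (simp add: H1_def H2_def algebra_simps)
    then show "ennreal (norm (H1 y z - H2 y z)) = ennreal (norm (K (x - z) - K (x - y))) * (ennreal (kern y z) * ennreal (norm (f z)))"
      by (simp add: norm_mult ennreal_mult)
  qed
  finally show ?thesis .
qed

text \<open>With \<open>x\<close> integrated first, the inner integral is Hoermander's for the shift
  \<open>y - z\<close>: a point outside the enlarged set is at distance at least 2 |y - z| from
  \<open>z\<close>. What remains has mass at most that of \<open>f\<close>.\<close>

lemma bad_part_L1_bound:
  assumes K: "cz_kernel A B K" and B: "B \<ge> 0"
  shows "(\<integral>\<^sup>+x. indicator (- enlarged) x * ennreal (norm (conv K f x - conv K good_part x)) \<partial>lborel) \<le> ennreal B * l1norm f"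
proof -
  have Ki: "integrable lborel K" using K by (simp add: cz_kernel_def)
  then have [measurable]: "K \<in> borel_measurable borel" by auto
  let ?k = "\<lambda>y z. ennreal (kern y z) * ennreal (norm (f z))"
  let ?I = "\<lambda>x. indicator (- enlarged) x :: ennreal"
  have "(\<integral>\<^sup>+x. ?I x * ennreal (norm (conv K f x - conv K good_part x)) \<partial>lborel)
    \<le> (\<integral>\<^sup>+x. \<integral>\<^sup>+z. \<integral>\<^sup>+y. ?I x * ennreal (norm (K (x - z) - K (x - y))) * ?k y z \<partial>lborel \<partial>lborel \<partial>lborel)"
  proof (intro nn_integral_mono)
    fix x
    show "?I x * ennreal (norm (conv K f x - conv K good_part x))
      \<le> (\<integral>\<^sup>+z. \<integral>\<^sup>+y. ?I x * ennreal (norm (K (x - z) - K (x - y))) * ?k y z \<partial>lborel \<partial>lborel)"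
      using bad_part_conv_le[OF Ki, of x] by (cases "x \<in> enlarged") auto
  qed
  also have "\<dots> = (\<integral>\<^sup>+z. \<integral>\<^sup>+x. \<integral>\<^sup>+y. ?I x * ennreal (norm (K (x - z) - K (x - y))) * ?k y z \<partial>lborel \<partial>lborel \<partial>lborel)"
    by (rule nn_integral_lborel_fubini) measurable
  also have "\<dots> = (\<integral>\<^sup>+z. \<integral>\<^sup>+y. \<integral>\<^sup>+x. ?I x * ennreal (norm (K (x - z) - K (x - y))) * ?k y z \<partial>lborel \<partial>lborel \<partial>lborel)"
    by (intro nn_integral_cong nn_integral_lborel_fubini) measurable
  also have "\<dots> \<le> (\<integral>\<^sup>+z. \<integral>\<^sup>+y. ennreal B * ?k y z \<partial>lborel \<partial>lborel)"
  proof (intro nn_integral_mono)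
    fix z y
    show "(\<integral>\<^sup>+x. ?I x * ennreal (norm (K (x - z) - K (x - y))) * ?k y z \<partial>lborel) \<le> ennreal B * ?k y z"
    proof (cases "same y z")
      case True
      then have bz: "bad z" and d: "norm (y - z) \<le> DIM('a) * side (level z)"
        by (auto simp: same_def intro!: corner_dist)
      let ?h = "\<lambda>x. if 2 * norm (y - z) \<le> norm x then ennreal (norm (K (x - (y - z)) - K x)) else 0"
      have "(\<integral>\<^sup>+x. ?I x * ennreal (norm (K (x - z) - K (x - y))) \<partial>lborel) \<le> (\<integral>\<^sup>+x. ?h (x - z) \<partial>lborel)"
      proof (intro nn_integral_mono)
        fix x
        have "2 * norm (y - z) \<le> norm (x - z)" if "x \<notin> enlarged"
          using that bz d by (auto simp: enlarged_def dist_norm norm_minus_commute not_less)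
        then show "?I x * ennreal (norm (K (x - z) - K (x - y))) \<le> ?h (x - z)"
          by (cases "x \<in> enlarged") (auto simp: norm_minus_commute)
      qed
      also have "\<dots> = (\<integral>\<^sup>+x. ?h x \<partial>lborel)" by (rule nn_integral_lborel_translate(3)) measurable
      also have "\<dots> \<le> ennreal B" using K by (auto simp: cz_kernel_def)
      finally show ?thesis by (subst nn_integral_multc) (auto intro: mult_right_mono)
    qed (simp add: kern_def)
  qed
  also have "\<dots> = ennreal B * (\<integral>\<^sup>+z. \<integral>\<^sup>+y. ?k y z \<partial>lborel \<partial>lborel)"
    by (simp add: nn_integral_cmult)
  also have "(\<integral>\<^sup>+z. \<integral>\<^sup>+y. ?k y z \<partial>lborel \<partial>lborel) = (\<integral>\<^sup>+y. \<integral>\<^sup>+z. ?k y z \<partial>lborel \<partial>lborel)"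
    by (rule nn_integral_lborel_fubini) measurable
  also have "ennreal B * \<dots> \<le> ennreal B * l1norm f"
    unfolding nn_integral_kern_f_swap l1norm_def
    by (intro mult_left_mono nn_integral_mono) (auto simp: indicator_def)
  finally show ?thesis .
qed

end

section \<open>Weak type (1,1)\<close>

context calderon_zygmund
begin

text \<open>Where the convolution exceeds \<open>lam\<close>, the good part is at least
  \<open>lam / 2\<close>, or the point is in the enlarged set, or the bad part is at least
  \<open>lam / 2\<close>. Chebyshev in L^2 with |good|^2 at most 2^d \<open>lam\<close> |good| gives
  4 A^2 2^d; the enlarged set gives (6 d)^d; Chebyshev in L^1 gives 2 B.\<close>

lemma weak_type_level:
  assumes K: "cz_kernel A B K" and B: "B \<ge> 0"
  shows "emeasure lborel {x. norm (conv K f x) > lam}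
    \<le> ennreal ((4 * A\<^sup>2 * 2 ^ DIM('a) + (6 * DIM('a)) ^ DIM('a) + 2 * B) / lam) * l1norm f"
proof -
  have Ki: "integrable lborel K" and KA: "\<And>\<xi>. norm (FT K \<xi>) \<le> A" using K by (auto simp: cz_kernel_def)
  then have [measurable]: "K \<in> borel_measurable borel" by auto
  let ?g = "conv K good_part" and ?b = "\<lambda>x. conv K f x - conv K good_part x"
  let ?E1 = "{x. lam / 2 \<le> norm (?g x)}" and ?E2 = "{x. x \<notin> enlarged \<and> lam / 2 \<le> norm (?b x)}"
  have E1: "emeasure lborel ?E1 \<le> ennreal (4 * A\<^sup>2 * 2 ^ DIM('a) / lam) * l1norm f"
  proof -
    have "(\<integral>\<^sup>+x. ennreal ((norm (good_part x))\<^sup>2) \<partial>lborel) \<le> (\<integral>\<^sup>+x. ennreal (2 ^ DIM('a) * lam) * ennreal (norm (good_part x)) \<partial>lborel)"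
    proof (intro nn_integral_mono)
      fix x
      have "norm (good_part x) * norm (good_part x) \<le> (2 ^ DIM('a) * lam) * norm (good_part x)"
        by (intro mult_right_mono good_bound) auto
      then show "ennreal ((norm (good_part x))\<^sup>2) \<le> ennreal (2 ^ DIM('a) * lam) * ennreal (norm (good_part x))"
        using lam by (subst ennreal_mult[symmetric]) (auto simp: power2_eq_square intro!: ennreal_leI)
    qed
    also have "\<dots> = ennreal (2 ^ DIM('a) * lam) * l1norm good_part"
      unfolding l1norm_def by (rule nn_integral_cmult) measurable
    also have "\<dots> \<le> ennreal (2 ^ DIM('a) * lam) * l1norm f"
      by (intro mult_left_mono l1norm_good) auto
    finally have g2: "(\<integral>\<^sup>+x. ennreal ((norm (good_part x))\<^sup>2) \<partial>lborel) \<le> ennreal (2 ^ DIM('a) * lam) * l1norm f" .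
    have "emeasure lborel ?E1 = (\<integral>\<^sup>+x. indicator ?E1 x \<partial>lborel)" by simp
    also have "\<dots> \<le> (\<integral>\<^sup>+x. ennreal (4 / lam\<^sup>2) * ennreal ((norm (?g x))\<^sup>2) \<partial>lborel)"
    proof (intro nn_integral_mono)
      fix x
      show "indicator ?E1 x \<le> ennreal (4 / lam\<^sup>2) * ennreal ((norm (?g x))\<^sup>2)"
      proof (cases "lam / 2 \<le> norm (?g x)")
        case True
        then have "(lam / 2)\<^sup>2 \<le> (norm (?g x))\<^sup>2" using lam by (intro power_mono) auto
        then have "1 \<le> 4 / lam\<^sup>2 * (norm (?g x))\<^sup>2" using lam by (simp add: field_simps power2_eq_square)
        then have "ennreal 1 \<le> ennreal (4 / lam\<^sup>2 * (norm (?g x))\<^sup>2)" by (rule ennreal_leI)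
        then show ?thesis using True by (subst ennreal_mult[symmetric]) auto
      qed simp
    qed
    also have "\<dots> = ennreal (4 / lam\<^sup>2) * (\<integral>\<^sup>+x. ennreal ((norm (?g x))\<^sup>2) \<partial>lborel)"
      by (rule nn_integral_cmult) measurable
    also have "\<dots> \<le> ennreal (4 / lam\<^sup>2) * (ennreal (A\<^sup>2) * (\<integral>\<^sup>+x. ennreal ((norm (good_part x))\<^sup>2) \<partial>lborel))"
      by (intro mult_left_mono conv_L2_bound[OF Ki KA good_integrable good_bound]) auto
    also have "\<dots> \<le> ennreal (4 / lam\<^sup>2) * (ennreal (A\<^sup>2) * (ennreal (2 ^ DIM('a) * lam) * l1norm f))"
      by (intro mult_left_mono g2) auto
    also have "\<dots> = ennreal (4 / lam\<^sup>2 * (A\<^sup>2 * (2 ^ DIM('a) * lam))) * l1norm f"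
      using lam by (simp add: mult.assoc[symmetric] flip: ennreal_mult)
    also have "4 / lam\<^sup>2 * (A\<^sup>2 * (2 ^ DIM('a) * lam)) = 4 * A\<^sup>2 * 2 ^ DIM('a) / lam"
      using lam by (simp add: field_simps power2_eq_square)
    finally show ?thesis .
  qed
  have E2: "emeasure lborel ?E2 \<le> ennreal (2 * B / lam) * l1norm f"
  proof -
    have "emeasure lborel ?E2 = (\<integral>\<^sup>+x. indicator ?E2 x \<partial>lborel)" by simp
    also have "\<dots> \<le> (\<integral>\<^sup>+x. ennreal (2 / lam) * (indicator (- enlarged) x * ennreal (norm (?b x))) \<partial>lborel)"
    proof (intro nn_integral_mono)
      fix x
      show "indicator ?E2 x \<le> ennreal (2 / lam) * (indicator (- enlarged) x * ennreal (norm (?b x)))"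
      proof (cases "x \<in> ?E2")
        case True
        then have "1 \<le> 2 / lam * norm (?b x)" using lam by (simp add: field_simps)
        then have "ennreal 1 \<le> ennreal (2 / lam * norm (?b x))" by (rule ennreal_leI)
        then show ?thesis using True lam by (subst (asm) ennreal_mult) auto
      qed simp
    qed
    also have "\<dots> = ennreal (2 / lam) * (\<integral>\<^sup>+x. indicator (- enlarged) x * ennreal (norm (?b x)) \<partial>lborel)"
      by (rule nn_integral_cmult) measurable
    also have "\<dots> \<le> ennreal (2 / lam) * (ennreal B * l1norm f)"
      by (intro mult_left_mono bad_part_L1_bound[OF K B]) auto
    also have "\<dots> = ennreal (2 * B / lam) * l1norm f"
      using lam B by (simp add: mult.assoc[symmetric] flip: ennreal_mult)
    finally show ?thesis .
  qed
  have E3: "emeasure lborel enlarged \<le> ennreal ((6 * DIM('a)) ^ DIM('a) / lam) * l1norm f"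
  proof -
    have "emeasure lborel {x. bad x} = ennreal (1 / lam) * (ennreal lam * emeasure lborel {x. bad x})"
      using lam by (simp add: mult.assoc[symmetric] flip: ennreal_mult)
    also have "\<dots> \<le> ennreal (1 / lam) * l1norm f" by (intro mult_left_mono emeasure_bad) auto
    finally have "emeasure lborel enlarged \<le> ennreal ((6 * DIM('a)) ^ DIM('a)) * (ennreal (1 / lam) * l1norm f)"
      using emeasure_enlarged by (meson mult_left_mono order_trans zero_le)
    also have "\<dots> = ennreal ((6 * DIM('a)) ^ DIM('a) / lam) * l1norm f"
      using lam by (simp add: mult.assoc[symmetric] flip: ennreal_mult)
    finally show ?thesis .
  qed
  have "{x. norm (conv K f x) > lam} \<subseteq> ?E1 \<union> enlarged \<union> ?E2"
  proof
    fix x assume "x \<in> {x. norm (conv K f x) > lam}"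
    moreover have "norm (conv K f x) \<le> norm (?g x) + norm (?b x)"
      using norm_triangle_ineq[of "?g x" "?b x"] by simp
    ultimately show "x \<in> ?E1 \<union> enlarged \<union> ?E2" by auto
  qed
  then have "emeasure lborel {x. norm (conv K f x) > lam} \<le> emeasure lborel (?E1 \<union> enlarged \<union> ?E2)"
    by (intro emeasure_mono) auto
  also have "\<dots> \<le> emeasure lborel ?E1 + emeasure lborel enlarged + emeasure lborel ?E2"
    by (intro order_trans[OF emeasure_subadditive] add_right_mono emeasure_subadditive) auto
  also have "\<dots> \<le> ennreal (4 * A\<^sup>2 * 2 ^ DIM('a) / lam) * l1norm f + ennreal ((6 * DIM('a)) ^ DIM('a) / lam) * l1norm f
      + ennreal (2 * B / lam) * l1norm f"
    by (intro add_mono E1 E2 E3)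
  also have "\<dots> = (ennreal (4 * A\<^sup>2 * 2 ^ DIM('a) / lam) + ennreal ((6 * DIM('a)) ^ DIM('a) / lam) + ennreal (2 * B / lam)) * l1norm f"
    by (simp only: distrib_right)
  also have "ennreal (4 * A\<^sup>2 * 2 ^ DIM('a) / lam) + ennreal ((6 * DIM('a)) ^ DIM('a) / lam) + ennreal (2 * B / lam)
      = ennreal ((4 * A\<^sup>2 * 2 ^ DIM('a) + (6 * DIM('a)) ^ DIM('a) + 2 * B) / lam)"
    using lam B by (simp add: add_divide_distrib flip: ennreal_plus)
  finally show ?thesis .
qed

end

lemma weak_type:
  fixes f K :: "'a::euclidean_space \<Rightarrow> complex"
  assumes K: "cz_kernel A B K" and B: "B \<ge> 0"
    and f: "integrable lborel f" "continuous_on UNIV f" "\<And>x. norm (f x) \<le> M" and lam: "lam > 0"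
  shows "emeasure lborel {x. norm (conv K f x) > lam}
    \<le> ennreal ((4 * A\<^sup>2 * 2 ^ DIM('a) + (6 * DIM('a)) ^ DIM('a) + 2 * B) / lam) * l1norm f"
proof -
  \<comment> \<open>Adding 1 makes the side at least 1, so it is bounded by its own d-th power and
    \<open>large\<close> follows.\<close>
  define s0 where "s0 = (\<integral>x. norm (f x) \<partial>lborel) / lam + 1"
  have s1: "s0 \<ge> 1" using lam by (simp add: s0_def)
  have "(\<integral>x. norm (f x) \<partial>lborel) \<le> lam * s0" using lam by (simp add: s0_def field_simps)
  also have "s0 \<le> s0 ^ DIM('a)" using s1 by (simp add: self_le_power)
  finally have "(\<integral>x. norm (f x) \<partial>lborel) \<le> lam * s0 ^ DIM('a)" using lam by simp
  then have "l1norm f \<le> ennreal (lam * s0 ^ DIM('a))"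
    by (simp add: l1norm_integrable[OF f(1)] ennreal_leI)
  then interpret calderon_zygmund f lam s0 M
    using lam s1 f by unfold_locales auto
  show ?thesis by (rule weak_type_level[OF K B])
qed

section \<open>Interpolation and duality\<close>

lemma nn_integral_powr_0:
  assumes "e > -1" "c \<ge> 0"
  shows "(\<integral>\<^sup>+x. ennreal (x powr e) * indicator {0<..<c} x \<partial>lborel) = ennreal (c powr (e + 1) / (e + 1))"
proof -
  have "((\<lambda>x. x powr e) has_integral (c powr (e + 1) / (e + 1))) {0..c}"
    using has_integral_powr_from_0[OF assms] .
  then have "(\<integral>\<^sup>+x. ennreal (x powr e) * indicator {0..c} x \<partial>lborel) = ennreal (c powr (e + 1) / (e + 1))"
    by (intro nn_integral_has_integral_lebesgue') auto
  moreover have "(\<integral>\<^sup>+x. ennreal (x powr e) * indicator {0<..<c} x \<partial>lborel) = (\<integral>\<^sup>+x. ennreal (x powr e) * indicator {0..c} x \<partial>lborel)"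
    by (intro nn_integral_cong_AE, use AE_lborel_singleton[of 0] AE_lborel_singleton[of c] in eventually_elim)
       (auto simp: indicator_def)
  ultimately show ?thesis by simp
qed

lemma nn_integral_powr_inf:
  assumes "e < -1" "c > 0"
  shows "(\<integral>\<^sup>+x. ennreal (x powr e) * indicator {c..} x \<partial>lborel) = ennreal (- (c powr (e + 1)) / (e + 1))"
proof -
  have "((\<lambda>x. x powr e) has_integral (- (c powr (e + 1)) / (e + 1))) {c..}"
    using has_integral_powr_to_inf[OF assms] .
  then show ?thesis by (intro nn_integral_has_integral_lebesgue') auto
qed


text \<open>The layers are taken at height 2 l because the function will be split at height l into
  two parts, each of which is then compared with l. This is the source of 2^p.\<close>

lemma powr_layer_cake:
  assumes "p > 1" "a \<ge> 0"
  shows "ennreal (a powr p) = (\<integral>\<^sup>+l. ennreal (p * 2 powr p * l powr (p - 1)) * indicator {l. 0 < l \<and> 2 * l < a} l \<partial>lborel)"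
proof -
  have "(\<integral>\<^sup>+l. ennreal (p * 2 powr p * l powr (p - 1)) * indicator {l. 0 < l \<and> 2 * l < a} l \<partial>lborel)
    = (\<integral>\<^sup>+l. ennreal (p * 2 powr p) * (ennreal (l powr (p - 1)) * indicator {0<..<a/2} l) \<partial>lborel)"
    using assms by (intro nn_integral_cong) (auto simp: indicator_def ennreal_mult)
  also have "\<dots> = ennreal (p * 2 powr p) * ennreal ((a / 2) powr p / p)"
    using assms nn_integral_powr_0[of "p - 1" "a / 2"] by (subst nn_integral_cmult) auto
  also have "\<dots> = ennreal (a powr p)"
    using assms by (subst ennreal_mult[symmetric]) (auto simp: powr_divide)
  finally show ?thesis by simp
qed

text \<open>Truncating the modulus rather than cutting off keeps the function continuous, which the stopping-time
  argument needs at points outside the bad set.\<close>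

definition low_part :: "real \<Rightarrow> complex \<Rightarrow> complex" where
  "low_part l z = z * complex_of_real (l / max l (norm z))"

lemma norm_low_part:
  assumes "l > 0"
  shows "norm (low_part l z) = min (norm z) l"
  using assms by (auto simp: low_part_def norm_mult norm_divide max_def min_def)

lemma norm_high_part:
  assumes "l > 0"
  shows "norm (z - low_part l z) = max 0 (norm z - l)"
proof -
  have "z - low_part l z = z * complex_of_real (1 - l / max l (norm z))"
    by (simp add: low_part_def algebra_simps)
  then have "norm (z - low_part l z) = norm z * \<bar>1 - l / max l (norm z)\<bar>"
    by (simp only: norm_mult norm_of_real)
  also have "\<dots> = max 0 (norm z - l)"
  proof (cases "norm z \<le> l")
    case True
    then show ?thesis using assms by (simp add: max_def)
  next
    case False
    then have "\<bar>1 - l / norm z\<bar> = 1 - l / norm z" using assms by (intro abs_of_nonneg) (simp add: divide_le_eq_1)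
    moreover have "norm z > 0" using False assms by linarith
    ultimately show ?thesis using False assms by (simp add: max_def field_simps)
  qed
  finally show ?thesis .
qed

lemma continuous_low_part:
  assumes "l > 0" "continuous_on S f"
  shows "continuous_on S (\<lambda>x. low_part l (f x))"
  unfolding low_part_def using assms by (intro continuous_intros) auto

text \<open>One of the two parts must exceed l. The high part is controlled by the weak type
  estimate, the low part by Chebyshev and the L^2 bound. Both right-hand sides are collected in one
  integral over \<open>x\<close>, ready for exchange with the integral over l.\<close>

lemma marcinkiewicz_level:
  fixes f K :: "'a::euclidean_space \<Rightarrow> complex"
  assumes K: "cz_kernel A B K" and B: "B \<ge> 0"
    and f: "integrable lborel f" "continuous_on UNIV f" "\<And>x. norm (f x) \<le> M" and l: "l > 0"
  defines "W \<equiv> 4 * A\<^sup>2 * 2 ^ DIM('a) + (6 * DIM('a)) ^ DIM('a) + 2 * B"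
  shows "emeasure lborel {x. norm (conv K f x) > 2 * l}
    \<le> (\<integral>\<^sup>+x. ennreal (W / l) * (ennreal (norm (f x)) * indicator {x. l < norm (f x)} x)
        + ennreal (A\<^sup>2 / l\<^sup>2) * ennreal ((min (norm (f x)) l)\<^sup>2) \<partial>lborel)"
proof -
  have Ki: "integrable lborel K" and KA: "\<And>\<xi>. norm (FT K \<xi>) \<le> A" using K by (auto simp: cz_kernel_def)
  have [measurable]: "f \<in> borel_measurable borel" "K \<in> borel_measurable borel" using f Ki by auto
  define g where "g x = low_part l (f x)" for x
  define h where "h x = f x - g x" for x
  have gn: "norm (g x) = min (norm (f x)) l" for x unfolding g_def by (rule norm_low_part[OF l])
  have hn: "norm (h x) = max 0 (norm (f x) - l)" for x unfolding h_def g_def by (rule norm_high_part[OF l])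
  have gc: "continuous_on UNIV g" unfolding g_def by (rule continuous_low_part[OF l f(2)])
  then have hc: "continuous_on UNIV h" unfolding h_def by (intro continuous_intros f(2))
  have [measurable]: "g \<in> borel_measurable borel" "h \<in> borel_measurable borel"
    using gc hc by (auto intro: borel_measurable_continuous_onI)
  have gi: "integrable lborel g"
    by (rule Bochner_Integration.integrable_bound[OF f(1)]) (auto simp: gn)
  then have hi: "integrable lborel h" unfolding h_def using f(1) by auto
  have hM: "norm (h x) \<le> M" for x using f(3)[of x] l by (auto simp: hn max_def intro: order_trans[OF norm_ge_zero])
  have gM: "norm (g x) \<le> l" for x by (simp add: gn)
  have split: "conv K f x = conv K h x + conv K g x" for x
  proof -
    have "integrable lborel (\<lambda>y. K (x - y) * h y)"
      by (rule integrable_mult_bounded(1)[OF integrable_lborel_translate(4)[OF Ki] _ hM]) measurable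
    moreover have "integrable lborel (\<lambda>y. K (x - y) * g y)"
      by (rule integrable_mult_bounded(1)[OF integrable_lborel_translate(4)[OF Ki] _ gM]) measurable
    ultimately have "conv K h x + conv K g x = (\<integral>y. K (x - y) * h y + K (x - y) * g y \<partial>lborel)"
      unfolding conv_def by (rule Bochner_Integration.integral_add[symmetric])
    then show ?thesis by (simp add: conv_def h_def algebra_simps)
  qed
  have W: "W \<ge> 0" using B by (simp add: W_def)
  have 1: "emeasure lborel {x. norm (conv K h x) > l} \<le> ennreal (W / l) * (\<integral>\<^sup>+x. ennreal (norm (f x)) * indicator {x. l < norm (f x)} x \<partial>lborel)"
  proof -
    have "emeasure lborel {x. norm (conv K h x) > l} \<le> ennreal (W / l) * l1norm h"
      unfolding W_def by (rule weak_type[OF K B hi hc hM l])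
    also have "\<dots> \<le> ennreal (W / l) * (\<integral>\<^sup>+x. ennreal (norm (f x)) * indicator {x. l < norm (f x)} x \<partial>lborel)"
      unfolding l1norm_def hn using l by (intro mult_left_mono nn_integral_mono) (auto simp: indicator_def max_def intro!: ennreal_leI)
    finally show ?thesis .
  qed
  have 2: "emeasure lborel {x. norm (conv K g x) > l} \<le> ennreal (A\<^sup>2 / l\<^sup>2) * (\<integral>\<^sup>+x. ennreal ((min (norm (f x)) l)\<^sup>2) \<partial>lborel)"
  proof -
    have "emeasure lborel {x. norm (conv K g x) > l} = (\<integral>\<^sup>+x. indicator {x. norm (conv K g x) > l} x \<partial>lborel)" by simp
    also have "\<dots> \<le> (\<integral>\<^sup>+x. ennreal (1 / l\<^sup>2) * ennreal ((norm (conv K g x))\<^sup>2) \<partial>lborel)"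
    proof (intro nn_integral_mono)
      fix x
      show "indicator {x. norm (conv K g x) > l} x \<le> ennreal (1 / l\<^sup>2) * ennreal ((norm (conv K g x))\<^sup>2)"
      proof (cases "norm (conv K g x) > l")
        case True
        then have "l\<^sup>2 \<le> (norm (conv K g x))\<^sup>2" using l by (intro power_mono) auto
        then have "1 \<le> 1 / l\<^sup>2 * (norm (conv K g x))\<^sup>2" using l by (simp add: field_simps)
        then have "ennreal 1 \<le> ennreal (1 / l\<^sup>2 * (norm (conv K g x))\<^sup>2)" by (rule ennreal_leI)
        then show ?thesis using True by (subst ennreal_mult[symmetric]) auto
      qed simp
    qed
    also have "\<dots> = ennreal (1 / l\<^sup>2) * (\<integral>\<^sup>+x. ennreal ((norm (conv K g x))\<^sup>2) \<partial>lborel)"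
      by (rule nn_integral_cmult) measurable
    also have "\<dots> \<le> ennreal (1 / l\<^sup>2) * (ennreal (A\<^sup>2) * (\<integral>\<^sup>+x. ennreal ((norm (g x))\<^sup>2) \<partial>lborel))"
      by (intro mult_left_mono conv_L2_bound[OF Ki KA gi gM]) auto
    also have "\<dots> = ennreal (A\<^sup>2 / l\<^sup>2) * (\<integral>\<^sup>+x. ennreal ((min (norm (f x)) l)\<^sup>2) \<partial>lborel)"
      by (simp add: gn mult.assoc[symmetric] flip: ennreal_mult)
    finally show ?thesis .
  qed
  have "{x. norm (conv K f x) > 2 * l} \<subseteq> {x. norm (conv K h x) > l} \<union> {x. norm (conv K g x) > l}"
  proof
    fix x assume "x \<in> {x. norm (conv K f x) > 2 * l}"
    moreover have "norm (conv K f x) \<le> norm (conv K h x) + norm (conv K g x)"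
      unfolding split by (rule norm_triangle_ineq)
    ultimately show "x \<in> {x. norm (conv K h x) > l} \<union> {x. norm (conv K g x) > l}" by auto
  qed
  then have "emeasure lborel {x. norm (conv K f x) > 2 * l} \<le> emeasure lborel ({x. norm (conv K h x) > l} \<union> {x. norm (conv K g x) > l})"
    by (intro emeasure_mono) auto
  also have "\<dots> \<le> emeasure lborel {x. norm (conv K h x) > l} + emeasure lborel {x. norm (conv K g x) > l}"
    by (intro emeasure_subadditive) auto
  also have "\<dots> \<le> ennreal (W / l) * (\<integral>\<^sup>+x. ennreal (norm (f x)) * indicator {x. l < norm (f x)} x \<partial>lborel)
      + ennreal (A\<^sup>2 / l\<^sup>2) * (\<integral>\<^sup>+x. ennreal ((min (norm (f x)) l)\<^sup>2) \<partial>lborel)"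
    by (intro add_mono 1 2)
  also have "\<dots> = (\<integral>\<^sup>+x. ennreal (W / l) * (ennreal (norm (f x)) * indicator {x. l < norm (f x)} x)
        + ennreal (A\<^sup>2 / l\<^sup>2) * ennreal ((min (norm (f x)) l)\<^sup>2) \<partial>lborel)"
    by (subst nn_integral_add) (simp_all add: nn_integral_cmult)
  finally show ?thesis .
qed

text \<open>The three terms are the integrals of l^(p-2) and l^(p-1) over (0, a) and of l^(p-3) over
  [a, \<infinity>). The first converges because 1 < p, the last because p < 2.\<close>

lemma marcinkiewicz_pointwise:
  fixes p W V a :: real
  assumes p: "1 < p" "p < 2" and W: "W \<ge> 0" and V: "V \<ge> 0" and a: "a \<ge> 0"
  shows "(\<integral>\<^sup>+l. ennreal (l powr (p - 1)) * indicator {0<..} l *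
      (ennreal (W / l) * (ennreal a * indicator {l. l < a} l) + ennreal (V / l\<^sup>2) * ennreal ((min a l)\<^sup>2)) \<partial>lborel)
    = ennreal (W / (p - 1) + V * (1 / p + 1 / (2 - p))) * ennreal (a powr p)"
proof (cases "a = 0")
  case True
  then have "(\<integral>\<^sup>+l. ennreal (l powr (p - 1)) * indicator {0<..} l *
      (ennreal (W / l) * (ennreal a * indicator {l. l < a} l) + ennreal (V / l\<^sup>2) * ennreal ((min a l)\<^sup>2)) \<partial>lborel)
    = (\<integral>\<^sup>+(l::real). 0 \<partial>lborel)"
    by (intro nn_integral_cong) (auto simp: indicator_def)
  then show ?thesis using True by simp
next
  case False
  then have a: "a > 0" using a by simp
  let ?I = "\<lambda>e l. ennreal (l powr e) * indicator {0<..<a} l" and ?J = "\<lambda>l. ennreal (l powr (p - 3)) * indicator {a..} l"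
  have "(\<integral>\<^sup>+l. ennreal (l powr (p - 1)) * indicator {0<..} l *
      (ennreal (W / l) * (ennreal a * indicator {l. l < a} l) + ennreal (V / l\<^sup>2) * ennreal ((min a l)\<^sup>2)) \<partial>lborel)
    = (\<integral>\<^sup>+l. ennreal (W * a) * ?I (p - 2) l + (ennreal V * ?I (p - 1) l + ennreal (V * a\<^sup>2) * ?J l) \<partial>lborel)"
  proof (intro nn_integral_cong)
    fix l :: real
    consider "l \<le> 0" | "0 < l" "l < a" | "a \<le> l" by linarith
    then show "ennreal (l powr (p - 1)) * indicator {0<..} l *
      (ennreal (W / l) * (ennreal a * indicator {l. l < a} l) + ennreal (V / l\<^sup>2) * ennreal ((min a l)\<^sup>2))
      = ennreal (W * a) * ?I (p - 2) l + (ennreal V * ?I (p - 1) l + ennreal (V * a\<^sup>2) * ?J l)"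
    proof cases
      case 1
      then show ?thesis using a by (auto simp: indicator_def)
    next
      case 2
      have e: "l powr (p - 1) = l powr (p - 2) * l"
        using 2 by (simp add: powr_mult_base mult.commute[of _ l])
      have "l powr (p - 1) * (W / l * a + V / l\<^sup>2 * l\<^sup>2) = W * a * l powr (p - 2) + V * l powr (p - 1)"
        using 2 by (simp add: e field_simps power2_eq_square)
      then have "ennreal (l powr (p - 1) * (W / l * a + V / l\<^sup>2 * l\<^sup>2)) = ennreal (W * a * l powr (p - 2) + V * l powr (p - 1))"
        by simp
      moreover have "ennreal (l powr (p - 1)) * (ennreal (W / l) * ennreal a + ennreal (V / l\<^sup>2) * ennreal (l\<^sup>2))
          = ennreal (l powr (p - 1) * (W / l * a + V / l\<^sup>2 * l\<^sup>2))"
        using 2 W V a by (subst ennreal_mult, simp, simp, subst ennreal_plus, simp, simp, subst ennreal_mult, simp, simp, subst ennreal_mult, simp_all)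
      moreover have "ennreal (W * a * l powr (p - 2) + V * l powr (p - 1)) = ennreal (W * a) * ennreal (l powr (p - 2)) + ennreal V * ennreal (l powr (p - 1))"
        using W V a by (subst ennreal_plus, simp, simp, subst ennreal_mult, simp, simp, subst ennreal_mult, simp_all)
      ultimately show ?thesis using 2 by simp
    next
      case 3
      then have l: "l > 0" using a by simp
      have "l powr (p - 1) = l powr (p - 3) * l powr 2" by (simp flip: powr_add)
      also have "l powr 2 = l\<^sup>2" using l by simp
      finally have "l powr (p - 1) * (V / l\<^sup>2 * a\<^sup>2) = V * a\<^sup>2 * l powr (p - 3)"
        using l by (simp add: field_simps)
      then have "ennreal (l powr (p - 1) * (V / l\<^sup>2 * a\<^sup>2)) = ennreal (V * a\<^sup>2 * l powr (p - 3))" by simp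
      moreover have "ennreal (l powr (p - 1) * (V / l\<^sup>2 * a\<^sup>2)) = ennreal (l powr (p - 1)) * (ennreal (V / l\<^sup>2) * ennreal (a\<^sup>2))"
        using V by (subst ennreal_mult, simp, simp, subst ennreal_mult, simp_all)
      moreover have "ennreal (V * a\<^sup>2 * l powr (p - 3)) = ennreal (V * a\<^sup>2) * ennreal (l powr (p - 3))"
        using V by (intro ennreal_mult) auto
      ultimately show ?thesis using 3 l by simp
    qed
  qed
  also have "\<dots> = ennreal (W * a) * ennreal (a powr (p - 1) / (p - 1))
      + (ennreal V * ennreal (a powr p / p) + ennreal (V * a\<^sup>2) * ennreal (a powr (p - 2) / (2 - p)))"
  proof -
    have "(\<integral>\<^sup>+l. ?I (p - 2) l \<partial>lborel) = ennreal (a powr (p - 1) / (p - 1))"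
      using nn_integral_powr_0[of "p - 2" a] p a by simp
    moreover have "(\<integral>\<^sup>+l. ?I (p - 1) l \<partial>lborel) = ennreal (a powr p / p)"
      using nn_integral_powr_0[of "p - 1" a] p a by simp
    moreover have "(\<integral>\<^sup>+l. ?J l \<partial>lborel) = ennreal (a powr (p - 2) / (2 - p))"
    proof -
      have "- (a powr (p - 3 + 1)) / (p - 3 + 1) = a powr (p - 2) / (2 - p)"
        using p by (simp add: divide_simps) (simp add: algebra_simps)
      then show ?thesis using nn_integral_powr_inf[of "p - 3" a] p a by simp
    qed
    ultimately show ?thesis
      by (subst nn_integral_add; simp add: nn_integral_add nn_integral_cmult)
  qed
  also have "\<dots> = ennreal (W * a * (a powr (p - 1) / (p - 1)) + (V * (a powr p / p) + V * a\<^sup>2 * (a powr (p - 2) / (2 - p))))"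
    using p a W V by (simp add: ennreal_mult[symmetric] ennreal_plus[symmetric] del: ennreal_plus)
  also have "W * a * (a powr (p - 1) / (p - 1)) + (V * (a powr p / p) + V * a\<^sup>2 * (a powr (p - 2) / (2 - p)))
      = (W / (p - 1) + V * (1 / p + 1 / (2 - p))) * a powr p"
  proof -
    have 1: "a * a powr (p - 1) = a powr p" using a by (simp add: powr_mult_base)
    have "a powr 2 * a powr (p - 2) = a powr p" by (simp flip: powr_add)
    then have 2: "a\<^sup>2 * a powr (p - 2) = a powr p" using a by simp
    have "W * a * (a powr (p - 1) / (p - 1)) = W / (p - 1) * (a * a powr (p - 1))" by simp
    moreover have "V * a\<^sup>2 * (a powr (p - 2) / (2 - p)) = V / (2 - p) * (a\<^sup>2 * a powr (p - 2))" by simp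
    ultimately have "W * a * (a powr (p - 1) / (p - 1)) + (V * (a powr p / p) + V * a\<^sup>2 * (a powr (p - 2) / (2 - p)))
        = W / (p - 1) * a powr p + (V * (a powr p / p) + V / (2 - p) * a powr p)"
      by (simp only: 1 2)
    then show ?thesis by (simp add: algebra_simps)
  qed
  also have "ennreal ((W / (p - 1) + V * (1 / p + 1 / (2 - p))) * a powr p) = ennreal (W / (p - 1) + V * (1 / p + 1 / (2 - p))) * ennreal (a powr p)"
    using p W V by (intro ennreal_mult) auto
  finally show ?thesis .
qed

text \<open>Layer cake for the output, the level estimate at each height, and Fubini, which leaves
  the one-dimensional integral of \<open>marcinkiewicz_pointwise\<close>.\<close>

lemma marcinkiewicz:
  fixes f K :: "'a::euclidean_space \<Rightarrow> complex"
  assumes K: "cz_kernel A B K" and B: "B \<ge> 0" and p: "1 < p" "p < 2"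
    and f: "integrable lborel f" "continuous_on UNIV f" "\<And>x. norm (f x) \<le> M"
  defines "W \<equiv> 4 * A\<^sup>2 * 2 ^ DIM('a) + (6 * DIM('a)) ^ DIM('a) + 2 * B"
  shows "(\<integral>\<^sup>+x. ennreal (norm (conv K f x) powr p) \<partial>lborel)
    \<le> ennreal (p * 2 powr p * (W / (p - 1) + A\<^sup>2 * (1 / p + 1 / (2 - p)))) * (\<integral>\<^sup>+x. ennreal (norm (f x) powr p) \<partial>lborel)"
proof -
  have Ki: "integrable lborel K" using K by (auto simp: cz_kernel_def)
  have [measurable]: "f \<in> borel_measurable borel" "K \<in> borel_measurable borel" using f Ki by auto
  have W: "W \<ge> 0" using B by (simp add: W_def)
  let ?c = "p * 2 powr p"
  have c: "?c \<ge> 0" using p by simp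
  define F where "F l x = ennreal (W / l) * (ennreal (norm (f x)) * indicator {l. l < norm (f x)} l)
        + ennreal (A\<^sup>2 / l\<^sup>2) * ennreal ((min (norm (f x)) l)\<^sup>2)" for l x
  have [measurable]: "case_prod F \<in> borel_measurable (borel \<Otimes>\<^sub>M borel)" unfolding F_def by measurable
  have "(\<integral>\<^sup>+x. ennreal (norm (conv K f x) powr p) \<partial>lborel)
    = (\<integral>\<^sup>+x. \<integral>\<^sup>+l. ennreal (?c * l powr (p - 1)) * indicator {l. 0 < l \<and> 2 * l < norm (conv K f x)} l \<partial>lborel \<partial>lborel)"
    using p by (intro nn_integral_cong powr_layer_cake) auto
  also have "\<dots> = (\<integral>\<^sup>+l. \<integral>\<^sup>+x. ennreal (?c * l powr (p - 1)) * indicator {l. 0 < l \<and> 2 * l < norm (conv K f x)} l \<partial>lborel \<partial>lborel)"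
    by (rule nn_integral_lborel_fubini) measurable
  also have "\<dots> \<le> (\<integral>\<^sup>+l. \<integral>\<^sup>+x. ennreal ?c * (ennreal (l powr (p - 1)) * indicator {0<..} l * F l x) \<partial>lborel \<partial>lborel)"
  proof (rule nn_integral_mono)
    fix l :: real
    show "(\<integral>\<^sup>+x. ennreal (?c * l powr (p - 1)) * indicator {l. 0 < l \<and> 2 * l < norm (conv K f x)} l \<partial>lborel)
      \<le> (\<integral>\<^sup>+x. ennreal ?c * (ennreal (l powr (p - 1)) * indicator {0<..} l * F l x) \<partial>lborel)"
    proof (cases "l > 0")
      case True
      have "(\<integral>\<^sup>+x. ennreal (?c * l powr (p - 1)) * indicator {l. 0 < l \<and> 2 * l < norm (conv K f x)} l \<partial>lborel)
        = (\<integral>\<^sup>+x. ennreal (?c * l powr (p - 1)) * indicator {x. norm (conv K f x) > 2 * l} x \<partial>lborel)"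
        using True by (intro nn_integral_cong) (auto simp: indicator_def)
      also have "\<dots> = ennreal (?c * l powr (p - 1)) * emeasure lborel {x. norm (conv K f x) > 2 * l}"
        by (subst nn_integral_cmult_indicator) auto
      also have "\<dots> \<le> ennreal (?c * l powr (p - 1)) * (\<integral>\<^sup>+x. F l x \<partial>lborel)"
      proof (intro mult_left_mono)
        have "indicator {x. l < norm (f x)} x = (indicator {l. l < norm (f x)} l :: ennreal)" for x
          by (auto simp: indicator_def)
        then show "emeasure lborel {x. norm (conv K f x) > 2 * l} \<le> (\<integral>\<^sup>+x. F l x \<partial>lborel)"
          using marcinkiewicz_level[OF K B f True] unfolding F_def W_def by simp
      qed simp
      also have "\<dots> = (\<integral>\<^sup>+x. ennreal (?c * l powr (p - 1)) * F l x \<partial>lborel)"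
        by (rule nn_integral_cmult[symmetric]) measurable
      also have "\<dots> = (\<integral>\<^sup>+x. ennreal ?c * (ennreal (l powr (p - 1)) * indicator {0<..} l * F l x) \<partial>lborel)"
        using True c p by (intro nn_integral_cong) (simp add: ennreal_mult mult.assoc)
      finally show ?thesis .
    qed simp
  qed
  also have "\<dots> = (\<integral>\<^sup>+x. \<integral>\<^sup>+l. ennreal ?c * (ennreal (l powr (p - 1)) * indicator {0<..} l * F l x) \<partial>lborel \<partial>lborel)"
    by (rule nn_integral_lborel_fubini) measurable
  also have "\<dots> = (\<integral>\<^sup>+x. ennreal ?c * (\<integral>\<^sup>+l. ennreal (l powr (p - 1)) * indicator {0<..} l * F l x \<partial>lborel) \<partial>lborel)"
    by (intro nn_integral_cong nn_integral_cmult) measurable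
  also have "\<dots> = (\<integral>\<^sup>+x. ennreal ?c * (ennreal (W / (p - 1) + A\<^sup>2 * (1 / p + 1 / (2 - p))) * ennreal (norm (f x) powr p)) \<partial>lborel)"
    unfolding F_def by (intro nn_integral_cong) (subst marcinkiewicz_pointwise[OF p W], auto)
  also have "\<dots> = ennreal (?c * (W / (p - 1) + A\<^sup>2 * (1 / p + 1 / (2 - p)))) * (\<integral>\<^sup>+x. ennreal (norm (f x) powr p) \<partial>lborel)"
    using p W c by (simp add: nn_integral_cmult ennreal_mult mult.assoc)
  finally show ?thesis .
qed

text \<open>Reflection only replaces xi and y by their negatives, and both conditions range over all
  of them. The transposed kernel thus obeys the same bounds.\<close>

lemma cz_kernel_reflect:
  assumes K: "cz_kernel A B K"
  shows "cz_kernel A B (\<lambda>x. K (- x))"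
  unfolding cz_kernel_def
proof (intro conjI allI)
  have Ki: "integrable lborel K" using K by (auto simp: cz_kernel_def)
  then have [measurable]: "K \<in> borel_measurable borel" by auto
  show "integrable lborel (\<lambda>x. K (- x))" by (rule integrable_lborel_translate(5)[OF Ki])
  show "norm (FT (\<lambda>x. K (- x)) \<xi>) \<le> A" for \<xi>
  proof -
    have "FT (\<lambda>x. K (- x)) \<xi> = FT K (- \<xi>)"
      using lborel_integral_translate(5)[of "\<lambda>x. iexp ((- \<xi>) \<bullet> x) * K x"] by (simp add: FT_def)
    then show ?thesis using K by (simp add: cz_kernel_def)
  qed
  fix y
  let ?h = "\<lambda>x. if 2 * norm (- y) \<le> norm x then ennreal (norm (K (x - - y) - K x)) else 0"
  have "(\<integral>\<^sup>+x. (if 2 * norm y \<le> norm x then ennreal (norm (K (- (x - y)) - K (- x))) else 0) \<partial>lborel) = (\<integral>\<^sup>+x. ?h (- x) \<partial>lborel)"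
    by (intro nn_integral_cong) simp
  also have "\<dots> = (\<integral>\<^sup>+x. ?h x \<partial>lborel)" by (rule nn_integral_lborel_translate(5)) measurable
  also have "\<dots> \<le> ennreal B" using K unfolding cz_kernel_def by blast
  finally show "(\<integral>\<^sup>+x. (if 2 * norm y \<le> norm x then ennreal (norm (K (- (x - y)) - K (- x))) else 0) \<partial>lborel) \<le> ennreal B" .
qed

text \<open>The pairing is bilinear, without a conjugate, so the transpose of \<open>K\<close> is
  its plain reflection.\<close>

lemma conv_duality:
  assumes K: "integrable lborel K" and f: "integrable lborel f" and [measurable]: "g \<in> borel_measurable borel"
    and g: "\<And>x. norm (g x) \<le> M"
  shows "(\<integral>x. conv K f x * g x \<partial>lborel) = (\<integral>y. f y * conv (\<lambda>x. K (- x)) g y \<partial>lborel)"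
proof -
  have [measurable]: "f \<in> borel_measurable borel" "K \<in> borel_measurable borel" using f K by auto
  have M: "M \<ge> 0" using g[of undefined] norm_ge_zero order_trans by blast
  have "(\<integral>x. conv K f x * g x \<partial>lborel) = (\<integral>x. \<integral>y. K (x - y) * f y * g x \<partial>lborel \<partial>lborel)"
    unfolding conv_def by simp
  also have "\<dots> = (\<integral>y. \<integral>x. K (x - y) * f y * g x \<partial>lborel \<partial>lborel)"
  proof (rule integral_lborel_fubini)
    have "(\<integral>\<^sup>+x. \<integral>\<^sup>+y. norm (K (x - y) * f y * g x) \<partial>lborel \<partial>lborel)
      \<le> (\<integral>\<^sup>+x. \<integral>\<^sup>+y. ennreal M * norm (K (x - y) * f y) \<partial>lborel \<partial>lborel)"
      using g M by (intro nn_integral_mono) (auto simp: norm_mult mult.commute[of M] intro!: ennreal_leI mult_left_mono simp flip: ennreal_mult)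
    also have "\<dots> = ennreal M * (\<integral>\<^sup>+x. \<integral>\<^sup>+y. norm (K (x - y) * f y) \<partial>lborel \<partial>lborel)"
      by (simp add: nn_integral_cmult)
    also have "\<dots> < \<infinity>" using conv_prod_fin[OF K f] by (simp add: ennreal_mult_less_top)
    finally show "(\<integral>\<^sup>+x. \<integral>\<^sup>+y. norm (K (x - y) * f y * g x) \<partial>lborel \<partial>lborel) < \<infinity>" .
  qed measurable
  also have "\<dots> = (\<integral>y. f y * conv (\<lambda>x. K (- x)) g y \<partial>lborel)"
    unfolding conv_def by (simp add: mult.assoc mult.left_commute[of _ "f _"])
  finally show ?thesis .
qed

text \<open>Test \<open>v = conv K f\<close> against \<open>g = cnj v * norm v powr (p - 2)\<close> and move \<open>K\<close> to \<open>g\<close>.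
  In Young's inequality the weight \<open>m = (2 * C) powr (1 / q)\<close> leaves half of
  \<open>\<integral> norm v powr p\<close> to be absorbed.\<close>

lemma cz_Lp_gt_2:
  fixes f K :: "'a::euclidean_space \<Rightarrow> complex"
  assumes K: "cz_kernel A B K" and p: "p > 2" and q: "q = p / (p - 1)"
    and f: "integrable lborel f" "continuous_on UNIV f" "\<And>x. norm (f x) \<le> M"
    and C: "C > 0"
    and dual: "\<And>(g::'a \<Rightarrow> complex) N. integrable lborel g \<Longrightarrow> continuous_on UNIV g \<Longrightarrow> (\<And>x. norm (g x) \<le> N) \<Longrightarrow>
      (\<integral>\<^sup>+x. ennreal (norm (conv (\<lambda>x. K (- x)) g x) powr q) \<partial>lborel) \<le> ennreal C * (\<integral>\<^sup>+x. ennreal (norm (g x) powr q) \<partial>lborel)"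
  shows "(\<integral>\<^sup>+x. ennreal (norm (conv K f x) powr p) \<partial>lborel)
    \<le> ennreal (2 * (2 * C) powr (p / q) / p) * (\<integral>\<^sup>+x. ennreal (norm (f x) powr p) \<partial>lborel)"
proof -
  have Ki: "integrable lborel K" using K by (auto simp: cz_kernel_def)
  have q1: "q > 1" and pq: "1 / p + 1 / q = 1" and pq': "(p - 1) * q = p" using p by (auto simp: q field_simps)
  define m where "m = (2 * C) powr (1 / q)"
  have m: "m > 0" and mp: "m powr p = (2 * C) powr (p / q)" and mq: "m powr q = 2 * C"
    using C q1 by (auto simp: m_def powr_powr)
  define v where "v = conv K f"
  define M1 where "M1 = M * (\<integral>x. norm (K x) \<partial>lborel)"
  have vM: "norm (v x) \<le> M1" for x unfolding v_def M1_def by (rule conv_bound[OF Ki f(3)])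
  then have M1: "M1 \<ge> 0" using norm_ge_zero order_trans by blast
  have vi: "integrable lborel v" unfolding v_def by (rule integrable_conv[OF Ki f(1)])
  have vc: "continuous_on UNIV v" unfolding v_def by (rule continuous_on_conv[OF Ki f(3) f(2)])
  define g where "g x = cnj (v x) * complex_of_real (norm (v x) powr (p - 2))" for x
  have gc: "continuous_on UNIV g" unfolding g_def using p
    by (intro continuous_intros vc continuous_on_powr') auto
  have [measurable]: "f \<in> borel_measurable borel" "K \<in> borel_measurable borel" "v \<in> borel_measurable borel"
    "g \<in> borel_measurable borel"
    using f Ki vi gc by (auto intro: borel_measurable_continuous_onI)
  have gn: "norm (g x) = norm (v x) powr (p - 1)" for x
    using p by (simp add: g_def norm_mult powr_mult_base)
  have gle: "norm (g x) \<le> M1 powr (p - 2) * norm (v x)" for x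
    using vM p unfolding g_def by (auto simp: norm_mult mult.commute[of "norm (v x)"] intro!: mult_right_mono powr_mono2)
  have gM: "norm (g x) \<le> M1 powr (p - 2) * M1" for x
    using gle[of x] vM[of x] by (rule order_trans[OF _ mult_left_mono]) auto
  have gi: "integrable lborel g"
  proof (rule Bochner_Integration.integrable_bound)
    show "integrable lborel (\<lambda>x. M1 powr (p - 2) * norm (v x))" using vi by simp
  qed (use gle in auto)
  have vg: "v x * g x = complex_of_real (norm (v x) powr p)" for x
  proof -
    have "v x * g x = complex_of_real ((norm (v x))\<^sup>2 * norm (v x) powr (p - 2))"
      unfolding g_def of_real_mult complex_norm_square by simp
    also have "(norm (v x))\<^sup>2 * norm (v x) powr (p - 2) = norm (v x) powr p"
      using p by (simp add: power2_eq_square mult.assoc powr_mult_base)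
    finally show ?thesis .
  qed
  define I where "I = (\<integral>x. norm (v x) powr p \<partial>lborel)"
  have I0: "I \<ge> 0" unfolding I_def by (intro integral_nonneg_AE) auto
  \<comment> \<open>Finiteness of \<open>I\<close> has to be known beforehand, or subtracting
    \<open>I / 2\<close> at the end would be meaningless. It holds because \<open>v\<close> is
    integrable and \<open>g\<close> is bounded.\<close>
  have Ii: "integrable lborel (\<lambda>x. norm (v x) powr p)"
  proof -
    have "integrable lborel (\<lambda>x. v x * g x)"
      by (rule integrable_mult_bounded(1)[OF vi _ gM]) measurable
    then show ?thesis unfolding vg by (simp add: complex_of_real_integrable_eq)
  qed
  have In: "ennreal I = (\<integral>\<^sup>+x. ennreal (norm (v x) powr p) \<partial>lborel)"
    unfolding I_def by (rule nn_integral_eq_integral[symmetric, OF Ii]) auto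
  define h where "h = conv (\<lambda>x. K (- x)) g"
  have [measurable]: "h \<in> borel_measurable borel" unfolding h_def by measurable
  have hq: "(\<integral>\<^sup>+x. ennreal (norm (h x) powr q) \<partial>lborel) \<le> ennreal C * ennreal I"
  proof -
    have "norm (g x) powr q = norm (v x) powr p" for x by (simp add: gn powr_powr pq')
    then show ?thesis using dual[OF gi gc gM] unfolding h_def In by simp
  qed
  have "complex_of_real I = (\<integral>x. v x * g x \<partial>lborel)"
    unfolding vg I_def by (rule integral_complex_of_real[symmetric])
  also have "\<dots> = (\<integral>x. f x * h x \<partial>lborel)"
    unfolding v_def h_def by (rule conv_duality[OF Ki f(1) _ gM]) measurable
  finally have "ennreal I = ennreal (norm (\<integral>x. f x * h x \<partial>lborel))"
    using I0 by (metis abs_of_nonneg norm_of_real)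
  also have "\<dots> \<le> (\<integral>\<^sup>+x. norm (f x * h x) \<partial>lborel)" by (rule norm_integral_le_nn_integral)
  also have "\<dots> \<le> (\<integral>\<^sup>+x. ennreal (m powr p / p) * ennreal (norm (f x) powr p) + ennreal (1 / (2 * C * q)) * ennreal (norm (h x) powr q) \<partial>lborel)"
  proof (rule nn_integral_mono)
    fix x
    have "norm (f x * h x) = (m * norm (f x)) * (norm (h x) / m)" using m by (simp add: norm_mult)
    also have "\<dots> \<le> (m * norm (f x)) powr p / p + (norm (h x) / m) powr q / q"
      using m p q1 pq by (intro Youngs_inequality) auto
    also have "\<dots> = m powr p / p * norm (f x) powr p + 1 / (2 * C * q) * norm (h x) powr q"
      using m by (simp add: powr_mult powr_divide mq)
    finally have "ennreal (norm (f x * h x)) \<le> ennreal (m powr p / p * norm (f x) powr p + 1 / (2 * C * q) * norm (h x) powr q)"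
      by (rule ennreal_leI)
    also have "\<dots> = ennreal (m powr p / p * norm (f x) powr p) + ennreal (1 / (2 * C * q) * norm (h x) powr q)"
      using p q1 C by (intro ennreal_plus) auto
    also have "\<dots> = ennreal (m powr p / p) * ennreal (norm (f x) powr p) + ennreal (1 / (2 * C * q)) * ennreal (norm (h x) powr q)"
      using p q1 C by (subst (1 2) ennreal_mult) auto
    finally show "ennreal (norm (f x * h x)) \<le> ennreal (m powr p / p) * ennreal (norm (f x) powr p) + ennreal (1 / (2 * C * q)) * ennreal (norm (h x) powr q)" .
  qed
  also have "\<dots> = ennreal (m powr p / p) * (\<integral>\<^sup>+x. ennreal (norm (f x) powr p) \<partial>lborel)
      + ennreal (1 / (2 * C * q)) * (\<integral>\<^sup>+x. ennreal (norm (h x) powr q) \<partial>lborel)"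
    by (subst nn_integral_add) (simp_all add: nn_integral_cmult)
  also have "\<dots> \<le> ennreal (m powr p / p) * (\<integral>\<^sup>+x. ennreal (norm (f x) powr p) \<partial>lborel)
      + ennreal (1 / (2 * C * q)) * (ennreal C * ennreal I)"
    by (intro add_mono mult_left_mono hq) auto
  also have "ennreal (1 / (2 * C * q)) * (ennreal C * ennreal I) = ennreal (I / (2 * q))"
    using C q1 I0 by (simp add: field_simps flip: ennreal_mult)
  also have "ennreal (I / (2 * q)) \<le> ennreal (I / 2)"
    using q1 I0 by (intro ennreal_leI divide_left_mono) auto
  finally have fin: "ennreal I \<le> ennreal (m powr p / p) * (\<integral>\<^sup>+x. ennreal (norm (f x) powr p) \<partial>lborel) + ennreal (I / 2)"
    by (simp add: add_left_mono)
  have "ennreal I \<le> ennreal (2 * m powr p / p) * (\<integral>\<^sup>+x. ennreal (norm (f x) powr p) \<partial>lborel)"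
  proof (cases "\<integral>\<^sup>+x. ennreal (norm (f x) powr p) \<partial>lborel")
    case (real r)
    have "ennreal I \<le> ennreal (m powr p / p * r + I / 2)"
    proof -
      have "ennreal (m powr p / p * r + I / 2) = ennreal (m powr p / p) * ennreal r + ennreal (I / 2)"
        using real p I0 by (subst ennreal_plus, simp, simp, subst ennreal_mult, simp_all)
      then show ?thesis using fin real by simp
    qed
    then have "I \<le> m powr p / p * r + I / 2" using real p I0 by (subst (asm) ennreal_le_iff) auto
    then have "I \<le> 2 * m powr p / p * r" by (simp add: field_simps)
    then have "ennreal I \<le> ennreal (2 * m powr p / p * r)" by (rule ennreal_leI)
    also have "\<dots> = ennreal (2 * m powr p / p) * ennreal r" using p real by (intro ennreal_mult) auto
    finally show ?thesis using real by simp
  next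
    case top
    then show ?thesis using m p by (simp add: ennreal_mult_top)
  qed
  then show ?thesis unfolding In v_def mp .
qed

text \<open>\<open>C\<close> is chosen before \<open>K\<close>, so it serves all truncated kernels
  at once. Interpolation gives p < 2, Plancherel's formula p = 2, and duality with the reflected
  kernel p > 2.\<close>

theorem calderon_zygmund_Lp:
  assumes p: "p > 1" and B: "B \<ge> 0"
  shows "\<exists>C\<ge>0. \<forall>(K::'a::euclidean_space \<Rightarrow> complex) f M. cz_kernel A B K \<longrightarrow> integrable lborel f \<longrightarrow> continuous_on UNIV f \<longrightarrow>
    (\<forall>x. norm (f x) \<le> M) \<longrightarrow>
    (\<integral>\<^sup>+x. ennreal (norm (conv K f x) powr p) \<partial>lborel) \<le> ennreal C * (\<integral>\<^sup>+x. ennreal (norm (f x) powr p) \<partial>lborel)"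
proof -
  have lt2: "\<exists>C>0. \<forall>(K::'a \<Rightarrow> complex) f M. cz_kernel A B K \<longrightarrow> integrable lborel f \<longrightarrow> continuous_on UNIV f \<longrightarrow>
    (\<forall>x. norm (f x) \<le> M) \<longrightarrow>
    (\<integral>\<^sup>+x. ennreal (norm (conv K f x) powr p) \<partial>lborel) \<le> ennreal C * (\<integral>\<^sup>+x. ennreal (norm (f x) powr p) \<partial>lborel)"
    if "1 < p" "p < 2" for p :: real
  proof -
    define C where "C = p * 2 powr p * ((4 * A\<^sup>2 * 2 ^ DIM('a) + (6 * DIM('a)) ^ DIM('a) + 2 * B) / (p - 1) + A\<^sup>2 * (1 / p + 1 / (2 - p)))"
    have "0 < 4 * A\<^sup>2 * 2 ^ DIM('a) + (6 * real DIM('a)) ^ DIM('a) + 2 * B"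
      using B by (intro add_pos_nonneg[of _ "2 * B"] add_nonneg_pos zero_less_power) auto
    then have "0 < (4 * A\<^sup>2 * 2 ^ DIM('a) + (6 * DIM('a)) ^ DIM('a) + 2 * B) / (p - 1)"
      using that by (intro divide_pos_pos) auto
    moreover have "0 \<le> A\<^sup>2 * (1 / p + 1 / (2 - p))" using that by simp
    ultimately have "C > 0" unfolding C_def using that
      by (intro mult_pos_pos add_pos_nonneg) auto
    moreover have "(\<integral>\<^sup>+x. ennreal (norm (conv K f x) powr p) \<partial>lborel) \<le> ennreal C * (\<integral>\<^sup>+x. ennreal (norm (f x) powr p) \<partial>lborel)"
      if "cz_kernel A B K" "integrable lborel f" "continuous_on UNIV f" "\<forall>x. norm (f x) \<le> M" for K f :: "'a \<Rightarrow> complex" and M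
      unfolding C_def using marcinkiewicz[OF that(1) B \<open>1 < p\<close> \<open>p < 2\<close> that(2,3), of M] that(4) by simp
    ultimately show ?thesis by blast
  qed
  consider "p < 2" | "p = 2" | "p > 2" by linarith
  then show ?thesis
  proof cases
    case 1
    from lt2[OF p 1] show ?thesis using less_imp_le by blast
  next
    case 2
    have "(\<integral>\<^sup>+x. ennreal (norm (conv K f x) powr p) \<partial>lborel) \<le> ennreal (A\<^sup>2) * (\<integral>\<^sup>+x. ennreal (norm (f x) powr p) \<partial>lborel)"
      if "cz_kernel A B K" "integrable lborel f" "\<forall>x. norm (f x) \<le> M" for K f :: "'a \<Rightarrow> complex" and M
      using conv_L2_bound[of K A f M] that by (simp add: 2 cz_kernel_def)
    then show ?thesis by (intro exI[of _ "A\<^sup>2"]) auto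
  next
    case 3
    define q where "q = p / (p - 1)"
    have q: "1 < q" "q < 2" using 3 by (auto simp: q_def field_simps)
    obtain C where C: "C > 0" and dual: "\<And>(K::'a \<Rightarrow> complex) f M. cz_kernel A B K \<Longrightarrow> integrable lborel f \<Longrightarrow> continuous_on UNIV f \<Longrightarrow>
      (\<forall>x. norm (f x) \<le> M) \<Longrightarrow>
      (\<integral>\<^sup>+x. ennreal (norm (conv K f x) powr q) \<partial>lborel) \<le> ennreal C * (\<integral>\<^sup>+x. ennreal (norm (f x) powr q) \<partial>lborel)"
      using lt2[OF q] by blast
    have "(\<integral>\<^sup>+x. ennreal (norm (conv K f x) powr p) \<partial>lborel) \<le> ennreal (2 * (2 * C) powr (p / q) / p) * (\<integral>\<^sup>+x. ennreal (norm (f x) powr p) \<partial>lborel)"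
      if K: "cz_kernel A B K" and f: "integrable lborel f" "continuous_on UNIV f" "\<forall>x. norm (f x) \<le> M" for K f :: "'a \<Rightarrow> complex" and M
    proof (rule cz_Lp_gt_2[OF K 3 q_def f(1,2) _ C])
      show "norm (f x) \<le> M" for x using f(3) by blast
      show "(\<integral>\<^sup>+x. ennreal (norm (conv (\<lambda>x. K (- x)) g x) powr q) \<partial>lborel) \<le> ennreal C * (\<integral>\<^sup>+x. ennreal (norm (g x) powr q) \<partial>lborel)"
        if "integrable lborel g" "continuous_on UNIV g" "\<And>x. norm (g x) \<le> N" for g :: "'a \<Rightarrow> complex" and N
        using dual[OF cz_kernel_reflect[OF K] that(1,2), of N] that(3) by blast
    qed
    moreover have "2 * (2 * C) powr (p / q) / p \<ge> 0" using 3 by simp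
    ultimately show ?thesis by blast
  qed
qed

section \<open>Averages of dilated kernels\<close>

text \<open>The moment together with mean zero controls low frequencies and the tail; the
  translation bound controls high frequencies and small shifts. A single exponent is used for both
  so that the two bounds on the dilates are reciprocal powers.\<close>

definition profile :: "real \<Rightarrow> real \<Rightarrow> ('a::euclidean_space \<Rightarrow> complex) \<Rightarrow> bool" where
  "profile e C \<psi> \<longleftrightarrow> 0 < e \<and> e \<le> 1 \<and> 0 \<le> C \<and> integrable lborel \<psi> \<and> FT \<psi> 0 = 0 \<and>
    (\<forall>h. l1norm (\<lambda>x. \<psi> (x + h) - \<psi> x) \<le> ennreal (C * norm h powr e)) \<and>
    (\<integral>\<^sup>+x. ennreal (norm x powr e * norm (\<psi> x)) \<partial>lborel) \<le> ennreal C"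

lemma norm_iexp_minus_1_le:
  assumes "0 < e" "e \<le> 1"
  shows "norm (iexp x - 1) \<le> 2 * \<bar>x\<bar> powr e"
proof (cases "\<bar>x\<bar> \<le> 1")
  case True
  have "norm (iexp x - 1) \<le> \<bar>x\<bar>" using iexp_approx1[of x 0] by simp
  also have "\<bar>x\<bar> \<le> \<bar>x\<bar> powr e"
  proof (cases "x = 0")
    case False
    then have "\<bar>x\<bar> powr 1 \<le> \<bar>x\<bar> powr e" using True assms by (intro powr_mono') auto
    then show ?thesis by simp
  qed simp
  finally show ?thesis using powr_ge_zero[of "\<bar>x\<bar>" e] by linarith
next
  case False
  have "norm (iexp x - 1) \<le> norm (iexp x) + norm (1::complex)" by (rule norm_triangle_ineq4)
  also have "\<dots> = 2 * 1" by simp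
  also have "1 \<le> \<bar>x\<bar> powr e" using False assms by (intro ge_one_powr_ge_zero) auto
  finally show ?thesis by simp
qed

text \<open>Mean zero allows 1 to be subtracted from the exponential, and |exp(i u) - 1| is at most
  2 |u|^e; the moment of order \<open>e\<close> does the rest.\<close>

lemma FT_profile_small:
  assumes "profile e C \<psi>"
  shows "norm (FT \<psi> \<xi>) \<le> 2 * C * norm \<xi> powr e"
proof -
  have e: "0 < e" "e \<le> 1" and C: "0 \<le> C" and i: "integrable lborel \<psi>" and 0: "FT \<psi> 0 = 0"
    and m: "(\<integral>\<^sup>+x. ennreal (norm x powr e * norm (\<psi> x)) \<partial>lborel) \<le> ennreal C"
    using assms by (auto simp: profile_def)
  have [measurable]: "\<psi> \<in> borel_measurable borel" using i by auto
  have "FT \<psi> \<xi> = FT \<psi> \<xi> - FT \<psi> 0" using 0 by simp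
  also have "\<dots> = (\<integral>x. (iexp (\<xi> \<bullet> x) - 1) * \<psi> x \<partial>lborel)"
    unfolding FT_def left_diff_distrib
    using Bochner_Integration.integral_diff[OF integrable_iexp_mult[OF i, of \<xi>] integrable_iexp_mult[OF i, of 0]] by simp
  finally have "ennreal (norm (FT \<psi> \<xi>)) \<le> (\<integral>\<^sup>+x. norm ((iexp (\<xi> \<bullet> x) - 1) * \<psi> x) \<partial>lborel)"
    by (simp only: norm_integral_le_nn_integral)
  also have "\<dots> \<le> (\<integral>\<^sup>+x. ennreal (2 * norm \<xi> powr e) * ennreal (norm x powr e * norm (\<psi> x)) \<partial>lborel)"
  proof (rule nn_integral_mono)
    fix x
    have "norm (iexp (\<xi> \<bullet> x) - 1) \<le> 2 * \<bar>\<xi> \<bullet> x\<bar> powr e" by (rule norm_iexp_minus_1_le[OF e])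
    also have "\<bar>\<xi> \<bullet> x\<bar> powr e \<le> (norm \<xi> * norm x) powr e"
      using e Cauchy_Schwarz_ineq2[of \<xi> x] by (intro powr_mono2) auto
    also have "\<dots> = norm \<xi> powr e * norm x powr e" by (simp add: powr_mult)
    finally have "norm (iexp (\<xi> \<bullet> x) - 1) * norm (\<psi> x) \<le> 2 * (norm \<xi> powr e * norm x powr e) * norm (\<psi> x)"
      by (intro mult_right_mono) auto
    then show "ennreal (norm ((iexp (\<xi> \<bullet> x) - 1) * \<psi> x)) \<le> ennreal (2 * norm \<xi> powr e) * ennreal (norm x powr e * norm (\<psi> x))"
      by (subst ennreal_mult[symmetric]) (auto simp: norm_mult mult.assoc intro!: ennreal_leI)
  qed
  also have "\<dots> = ennreal (2 * norm \<xi> powr e) * (\<integral>\<^sup>+x. ennreal (norm x powr e * norm (\<psi> x)) \<partial>lborel)"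
    by (rule nn_integral_cmult) measurable
  also have "\<dots> \<le> ennreal (2 * norm \<xi> powr e) * ennreal C" by (intro mult_left_mono m) auto
  also have "\<dots> = ennreal (2 * C * norm \<xi> powr e)" using C by (subst ennreal_mult[symmetric]) (auto simp: ac_simps)
  finally show ?thesis using C by (subst (asm) ennreal_le_iff) auto
qed

text \<open>The shift \<open>h\<close> is half a period in the direction of the frequency: it turns
  the phase into -1, so the transform of the difference has twice the size of the transform of
  \<open>\<psi>\<close>. The final constant uses pi^e \<le> pi < 4.\<close>

lemma FT_profile_large:
  assumes "profile e C \<psi>" and \<xi>: "\<xi> \<noteq> 0"
  shows "norm (FT \<psi> \<xi>) \<le> 2 * C * norm \<xi> powr (- e)"
proof -
  have e: "0 < e" "e \<le> 1" and C: "0 \<le> C" and i: "integrable lborel \<psi>"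
    and tr: "\<And>h. l1norm (\<lambda>x. \<psi> (x + h) - \<psi> x) \<le> ennreal (C * norm h powr e)"
    using assms by (auto simp: profile_def)
  have [measurable]: "\<psi> \<in> borel_measurable borel" using i by auto
  define h where "h = (pi / (norm \<xi>)\<^sup>2) *\<^sub>R \<xi>"
  have hn: "norm h = pi / norm \<xi>" using \<xi> by (simp add: h_def power2_eq_square)
  have "\<xi> \<bullet> h = pi" using \<xi> by (simp add: h_def power2_norm_eq_inner)
  then have "iexp (- (\<xi> \<bullet> h)) = -1" by (simp add: exp_minus)
  then have "FT (\<lambda>x. \<psi> (x + h) - \<psi> x) \<xi> = - 2 * FT \<psi> \<xi>"
    using FT_diff[OF integrable_lborel_translate(2)[OF i, of h] i, of \<xi>] FT_translate[of \<psi> h \<xi>] by simp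
  then have "ennreal (2 * norm (FT \<psi> \<xi>)) \<le> ennreal (C * norm h powr e)"
    using order_trans[OF norm_FT_le[of "\<lambda>x. \<psi> (x + h) - \<psi> x" \<xi>] tr] by (simp add: norm_mult)
  then have "2 * norm (FT \<psi> \<xi>) \<le> C * norm h powr e" using C by (subst (asm) ennreal_le_iff) auto
  also have "norm h powr e = pi powr e * norm \<xi> powr (- e)"
    unfolding hn by (subst powr_divide) (simp_all add: powr_minus divide_inverse)
  also have "C * (pi powr e * norm \<xi> powr (- e)) \<le> C * (4 * norm \<xi> powr (- e))"
  proof (intro mult_left_mono mult_right_mono C)
    have "pi powr e \<le> pi powr 1" using e pi_gt3 by (intro powr_mono) auto
    then show "pi powr e \<le> 4" using pi_less_4 by simp
  qed auto
  finally show ?thesis by simp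
qed

lemma ennreal_norm_of_real_mult:
  "c \<ge> 0 \<Longrightarrow> ennreal (norm (complex_of_real c * z)) = ennreal c * ennreal (norm z)"
  by (simp add: norm_mult ennreal_mult)

text \<open>The reflection makes \<open>conv (dilate s \<psi>) f x\<close> the average of \<open>f (x + s z)\<close> against \<open>\<psi>\<close>.\<close>

definition dilate :: "real \<Rightarrow> ('a::euclidean_space \<Rightarrow> complex) \<Rightarrow> 'a \<Rightarrow> complex" where
  "dilate s \<psi> y = complex_of_real (1 / s ^ DIM('a)) * \<psi> (- (y /\<^sub>R s))"

lemma nn_integral_dilate:
  fixes F :: "'a::euclidean_space \<Rightarrow> ennreal"
  assumes [measurable]: "F \<in> borel_measurable borel" and s: "s > 0"
  shows "(\<integral>\<^sup>+y. ennreal (1 / s ^ DIM('a)) * F (- (y /\<^sub>R s)) \<partial>lborel) = (\<integral>\<^sup>+y. F y \<partial>lborel)"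
proof -
  have "(\<integral>\<^sup>+y. F (- (y /\<^sub>R s)) \<partial>lborel) = ennreal (s ^ DIM('a)) * (\<integral>\<^sup>+y. F y \<partial>lborel)"
    using nn_integral_lborel_affine[of F "- inverse s" 0] s by (simp add: power_divide inverse_eq_divide)
  then show ?thesis using s by (simp add: nn_integral_cmult mult.assoc[symmetric] flip: ennreal_mult)
qed

lemma l1norm_dilate:
  fixes \<psi> :: "'a::euclidean_space \<Rightarrow> complex"
  assumes [measurable]: "\<psi> \<in> borel_measurable borel" and s: "s > 0"
  shows "l1norm (dilate s \<psi>) = l1norm \<psi>"
  unfolding l1norm_def dilate_def
  using nn_integral_dilate[of "\<lambda>y. ennreal (norm (\<psi> y))" s] s
  by (subst ennreal_norm_of_real_mult) auto

lemma FT_dilate: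
  fixes \<psi> :: "'a::euclidean_space \<Rightarrow> complex"
  assumes [measurable]: "\<psi> \<in> borel_measurable borel" and s: "s > 0"
  shows "FT (dilate s \<psi>) \<xi> = FT \<psi> (- (s *\<^sub>R \<xi>))"
proof -
  have "FT (\<lambda>y. \<psi> ((- inverse s) *\<^sub>R y)) \<xi> = complex_of_real (s ^ DIM('a)) * FT \<psi> (- (s *\<^sub>R \<xi>))"
    using s by (subst FT_scale) (auto simp: power_divide inverse_eq_divide scaleR_conv_of_real)
  moreover have "FT (dilate s \<psi>) \<xi> = complex_of_real (1 / s ^ DIM('a)) * FT (\<lambda>y. \<psi> ((- inverse s) *\<^sub>R y)) \<xi>"
    unfolding FT_def dilate_def integral_mult_right_zero[symmetric]
    by (intro Bochner_Integration.integral_cong refl) (simp add: mult.left_commute)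
  ultimately show ?thesis using s by simp
qed

lemma conv_dilate:
  fixes \<psi> :: "'a::euclidean_space \<Rightarrow> complex"
  assumes [measurable]: "\<psi> \<in> borel_measurable borel" "f \<in> borel_measurable borel" and s: "s > 0"
  shows "conv (dilate s \<psi>) f x = (\<integral>z. f (x + s *\<^sub>R z) * \<psi> z \<partial>lborel)"
proof -
  have "(\<lambda>y. dilate s \<psi> (x - y) * f y) \<in> borel_measurable borel" unfolding dilate_def by measurable
  from lborel_integral_affine[OF this, of s x] s
  have "conv (dilate s \<psi>) f x = complex_of_real (s ^ DIM('a)) * (\<integral>z. dilate s \<psi> (x - (x + s *\<^sub>R z)) * f (x + s *\<^sub>R z) \<partial>lborel)"
    by (simp add: conv_def scaleR_conv_of_real)
  also have "\<dots> = (\<integral>z. f (x + s *\<^sub>R z) * \<psi> z \<partial>lborel)"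
    unfolding integral_mult_right_zero[symmetric] dilate_def
    using s by (intro Bochner_Integration.integral_cong refl) (simp add: mult.commute)
  finally show ?thesis .
qed

text \<open>After rescaling, the shift becomes v = y / s. For small v the translation bound is used
  and the domain restriction dropped. For large v the difference is dropped: |z| \<ge> 2 |v| forces
  both |z| and |z + v| to be at least |v|, and the moment bounds that tail.\<close>

lemma hormander_dilate:
  fixes \<psi> :: "'a::euclidean_space \<Rightarrow> complex"
  assumes \<psi>: "profile e C \<psi>" and s: "s > 0" and y: "y \<noteq> 0"
  shows "(\<integral>\<^sup>+x. (if 2 * norm y \<le> norm x then ennreal (norm (dilate s \<psi> (x - y) - dilate s \<psi> x)) else 0) \<partial>lborel)
    \<le> ennreal (2 * C * min ((norm y / s) powr e) ((norm y / s) powr (- e)))"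
proof -
  have e: "0 < e" "e \<le> 1" and C: "0 \<le> C" and i: "integrable lborel \<psi>"
    and tr: "\<And>h. l1norm (\<lambda>x. \<psi> (x + h) - \<psi> x) \<le> ennreal (C * norm h powr e)"
    and m: "(\<integral>\<^sup>+x. ennreal (norm x powr e * norm (\<psi> x)) \<partial>lborel) \<le> ennreal C"
    using assms by (auto simp: profile_def)
  have [measurable]: "\<psi> \<in> borel_measurable borel" using i by auto
  define v where "v = y /\<^sub>R s"
  have vn: "norm v = norm y / s" using s by (simp add: v_def divide_inverse mult.commute)
  have v0: "norm v > 0" using y s by (simp add: v_def)
  let ?F = "\<lambda>z. if 2 * norm v \<le> norm z then ennreal (norm (\<psi> (z + v) - \<psi> z)) else 0"
  have "(\<integral>\<^sup>+x. (if 2 * norm y \<le> norm x then ennreal (norm (dilate s \<psi> (x - y) - dilate s \<psi> x)) else 0) \<partial>lborel)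
    = (\<integral>\<^sup>+x. ennreal (1 / s ^ DIM('a)) * ?F (- (x /\<^sub>R s)) \<partial>lborel)"
  proof (rule nn_integral_cong)
    fix x
    have "dilate s \<psi> (x - y) - dilate s \<psi> x = complex_of_real (1 / s ^ DIM('a)) * (\<psi> (- (x /\<^sub>R s) + v) - \<psi> (- (x /\<^sub>R s)))"
      by (simp add: dilate_def v_def scaleR_diff_right right_diff_distrib)
    then have "ennreal (norm (dilate s \<psi> (x - y) - dilate s \<psi> x))
        = ennreal (1 / s ^ DIM('a)) * ennreal (norm (\<psi> (- (x /\<^sub>R s) + v) - \<psi> (- (x /\<^sub>R s))))"
      using s by (simp only:) (subst ennreal_norm_of_real_mult, auto)
    moreover have "2 * norm v \<le> norm (- (x /\<^sub>R s)) \<longleftrightarrow> 2 * norm y \<le> norm x"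
      using s by (simp add: vn field_simps)
    ultimately show "(if 2 * norm y \<le> norm x then ennreal (norm (dilate s \<psi> (x - y) - dilate s \<psi> x)) else 0)
      = ennreal (1 / s ^ DIM('a)) * ?F (- (x /\<^sub>R s))"
      by (simp only: if_distrib[of "(*) _"] mult_zero_right cong: if_cong)
  qed
  also have "\<dots> = (\<integral>\<^sup>+z. ?F z \<partial>lborel)" by (rule nn_integral_dilate[OF _ s]) measurable
  also have "\<dots> \<le> ennreal (2 * C * min (norm v powr e) (norm v powr (- e)))"
  proof -
    have "(\<integral>\<^sup>+z. ?F z \<partial>lborel) \<le> l1norm (\<lambda>x. \<psi> (x + v) - \<psi> x)"
      unfolding l1norm_def by (intro nn_integral_mono) auto
    also have "\<dots> \<le> ennreal (C * norm v powr e)" by (rule tr)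
    also have "\<dots> \<le> ennreal (2 * C * norm v powr e)" using C by (intro ennreal_leI mult_right_mono) auto
    finally have 1: "(\<integral>\<^sup>+z. ?F z \<partial>lborel) \<le> ennreal (2 * C * norm v powr e)" .
    let ?G = "\<lambda>z. if norm v \<le> norm z then ennreal (norm (\<psi> z)) else 0"
    have G: "(\<integral>\<^sup>+z. ?G z \<partial>lborel) \<le> ennreal (C * norm v powr (- e))"
    proof -
      have "(\<integral>\<^sup>+z. ?G z \<partial>lborel) \<le> (\<integral>\<^sup>+z. ennreal (norm v powr (- e)) * ennreal (norm z powr e * norm (\<psi> z)) \<partial>lborel)"
      proof (rule nn_integral_mono)
        fix z
        show "?G z \<le> ennreal (norm v powr (- e)) * ennreal (norm z powr e * norm (\<psi> z))"
        proof (cases "norm v \<le> norm z")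
          case True
          have "norm v powr e \<le> norm z powr e" using True e by (intro powr_mono2) auto
          then have "norm v powr (- e) * norm v powr e \<le> norm v powr (- e) * norm z powr e" by (intro mult_left_mono) auto
          moreover have "norm v powr (- e) * norm v powr e = 1" using v0 by (simp flip: powr_add)
          ultimately have "1 * norm (\<psi> z) \<le> norm v powr (- e) * norm z powr e * norm (\<psi> z)" by (intro mult_right_mono) auto
          then show ?thesis using True by (subst ennreal_mult[symmetric]) (auto simp: mult.assoc intro!: ennreal_leI)
        qed simp
      qed
      also have "\<dots> = ennreal (norm v powr (- e)) * (\<integral>\<^sup>+z. ennreal (norm z powr e * norm (\<psi> z)) \<partial>lborel)"
        by (rule nn_integral_cmult) measurable
      also have "\<dots> \<le> ennreal (norm v powr (- e)) * ennreal C" by (intro mult_left_mono m) auto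
      also have "\<dots> = ennreal (C * norm v powr (- e))" using C by (subst ennreal_mult[symmetric]) (auto simp: mult.commute)
      finally show ?thesis .
    qed
    have "(\<integral>\<^sup>+z. ?F z \<partial>lborel) \<le> (\<integral>\<^sup>+z. ?G (z + v) + ?G z \<partial>lborel)"
    proof (rule nn_integral_mono)
      fix z
      have "norm z \<le> norm (z + v) + norm v" using norm_triangle_ineq4[of "z + v" v] by simp
      then have "norm v \<le> norm (z + v)" "norm v \<le> norm z" if "2 * norm v \<le> norm z" using that v0 by linarith+
      then show "?F z \<le> ?G (z + v) + ?G z"
        by (auto simp: norm_triangle_ineq4 ennreal_plus[symmetric] simp del: ennreal_plus intro!: ennreal_leI)
    qed
    also have "\<dots> = (\<integral>\<^sup>+z. ?G z \<partial>lborel) + (\<integral>\<^sup>+z. ?G z \<partial>lborel)"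
      using nn_integral_lborel_translate(2)[of ?G v] by (subst nn_integral_add) auto
    also have "\<dots> \<le> ennreal (C * norm v powr (- e)) + ennreal (C * norm v powr (- e))" by (intro add_mono G)
    also have "\<dots> = ennreal (2 * C * norm v powr (- e))" using C by (subst ennreal_plus[symmetric]) auto
    finally have "(\<integral>\<^sup>+z. ?F z \<partial>lborel) \<le> ennreal (2 * C * norm v powr (- e))" .
    with 1 show ?thesis by (simp add: min_def)
  qed
  finally show ?thesis unfolding vn .
qed

text \<open>The two powers balance at t = \<open>w\<close>, where v / t^\<open>\<kappa>\<close> = 1;
  each side of \<open>w\<close> contributes 1 / (\<open>\<kappa>\<close> e), independently of
  v.\<close>

lemma nn_integral_scale_min:
  assumes "v > 0" "\<kappa> > 0" "e > 0"
  shows "(\<integral>\<^sup>+t. indicator {0<..} t * ennreal (1 / t * min ((v / t powr \<kappa>) powr e) ((v / t powr \<kappa>) powr (- e))) \<partial>lborel)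
    \<le> ennreal (2 / (\<kappa> * e))"
proof -
  define w where "w = v powr (1 / \<kappa>)"
  define n where "n = \<kappa> * e"
  have n: "n > 0" using assms by (simp add: n_def)
  have w: "w > 0" using assms by (simp add: w_def)
  have wn: "w powr n = v powr e" using assms by (simp add: w_def n_def powr_powr)
  have "(\<integral>\<^sup>+t. indicator {0<..} t * ennreal (1 / t * min ((v / t powr \<kappa>) powr e) ((v / t powr \<kappa>) powr (- e))) \<partial>lborel)
    \<le> (\<integral>\<^sup>+t. ennreal (v powr (- e)) * (ennreal (t powr (n - 1)) * indicator {0<..<w} t)
        + ennreal (v powr e) * (ennreal (t powr (- n - 1)) * indicator {w..} t) \<partial>lborel)"
  proof (rule nn_integral_mono)
    fix t :: real
    consider "t \<le> 0" | "0 < t" "t < w" | "w \<le> t" by linarith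
    then show "indicator {0<..} t * ennreal (1 / t * min ((v / t powr \<kappa>) powr e) ((v / t powr \<kappa>) powr (- e)))
      \<le> ennreal (v powr (- e)) * (ennreal (t powr (n - 1)) * indicator {0<..<w} t)
        + ennreal (v powr e) * (ennreal (t powr (- n - 1)) * indicator {w..} t)"
    proof cases
      case 1
      then show ?thesis by simp
    next
      case 2
      have "1 / t * min ((v / t powr \<kappa>) powr e) ((v / t powr \<kappa>) powr (- e)) \<le> 1 / t * (v / t powr \<kappa>) powr (- e)"
        using 2 by (intro mult_left_mono) auto
      also have "\<dots> = v powr (- e) * t powr (n - 1)"
        using 2 assms by (simp add: powr_divide powr_powr powr_diff powr_minus n_def field_simps)
      finally have "ennreal (1 / t * min ((v / t powr \<kappa>) powr e) ((v / t powr \<kappa>) powr (- e))) \<le> ennreal (v powr (- e) * t powr (n - 1))"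
        by (rule ennreal_leI)
      then show ?thesis using 2 by (simp add: ennreal_mult)
    next
      case 3
      then have t: "t > 0" using w by simp
      have "1 / t * min ((v / t powr \<kappa>) powr e) ((v / t powr \<kappa>) powr (- e)) \<le> 1 / t * (v / t powr \<kappa>) powr e"
        using t by (intro mult_left_mono) auto
      also have "\<dots> = v powr e * t powr (- n - 1)"
        using t assms by (simp add: powr_divide powr_powr powr_diff powr_minus n_def field_simps)
      finally have "ennreal (1 / t * min ((v / t powr \<kappa>) powr e) ((v / t powr \<kappa>) powr (- e))) \<le> ennreal (v powr e * t powr (- n - 1))"
        by (rule ennreal_leI)
      then show ?thesis using 3 t by (simp add: ennreal_mult)
    qed
  qed
  also have "\<dots> = ennreal (v powr (- e)) * ennreal (w powr n / n) + ennreal (v powr e) * ennreal (w powr (- n) / n)"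
    using nn_integral_powr_0[of "n - 1" w] nn_integral_powr_inf[of "- n - 1" w] n w
    by (subst nn_integral_add) (simp_all add: nn_integral_cmult)
  also have "\<dots> = ennreal (v powr (- e) * (w powr n / n) + v powr e * (w powr (- n) / n))"
    using n by (simp add: ennreal_mult[symmetric] ennreal_plus[symmetric] del: ennreal_plus)
  also have "v powr (- e) * (w powr n / n) + v powr e * (w powr (- n) / n) = 2 / n"
    using assms by (simp add: powr_minus wn)
  finally show ?thesis by (simp add: n_def)
qed

text \<open>The weight lives on [a, b], which makes \<open>K\<close> integrable, but the constant is
  free of a and b. It is the product of 2 C from a single scale, R from the weight, and 2 /
  (\<open>\<kappa>\<close> e) from \<open>nn_integral_scale_min\<close>.\<close>

lemma truncated_kernel:
  fixes \<psi> :: "'a::euclidean_space \<Rightarrow> complex" and w :: "real \<Rightarrow> real"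
  assumes \<psi>: "profile e C \<psi>" and \<kappa>: "\<kappa> > 0" and [measurable]: "w \<in> borel_measurable borel"
    and w: "\<And>t. \<bar>w t\<bar> \<le> R * indicator {a..b} t / t" and ab: "0 < a" "a \<le> b" and R: "R \<ge> 0"
  defines "K \<equiv> \<lambda>y. \<integral>t. complex_of_real (w t) * dilate (t powr \<kappa>) \<psi> y \<partial>lborel"
  shows "cz_kernel (4 * C * R / (\<kappa> * e)) (4 * C * R / (\<kappa> * e)) K"
    and "\<And>f x M. f \<in> borel_measurable borel \<Longrightarrow> (\<And>x. norm (f x) \<le> M) \<Longrightarrow>
      conv K f x = (\<integral>t. complex_of_real (w t) * (\<integral>z. f (x + t powr \<kappa> *\<^sub>R z) * \<psi> z \<partial>lborel) \<partial>lborel)"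
proof -
  have e: "0 < e" "e \<le> 1" and C: "0 \<le> C" and i: "integrable lborel \<psi>"
    using \<psi> by (auto simp: profile_def)
  have [measurable]: "\<psi> \<in> borel_measurable borel" using i by auto
  have w0: "w t = 0" if "t \<le> 0" for t using w[of t] that ab by (auto simp: indicator_def split: if_splits)
  have wR: "ennreal \<bar>w t\<bar> \<le> indicator {0<..} t * ennreal (R * (1 / t))" for t
  proof (cases "t > 0")
    case True
    have "R * indicator {a..b} t / t \<le> R * (1 / t)" using True R by (auto simp: indicator_def)
    then show ?thesis using w[of t] True by (simp add: ennreal_leI)
  qed (simp add: w0)
  let ?d = "\<lambda>t y. dilate (t powr \<kappa>) \<psi> y"
  have [measurable]: "(\<lambda>(y, t). ?d t y) \<in> borel_measurable (borel \<Otimes>\<^sub>M borel)"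
    "(\<lambda>(t, y). ?d t y) \<in> borel_measurable (borel \<Otimes>\<^sub>M borel)"
    "\<And>t. ?d t \<in> borel_measurable borel"
    unfolding dilate_def by measurable
  have wi: "(\<integral>\<^sup>+t. ennreal \<bar>w t\<bar> \<partial>lborel) < \<infinity>"
  proof -
    have "(\<integral>\<^sup>+t. ennreal \<bar>w t\<bar> \<partial>lborel) \<le> (\<integral>\<^sup>+t. ennreal (R / a) * indicator {a..b} t \<partial>lborel)"
    proof (rule nn_integral_mono)
      fix t
      have "R * indicator {a..b} t / t \<le> R / a * indicator {a..b} t"
        using ab R by (auto simp: indicator_def intro!: divide_left_mono)
      then have "\<bar>w t\<bar> \<le> R / a * indicator {a..b} t" using w[of t] by linarith
      then show "ennreal \<bar>w t\<bar> \<le> ennreal (R / a) * indicator {a..b} t"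
        by (auto simp: indicator_def intro!: ennreal_leI split: if_splits)
    qed
    also have "\<dots> < \<infinity>" using ab by (subst nn_integral_cmult_indicator) (auto simp: ennreal_mult_less_top)
    finally show ?thesis .
  qed
  have l1d: "ennreal \<bar>w t\<bar> * l1norm (?d t) = ennreal \<bar>w t\<bar> * l1norm \<psi>" for t
    using l1norm_dilate[of \<psi> "t powr \<kappa>"] by (cases "t > 0") (auto simp: w0)
  have fin: "(\<integral>\<^sup>+t. \<integral>\<^sup>+y. norm (complex_of_real (w t) * ?d t y) \<partial>lborel \<partial>lborel) < \<infinity>"
  proof -
    have "(\<integral>\<^sup>+t. \<integral>\<^sup>+y. norm (complex_of_real (w t) * ?d t y) \<partial>lborel \<partial>lborel) = (\<integral>\<^sup>+t. ennreal \<bar>w t\<bar> * l1norm (?d t) \<partial>lborel)"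
      unfolding l1norm_def by (intro nn_integral_cong) (simp add: norm_mult ennreal_mult nn_integral_cmult)
    also have "\<dots> = (\<integral>\<^sup>+t. ennreal \<bar>w t\<bar> \<partial>lborel) * l1norm \<psi>"
      unfolding l1d by (rule nn_integral_multc) measurable
    also have "\<dots> < \<infinity>" using wi i by (simp add: ennreal_mult_less_top integrable_iff_l1norm)
    finally show ?thesis .
  qed
  have Ki: "integrable lborel K"
  proof -
    have "integrable (lborel \<Otimes>\<^sub>M lborel) (\<lambda>(t, y). complex_of_real (w t) * ?d t y)"
      by (rule integrable_lborel_prod[OF _ fin]) measurable
    then show ?thesis unfolding K_def by (rule lborel_pair.integrable_snd)
  qed
  have [measurable]: "K \<in> borel_measurable borel" using Ki by auto
  let ?m = "\<lambda>v t. min ((v / t powr \<kappa>) powr e) ((v / t powr \<kappa>) powr (- e))"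
  have key: "(\<integral>\<^sup>+t. ennreal \<bar>w t\<bar> * ennreal (2 * C * ?m v t) \<partial>lborel) \<le> ennreal (4 * C * R / (\<kappa> * e))" if v: "v > 0" for v
  proof -
    have "(\<integral>\<^sup>+t. ennreal \<bar>w t\<bar> * ennreal (2 * C * ?m v t) \<partial>lborel)
      \<le> (\<integral>\<^sup>+t. ennreal (2 * C * R) * (indicator {0<..} t * ennreal (1 / t * ?m v t)) \<partial>lborel)"
    proof (rule nn_integral_mono)
      fix t
      have "ennreal \<bar>w t\<bar> * ennreal (2 * C * ?m v t) \<le> indicator {0<..} t * ennreal (R * (1 / t)) * ennreal (2 * C * ?m v t)"
        by (intro mult_right_mono wR) auto
      also have "\<dots> = ennreal (2 * C * R) * (indicator {0<..} t * ennreal (1 / t * ?m v t))"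
      proof (cases "t > 0")
        case True
        have "ennreal (R * (1 / t)) * ennreal (2 * C * ?m v t) = ennreal (2 * C * R) * ennreal (1 / t * ?m v t)"
          using True R C by (simp add: ac_simps flip: ennreal_mult)
        then show ?thesis using True by simp
      qed simp
      finally show "ennreal \<bar>w t\<bar> * ennreal (2 * C * ?m v t) \<le> ennreal (2 * C * R) * (indicator {0<..} t * ennreal (1 / t * ?m v t))" .
    qed
    also have "\<dots> = ennreal (2 * C * R) * (\<integral>\<^sup>+t. indicator {0<..} t * ennreal (1 / t * ?m v t) \<partial>lborel)"
      by (rule nn_integral_cmult) measurable
    also have "\<dots> \<le> ennreal (2 * C * R) * ennreal (2 / (\<kappa> * e))"
      by (intro mult_left_mono nn_integral_scale_min v \<kappa> e) auto
    also have "\<dots> = ennreal (4 * C * R / (\<kappa> * e))"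
      using C R \<kappa> e by (subst ennreal_mult[symmetric]) auto
    finally show ?thesis .
  qed
  have FTK: "norm (FT K \<xi>) \<le> 4 * C * R / (\<kappa> * e)" for \<xi>
  proof -
    have nonneg: "4 * C * R / (\<kappa> * e) \<ge> 0" using C R \<kappa> e by simp
    have "FT K \<xi> = (\<integral>y. \<integral>t. iexp (\<xi> \<bullet> y) * (complex_of_real (w t) * ?d t y) \<partial>lborel \<partial>lborel)"
      unfolding FT_def K_def by simp
    also have "\<dots> = (\<integral>t. \<integral>y. iexp (\<xi> \<bullet> y) * (complex_of_real (w t) * ?d t y) \<partial>lborel \<partial>lborel)"
      by (rule integral_lborel_fubini[symmetric]) (measurable, use fin in \<open>simp add: norm_mult\<close>)
    also have "\<dots> = (\<integral>t. complex_of_real (w t) * FT (?d t) \<xi> \<partial>lborel)"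
      unfolding FT_def by (simp add: mult.left_commute)
    finally have FTeq: "FT K \<xi> = (\<integral>t. complex_of_real (w t) * FT (?d t) \<xi> \<partial>lborel)" .
    have FTd: "complex_of_real (w t) * FT (?d t) \<xi> = complex_of_real (w t) * FT \<psi> (- (t powr \<kappa> *\<^sub>R \<xi>))" for t
      using FT_dilate[of \<psi> "t powr \<kappa>" \<xi>] by (cases "t > 0") (auto simp: w0)
    show ?thesis
    proof (cases "\<xi> = 0")
      case True
      then show ?thesis using \<psi> nonneg unfolding FTeq FTd by (simp add: profile_def)
    next
      case False
      have "ennreal (norm (FT K \<xi>)) \<le> (\<integral>\<^sup>+t. norm (complex_of_real (w t) * FT (?d t) \<xi>) \<partial>lborel)"
        unfolding FTeq by (rule norm_integral_le_nn_integral)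
      \<comment> \<open>The reciprocal of the frequency plays the part of the length |y|. Small
        arguments of the transform correspond to the exponent -e and large ones to e, so the minimum
        is the same.\<close>
      also have "\<dots> \<le> (\<integral>\<^sup>+t. ennreal \<bar>w t\<bar> * ennreal (2 * C * ?m (1 / norm \<xi>) t) \<partial>lborel)"
        unfolding FTd
      proof (rule nn_integral_mono)
        fix t
        show "ennreal (norm (complex_of_real (w t) * FT \<psi> (- (t powr \<kappa> *\<^sub>R \<xi>)))) \<le> ennreal \<bar>w t\<bar> * ennreal (2 * C * ?m (1 / norm \<xi>) t)"
        proof (cases "t > 0")
          case True
          let ?\<zeta> = "- (t powr \<kappa> *\<^sub>R \<xi>)"
          have z: "norm ?\<zeta> = t powr \<kappa> * norm \<xi>" by simp
          have zi: "1 / norm \<xi> / t powr \<kappa> = inverse (norm ?\<zeta>)" unfolding z by (simp add: field_simps)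
          have ip: "inverse N powr a = N powr (- a)" if "N \<ge> 0" for N a :: real
            using that by (simp add: powr_minus inverse_powr)
          have "norm (FT \<psi> ?\<zeta>) \<le> 2 * C * norm ?\<zeta> powr e" by (rule FT_profile_small[OF \<psi>])
          moreover have "norm (FT \<psi> ?\<zeta>) \<le> 2 * C * norm ?\<zeta> powr (- e)" by (rule FT_profile_large[OF \<psi>]) (use True False in auto)
          moreover have "norm ?\<zeta> powr e = (1 / norm \<xi> / t powr \<kappa>) powr (- e)" "norm ?\<zeta> powr (- e) = (1 / norm \<xi> / t powr \<kappa>) powr e"
            unfolding zi by (simp_all only: ip[OF norm_ge_zero] minus_minus)
          ultimately have "norm (FT \<psi> ?\<zeta>) \<le> 2 * C * ?m (1 / norm \<xi>) t" by (simp add: min_def)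
          then have "\<bar>w t\<bar> * norm (FT \<psi> ?\<zeta>) \<le> \<bar>w t\<bar> * (2 * C * ?m (1 / norm \<xi>) t)" by (intro mult_left_mono) auto
          then have "ennreal (norm (complex_of_real (w t) * FT \<psi> ?\<zeta>)) \<le> ennreal (\<bar>w t\<bar> * (2 * C * ?m (1 / norm \<xi>) t))"
            by (intro ennreal_leI) (simp add: norm_mult)
          then show ?thesis using C by (simp add: ennreal_mult)
        qed (simp add: w0)
      qed
      also have "\<dots> \<le> ennreal (4 * C * R / (\<kappa> * e))" using False by (intro key) auto
      finally show ?thesis using nonneg by (subst (asm) ennreal_le_iff) auto
    qed
  qed
  \<comment> \<open>The integral defining \<open>K\<close> need converge only almost everywhere. The
    difference K(x - y) - K(x) may be taken under the integral only where it converges at both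
    points, hence also the translated statement \<open>Kty\<close>.\<close>
  have Ktc: "AE y in lborel. integrable lborel (\<lambda>t. complex_of_real (w t) * ?d t y)"
  proof -
    have "integrable (lborel \<Otimes>\<^sub>M lborel) (\<lambda>(t, y). complex_of_real (w t) * ?d t y)"
      by (rule integrable_lborel_prod[OF _ fin]) measurable
    from lborel_pair.AE_integrable_snd[OF this] show ?thesis by simp
  qed
  have horm: "(\<integral>\<^sup>+x. (if 2 * norm y \<le> norm x then ennreal (norm (K (x - y) - K x)) else 0) \<partial>lborel) \<le> ennreal (4 * C * R / (\<kappa> * e))" for y
  proof (cases "y = 0")
    case False
    have Kty: "AE x in lborel. integrable lborel (\<lambda>t. complex_of_real (w t) * ?d t (x - y))"
    proof -
      have "(+) (- y) = (\<lambda>x. x - y)" by (auto simp: fun_eq_iff)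
      then have dl: "lborel = distr lborel borel (\<lambda>x. x - y)" using lborel_distr_plus[of "- y"] by simp
      have "AE x in distr lborel borel (\<lambda>x. x - y). integrable lborel (\<lambda>t. complex_of_real (w t) * ?d t x)"
        unfolding dl[symmetric] by (rule Ktc)
      from AE_distrD[OF _ this] show ?thesis by simp
    qed
    have "(\<integral>\<^sup>+x. (if 2 * norm y \<le> norm x then ennreal (norm (K (x - y) - K x)) else 0) \<partial>lborel)
      \<le> (\<integral>\<^sup>+x. \<integral>\<^sup>+t. ennreal \<bar>w t\<bar> * (if 2 * norm y \<le> norm x then ennreal (norm (?d t (x - y) - ?d t x)) else 0) \<partial>lborel \<partial>lborel)"
    proof (rule nn_integral_mono_AE, use Ktc Kty in eventually_elim)
      fix x
      assume 1: "integrable lborel (\<lambda>t. complex_of_real (w t) * ?d t x)"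
        and 2: "integrable lborel (\<lambda>t. complex_of_real (w t) * ?d t (x - y))"
      have "K (x - y) - K x = (\<integral>t. complex_of_real (w t) * ?d t (x - y) - complex_of_real (w t) * ?d t x \<partial>lborel)"
        unfolding K_def by (rule Bochner_Integration.integral_diff[OF 2 1, symmetric])
      then have "ennreal (norm (K (x - y) - K x)) \<le> (\<integral>\<^sup>+t. norm (complex_of_real (w t) * ?d t (x - y) - complex_of_real (w t) * ?d t x) \<partial>lborel)"
        by (simp only: norm_integral_le_nn_integral)
      also have "\<dots> = (\<integral>\<^sup>+t. ennreal \<bar>w t\<bar> * ennreal (norm (?d t (x - y) - ?d t x)) \<partial>lborel)"
        unfolding right_diff_distrib[symmetric] by (simp add: norm_mult ennreal_mult)
      finally show "(if 2 * norm y \<le> norm x then ennreal (norm (K (x - y) - K x)) else 0)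
        \<le> (\<integral>\<^sup>+t. ennreal \<bar>w t\<bar> * (if 2 * norm y \<le> norm x then ennreal (norm (?d t (x - y) - ?d t x)) else 0) \<partial>lborel)"
        by simp
    qed
    also have "\<dots> = (\<integral>\<^sup>+t. \<integral>\<^sup>+x. ennreal \<bar>w t\<bar> * (if 2 * norm y \<le> norm x then ennreal (norm (?d t (x - y) - ?d t x)) else 0) \<partial>lborel \<partial>lborel)"
      by (rule nn_integral_lborel_fubini) (unfold dilate_def, measurable)
    also have "\<dots> = (\<integral>\<^sup>+t. ennreal \<bar>w t\<bar> * (\<integral>\<^sup>+x. (if 2 * norm y \<le> norm x then ennreal (norm (?d t (x - y) - ?d t x)) else 0) \<partial>lborel) \<partial>lborel)"
      by (intro nn_integral_cong nn_integral_cmult) measurable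
    also have "\<dots> \<le> (\<integral>\<^sup>+t. ennreal \<bar>w t\<bar> * ennreal (2 * C * ?m (norm y) t) \<partial>lborel)"
    proof (rule nn_integral_mono)
      fix t
      show "ennreal \<bar>w t\<bar> * (\<integral>\<^sup>+x. (if 2 * norm y \<le> norm x then ennreal (norm (?d t (x - y) - ?d t x)) else 0) \<partial>lborel) \<le> ennreal \<bar>w t\<bar> * ennreal (2 * C * ?m (norm y) t)"
        using hormander_dilate[OF \<psi> _ False, of "t powr \<kappa>"] by (cases "t > 0") (auto simp: w0 intro!: mult_left_mono)
    qed
    also have "\<dots> \<le> ennreal (4 * C * R / (\<kappa> * e))" using False by (intro key) auto
    finally show ?thesis .
  qed simp
  show "cz_kernel (4 * C * R / (\<kappa> * e)) (4 * C * R / (\<kappa> * e)) K"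
    unfolding cz_kernel_def using Ki FTK horm by blast
  fix f :: "'a \<Rightarrow> complex" and x M
  assume [measurable]: "f \<in> borel_measurable borel" and f: "\<And>x. norm (f x) \<le> M"
  have M: "M \<ge> 0" using f[of undefined] norm_ge_zero order_trans by blast
  have "conv K f x = (\<integral>y. \<integral>t. complex_of_real (w t) * ?d t (x - y) * f y \<partial>lborel \<partial>lborel)"
    unfolding conv_def K_def by simp
  also have "\<dots> = (\<integral>t. \<integral>y. complex_of_real (w t) * ?d t (x - y) * f y \<partial>lborel \<partial>lborel)"
  proof (rule integral_lborel_fubini[symmetric])
    have "(\<integral>\<^sup>+t. \<integral>\<^sup>+y. norm (complex_of_real (w t) * ?d t (x - y) * f y) \<partial>lborel \<partial>lborel)
      \<le> (\<integral>\<^sup>+t. \<integral>\<^sup>+y. ennreal M * norm (complex_of_real (w t) * ?d t (x - y)) \<partial>lborel \<partial>lborel)"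
      using f M by (intro nn_integral_mono) (auto simp: norm_mult mult.commute[of M] intro!: ennreal_leI mult_left_mono simp flip: ennreal_mult)
    also have "\<dots> = (\<integral>\<^sup>+t. ennreal M * (\<integral>\<^sup>+y. norm (complex_of_real (w t) * ?d t y) \<partial>lborel) \<partial>lborel)"
    proof (rule nn_integral_cong)
      fix t
      have "(\<integral>\<^sup>+y. norm (complex_of_real (w t) * ?d t (x - y)) \<partial>lborel) = (\<integral>\<^sup>+y. norm (complex_of_real (w t) * ?d t y) \<partial>lborel)"
        using nn_integral_lborel_translate(4)[of "\<lambda>y. ennreal (norm (complex_of_real (w t) * ?d t y))" x] by simp
      then show "(\<integral>\<^sup>+y. ennreal M * norm (complex_of_real (w t) * ?d t (x - y)) \<partial>lborel) = ennreal M * (\<integral>\<^sup>+y. norm (complex_of_real (w t) * ?d t y) \<partial>lborel)"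
        by (simp add: nn_integral_cmult)
    qed
    also have "\<dots> = ennreal M * (\<integral>\<^sup>+t. \<integral>\<^sup>+y. norm (complex_of_real (w t) * ?d t y) \<partial>lborel \<partial>lborel)"
      by (rule nn_integral_cmult) measurable
    also have "\<dots> < \<infinity>" using fin by (simp add: ennreal_mult_less_top)
    finally show "(\<integral>\<^sup>+t. \<integral>\<^sup>+y. norm (complex_of_real (w t) * ?d t (x - y) * f y) \<partial>lborel \<partial>lborel) < \<infinity>" .
  qed (unfold dilate_def, measurable)
  also have "\<dots> = (\<integral>t. complex_of_real (w t) * conv (?d t) f x \<partial>lborel)"
    unfolding conv_def by (simp add: mult.assoc)
  also have "\<dots> = (\<integral>t. complex_of_real (w t) * (\<integral>z. f (x + t powr \<kappa> *\<^sub>R z) * \<psi> z \<partial>lborel) \<partial>lborel)"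
  proof (rule Bochner_Integration.integral_cong[OF refl])
    fix t
    show "complex_of_real (w t) * conv (?d t) f x = complex_of_real (w t) * (\<integral>z. f (x + t powr \<kappa> *\<^sub>R z) * \<psi> z \<partial>lborel)"
      using conv_dilate[of \<psi> f "t powr \<kappa>" x] by (cases "t > 0") (auto simp: w0)
  qed
  finally show "conv K f x = (\<integral>t. complex_of_real (w t) * (\<integral>z. f (x + t powr \<kappa> *\<^sub>R z) * \<psi> z \<partial>lborel) \<partial>lborel)" .
qed

text \<open>Where the outer integral diverges the Bochner integral is \<open>0\<close>, so the norm of \<open>T f x\<close> is in every case at most
  the lower limit of the truncated operators, and Fatou's lemma applies.\<close>

lemma singular_integral_Lp:
  fixes \<psi> :: "'a::euclidean_space \<Rightarrow> complex" and r :: "real \<Rightarrow> real"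
  assumes \<psi>: "profile e C \<psi>" and \<kappa>: "\<kappa> > 0" and [measurable]: "r \<in> borel_measurable borel"
    and r: "\<And>t. \<bar>r t\<bar> \<le> R" and p: "p > 1"
  defines "T \<equiv> \<lambda>f x. \<integral>t. complex_of_real (indicator {0<..} t * r t / t) * (\<integral>z. f (x + t powr \<kappa> *\<^sub>R z) * \<psi> z \<partial>lborel) \<partial>lborel"
  shows "\<exists>D\<ge>0. \<forall>f M. integrable lborel f \<longrightarrow> continuous_on UNIV f \<longrightarrow> (\<forall>x. norm (f x) \<le> M) \<longrightarrow>
    T f \<in> borel_measurable borel \<and>
    (\<integral>\<^sup>+x. ennreal (norm (T f x) powr p) \<partial>lborel) \<le> ennreal D * (\<integral>\<^sup>+x. ennreal (norm (f x) powr p) \<partial>lborel)"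
proof -
  have e: "0 < e" and C: "0 \<le> C" and i: "integrable lborel \<psi>" using \<psi> by (auto simp: profile_def)
  have [measurable]: "\<psi> \<in> borel_measurable borel" using i by auto
  have R: "R \<ge> 0" using r[of 0] by linarith
  let ?A = "4 * C * R / (\<kappa> * e)"
  have "?A \<ge> 0" using C R \<kappa> e by simp
  from calderon_zygmund_Lp[OF p this, of ?A] obtain D where D: "D \<ge> 0"
    and DK: "\<And>(K::'a \<Rightarrow> complex) f M. cz_kernel ?A ?A K \<Longrightarrow> integrable lborel f \<Longrightarrow> continuous_on UNIV f \<Longrightarrow>
      (\<forall>x. norm (f x) \<le> M) \<Longrightarrow>
      (\<integral>\<^sup>+x. ennreal (norm (conv K f x) powr p) \<partial>lborel) \<le> ennreal D * (\<integral>\<^sup>+x. ennreal (norm (f x) powr p) \<partial>lborel)"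
    by blast
  have "T f \<in> borel_measurable borel \<and>
    (\<integral>\<^sup>+x. ennreal (norm (T f x) powr p) \<partial>lborel) \<le> ennreal D * (\<integral>\<^sup>+x. ennreal (norm (f x) powr p) \<partial>lborel)"
    if f: "integrable lborel f" "continuous_on UNIV f" "\<forall>x. norm (f x) \<le> M" for f M
  proof
    have [measurable]: "f \<in> borel_measurable borel" using f(1) by auto
    define H where "H x t = (\<integral>z. f (x + t powr \<kappa> *\<^sub>R z) * \<psi> z \<partial>lborel)" for x t
    have [measurable]: "(\<lambda>(x, t). H x t) \<in> borel_measurable (borel \<Otimes>\<^sub>M borel)"
      unfolding H_def by measurable
    define G where "G x t = complex_of_real (indicator {0<..} t * r t / t) * H x t" for x t
    have [measurable]: "(\<lambda>(x, t). G x t) \<in> borel_measurable (borel \<Otimes>\<^sub>M borel)"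
      unfolding G_def by measurable
    have TG: "T f x = (\<integral>t. G x t \<partial>lborel)" for x unfolding T_def G_def H_def ..
    show "T f \<in> borel_measurable borel" unfolding TG[abs_def] by measurable
    define a where "a n = 1 / real (Suc n)" for n
    define w where "w n t = indicator {a n..real (Suc n)} t * r t / t" for n t
    have [measurable]: "w n \<in> borel_measurable borel" for n unfolding w_def[abs_def] by measurable
    have a: "a n > 0" "a n \<le> real (Suc n)" for n
    proof -
      show "a n > 0" by (simp add: a_def)
      have "a n \<le> 1" by (simp add: a_def)
      also have "1 \<le> real (Suc n)" by simp
      finally show "a n \<le> real (Suc n)" .
    qed
    have w: "\<bar>w n t\<bar> \<le> R * indicator {a n..real (Suc n)} t / t" for n t
      using r[of t] a(1)[of n] by (auto simp: w_def indicator_def abs_mult divide_right_mono)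
    define S where "S n x = (\<integral>t. complex_of_real (w n t) * H x t \<partial>lborel)" for n x
    have [measurable]: "S n \<in> borel_measurable borel" for n unfolding S_def[abs_def] by measurable
    have Sn: "(\<integral>\<^sup>+x. ennreal (norm (S n x) powr p) \<partial>lborel) \<le> ennreal D * (\<integral>\<^sup>+x. ennreal (norm (f x) powr p) \<partial>lborel)" for n
    proof -
      note tk = truncated_kernel[OF \<psi> \<kappa> _ w a R, of n]
      have "conv (\<lambda>y. \<integral>t. complex_of_real (w n t) * dilate (t powr \<kappa>) \<psi> y \<partial>lborel) f x = S n x" for x
        unfolding S_def H_def by (rule tk(2)[of f M]) (use f in auto)
      then show ?thesis using DK[OF tk(1) f] by simp
    qed
    have Seq: "complex_of_real (w n t) * H x t = indicator {a n..real (Suc n)} t *\<^sub>R G x t" for n x t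
      using a(1)[of n] by (auto simp: w_def G_def indicator_def)
    have lim: "ennreal (norm (T f x) powr p) \<le> liminf (\<lambda>n. ennreal (norm (S n x) powr p))" for x
    proof (cases "integrable lborel (G x)")
      case True
      have "(\<lambda>n. S n x) \<longlonglongrightarrow> T f x"
        unfolding S_def TG Seq
      proof (rule integral_dominated_convergence)
        show "integrable lborel (\<lambda>t. norm (G x t))" using True by simp
        show "AE t in lborel. norm (indicator {a n..real (Suc n)} t *\<^sub>R G x t) \<le> norm (G x t)" for n
          by (auto simp: indicator_def)
        show "AE t in lborel. (\<lambda>n. indicator {a n..real (Suc n)} t *\<^sub>R G x t) \<longlonglongrightarrow> G x t"
        proof (rule AE_I2)
          fix t :: real
          show "(\<lambda>n. indicator {a n..real (Suc n)} t *\<^sub>R G x t) \<longlonglongrightarrow> G x t"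
          proof (cases "t > 0")
            case False
            then have "G x t = 0" by (simp add: G_def)
            then show ?thesis by simp
          next
            case True
            obtain n0 where n0: "max t (1 / t) < real n0" using reals_Archimedean2 by blast
            have "\<forall>\<^sub>F n in sequentially. indicator {a n..real (Suc n)} t *\<^sub>R G x t = G x t"
            proof (rule eventually_sequentiallyI)
              fix n assume n: "n0 \<le> n"
              have "1 / t < real (Suc n)" "t \<le> real (Suc n)" using n n0 by auto
              then have "a n \<le> t" using True by (simp add: a_def field_simps)
              then show "indicator {a n..real (Suc n)} t *\<^sub>R G x t = G x t" using \<open>t \<le> real (Suc n)\<close> by simp
            qed
            then show ?thesis by (rule tendsto_eventually)
          qed
        qed
      qed measurable
      then have "(\<lambda>n. norm (S n x) powr p) \<longlonglongrightarrow> norm (T f x) powr p"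
        using p by (intro tendsto_powr' tendsto_norm tendsto_const) auto
      then have "(\<lambda>n. ennreal (norm (S n x) powr p)) \<longlonglongrightarrow> ennreal (norm (T f x) powr p)"
        by (rule tendsto_ennrealI)
      from lim_imp_Liminf[OF _ this] show ?thesis by simp
    next
      case False
      then have "T f x = 0" unfolding TG by (rule not_integrable_integral_eq)
      then show ?thesis by simp
    qed
    have "(\<integral>\<^sup>+x. ennreal (norm (T f x) powr p) \<partial>lborel) \<le> (\<integral>\<^sup>+x. liminf (\<lambda>n. ennreal (norm (S n x) powr p)) \<partial>lborel)"
      by (intro nn_integral_mono lim)
    also have "\<dots> \<le> liminf (\<lambda>n. \<integral>\<^sup>+x. ennreal (norm (S n x) powr p) \<partial>lborel)"
      by (rule nn_integral_liminf) measurable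
    also have "\<dots> \<le> liminf (\<lambda>n::nat. ennreal D * (\<integral>\<^sup>+x. ennreal (norm (f x) powr p) \<partial>lborel))"
      by (intro Liminf_mono always_eventually allI Sn)
    also have "\<dots> = ennreal D * (\<integral>\<^sup>+x. ennreal (norm (f x) powr p) \<partial>lborel)"
      by (simp add: Liminf_const)
    finally show "(\<integral>\<^sup>+x. ennreal (norm (T f x) powr p) \<partial>lborel) \<le> ennreal D * (\<integral>\<^sup>+x. ennreal (norm (f x) powr p) \<partial>lborel)" .
  qed
  then show ?thesis using D by blast
qed

section \<open>Stable densities\<close>

text \<open>Near 0 one has W(L h) \<le> d, so the square in the recursion is at most d W(L h) and
  the recursion becomes linear. It then reproduces a bound A |h|^g, since (2^g + d L^g) / 2 = 1 by
  the choice of \<open>d\<close>; a positive \<open>d\<close> exists exactly because g < 1. The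
  induction runs over the number of dilations needed to leave the small ball.\<close>

lemma hoelder_bootstrap:
  fixes W :: "'a::real_normed_vector \<Rightarrow> real"
  assumes W0: "W 0 = 0" and nn: "\<And>h. W h \<ge> 0" and W2: "\<And>h. W h \<le> 2" and lim: "(W \<longlongrightarrow> 0) (nhds 0)"
    and rec: "\<And>h. 2 * W h \<le> W (2 *\<^sub>R h) + (W (L *\<^sub>R h))\<^sup>2" and L: "L > 1" and g: "0 < g" "g < 1"
  shows "\<exists>A\<ge>0. \<forall>h. W h \<le> A * norm h powr g"
proof -
  define d where "d = 2 * (1 - 2 powr (g - 1)) / L powr g"
  have "2 powr (g - 1) < 2 powr 0" using g by (intro powr_less_mono) auto
  then have d: "d > 0" using L by (simp add: d_def)
  have dL: "2 powr (g - 1) + d * L powr g / 2 = 1" using L by (simp add: d_def) (simp add: field_simps)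
  have "\<forall>\<^sub>F h in nhds 0. W h < d" using lim d by (rule order_tendstoD)
  then obtain \<rho> where \<rho>: "\<rho> > 0" and small: "\<And>h. norm h < \<rho> \<Longrightarrow> W h < d"
    by (auto simp: eventually_nhds_metric)
  \<comment> \<open>Chosen so that the claimed bound is at least 2 as soon as |h| \<ge>
    \<open>\<rho> / L\<close>, where W \<le> 2 suffices.\<close>
  define A where "A = 2 * (L / \<rho>) powr g"
  have A: "A \<ge> 0" by (simp add: A_def)
  have big: "W h \<le> A * norm h powr g" if "norm h \<ge> \<rho> / L" for h
  proof -
    have "1 \<le> L / \<rho> * norm h" using that L \<rho> by (simp add: field_simps)
    then have "1 \<le> (L / \<rho> * norm h) powr g" using g by (intro ge_one_powr_ge_zero) auto
    also have "\<dots> = (L / \<rho>) powr g * norm h powr g" by (rule powr_mult)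
    finally show ?thesis using W2[of h] by (simp add: A_def)
  qed
  \<comment> \<open>Both points in the recursion, 2 h and L h, are at least this factor further out
    than h, so the counter \<open>n\<close> drops by one for each.\<close>
  define \<mu> where "\<mu> = min 2 L"
  have \<mu>: "\<mu> > 1" "\<mu> \<le> 2" "\<mu> \<le> L" using L by (auto simp: \<mu>_def)
  have step: "W h \<le> A * norm h powr g" if "norm h * \<mu> ^ n \<ge> \<rho> / L" for h n
    using that
  proof (induction n arbitrary: h)
    case 0
    then show ?case using big[of h] by simp
  next
    case (Suc n)
    show ?case
    proof (cases "norm h \<ge> \<rho> / L")
      case True
      then show ?thesis by (rule big)
    next
      case False
      then have "norm (L *\<^sub>R h) < \<rho>" using L by (simp add: field_simps)
      then have Ld: "W (L *\<^sub>R h) \<le> d" using small less_imp_le by blast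
      have le: "\<rho> / L \<le> norm (c *\<^sub>R h) * \<mu> ^ n" if "c \<ge> \<mu>" for c
      proof -
        have "\<rho> / L \<le> \<mu> * (norm h * \<mu> ^ n)" using Suc.prems by (simp add: ac_simps)
        also have "\<dots> \<le> c * (norm h * \<mu> ^ n)" using that \<mu> by (intro mult_right_mono) auto
        finally show ?thesis using that \<mu> by simp
      qed
      have 1: "W (2 *\<^sub>R h) \<le> A * (2 powr g * norm h powr g)"
        using Suc.IH[OF le[of 2]] \<mu> by (simp add: powr_mult)
      have 2: "W (L *\<^sub>R h) \<le> A * (L powr g * norm h powr g)"
        using Suc.IH[OF le[of L]] \<mu> L by (simp add: powr_mult)
      have "(W (L *\<^sub>R h))\<^sup>2 \<le> d * W (L *\<^sub>R h)"
        unfolding power2_eq_square by (intro mult_right_mono Ld nn)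
      also have "\<dots> \<le> d * (A * (L powr g * norm h powr g))" using d by (intro mult_left_mono 2) auto
      finally have "2 * W h \<le> A * (2 powr g * norm h powr g) + d * (A * (L powr g * norm h powr g))"
        using rec[of h] 1 by linarith
      also have "\<dots> = 2 * (2 powr (g - 1) + d * L powr g / 2) * (A * norm h powr g)"
        by (simp add: powr_diff algebra_simps)
      finally show ?thesis unfolding dL by simp
    qed
  qed
  have "W h \<le> A * norm h powr g" for h
  proof (cases "h = 0")
    case False
    obtain n where "\<rho> / L / norm h < \<mu> ^ n" using real_arch_pow[OF \<mu>(1)] by blast
    moreover have "norm h > 0" using False by simp
    ultimately have "\<rho> / L < \<mu> ^ n * norm h" by (simp only: pos_divide_less_eq)
    then have "\<rho> / L \<le> norm h * \<mu> ^ n" by (simp only: mult.commute less_imp_le)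
    then show ?thesis by (rule step)
  qed (simp add: W0)
  then show ?thesis using A by blast
qed

definition stable_density :: "real \<Rightarrow> ('a::euclidean_space \<Rightarrow> real) \<Rightarrow> bool" where
  "stable_density \<alpha> \<rho> \<longleftrightarrow> (\<forall>x. 0 \<le> \<rho> x) \<and> integrable lborel \<rho> \<and>
    (\<forall>\<xi>. FT (\<lambda>x. complex_of_real (\<rho> x)) \<xi> = complex_of_real (exp (- (norm \<xi> powr \<alpha>))))"

lemma l1norm_AE_cong: "(AE x in lborel. f x = g x) \<Longrightarrow> l1norm f = l1norm g"
  unfolding l1norm_def by (intro nn_integral_cong_AE) auto

lemma l1norm_eq_0_AE:
  assumes [measurable]: "f \<in> borel_measurable borel"
  shows "l1norm f = 0 \<longleftrightarrow> (AE x in lborel. f x = 0)"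
  unfolding l1norm_def by (subst nn_integral_0_iff_AE) auto

text \<open>Reduces identities between densities and convolutions to algebra with
  multipliers.\<close>

lemma FT_eq_imp_AE:
  fixes f g :: "'a::euclidean_space \<Rightarrow> complex"
  assumes f: "integrable lborel f" and g: "integrable lborel g" and eq: "\<And>\<xi>. FT f \<xi> = FT g \<xi>"
  shows "AE x in lborel. f x = g x"
proof -
  have "l1norm (\<lambda>x. f x - g x) = 0"
    by (rule FT_eq_0_imp) (use f g eq in \<open>auto simp: FT_diff\<close>)
  moreover have "(\<lambda>x. f x - g x) \<in> borel_measurable borel" using f g by auto
  ultimately show ?thesis by (simp add: l1norm_eq_0_AE)
qed

lemma AE_lborel_translate:
  fixes a :: "'a::euclidean_space"
  assumes "AE x in lborel. P x"
  shows "AE x in lborel. P (x + a)"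
proof -
  have "(+) a = (\<lambda>x. x + a)" by (auto simp: fun_eq_iff)
  then have dl: "lborel = distr lborel borel (\<lambda>x. x + a)" using lborel_distr_plus[of a] by simp
  have "AE x in distr lborel borel (\<lambda>x. x + a). P x"
    unfolding dl[symmetric] by (rule assms)
  from AE_distrD[OF _ this] show ?thesis by simp
qed

text \<open>The self-similarity of the convolution square and the factorization of its second difference give
  the recursion \<open>2 W h \<le> W (2 h) + (W (L h))\<^sup>2\<close> for the translation modulus \<open>W\<close>,
  where \<open>L = 2 powr (1 / \<alpha>)\<close>.\<close>

lemma stable_density_hoelder:
  fixes \<rho> :: "'a::euclidean_space \<Rightarrow> real"
  assumes \<rho>: "stable_density \<alpha> \<rho>" and \<alpha>: "\<alpha> > 0" and g: "0 < g" "g < 1"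
  shows "\<exists>A\<ge>0. \<forall>h. l1norm (\<lambda>x. complex_of_real (\<rho> (x + h)) - complex_of_real (\<rho> x)) \<le> ennreal (A * norm h powr g)"
proof -
  define p where "p x = complex_of_real (\<rho> x)" for x
  have pi: "integrable lborel p"
    using \<rho> unfolding p_def[abs_def] stable_density_def by (simp add: complex_of_real_integrable_eq)
  then have [measurable]: "p \<in> borel_measurable borel" by auto
  have FTp: "FT p \<xi> = complex_of_real (exp (- (norm \<xi> powr \<alpha>)))" for \<xi>
    using \<rho> unfolding p_def stable_density_def by blast
  have p1: "l1norm p = 1"
  proof -
    have "complex_of_real (\<integral>x. \<rho> x \<partial>lborel) = 1" using FTp[of 0] by (simp add: FT_def p_def)
    then have "(\<integral>x. \<rho> x \<partial>lborel) = 1" by (simp only: of_real_eq_1_iff)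
    then show ?thesis using \<rho> unfolding l1norm_integrable[OF pi] by (simp add: p_def stable_density_def)
  qed
  define W' where "W' h = l1norm (\<lambda>x. p (x + h) - p x)" for h
  have W'2: "W' h \<le> 2" for h
  proof -
    have "W' h \<le> l1norm (\<lambda>x. p (x + h)) + l1norm p" unfolding W'_def by (rule l1norm_diff_le) measurable
    then show ?thesis by (simp add: l1norm_translate p1 one_add_one)
  qed
  define W where "W h = enn2real (W' h)" for h
  have W: "ennreal (W h) = W' h" for h
    unfolding W_def using W'2[of h] by (intro ennreal_enn2real) (auto intro: le_less_trans)
  define c where "c = 2 powr (- (1 / \<alpha>))"
  define L where "L = 2 powr (1 / \<alpha>)"
  have c: "c > 0" and cL: "c * L = 1" by (simp_all add: c_def L_def flip: powr_add)
  have L: "L > 1" using \<alpha> by (simp add: L_def)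
  define G where "G = conv p p"
  have Gi: "integrable lborel G" unfolding G_def by (rule integrable_conv[OF pi pi])
  then have [measurable]: "G \<in> borel_measurable borel" by auto
  have FTG: "FT G \<xi> = (FT p \<xi>)\<^sup>2" for \<xi> unfolding G_def by (simp add: FT_conv[OF pi pi] power2_eq_square)
  \<comment> \<open>The sum of two independent copies has the law of L times one copy, so
    \<open>p2\<close> is the density of that multiple, with \<open>c\<close> = 1 / L.\<close>
  define p2 where "p2 x = complex_of_real (c ^ DIM('a)) * p (c *\<^sub>R x)" for x
  have p2i: "integrable lborel p2"
    unfolding p2_def using integrable_lborel_affine[OF pi, of c 0] c by simp
  have "FT G \<xi> = FT p2 \<xi>" for \<xi>
  proof -
    have "FT p2 \<xi> = complex_of_real (c ^ DIM('a)) * FT (\<lambda>x. p (c *\<^sub>R x)) \<xi>"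
      unfolding FT_def p2_def integral_mult_right_zero[symmetric]
      by (intro Bochner_Integration.integral_cong refl) (simp add: mult.left_commute)
    also have "\<dots> = FT p (\<xi> /\<^sub>R c)"
      using c by (subst FT_scale) (auto simp: scaleR_conv_of_real)
    also have "norm (\<xi> /\<^sub>R c) powr \<alpha> = 2 * norm \<xi> powr \<alpha>"
    proof -
      have "norm (\<xi> /\<^sub>R c) = L * norm \<xi>" using c cL by (simp add: field_simps)
      then have "norm (\<xi> /\<^sub>R c) powr \<alpha> = L powr \<alpha> * norm \<xi> powr \<alpha>" by (simp only: powr_mult)
      also have "L powr \<alpha> = 2" using \<alpha> by (simp add: L_def powr_powr)
      finally show ?thesis .
    qed
    then have "FT p (\<xi> /\<^sub>R c) = FT G \<xi>"
      by (simp add: FTp FTG flip: exp_of_nat_mult of_real_power)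
    finally show ?thesis by simp
  qed
  then have AEG: "AE x in lborel. G x = p2 x" by (rule FT_eq_imp_AE[OF Gi p2i])
  have G2: "l1norm (\<lambda>x. G (x + h) - G x) = W' (c *\<^sub>R h)" for h
  proof -
    have "l1norm (\<lambda>x. G (x + h) - G x) = l1norm (\<lambda>x. p2 (x + h) - p2 x)"
      by (rule l1norm_AE_cong, use AEG AE_lborel_translate[OF AEG, of h] in eventually_elim) simp
    also have "\<dots> = (\<integral>\<^sup>+x. ennreal (c ^ DIM('a)) * ennreal (norm (p (c *\<^sub>R x + c *\<^sub>R h) - p (c *\<^sub>R x))) \<partial>lborel)"
      unfolding l1norm_def p2_def right_diff_distrib[symmetric]
      using c by (subst ennreal_norm_of_real_mult) (auto simp: scaleR_add_right)
    also have "\<dots> = ennreal (c ^ DIM('a)) * (\<integral>\<^sup>+x. ennreal (norm (p (c *\<^sub>R x + c *\<^sub>R h) - p (c *\<^sub>R x))) \<partial>lborel)"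
      by (rule nn_integral_cmult) measurable
    also have "(\<integral>\<^sup>+x. ennreal (norm (p (c *\<^sub>R x + c *\<^sub>R h) - p (c *\<^sub>R x))) \<partial>lborel) = ennreal (1 / c ^ DIM('a)) * W' (c *\<^sub>R h)"
      unfolding W'_def l1norm_def
      using nn_integral_lborel_affine[of "\<lambda>x. ennreal (norm (p (x + c *\<^sub>R h) - p x))" c 0] c by simp
    finally show ?thesis using c by (simp add: mult.assoc[symmetric] flip: ennreal_mult)
  qed
  have second: "2 * W (c *\<^sub>R h) \<le> W (2 *\<^sub>R (c *\<^sub>R h)) + (W h)\<^sup>2" for h
  proof -
    define D where "D x = p (x + h) - p x" for x
    have pth: "integrable lborel (\<lambda>x. p (x + h))" by (rule integrable_lborel_translate(2)[OF pi])
    have Di: "integrable lborel D" unfolding D_def using pi pth by simp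
    then have [measurable]: "D \<in> borel_measurable borel" by auto
    \<comment> \<open>On the Fourier side this multiplies by (z^2 - 1) - 2 (z - 1) = (z - 1)^2, the
      square of the multiplier of the first difference.\<close>
    define E where "E x = (G (x + 2 *\<^sub>R h) - G x) - (2 * (G (x + h) - G x))" for x
    have Gt: "integrable lborel (\<lambda>x. G (x + a))" for a by (rule integrable_lborel_translate(2)[OF Gi])
    have i1: "integrable lborel (\<lambda>x. G (x + 2 *\<^sub>R h) - G x)" and i2: "integrable lborel (\<lambda>x. 2 * (G (x + h) - G x))"
      using Gt Gi by auto
    have Ei: "integrable lborel E" unfolding E_def by (rule Bochner_Integration.integrable_diff[OF i1 i2])
    have FT2: "FT (\<lambda>x. 2 * F x) \<xi> = 2 * FT F \<xi>" for F :: "'a \<Rightarrow> complex" and \<xi>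
      unfolding FT_def integral_mult_right_zero[symmetric]
      by (intro Bochner_Integration.integral_cong refl) (simp add: mult.left_commute)
    have "AE x in lborel. E x = conv D D x"
    proof (rule FT_eq_imp_AE[OF Ei integrable_conv[OF Di Di]])
      fix \<xi>
      let ?z = "iexp (- (\<xi> \<bullet> h))"
      have "iexp (- (\<xi> \<bullet> (2 *\<^sub>R h))) = ?z\<^sup>2"
      proof -
        have "- (\<xi> \<bullet> (2 *\<^sub>R h)) = - (\<xi> \<bullet> h) + - (\<xi> \<bullet> h)" by simp
        then show ?thesis by (simp only: of_real_add distrib_left exp_add power2_eq_square)
      qed
      then have "FT E \<xi> = (?z\<^sup>2 * FT G \<xi> - FT G \<xi>) - 2 * (?z * FT G \<xi> - FT G \<xi>)"
        unfolding E_def by (simp only: FT_diff[OF i1 i2] FT2 FT_diff[OF Gt Gi] FT_translate[OF \<open>G \<in> borel_measurable borel\<close>])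
      also have "\<dots> = ((?z - 1) * FT p \<xi>)\<^sup>2"
        by (simp add: FTG power2_eq_square algebra_simps)
      also have "(?z - 1) * FT p \<xi> = FT D \<xi>"
        unfolding D_def by (simp only: FT_diff[OF pth pi] FT_translate[OF \<open>p \<in> borel_measurable borel\<close>]) (simp add: algebra_simps)
      finally show "FT E \<xi> = FT (conv D D) \<xi>" by (simp only: FT_conv[OF Di Di] power2_eq_square)
    qed
    then have "AE x in lborel. 2 * (G (x + h) - G x) = (G (x + 2 *\<^sub>R h) - G x) - conv D D x"
      by eventually_elim (simp add: E_def algebra_simps)
    then have "l1norm (\<lambda>x. 2 * (G (x + h) - G x)) = l1norm (\<lambda>x. (G (x + 2 *\<^sub>R h) - G x) - conv D D x)"
      by (rule l1norm_AE_cong)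
    also have "\<dots> \<le> l1norm (\<lambda>x. G (x + 2 *\<^sub>R h) - G x) + l1norm (conv D D)"
      by (rule l1norm_diff_le) measurable
    also have "l1norm (conv D D) \<le> l1norm D * l1norm D" by (rule l1norm_conv_le) measurable
    also have "l1norm D = ennreal (W h)" unfolding W W'_def D_def ..
    also have "l1norm (\<lambda>x. 2 * (G (x + h) - G x)) = 2 * l1norm (\<lambda>x. G (x + h) - G x)"
    proof -
      have "l1norm (\<lambda>x. 2 * (G (x + h) - G x)) = (\<integral>\<^sup>+x. 2 * ennreal (norm (G (x + h) - G x)) \<partial>lborel)"
      proof -
        have "ennreal (norm (2 * z)) = 2 * ennreal (norm z)" for z :: complex
          by (simp add: norm_mult ennreal_mult)
        then show ?thesis unfolding l1norm_def by (simp only:)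
      qed
      also have "\<dots> = 2 * l1norm (\<lambda>x. G (x + h) - G x)"
        unfolding l1norm_def by (rule nn_integral_cmult) measurable
      finally show ?thesis .
    qed
    finally have "2 * ennreal (W (c *\<^sub>R h)) \<le> ennreal (W (2 *\<^sub>R (c *\<^sub>R h))) + ennreal (W h) * ennreal (W h)"
      unfolding G2 W by (simp add: add_left_mono mult.commute[of c 2])
    then have "ennreal (2 * W (c *\<^sub>R h)) \<le> ennreal (W (2 *\<^sub>R (c *\<^sub>R h)) + (W h)\<^sup>2)"
      by (simp add: W_def ennreal_mult ennreal_plus power2_eq_square)
    then show ?thesis by (subst (asm) ennreal_le_iff) (auto simp: W_def)
  qed
  have "\<exists>A\<ge>0. \<forall>h. W h \<le> A * norm h powr g"
  proof (rule hoelder_bootstrap[OF _ _ _ _ _ L g])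
    show "W 0 = 0" by (simp add: W_def W'_def l1norm_def)
    show "W h \<ge> 0" for h by (simp add: W_def)
    show "W h \<le> 2" for h
    proof -
      have "ennreal (W h) \<le> ennreal 2" unfolding W using W'2[of h] by simp
      then show ?thesis by (subst (asm) ennreal_le_iff) auto
    qed
    have "((\<lambda>h. ennreal (W h)) \<longlongrightarrow> ennreal 0) (nhds 0)"
      unfolding W W'_def ennreal_0 by (rule l1norm_translation_continuous[OF pi])
    then show "(W \<longlongrightarrow> 0) (nhds 0)"
      by (subst (asm) tendsto_ennreal_iff) (auto simp: W_def)
    show "2 * W h \<le> W (2 *\<^sub>R h) + (W (L *\<^sub>R h))\<^sup>2" for h
      using second[of "L *\<^sub>R h"] cL by simp
  qed
  then obtain A where "A \<ge> 0" and A: "\<And>h. W h \<le> A * norm h powr g" by blast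
  moreover have "l1norm (\<lambda>x. p (x + h) - p x) \<le> ennreal (A * norm h powr g)" for h
    using ennreal_leI[OF A[of h]] unfolding W W'_def .
  ultimately show ?thesis unfolding p_def by blast
qed

text \<open>The function 1 - gauss(x / s) is a smooth stand-in for the indicator of |x| > s whose
  mean \<open>gauss_smoothing\<close> computes exactly: it is the Gaussian average of 1 - exp(-(|z|
  / s)^\<open>\<alpha>\<close>), which is at most that of (|z| / s)^\<open>\<alpha>\<close>. So the
  tail is read off from the transform near 0.\<close>

lemma stable_density_gauss_tail:
  fixes \<rho> :: "'a::euclidean_space \<Rightarrow> real"
  assumes \<rho>: "stable_density \<alpha> \<rho>" and \<alpha>: "0 < \<alpha>" "\<alpha> \<le> 2"
  shows "\<exists>G\<ge>0. \<forall>s>0. (\<integral>\<^sup>+x. ennreal (\<rho> x * (1 - gauss (x /\<^sub>R s))) \<partial>lborel) \<le> ennreal (min 1 (G * s powr (- \<alpha>)))"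
proof -
  define p where "p x = complex_of_real (\<rho> x)" for x
  have \<rho>0: "\<And>x. \<rho> x \<ge> 0" and \<rho>i: "integrable lborel \<rho>" using \<rho> by (auto simp: stable_density_def)
  then have [measurable]: "\<rho> \<in> borel_measurable borel" by auto
  have pi: "integrable lborel p"
    using \<rho>i unfolding p_def[abs_def] by (simp add: complex_of_real_integrable_eq)
  have FTp: "FT p \<xi> = complex_of_real (exp (- (norm \<xi> powr \<alpha>)))" for \<xi>
    using \<rho> unfolding p_def stable_density_def by blast
  have \<rho>1: "(\<integral>x. \<rho> x \<partial>lborel) = 1"
  proof -
    have "complex_of_real (\<integral>x. \<rho> x \<partial>lborel) = 1" using FTp[of 0] by (simp add: FT_def p_def)
    then show ?thesis by (simp only: of_real_eq_1_iff)
  qed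
  define c where "c = sqrt (2 * pi) ^ DIM('a)"
  have c: "c > 0" by (simp add: c_def)
  have gi: "integrable lborel (\<lambda>z::'a. gauss ((1/2) *\<^sub>R z))"
    using integrable_lborel_affine[OF gauss_integrable, of "1/2" 0] by simp
  define G where "G = 3 * (\<integral>z. gauss ((1/2) *\<^sub>R (z::'a)) \<partial>lborel) / c"
  have G: "G \<ge> 0" using c by (auto simp: G_def less_imp_le[OF gauss_pos])
  \<comment> \<open>The power is at most 1 + |z|^2, hence at most 3 exp(3/8 |z|^2), and 3/8 - 1/2 =
    -1/8 is the exponent of the Gaussian of half the argument.\<close>
  have wle: "norm z powr \<alpha> * gauss z \<le> 3 * gauss ((1/2) *\<^sub>R z)" for z :: 'a
  proof -
    have "norm z powr \<alpha> \<le> 1 + (norm z)\<^sup>2"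
    proof (cases "norm z \<le> 1")
      case True
      then have "norm z powr \<alpha> \<le> 1 powr \<alpha>" using \<alpha> by (intro powr_mono2) auto
      moreover have "0 \<le> (norm z)\<^sup>2" by simp
      ultimately show ?thesis unfolding powr_one_eq_one by linarith
    next
      case False
      then have "norm z powr \<alpha> \<le> norm z powr 2" using \<alpha> by (intro powr_mono) auto
      moreover have "norm z powr 2 = (norm z)\<^sup>2" using False by (intro powr_numeral) auto
      ultimately show ?thesis by linarith
    qed
    also have "\<dots> \<le> 3 * (1 + 3/8 * (norm z)\<^sup>2)" using zero_le_power2[of "norm z"] by argo
    also have "\<dots> \<le> 3 * exp (3/8 * (norm z)\<^sup>2)" by (intro mult_left_mono exp_ge_add_one_self) auto
    finally have "norm z powr \<alpha> * gauss z \<le> 3 * exp (3/8 * (norm z)\<^sup>2) * gauss z"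
      by (intro mult_right_mono) (auto simp: less_imp_le[OF gauss_pos])
    also have "\<dots> = 3 * gauss ((1/2) *\<^sub>R z)"
      by (simp add: gauss_def power_divide flip: exp_add)
    finally show ?thesis .
  qed
  have "(\<integral>\<^sup>+x. ennreal (\<rho> x * (1 - gauss (x /\<^sub>R s))) \<partial>lborel) \<le> ennreal (min 1 (G * s powr (- \<alpha>)))" if s: "s > 0" for s
  proof -
    let ?E = "\<lambda>z::'a. exp (- (s powr (- \<alpha>) * norm z powr \<alpha>))"
    have rgi: "integrable lborel (\<lambda>x. \<rho> x * gauss (x /\<^sub>R s))"
      by (rule Bochner_Integration.integrable_bound[OF \<rho>i])
        (auto simp: abs_mult \<rho>0 gauss_le_1 less_imp_le[OF gauss_pos] intro!: mult_left_le)
    have Ei: "integrable lborel (\<lambda>z. ?E z * gauss z)"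
      by (rule Bochner_Integration.integrable_bound[OF gauss_integrable])
        (auto simp: abs_mult less_imp_le[OF gauss_pos] intro!: mult_left_le_one_le)
    have eq: "c * (\<integral>x. \<rho> x * gauss (x /\<^sub>R s) \<partial>lborel) = (\<integral>z. ?E z * gauss z \<partial>lborel)"
    proof -
      have m1: "(\<lambda>z::'a. complex_of_real (?E z * gauss z)) \<in> borel_measurable borel" by measurable
      have m2: "(\<lambda>x. complex_of_real (\<rho> x * gauss (x /\<^sub>R s))) \<in> borel_measurable borel" by measurable
      have "norm (s *\<^sub>R \<xi>) = s * norm \<xi>" for \<xi> :: 'a using s by simp
      then have Es: "?E (s *\<^sub>R \<xi>) = exp (- (norm \<xi> powr \<alpha>))" for \<xi>
        using s by (simp add: powr_mult powr_minus)
      have "(\<integral>\<xi>. FT p \<xi> * (iexp (- (\<xi> \<bullet> 0)) * complex_of_real (gauss (s *\<^sub>R \<xi>))) \<partial>lborel)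
          = (\<integral>\<xi>. complex_of_real (?E (0 + s *\<^sub>R \<xi>) * gauss (0 + s *\<^sub>R \<xi>)) \<partial>lborel)"
        by (simp only: FTp Es add_0 of_real_mult) simp
      also have "\<dots> = (1 / \<bar>s\<bar> ^ DIM('a)) *\<^sub>R (\<integral>z. complex_of_real (?E z * gauss z) \<partial>lborel)"
        by (rule lborel_integral_affine[OF m1]) (use s in simp)
      finally have 1: "(\<integral>\<xi>. FT p \<xi> * (iexp (- (\<xi> \<bullet> 0)) * complex_of_real (gauss (s *\<^sub>R \<xi>))) \<partial>lborel)
          = (1 / \<bar>s\<bar> ^ DIM('a)) *\<^sub>R complex_of_real (\<integral>z. ?E z * gauss z \<partial>lborel)"
        by (simp only: Bochner_Integration.integral_complex_of_real)
      have "(\<integral>x. p (0 + s *\<^sub>R x) * complex_of_real (gauss x) \<partial>lborel)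
          = (\<integral>x. complex_of_real (\<rho> (0 + s *\<^sub>R x) * gauss ((0 + s *\<^sub>R x) /\<^sub>R s)) \<partial>lborel)"
        using s by (simp add: p_def)
      also have "\<dots> = (1 / \<bar>s\<bar> ^ DIM('a)) *\<^sub>R (\<integral>x. complex_of_real (\<rho> x * gauss (x /\<^sub>R s)) \<partial>lborel)"
        by (rule lborel_integral_affine[OF m2]) (use s in simp)
      finally have 2: "(\<integral>x. p (0 + s *\<^sub>R x) * complex_of_real (gauss x) \<partial>lborel)
          = (1 / \<bar>s\<bar> ^ DIM('a)) *\<^sub>R complex_of_real (\<integral>x. \<rho> x * gauss (x /\<^sub>R s) \<partial>lborel)"
        by (simp only: Bochner_Integration.integral_complex_of_real)
      have "(1 / \<bar>s\<bar> ^ DIM('a)) *\<^sub>R complex_of_real (\<integral>z. ?E z * gauss z \<partial>lborel)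
        = complex_of_real c * ((1 / \<bar>s\<bar> ^ DIM('a)) *\<^sub>R complex_of_real (\<integral>x. \<rho> x * gauss (x /\<^sub>R s) \<partial>lborel))"
        using gauss_smoothing[OF pi s, of 0] unfolding 1 2 c_def .
      then have "complex_of_real (\<integral>z. ?E z * gauss z \<partial>lborel) = complex_of_real (c * (\<integral>x. \<rho> x * gauss (x /\<^sub>R s) \<partial>lborel))"
        using s by (simp add: scaleR_conv_of_real)
      then show ?thesis by (simp only: of_real_eq_iff)
    qed
    have cg: "c = (\<integral>z. gauss (z::'a) \<partial>lborel)"
      using gauss_integral[where 'a = 'a] by (simp only: Bochner_Integration.integral_complex_of_real of_real_eq_iff c_def)
    have "c * (\<integral>x. \<rho> x * (1 - gauss (x /\<^sub>R s)) \<partial>lborel) = (\<integral>z. gauss z - ?E z * gauss z \<partial>lborel)"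
      using \<rho>1 rgi \<rho>i Ei gauss_integrable[where 'a = 'a]
      by (simp add: right_diff_distrib eq cg[symmetric])
    also have "\<dots> \<le> (\<integral>z. s powr (- \<alpha>) * (3 * gauss ((1/2) *\<^sub>R (z::'a))) \<partial>lborel)"
    proof (rule Bochner_Integration.integral_mono)
      show "integrable lborel (\<lambda>z::'a. gauss z - ?E z * gauss z)" using Ei gauss_integrable[where 'a = 'a] by simp
      show "integrable lborel (\<lambda>z::'a. s powr (- \<alpha>) * (3 * gauss ((1/2) *\<^sub>R z)))" using gi by simp
      fix z :: 'a
      have "1 - ?E z \<le> s powr (- \<alpha>) * norm z powr \<alpha>"
        using exp_ge_add_one_self[of "- (s powr (- \<alpha>) * norm z powr \<alpha>)"] by linarith
      then have "(1 - ?E z) * gauss z \<le> s powr (- \<alpha>) * norm z powr \<alpha> * gauss z"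
        by (intro mult_right_mono) (auto simp: less_imp_le[OF gauss_pos])
      also have "\<dots> \<le> s powr (- \<alpha>) * (3 * gauss ((1/2) *\<^sub>R z))"
        unfolding mult.assoc by (intro mult_left_mono wle) auto
      finally show "gauss z - ?E z * gauss z \<le> s powr (- \<alpha>) * (3 * gauss ((1/2) *\<^sub>R z))"
        by (simp add: left_diff_distrib)
    qed
    also have "\<dots> = c * (G * s powr (- \<alpha>))" using c by (simp add: G_def)
    finally have b1: "(\<integral>x. \<rho> x * (1 - gauss (x /\<^sub>R s)) \<partial>lborel) \<le> G * s powr (- \<alpha>)" using c by simp
    have ti: "integrable lborel (\<lambda>x. \<rho> x * (1 - gauss (x /\<^sub>R s)))"
      unfolding right_diff_distrib using \<rho>i rgi by simp
    have "(\<integral>x. \<rho> x * (1 - gauss (x /\<^sub>R s)) \<partial>lborel) \<le> (\<integral>x. \<rho> x \<partial>lborel)"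
      by (rule Bochner_Integration.integral_mono[OF ti \<rho>i]) (auto simp: less_imp_le[OF gauss_pos] \<rho>0 intro!: mult_left_le)
    with b1 have "(\<integral>x. \<rho> x * (1 - gauss (x /\<^sub>R s)) \<partial>lborel) \<le> min 1 (G * s powr (- \<alpha>))" using \<rho>1 by simp
    moreover have "(\<integral>\<^sup>+x. ennreal (\<rho> x * (1 - gauss (x /\<^sub>R s))) \<partial>lborel) = ennreal (\<integral>x. \<rho> x * (1 - gauss (x /\<^sub>R s)) \<partial>lborel)"
      by (rule nn_integral_eq_integral[OF ti]) (auto simp: \<rho>0 gauss_le_1)
    ultimately show ?thesis by (simp add: ennreal_leI)
  qed
  then show ?thesis using G by blast
qed

text \<open>|x|^e is e times the integral of s^(e-1) over 0 < s < |x|, and on that range 1 - gauss(x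
  / s) is at least 1 - exp(-1/2), whence \<open>k\<close>. After Fubini the tail bound min(1, G
  s^(-\<open>\<alpha>\<close>)) is integrated against s^(e-1), which converges at 0 because e > 0
  and at infinity because e < \<open>\<alpha>\<close>.\<close>

lemma stable_density_moment:
  fixes \<rho> :: "'a::euclidean_space \<Rightarrow> real"
  assumes \<rho>: "stable_density \<alpha> \<rho>" and \<alpha>: "\<alpha> \<le> 2" and e: "0 < e" "e < \<alpha>"
  shows "(\<integral>\<^sup>+x. ennreal (norm x powr e * \<rho> x) \<partial>lborel) < \<infinity>"
proof -
  have \<rho>0: "\<And>x. \<rho> x \<ge> 0" and "integrable lborel \<rho>" using \<rho> by (auto simp: stable_density_def)
  then have [measurable]: "\<rho> \<in> borel_measurable borel" by auto
  obtain G where G: "G \<ge> 0"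
    and tail: "\<And>s. s > 0 \<Longrightarrow> (\<integral>\<^sup>+x. ennreal (\<rho> x * (1 - gauss (x /\<^sub>R s))) \<partial>lborel) \<le> ennreal (min 1 (G * s powr (- \<alpha>)))"
    using stable_density_gauss_tail[OF \<rho> _ \<alpha>] e by auto
  define k where "k = (1 - exp (- (1/2))) / e"
  have k: "k > 0" using e by (simp add: k_def)
  let ?F = "\<lambda>s x. indicator {0<..} s * (ennreal (s powr (e - 1)) * ennreal (\<rho> x * (1 - gauss (x /\<^sub>R s))))"
  have "ennreal k * (\<integral>\<^sup>+x. ennreal (norm x powr e * \<rho> x) \<partial>lborel) = (\<integral>\<^sup>+x. ennreal k * ennreal (norm x powr e * \<rho> x) \<partial>lborel)"
    by (rule nn_integral_cmult[symmetric]) measurable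
  also have "\<dots> \<le> (\<integral>\<^sup>+x. \<integral>\<^sup>+s. ?F s x \<partial>lborel \<partial>lborel)"
  proof (rule nn_integral_mono)
    fix x
    let ?c = "1 - exp (- (1/2)) :: real"
    have c: "?c \<ge> 0" by simp
    have "ennreal k * ennreal (norm x powr e * \<rho> x) = ennreal (\<rho> x * ?c) * ennreal (norm x powr e / e)"
      using e c \<rho>0[of x] by (simp add: k_def ac_simps flip: ennreal_mult)
    also have "\<dots> = ennreal (\<rho> x * ?c) * (\<integral>\<^sup>+s. ennreal (s powr (e - 1)) * indicator {0<..<norm x} s \<partial>lborel)"
      using nn_integral_powr_0[of "e - 1" "norm x"] e by simp
    also have "\<dots> = (\<integral>\<^sup>+s. ennreal (\<rho> x * ?c) * (ennreal (s powr (e - 1)) * indicator {0<..<norm x} s) \<partial>lborel)"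
      by (rule nn_integral_cmult[symmetric]) measurable
    also have "\<dots> \<le> (\<integral>\<^sup>+s. ?F s x \<partial>lborel)"
    proof (rule nn_integral_mono)
      fix s
      show "ennreal (\<rho> x * ?c) * (ennreal (s powr (e - 1)) * indicator {0<..<norm x} s) \<le> ?F s x"
      proof (cases "s \<in> {0<..<norm x}")
        case True
        then have "1 \<le> norm (x /\<^sub>R s)" by (simp add: field_simps)
        then have "1\<^sup>2 \<le> (norm (x /\<^sub>R s))\<^sup>2" by (intro power_mono) auto
        then have "1 \<le> (norm (x /\<^sub>R s))\<^sup>2" unfolding power_one .
        then have "gauss (x /\<^sub>R s) \<le> exp (- (1/2))" unfolding gauss_def exp_le_cancel_iff by linarith
        then have "\<rho> x * ?c \<le> \<rho> x * (1 - gauss (x /\<^sub>R s))" using \<rho>0 by (intro mult_left_mono) auto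
        then have "ennreal (\<rho> x * ?c) * ennreal (s powr (e - 1)) \<le> ennreal (\<rho> x * (1 - gauss (x /\<^sub>R s))) * ennreal (s powr (e - 1))"
          by (intro mult_right_mono ennreal_leI) auto
        then show ?thesis using True by (simp add: mult.commute)
      qed simp
    qed
    finally show "ennreal k * ennreal (norm x powr e * \<rho> x) \<le> (\<integral>\<^sup>+s. ?F s x \<partial>lborel)" .
  qed
  also have "\<dots> = (\<integral>\<^sup>+s. \<integral>\<^sup>+x. ?F s x \<partial>lborel \<partial>lborel)"
    by (rule nn_integral_lborel_fubini) measurable
  also have "\<dots> \<le> (\<integral>\<^sup>+s. ennreal (s powr (e - 1)) * indicator {0<..<1} s + ennreal G * (ennreal (s powr (e - 1 - \<alpha>)) * indicator {1..} s) \<partial>lborel)"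
  proof (rule nn_integral_mono)
    fix s :: real
    show "(\<integral>\<^sup>+x. ?F s x \<partial>lborel) \<le> ennreal (s powr (e - 1)) * indicator {0<..<1} s + ennreal G * (ennreal (s powr (e - 1 - \<alpha>)) * indicator {1..} s)"
    proof (cases "s > 0")
      case True
      have "(\<integral>\<^sup>+x. ?F s x \<partial>lborel) = ennreal (s powr (e - 1)) * (\<integral>\<^sup>+x. ennreal (\<rho> x * (1 - gauss (x /\<^sub>R s))) \<partial>lborel)"
        using True by (simp add: nn_integral_cmult)
      also have "\<dots> \<le> ennreal (s powr (e - 1)) * ennreal (min 1 (G * s powr (- \<alpha>)))"
        by (intro mult_left_mono tail True) auto
      also have "\<dots> \<le> ennreal (s powr (e - 1)) * indicator {0<..<1} s + ennreal G * (ennreal (s powr (e - 1 - \<alpha>)) * indicator {1..} s)"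
      proof (cases "s < 1")
        case True
        have "ennreal (s powr (e - 1)) * ennreal (min 1 (G * s powr (- \<alpha>))) \<le> ennreal (s powr (e - 1)) * 1"
          by (intro mult_left_mono) (auto simp: ennreal_le_1)
        then show ?thesis using True \<open>s > 0\<close> by simp
      next
        case False
        have "ennreal (s powr (e - 1)) * ennreal (min 1 (G * s powr (- \<alpha>))) \<le> ennreal (s powr (e - 1)) * ennreal (G * s powr (- \<alpha>))"
          by (intro mult_left_mono ennreal_leI) auto
        also have "\<dots> = ennreal G * ennreal (s powr (e - 1 - \<alpha>))"
        proof -
          have "s powr (e - 1) * (G * s powr (- \<alpha>)) = G * s powr (e - 1 - \<alpha>)"
            unfolding mult.left_commute[of _ G] powr_add[symmetric] by (simp add: algebra_simps)
          then show ?thesis using G by (simp flip: ennreal_mult)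
        qed
        finally show ?thesis using False by simp
      qed
      finally show ?thesis .
    qed simp
  qed
  also have "\<dots> = ennreal (1 / e) + ennreal G * ennreal (1 / (\<alpha> - e))"
  proof -
    have "(\<integral>\<^sup>+s. ennreal (s powr (e - 1 - \<alpha>)) * indicator {1..} s \<partial>lborel) = ennreal (1 / (\<alpha> - e))"
    proof -
      have "- (1 powr (e - 1 - \<alpha> + 1)) / (e - 1 - \<alpha> + 1) = 1 / (\<alpha> - e)" using e by (simp add: divide_simps)
      then show ?thesis using nn_integral_powr_inf[of "e - 1 - \<alpha>" 1] e by simp
    qed
    then show ?thesis using nn_integral_powr_0[of "e - 1" 1] e
      by (subst nn_integral_add) (simp_all add: nn_integral_cmult)
  qed
  also have "\<dots> < \<infinity>" by (simp add: ennreal_mult_less_top)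
  finally have "ennreal k * (\<integral>\<^sup>+x. ennreal (norm x powr e * \<rho> x) \<partial>lborel) < \<infinity>" .
  then show ?thesis using k by (auto simp: ennreal_mult_less_top)
qed

section \<open>Superpositions and subordination\<close>

text \<open>The density of the subordinator measure for t = 1; all others are its images under v ->
  t^2 v.\<close>

definition sub_weight :: "real \<Rightarrow> real" where
  "sub_weight v = indicator {0<..} v * (1 / (2 * sqrt pi) * exp (- (1 / (4 * v))) * v powr (- 3 / 2))"

lemma sub_weight_measurable [measurable]: "sub_weight \<in> borel_measurable borel"
  unfolding sub_weight_def[abs_def] by measurable

lemma sub_weight_nonneg [simp]: "sub_weight v \<ge> 0" by (simp add: sub_weight_def)

lemma sub_weight_eq_0 [simp]: "v \<le> 0 \<Longrightarrow> sub_weight v = 0" by (simp add: sub_weight_def)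

text \<open>At infinity the integrand decays like v^(a - 3/2), which is where a < 1/2 enters. At 0
  the exponential beats every power, so \<open>a\<close> may be arbitrarily negative.\<close>

lemma sub_weight_moment:
  assumes a: "a < 1/2"
  shows "(\<integral>\<^sup>+v. ennreal (sub_weight v * v powr a) \<partial>lborel) < \<infinity>"
proof -
  \<comment> \<open>Enough powers from the \<open>n\<close>-th Taylor term of the exponential to
    make v^(n + a - 3/2) integrable at 0.\<close>
  define n where "n = nat \<lceil>1 - a\<rceil>"
  have n: "real n + a - 3 / 2 > -1" unfolding n_def by linarith
  define C where "C = (fact n * 4 ^ n :: real)"
  have exp_le: "exp (- (1 / (4 * v))) \<le> C * v powr real n" if v: "v > 0" for v
  proof -
    have taylor: "x ^ n / fact n \<le> exp x" if "x \<ge> 0" for x :: real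
    proof -
      have "(\<Sum>k\<in>{n}. x ^ k /\<^sub>R fact k) \<le> exp x"
        unfolding exp_def by (rule sum_le_suminf[OF summable_exp_generic]) (use that in auto)
      then show ?thesis by (simp add: divide_inverse mult.commute)
    qed
    have "(1 / (4 * v)) ^ n / fact n = 1 / (C * v ^ n)" by (simp add: C_def power_divide power_mult_distrib)
    then have "1 / (C * v ^ n) \<le> exp (1 / (4 * v))" using taylor[of "1 / (4 * v)"] v by simp
    moreover have "C * v ^ n > 0" using v by (simp add: C_def)
    ultimately have "1 \<le> exp (1 / (4 * v)) * (C * v ^ n)" by (simp only: pos_divide_le_eq)
    then have "exp (- (1 / (4 * v))) * 1 \<le> exp (- (1 / (4 * v))) * (exp (1 / (4 * v)) * (C * v ^ n))"
      by (intro mult_left_mono) auto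
    also have "\<dots> = C * v ^ n" by (simp add: mult.assoc[symmetric] flip: exp_add)
    finally show ?thesis using v by (simp add: powr_realpow)
  qed
  have pi1: "1 / (2 * sqrt pi) \<le> 1" 
  proof -
    have "1 \<le> sqrt pi" using pi_gt3 by simp
    then have "1 \<le> 2 * sqrt pi" by linarith
    then show ?thesis by (simp only: divide_le_eq_1) simp
  qed
  have "(\<integral>\<^sup>+v. ennreal (sub_weight v * v powr a) \<partial>lborel)
    \<le> (\<integral>\<^sup>+v. ennreal C * (ennreal (v powr (n + a - 3/2)) * indicator {0<..<1} v) + ennreal (v powr (a - 3/2)) * indicator {1..} v \<partial>lborel)"
  proof (rule nn_integral_mono)
    fix v :: real
    consider "v \<le> 0" | "0 < v" "v < 1" | "1 \<le> v" by linarith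
    then show "ennreal (sub_weight v * v powr a)
      \<le> ennreal C * (ennreal (v powr (n + a - 3/2)) * indicator {0<..<1} v) + ennreal (v powr (a - 3/2)) * indicator {1..} v"
    proof cases
      case 1
      then show ?thesis by simp
    next
      case 2
      have "sub_weight v * v powr a \<le> 1 * (C * v powr real n) * v powr (- 3 / 2) * v powr a"
      proof -
        have "1 / (2 * sqrt pi) * exp (- (1 / (4 * v))) \<le> 1 * (C * v powr real n)"
          using 2 by (intro mult_mono pi1 exp_le) auto
        then have "1 / (2 * sqrt pi) * exp (- (1 / (4 * v))) * v powr (- 3 / 2) * v powr a \<le> 1 * (C * v powr real n) * v powr (- 3 / 2) * v powr a"
          by (intro mult_right_mono) auto
        then show ?thesis using 2 by (simp add: sub_weight_def)
      qed
      also have "\<dots> = C * v powr (n + a - 3/2)"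
      proof -
        have "n + a - 3/2 = real n + (- 3/2 + a)" by simp
        then show ?thesis by (simp only: powr_add mult_1_left mult.assoc)
      qed
      finally have "ennreal (sub_weight v * v powr a) \<le> ennreal (C * v powr (n + a - 3/2))" by (rule ennreal_leI)
      then show ?thesis using 2 by (simp add: ennreal_mult C_def)
    next
      case 3
      have "sub_weight v * v powr a \<le> 1 * 1 * v powr (- 3 / 2) * v powr a"
      proof -
        have "1 / (2 * sqrt pi) * exp (- (1 / (4 * v))) \<le> 1 * 1"
          using 3 by (intro mult_mono pi1) auto
        then have "1 / (2 * sqrt pi) * exp (- (1 / (4 * v))) * v powr (- 3 / 2) * v powr a \<le> 1 * 1 * v powr (- 3 / 2) * v powr a"
          by (intro mult_right_mono) auto
        then show ?thesis using 3 by (simp add: sub_weight_def)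
      qed
      also have "\<dots> = v powr (a - 3/2)" using 3 by (simp flip: powr_add)
      finally have "ennreal (sub_weight v * v powr a) \<le> ennreal (v powr (a - 3/2))" by (rule ennreal_leI)
      then show ?thesis using 3 by simp
    qed
  qed
  also have "\<dots> = ennreal C * (\<integral>\<^sup>+v. ennreal (v powr (n + a - 3/2)) * indicator {0<..<1} v \<partial>lborel)
      + (\<integral>\<^sup>+v. ennreal (v powr (a - 3/2)) * indicator {1..} v \<partial>lborel)"
    by (subst nn_integral_add) (simp_all add: nn_integral_cmult)
  also have "\<dots> < \<infinity>"
    using nn_integral_powr_0[of "n + a - 3/2" 1] nn_integral_powr_inf[of "a - 3/2" 1] n a
    by (simp add: ennreal_mult_less_top)
  finally show ?thesis .
qed

text \<open>Mixtures of kernels over a parameter, with a real weight of either sign. The locale is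
  used for the subordination integral over v and again for the integral over k in the kernel of T:
  norms, moments and translation moduli of the mixture are bounded by the mixture of those of its
  members.\<close>

locale superposition =
  fixes w :: "'b::euclidean_space \<Rightarrow> real" and E :: "'b \<Rightarrow> 'a::euclidean_space \<Rightarrow> complex"
  assumes w_meas [measurable]: "w \<in> borel_measurable borel"
    and E_meas: "(\<lambda>(k, z). E k z) \<in> borel_measurable (borel \<Otimes>\<^sub>M borel)"
    and fin: "(\<integral>\<^sup>+k. ennreal \<bar>w k\<bar> * l1norm (E k) \<partial>lborel) < \<infinity>"
begin

definition F :: "'a \<Rightarrow> complex" where "F z = (\<integral>k. complex_of_real (w k) * E k z \<partial>lborel)"

lemma E_meas' [measurable]: "(\<lambda>p. E (fst p) (snd p)) \<in> borel_measurable (borel \<Otimes>\<^sub>M borel)"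
  using E_meas by (simp add: case_prod_beta')

lemma E_comp [measurable (raw)]:
  "f \<in> borel_measurable N \<Longrightarrow> g \<in> borel_measurable N \<Longrightarrow> (\<lambda>x. E (f x) (g x)) \<in> borel_measurable N"
  using measurable_compose[OF measurable_Pair E_meas'] by simp

lemma nn_swap:
  assumes [measurable]: "g \<in> borel_measurable borel"
  shows "(\<integral>\<^sup>+z. \<integral>\<^sup>+k. g z * ennreal (norm (complex_of_real (w k) * E k z)) \<partial>lborel \<partial>lborel)
    = (\<integral>\<^sup>+k. ennreal \<bar>w k\<bar> * (\<integral>\<^sup>+z. g z * ennreal (norm (E k z)) \<partial>lborel) \<partial>lborel)"
proof -
  have "(\<integral>\<^sup>+z. \<integral>\<^sup>+k. g z * ennreal (norm (complex_of_real (w k) * E k z)) \<partial>lborel \<partial>lborel)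
    = (\<integral>\<^sup>+k. \<integral>\<^sup>+z. g z * ennreal (norm (complex_of_real (w k) * E k z)) \<partial>lborel \<partial>lborel)"
    by (rule nn_integral_lborel_fubini) measurable
  also have "\<dots> = (\<integral>\<^sup>+k. ennreal \<bar>w k\<bar> * (\<integral>\<^sup>+z. g z * ennreal (norm (E k z)) \<partial>lborel) \<partial>lborel)"
    by (intro nn_integral_cong, subst nn_integral_cmult[symmetric]) (simp_all add: norm_mult ennreal_mult ac_simps)
  finally show ?thesis .
qed

lemma prod_fin: "(\<integral>\<^sup>+z. \<integral>\<^sup>+k. norm (complex_of_real (w k) * E k z) \<partial>lborel \<partial>lborel) < \<infinity>"
  using nn_swap[of "\<lambda>_. 1"] fin by (simp add: l1norm_def)

lemma prod_integrable: "integrable (lborel \<Otimes>\<^sub>M lborel) (\<lambda>(z, k). complex_of_real (w k) * E k z)"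
  by (rule integrable_lborel_prod[OF _ prod_fin]) measurable

lemma F_integrable: "integrable lborel F"
  unfolding F_def[abs_def] by (rule lborel_pair.integrable_fst[OF prod_integrable])

lemma F_meas [measurable]: "F \<in> borel_measurable borel" using F_integrable by auto

lemma AE_integrable: "AE z in lborel. integrable lborel (\<lambda>k. complex_of_real (w k) * E k z)"
  using lborel_pair.AE_integrable_fst[OF prod_integrable] by simp

text \<open>The free weight \<open>g\<close> gives the L^1 norm for \<open>g\<close> = 1 and a
  moment for a power of the norm.\<close>

lemma F_weighted:
  assumes [measurable]: "g \<in> borel_measurable borel"
  shows "(\<integral>\<^sup>+z. g z * ennreal (norm (F z)) \<partial>lborel) \<le> (\<integral>\<^sup>+k. ennreal \<bar>w k\<bar> * (\<integral>\<^sup>+z. g z * ennreal (norm (E k z)) \<partial>lborel) \<partial>lborel)"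
proof -
  have "(\<integral>\<^sup>+z. g z * ennreal (norm (F z)) \<partial>lborel) \<le> (\<integral>\<^sup>+z. \<integral>\<^sup>+k. g z * ennreal (norm (complex_of_real (w k) * E k z)) \<partial>lborel \<partial>lborel)"
  proof (rule nn_integral_mono)
    fix z
    have "g z * ennreal (norm (F z)) \<le> g z * (\<integral>\<^sup>+k. norm (complex_of_real (w k) * E k z) \<partial>lborel)"
      unfolding F_def by (intro mult_left_mono norm_integral_le_nn_integral) auto
    also have "\<dots> = (\<integral>\<^sup>+k. g z * ennreal (norm (complex_of_real (w k) * E k z)) \<partial>lborel)"
      by (rule nn_integral_cmult[symmetric]) measurable
    finally show "g z * ennreal (norm (F z)) \<le> (\<integral>\<^sup>+k. g z * ennreal (norm (complex_of_real (w k) * E k z)) \<partial>lborel)" .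
  qed
  then show ?thesis by (simp only: nn_swap[OF assms])
qed

lemma F_l1norm: "l1norm F \<le> (\<integral>\<^sup>+k. ennreal \<bar>w k\<bar> * l1norm (E k) \<partial>lborel)"
  using F_weighted[of "\<lambda>_. 1"] by (simp add: l1norm_def)

lemma F_translate:
  "l1norm (\<lambda>z. F (z + h) - F z) \<le> (\<integral>\<^sup>+k. ennreal \<bar>w k\<bar> * l1norm (\<lambda>z. E k (z + h) - E k z) \<partial>lborel)"
proof -
  have "l1norm (\<lambda>z. F (z + h) - F z) \<le> (\<integral>\<^sup>+z. \<integral>\<^sup>+k. ennreal \<bar>w k\<bar> * ennreal (norm (E k (z + h) - E k z)) \<partial>lborel \<partial>lborel)"
    unfolding l1norm_def
  proof (rule nn_integral_mono_AE, use AE_integrable AE_lborel_translate[OF AE_integrable, of h] in eventually_elim)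
    fix z
    assume 1: "integrable lborel (\<lambda>k. complex_of_real (w k) * E k z)"
      and 2: "integrable lborel (\<lambda>k. complex_of_real (w k) * E k (z + h))"
    have "F (z + h) - F z = (\<integral>k. complex_of_real (w k) * E k (z + h) - complex_of_real (w k) * E k z \<partial>lborel)"
      unfolding F_def by (rule Bochner_Integration.integral_diff[OF 2 1, symmetric])
    then have "ennreal (norm (F (z + h) - F z)) \<le> (\<integral>\<^sup>+k. norm (complex_of_real (w k) * E k (z + h) - complex_of_real (w k) * E k z) \<partial>lborel)"
      by (simp only: norm_integral_le_nn_integral)
    also have "\<dots> = (\<integral>\<^sup>+k. ennreal \<bar>w k\<bar> * ennreal (norm (E k (z + h) - E k z)) \<partial>lborel)"
      unfolding right_diff_distrib[symmetric] by (simp add: norm_mult ennreal_mult)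
    finally show "ennreal (norm (F (z + h) - F z)) \<le> (\<integral>\<^sup>+k. ennreal \<bar>w k\<bar> * ennreal (norm (E k (z + h) - E k z)) \<partial>lborel)" .
  qed
  also have "\<dots> = (\<integral>\<^sup>+k. \<integral>\<^sup>+z. ennreal \<bar>w k\<bar> * ennreal (norm (E k (z + h) - E k z)) \<partial>lborel \<partial>lborel)"
    by (rule nn_integral_lborel_fubini) measurable
  also have "\<dots> = (\<integral>\<^sup>+k. ennreal \<bar>w k\<bar> * l1norm (\<lambda>z. E k (z + h) - E k z) \<partial>lborel)"
    unfolding l1norm_def by (intro nn_integral_cong nn_integral_cmult) measurable
  finally show ?thesis .
qed

lemma F_integral:
  assumes [measurable]: "g \<in> borel_measurable borel" and M: "\<And>z. norm (g z) \<le> M"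
  shows "(\<integral>z. g z * F z \<partial>lborel) = (\<integral>k. complex_of_real (w k) * (\<integral>z. g z * E k z \<partial>lborel) \<partial>lborel)"
proof -
  have M0: "M \<ge> 0" using M[of undefined] norm_ge_zero order_trans by blast
  have "(\<integral>z. g z * F z \<partial>lborel) = (\<integral>z. \<integral>k. g z * (complex_of_real (w k) * E k z) \<partial>lborel \<partial>lborel)"
    unfolding F_def by simp
  also have "\<dots> = (\<integral>k. \<integral>z. g z * (complex_of_real (w k) * E k z) \<partial>lborel \<partial>lborel)"
  proof (rule integral_lborel_fubini)
    have "(\<integral>\<^sup>+z. \<integral>\<^sup>+k. norm (g z * (complex_of_real (w k) * E k z)) \<partial>lborel \<partial>lborel)
      \<le> (\<integral>\<^sup>+z. \<integral>\<^sup>+k. ennreal M * norm (complex_of_real (w k) * E k z) \<partial>lborel \<partial>lborel)"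
    proof (intro nn_integral_mono)
      fix z k
      have "norm (g z) * norm (complex_of_real (w k) * E k z) \<le> M * norm (complex_of_real (w k) * E k z)"
        by (intro mult_right_mono M) auto
      then show "ennreal (norm (g z * (complex_of_real (w k) * E k z))) \<le> ennreal M * norm (complex_of_real (w k) * E k z)"
        using M0 by (subst ennreal_mult[symmetric]) (auto simp: norm_mult[of "g z"] intro!: ennreal_leI)
    qed
    also have "\<dots> = ennreal M * (\<integral>\<^sup>+z. \<integral>\<^sup>+k. norm (complex_of_real (w k) * E k z) \<partial>lborel \<partial>lborel)"
      by (simp add: nn_integral_cmult)
    also have "\<dots> < \<infinity>" using prod_fin by (simp add: ennreal_mult_less_top)
    finally show "(\<integral>\<^sup>+z. \<integral>\<^sup>+k. norm (g z * (complex_of_real (w k) * E k z)) \<partial>lborel \<partial>lborel) < \<infinity>" .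
  qed measurable
  also have "\<dots> = (\<integral>k. complex_of_real (w k) * (\<integral>z. g z * E k z \<partial>lborel) \<partial>lborel)"
    by (intro Bochner_Integration.integral_cong refl, subst integral_mult_right_zero[symmetric])
      (simp add: mult.left_commute)
  finally show ?thesis .
qed

end

section \<open>Fractional moments and integrability of a power near the origin\<close>

lemma powr_add_le:
  fixes x y e :: real
  assumes "0 \<le> x" "0 \<le> y" "0 < e" "e \<le> 1"
  shows "(x + y) powr e \<le> x powr e + y powr e"
proof (cases "x + y = 0")
  case False
  then have s: "x + y > 0" using assms by linarith
  have le: "u * (x + y) powr (e - 1) \<le> u powr e" if "0 \<le> u" "u \<le> x + y" for u
  proof (cases "u = 0")
    case False
    then have "(x + y) powr (e - 1) \<le> u powr (e - 1)" using that assms by (intro powr_mono2') auto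
    then have "u * (x + y) powr (e - 1) \<le> u * u powr (e - 1)" using that by (intro mult_left_mono) auto
    also have "u * u powr (e - 1) = u powr e" using that by (simp add: powr_mult_base)
    finally show ?thesis .
  qed simp
  have "(x + y) powr e = x * (x + y) powr (e - 1) + y * (x + y) powr (e - 1)"
    using s powr_mult_base[of "x + y" "e - 1"] by (simp add: distrib_right)
  also have "\<dots> \<le> x powr e + y powr e" using assms by (intro add_mono le) auto
  finally show ?thesis .
qed (use assms in auto)

lemma norm_add_powr_le:
  assumes "0 < e" "e \<le> 1"
  shows "norm (x + y) powr e \<le> norm x powr e + norm y powr e"
  using assms by (intro order_trans[OF powr_mono2 powr_add_le] norm_triangle_ineq) auto

definition moment :: "real \<Rightarrow> ('a::euclidean_space \<Rightarrow> complex) \<Rightarrow> ennreal" where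
  "moment e f = (\<integral>\<^sup>+x. ennreal (norm x powr e) * ennreal (norm (f x)) \<partial>lborel)"

text \<open>For e \<le> 1 the power is subadditive, so |x|^e is at most |x - y|^e + |y|^e and the
  weight splits between the two factors.\<close>

lemma moment_conv_le:
  assumes [measurable]: "f \<in> borel_measurable borel" "g \<in> borel_measurable borel" and e: "0 < e" "e \<le> 1"
  shows "moment e (conv f g) \<le> moment e f * l1norm g + l1norm f * moment e g"
proof -
  have "moment e (conv f g) \<le> (\<integral>\<^sup>+x. \<integral>\<^sup>+y. ennreal (norm x powr e) * (ennreal (norm (f (x - y))) * ennreal (norm (g y))) \<partial>lborel \<partial>lborel)"
    unfolding moment_def
  proof (rule nn_integral_mono)
    fix x
    have "ennreal (norm x powr e) * ennreal (norm (conv f g x)) \<le> ennreal (norm x powr e) * (\<integral>\<^sup>+y. norm (f (x - y) * g y) \<partial>lborel)"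
      unfolding conv_def by (intro mult_left_mono norm_integral_le_nn_integral) auto
    also have "\<dots> = (\<integral>\<^sup>+y. ennreal (norm x powr e) * (ennreal (norm (f (x - y))) * ennreal (norm (g y))) \<partial>lborel)"
      by (subst nn_integral_cmult[symmetric]) (simp_all add: norm_mult ennreal_mult)
    finally show "ennreal (norm x powr e) * ennreal (norm (conv f g x)) \<le> (\<integral>\<^sup>+y. ennreal (norm x powr e) * (ennreal (norm (f (x - y))) * ennreal (norm (g y))) \<partial>lborel)" .
  qed
  also have "\<dots> = (\<integral>\<^sup>+y. \<integral>\<^sup>+x. ennreal (norm x powr e) * (ennreal (norm (f (x - y))) * ennreal (norm (g y))) \<partial>lborel \<partial>lborel)"
    by (rule nn_integral_lborel_fubini) measurable
  also have "\<dots> \<le> (\<integral>\<^sup>+y. moment e f * ennreal (norm (g y)) + l1norm f * (ennreal (norm y powr e) * ennreal (norm (g y))) \<partial>lborel)"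
  proof (rule nn_integral_mono)
    fix y
    have I: "(\<integral>\<^sup>+x. ennreal (norm x powr e) * (ennreal (norm (f (x - y))) * ennreal (norm (g y))) \<partial>lborel)
      = (\<integral>\<^sup>+x. ennreal (norm ((x - y) + y) powr e) * ennreal (norm (f (x - y))) \<partial>lborel) * ennreal (norm (g y))"
      by (subst nn_integral_multc[symmetric]) (simp_all add: mult.assoc)
    have "(\<integral>\<^sup>+x. ennreal (norm ((x - y) + y) powr e) * ennreal (norm (f (x - y))) \<partial>lborel)
      = (\<integral>\<^sup>+x. ennreal (norm (x + y) powr e) * ennreal (norm (f x)) \<partial>lborel)"
      by (rule nn_integral_lborel_translate(3)[of "\<lambda>x. ennreal (norm (x + y) powr e) * ennreal (norm (f x))"]) measurable
    also have "\<dots> \<le> (\<integral>\<^sup>+x. ennreal (norm x powr e) * ennreal (norm (f x)) + ennreal (norm y powr e) * ennreal (norm (f x)) \<partial>lborel)"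
    proof (rule nn_integral_mono)
      fix x
      have "ennreal (norm (x + y) powr e) \<le> ennreal (norm x powr e) + ennreal (norm y powr e)"
        using norm_add_powr_le[OF e, of x y] by (simp add: ennreal_leI flip: ennreal_plus)
      then show "ennreal (norm (x + y) powr e) * ennreal (norm (f x)) \<le> ennreal (norm x powr e) * ennreal (norm (f x)) + ennreal (norm y powr e) * ennreal (norm (f x))"
        unfolding distrib_right[symmetric] by (rule mult_right_mono) simp
    qed
    also have "\<dots> = moment e f + ennreal (norm y powr e) * l1norm f"
      unfolding moment_def l1norm_def by (subst nn_integral_add) (simp_all add: nn_integral_cmult)
    finally have "(\<integral>\<^sup>+x. ennreal (norm ((x - y) + y) powr e) * ennreal (norm (f (x - y))) \<partial>lborel) * ennreal (norm (g y))
        \<le> (moment e f + ennreal (norm y powr e) * l1norm f) * ennreal (norm (g y))"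
      by (rule mult_right_mono) simp
    also have "\<dots> = moment e f * ennreal (norm (g y)) + l1norm f * (ennreal (norm y powr e) * ennreal (norm (g y)))"
      by (simp only: distrib_right mult.assoc mult.left_commute[of "l1norm f"])
    finally show "(\<integral>\<^sup>+x. ennreal (norm x powr e) * (ennreal (norm (f (x - y))) * ennreal (norm (g y))) \<partial>lborel)
        \<le> moment e f * ennreal (norm (g y)) + l1norm f * (ennreal (norm y powr e) * ennreal (norm (g y)))"
      unfolding I .
  qed
  also have "\<dots> = moment e f * l1norm g + l1norm f * moment e g"
    unfolding l1norm_def[of g] moment_def[of e g]
    by (subst nn_integral_add) (simp_all add: nn_integral_cmult)
  finally show ?thesis .
qed

lemma moment_translate_le:
  assumes [measurable]: "f \<in> borel_measurable borel" and e: "0 < e" "e \<le> 1"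
  shows "moment e (\<lambda>x. f (x + a)) \<le> moment e f + ennreal (norm a powr e) * l1norm f"
proof -
  have "moment e (\<lambda>x. f (x + a)) = (\<integral>\<^sup>+x. ennreal (norm (x - a) powr e) * ennreal (norm (f x)) \<partial>lborel)"
    unfolding moment_def
    using nn_integral_lborel_translate(2)[of "\<lambda>x. ennreal (norm (x - a) powr e) * ennreal (norm (f x))" a] by simp
  also have "\<dots> \<le> (\<integral>\<^sup>+x. ennreal (norm x powr e) * ennreal (norm (f x)) + ennreal (norm a powr e) * ennreal (norm (f x)) \<partial>lborel)"
  proof (rule nn_integral_mono)
    fix x
    have "ennreal (norm (x - a) powr e) \<le> ennreal (norm x powr e) + ennreal (norm a powr e)"
      using norm_add_powr_le[OF e, of x "- a"] by (simp add: ennreal_leI flip: ennreal_plus)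
    then show "ennreal (norm (x - a) powr e) * ennreal (norm (f x)) \<le> ennreal (norm x powr e) * ennreal (norm (f x)) + ennreal (norm a powr e) * ennreal (norm (f x))"
      unfolding distrib_right[symmetric] by (rule mult_right_mono) simp
  qed
  also have "\<dots> = moment e f + ennreal (norm a powr e) * l1norm f"
    unfolding moment_def l1norm_def by (subst nn_integral_add) (simp_all add: nn_integral_cmult)
  finally show ?thesis .
qed

text \<open>Polar coordinates are replaced by writing |k|^(n-d) as (d - n) times the integral of
  rho^(n-d-1) over rho \<ge> |k|. After Fubini only the volume of a ball, of order rho^d, is
  needed.\<close>

lemma nn_integral_ball_powr:
  fixes n :: real
  assumes n: "0 < n" "n < 1"
  shows "(\<integral>\<^sup>+k. indicator {k. norm k < 1} k * ennreal (norm (k::'a::euclidean_space) powr (n - DIM('a))) \<partial>lborel) < \<infinity>"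
proof -
  let ?d = "real DIM('a)"
  have d: "?d \<ge> 1" by simp
  then have dn: "?d - n > 0" using n by linarith
  let ?H = "\<lambda>(\<rho>::real) (k::'a). indicator {k. norm k < 1} k * (ennreal (\<rho> powr (n - ?d - 1)) * indicator {\<rho>. norm k \<le> \<rho> \<and> 0 < \<rho>} \<rho>)"
  have "(\<integral>\<^sup>+k. indicator {k. norm k < 1} k * ennreal (norm (k::'a) powr (n - ?d)) \<partial>lborel)
    \<le> (\<integral>\<^sup>+k. ennreal (?d - n) * (\<integral>\<^sup>+\<rho>. ?H \<rho> k \<partial>lborel) \<partial>lborel)"
  proof (rule nn_integral_mono)
    fix k :: 'a
    show "indicator {k. norm k < 1} k * ennreal (norm k powr (n - ?d)) \<le> ennreal (?d - n) * (\<integral>\<^sup>+\<rho>. ?H \<rho> k \<partial>lborel)"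
    proof (cases "norm k < 1 \<and> k \<noteq> 0")
      case True
      then have k: "norm k > 0" by simp
      have "(\<integral>\<^sup>+\<rho>. ?H \<rho> k \<partial>lborel) = (\<integral>\<^sup>+\<rho>. ennreal (\<rho> powr (n - ?d - 1)) * indicator {norm k..} \<rho> \<partial>lborel)"
      proof -
        have "norm k \<le> \<rho> \<and> 0 < \<rho> \<longleftrightarrow> norm k \<le> \<rho>" for \<rho> using k by linarith
        then show ?thesis using True by (intro nn_integral_cong) (auto simp: indicator_def)
      qed
      also have "\<dots> = ennreal (norm k powr (n - ?d) / (?d - n))"
      proof -
        have "- (norm k powr (n - ?d - 1 + 1)) / (n - ?d - 1 + 1) = norm k powr (n - ?d) / (?d - n)"
          using n d by (simp add: divide_simps) (simp add: algebra_simps)?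
        then show ?thesis using nn_integral_powr_inf[of "n - ?d - 1" "norm k"] k n d by simp
      qed
      finally have "ennreal (?d - n) * (\<integral>\<^sup>+\<rho>. ?H \<rho> k \<partial>lborel) = ennreal (norm k powr (n - ?d))"
        using dn by (simp only:) (subst ennreal_mult[symmetric], auto)
      then show ?thesis using True by simp
    qed auto
  qed
  also have "\<dots> = ennreal (?d - n) * (\<integral>\<^sup>+k. \<integral>\<^sup>+\<rho>. ?H \<rho> k \<partial>lborel \<partial>lborel)"
    by (rule nn_integral_cmult) measurable
  also have "(\<integral>\<^sup>+k. \<integral>\<^sup>+\<rho>. ?H \<rho> k \<partial>lborel \<partial>lborel) = (\<integral>\<^sup>+\<rho>. \<integral>\<^sup>+k. ?H \<rho> k \<partial>lborel \<partial>lborel)"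
    by (rule nn_integral_lborel_fubini) measurable
  also have "\<dots> \<le> (\<integral>\<^sup>+\<rho>. ennreal (4 ^ DIM('a)) * (ennreal (\<rho> powr (n - 1)) * indicator {0<..<1} \<rho>)
      + ennreal (4 ^ DIM('a)) * (ennreal (\<rho> powr (n - ?d - 1)) * indicator {1..} \<rho>) \<partial>lborel)"
  proof (rule nn_integral_mono)
    fix \<rho> :: real
    show "(\<integral>\<^sup>+k. ?H \<rho> k \<partial>lborel) \<le> ennreal (4 ^ DIM('a)) * (ennreal (\<rho> powr (n - 1)) * indicator {0<..<1} \<rho>)
      + ennreal (4 ^ DIM('a)) * (ennreal (\<rho> powr (n - ?d - 1)) * indicator {1..} \<rho>)"
    proof (cases "\<rho> > 0")
      case True
      \<comment> \<open>The constraints give |k| \<le> min \<open>\<rho>\<close> 1; doubling the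
        radius places such points inside an open ball.\<close>
      have "(\<integral>\<^sup>+k. ?H \<rho> k \<partial>lborel) \<le> (\<integral>\<^sup>+k. ennreal (\<rho> powr (n - ?d - 1)) * indicator (ball (0::'a) (2 * min \<rho> 1)) k \<partial>lborel)"
        using True by (intro nn_integral_mono) (auto simp: indicator_def)
      also have "\<dots> = ennreal (\<rho> powr (n - ?d - 1)) * emeasure lborel (ball (0::'a) (2 * min \<rho> 1))"
        by (subst nn_integral_cmult_indicator) auto
      also have "\<dots> \<le> ennreal (\<rho> powr (n - ?d - 1)) * ennreal ((2 * (2 * min \<rho> 1)) ^ DIM('a))"
        using True by (intro mult_left_mono emeasure_ball_le) auto
      also have "\<dots> \<le> ennreal (4 ^ DIM('a)) * (ennreal (\<rho> powr (n - 1)) * indicator {0<..<1} \<rho>)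
      + ennreal (4 ^ DIM('a)) * (ennreal (\<rho> powr (n - ?d - 1)) * indicator {1..} \<rho>)"
      proof (cases "\<rho> < 1")
        case True
        have "\<rho> powr (n - ?d - 1) * (4 * \<rho>) ^ DIM('a) = 4 ^ DIM('a) * (\<rho> powr (n - ?d - 1) * \<rho> powr ?d)"
          using \<open>\<rho> > 0\<close> by (simp add: power_mult_distrib powr_realpow)
        also have "\<rho> powr (n - ?d - 1) * \<rho> powr ?d = \<rho> powr (n - 1)" by (simp flip: powr_add)
        finally have "ennreal (\<rho> powr (n - ?d - 1) * (4 * \<rho>) ^ DIM('a)) = ennreal (4 ^ DIM('a) * \<rho> powr (n - 1))"
          by (rule arg_cong)
        then show ?thesis using True \<open>\<rho> > 0\<close> by (simp add: ennreal_mult)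
      next
        case False
        then show ?thesis by (simp add: mult.commute)
      qed
      finally show ?thesis .
    qed simp
  qed
  also have "\<dots> = ennreal (4 ^ DIM('a)) * (\<integral>\<^sup>+\<rho>. ennreal (\<rho> powr (n - 1)) * indicator {0<..<1} \<rho> \<partial>lborel)
      + ennreal (4 ^ DIM('a)) * (\<integral>\<^sup>+\<rho>. ennreal (\<rho> powr (n - ?d - 1)) * indicator {1..} \<rho> \<partial>lborel)"
    by (subst nn_integral_add) (simp_all add: nn_integral_cmult)
  finally have "(\<integral>\<^sup>+k. indicator {k. norm k < 1} k * ennreal (norm (k::'a) powr (n - ?d)) \<partial>lborel)
    \<le> ennreal (?d - n) * (ennreal (4 ^ DIM('a)) * (\<integral>\<^sup>+\<rho>. ennreal (\<rho> powr (n - 1)) * indicator {0<..<1} \<rho> \<partial>lborel)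
      + ennreal (4 ^ DIM('a)) * (\<integral>\<^sup>+\<rho>. ennreal (\<rho> powr (n - ?d - 1)) * indicator {1..} \<rho> \<partial>lborel))"
    by (simp add: mult_left_mono)
  also have "\<dots> < \<infinity>"
    using nn_integral_powr_0[of "n - 1" 1] nn_integral_powr_inf[of "n - ?d - 1" 1] n d
    by (simp add: ennreal_mult_less_top)
  finally show ?thesis .
qed

text \<open>The density of \<open>s\<close> times a variable with density \<open>p\<close>; unlike
  \<open>dilate\<close> it does not reflect.\<close>

definition dil :: "real \<Rightarrow> ('a::euclidean_space \<Rightarrow> complex) \<Rightarrow> 'a \<Rightarrow> complex" where
  "dil s p z = complex_of_real (1 / s ^ DIM('a)) * p (z /\<^sub>R s)"

lemma nn_integral_dil:
  fixes F :: "'a::euclidean_space \<Rightarrow> ennreal"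
  assumes [measurable]: "F \<in> borel_measurable borel" and s: "s > 0"
  shows "(\<integral>\<^sup>+y. ennreal (1 / s ^ DIM('a)) * F (y /\<^sub>R s) \<partial>lborel) = (\<integral>\<^sup>+y. F y \<partial>lborel)"
  using nn_integral_dilate[of "\<lambda>y. F (- y)" s] s nn_integral_lborel_translate(5)[of F] by simp

lemma integral_dil:
  fixes p f :: "'a::euclidean_space \<Rightarrow> complex"
  assumes [measurable]: "p \<in> borel_measurable borel" "f \<in> borel_measurable borel" and s: "s > 0"
  shows "(\<integral>z. f z * dil s p z \<partial>lborel) = (\<integral>z. f (s *\<^sub>R z) * p z \<partial>lborel)"
proof -
  have "(\<lambda>z. f z * dil s p z) \<in> borel_measurable borel" unfolding dil_def by measurable
  from lborel_integral_affine[OF this, of s 0] s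
  have "(\<integral>z. f z * dil s p z \<partial>lborel) = complex_of_real (s ^ DIM('a)) * (\<integral>z. f (s *\<^sub>R z) * dil s p (s *\<^sub>R z) \<partial>lborel)"
    by (simp add: scaleR_conv_of_real)
  also have "\<dots> = (\<integral>z. f (s *\<^sub>R z) * p z \<partial>lborel)"
    unfolding integral_mult_right_zero[symmetric] dil_def
    using s by (intro Bochner_Integration.integral_cong refl) simp
  finally show ?thesis .
qed

text \<open>The density of \<open>v powr (1 / \<alpha>)\<close> times a stable variable, mixed over the weight of the subordinator.\<close>

definition subordinate :: "real \<Rightarrow> ('a::euclidean_space \<Rightarrow> complex) \<Rightarrow> 'a \<Rightarrow> complex" where
  "subordinate \<alpha> p z = (\<integral>v. complex_of_real (sub_weight v) * dil (v powr (1 / \<alpha>)) p z \<partial>lborel)"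

text \<open>Dilation by v^(1/\<open>\<alpha>\<close>) multiplies the moment by
  v^(e/\<open>\<alpha>\<close>) and the translation modulus by v^(-g/\<open>\<alpha>\<close>). Both
  powers have finite mean under \<open>sub_weight\<close>, the first because e <
  \<open>\<alpha>\<close> / 2, the second because its exponent is negative.\<close>

lemma subordinate_facts:
  fixes p :: "'a::euclidean_space \<Rightarrow> complex"
  assumes p: "integrable lborel p" and \<alpha>: "\<alpha> > 0"
    and e: "0 < e" "e < \<alpha> / 2" "e \<le> 1" and mom: "moment e p < \<infinity>"
    and g: "g > 0" and A: "A \<ge> 0" and hoel: "\<And>h. l1norm (\<lambda>x. p (x + h) - p x) \<le> ennreal (A * norm h powr g)"
  defines "q \<equiv> subordinate \<alpha> p"
  shows "integrable lborel q"
    and "moment e q < \<infinity>"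
    and "\<exists>B\<ge>0. \<forall>h. l1norm (\<lambda>x. q (x + h) - q x) \<le> ennreal (B * norm h powr g)"
    and "\<And>f M. f \<in> borel_measurable borel \<Longrightarrow> (\<And>x. norm (f x) \<le> M) \<Longrightarrow>
      (\<integral>z. f z * q z \<partial>lborel) = (\<integral>v. complex_of_real (sub_weight v) * (\<integral>z. f (v powr (1 / \<alpha>) *\<^sub>R z) * p z \<partial>lborel) \<partial>lborel)"
proof -
  have [measurable]: "p \<in> borel_measurable borel" using p by auto
  let ?E = "\<lambda>v. dil (v powr (1 / \<alpha>)) p"
  have l1: "l1norm (?E v) = l1norm p" if "v > 0" for v
    unfolding l1norm_def dil_def
    using nn_integral_dil[of "\<lambda>y. ennreal (norm (p y))" "v powr (1 / \<alpha>)"] that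
    by (subst ennreal_norm_of_real_mult) auto
  have wl1: "ennreal \<bar>sub_weight v\<bar> * l1norm (?E v) = ennreal (sub_weight v) * l1norm p" for v
    by (cases "v > 0") (auto simp: l1)
  have w1: "(\<integral>\<^sup>+v. ennreal (sub_weight v) \<partial>lborel) < \<infinity>"
  proof -
    have "sub_weight v * v powr 0 = sub_weight v" for v by (cases "v > 0") auto
    moreover have "(\<integral>\<^sup>+v. ennreal (sub_weight v * v powr 0) \<partial>lborel) < \<infinity>"
      by (rule sub_weight_moment) simp
    ultimately show ?thesis by (simp only:)
  qed
  interpret superposition sub_weight ?E
  proof
    show "(\<lambda>(k, z). dil (k powr (1 / \<alpha>)) p z) \<in> borel_measurable (borel \<Otimes>\<^sub>M borel)"
      unfolding dil_def by measurable
    have "(\<integral>\<^sup>+k. ennreal \<bar>sub_weight k\<bar> * l1norm (?E k) \<partial>lborel) = (\<integral>\<^sup>+k. ennreal (sub_weight k) \<partial>lborel) * l1norm p"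
      unfolding wl1 by (rule nn_integral_multc) measurable
    also have "\<dots> < \<infinity>" using w1 p by (simp add: ennreal_mult_less_top integrable_iff_l1norm)
    finally show "(\<integral>\<^sup>+k. ennreal \<bar>sub_weight k\<bar> * l1norm (?E k) \<partial>lborel) < \<infinity>" .
  qed measurable
  have qF: "q = F" unfolding q_def subordinate_def[abs_def] F_def[abs_def] ..
  show "integrable lborel q" unfolding qF by (rule F_integrable)
  have Emom: "(\<integral>\<^sup>+z. ennreal (norm z powr e) * ennreal (norm (?E v z)) \<partial>lborel) = ennreal (v powr (e / \<alpha>)) * moment e p" if v: "v > 0" for v
  proof -
    let ?s = "v powr (1 / \<alpha>)"
    have s: "?s > 0" using v by simp
    have "(\<integral>\<^sup>+z. ennreal (norm z powr e) * ennreal (norm (?E v z)) \<partial>lborel)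
      = (\<integral>\<^sup>+z. ennreal (1 / ?s ^ DIM('a)) * (ennreal (norm (?s *\<^sub>R (z /\<^sub>R ?s)) powr e) * ennreal (norm (p (z /\<^sub>R ?s)))) \<partial>lborel)"
      unfolding dil_def using s by (intro nn_integral_cong, subst ennreal_norm_of_real_mult) (auto simp: ac_simps)
    also have "\<dots> = (\<integral>\<^sup>+z. ennreal (norm (?s *\<^sub>R z) powr e) * ennreal (norm (p z)) \<partial>lborel)"
      by (rule nn_integral_dil[OF _ s]) measurable
    also have "\<dots> = (\<integral>\<^sup>+z. ennreal (v powr (e / \<alpha>)) * (ennreal (norm z powr e) * ennreal (norm (p z))) \<partial>lborel)"
      using v by (intro nn_integral_cong) (simp add: powr_mult powr_powr ennreal_mult mult.assoc)
    also have "\<dots> = ennreal (v powr (e / \<alpha>)) * moment e p"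
      unfolding moment_def by (rule nn_integral_cmult) measurable
    finally show ?thesis .
  qed
  show "moment e q < \<infinity>"
  proof -
    have "moment e q \<le> (\<integral>\<^sup>+v. ennreal \<bar>sub_weight v\<bar> * (\<integral>\<^sup>+z. ennreal (norm z powr e) * ennreal (norm (?E v z)) \<partial>lborel) \<partial>lborel)"
      unfolding qF moment_def by (rule F_weighted) measurable
    also have "\<dots> = (\<integral>\<^sup>+v. ennreal (sub_weight v * v powr (e / \<alpha>)) * moment e p \<partial>lborel)"
    proof (rule nn_integral_cong)
      fix v
      show "ennreal \<bar>sub_weight v\<bar> * (\<integral>\<^sup>+z. ennreal (norm z powr e) * ennreal (norm (?E v z)) \<partial>lborel) = ennreal (sub_weight v * v powr (e / \<alpha>)) * moment e p"
        using Emom[of v] by (cases "v > 0") (auto simp: ennreal_mult mult.assoc)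
    qed
    also have "\<dots> = (\<integral>\<^sup>+v. ennreal (sub_weight v * v powr (e / \<alpha>)) \<partial>lborel) * moment e p"
      by (rule nn_integral_multc) measurable
    also have "\<dots> < \<infinity>" using sub_weight_moment[of "e / \<alpha>"] e \<alpha> mom by (simp add: ennreal_mult_less_top field_simps)
    finally show ?thesis .
  qed
  define I where "I = enn2real (\<integral>\<^sup>+v. ennreal (sub_weight v * v powr (- g / \<alpha>)) \<partial>lborel)"
  show "\<exists>B\<ge>0. \<forall>h. l1norm (\<lambda>x. q (x + h) - q x) \<le> ennreal (B * norm h powr g)"
  proof -
    have fin: "(\<integral>\<^sup>+v. ennreal (sub_weight v * v powr (- g / \<alpha>)) \<partial>lborel) < \<infinity>"
      using g \<alpha> by (intro sub_weight_moment) (simp add: field_simps)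
    have I: "ennreal I = (\<integral>\<^sup>+v. ennreal (sub_weight v * v powr (- g / \<alpha>)) \<partial>lborel)"
      unfolding I_def using fin by (intro ennreal_enn2real) simp
    have "l1norm (\<lambda>x. q (x + h) - q x) \<le> ennreal (A * I * norm h powr g)" for h
    proof -
      have "l1norm (\<lambda>x. q (x + h) - q x) \<le> (\<integral>\<^sup>+v. ennreal \<bar>sub_weight v\<bar> * l1norm (\<lambda>z. ?E v (z + h) - ?E v z) \<partial>lborel)"
        unfolding qF by (rule F_translate)
      also have "\<dots> \<le> (\<integral>\<^sup>+v. ennreal (A * norm h powr g) * ennreal (sub_weight v * v powr (- g / \<alpha>)) \<partial>lborel)"
      proof (rule nn_integral_mono)
        fix v
        show "ennreal \<bar>sub_weight v\<bar> * l1norm (\<lambda>z. ?E v (z + h) - ?E v z) \<le> ennreal (A * norm h powr g) * ennreal (sub_weight v * v powr (- g / \<alpha>))"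
        proof (cases "v > 0")
          case True
          let ?s = "v powr (1 / \<alpha>)"
          have s: "?s > 0" using True by simp
          have "l1norm (\<lambda>z. ?E v (z + h) - ?E v z)
            = (\<integral>\<^sup>+z. ennreal (1 / ?s ^ DIM('a)) * ennreal (norm (p (z /\<^sub>R ?s + h /\<^sub>R ?s) - p (z /\<^sub>R ?s))) \<partial>lborel)"
            unfolding l1norm_def dil_def right_diff_distrib[symmetric] scaleR_add_right using s
            by (intro nn_integral_cong, subst ennreal_norm_of_real_mult) auto
          also have "\<dots> = l1norm (\<lambda>z. p (z + h /\<^sub>R ?s) - p z)"
            unfolding l1norm_def by (rule nn_integral_dil[OF _ s, of "\<lambda>z. ennreal (norm (p (z + h /\<^sub>R ?s) - p z))"]) measurable
          also have "\<dots> \<le> ennreal (A * norm (h /\<^sub>R ?s) powr g)" by (rule hoel)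
          also have "norm (h /\<^sub>R ?s) powr g = norm h powr g * v powr (- g / \<alpha>)"
          proof -
            have "norm (h /\<^sub>R ?s) = norm h * v powr (- (1 / \<alpha>))" using s by (simp add: powr_minus mult.commute)
            then show ?thesis by (simp only: powr_mult powr_powr) simp
          qed
          finally have "ennreal (sub_weight v) * l1norm (\<lambda>z. ?E v (z + h) - ?E v z) \<le> ennreal (sub_weight v) * ennreal (A * (norm h powr g * v powr (- g / \<alpha>)))"
            by (intro mult_left_mono) auto
          also have "\<dots> = ennreal (A * norm h powr g) * ennreal (sub_weight v * v powr (- g / \<alpha>))"
            using A by (simp add: ac_simps flip: ennreal_mult)
          finally show ?thesis by simp
        qed simp
      qed
      also have "\<dots> = ennreal (A * norm h powr g) * ennreal I"
        unfolding I by (rule nn_integral_cmult) measurable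
      also have "\<dots> = ennreal (A * I * norm h powr g)"
        using A by (simp add: I_def ac_simps flip: ennreal_mult)
      finally show ?thesis .
    qed
    moreover have "A * I \<ge> 0" using A by (simp add: I_def)
    ultimately show ?thesis by blast
  qed
  fix f :: "'a \<Rightarrow> complex" and M
  assume [measurable]: "f \<in> borel_measurable borel" and f: "\<And>x. norm (f x) \<le> M"
  have "(\<integral>z. f z * q z \<partial>lborel) = (\<integral>v. complex_of_real (sub_weight v) * (\<integral>z. f z * ?E v z \<partial>lborel) \<partial>lborel)"
    unfolding qF by (rule F_integral[OF _ f]) measurable
  also have "\<dots> = (\<integral>v. complex_of_real (sub_weight v) * (\<integral>z. f (v powr (1 / \<alpha>) *\<^sub>R z) * p z \<partial>lborel) \<partial>lborel)"
  proof (rule Bochner_Integration.integral_cong[OF refl])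
    fix v
    show "complex_of_real (sub_weight v) * (\<integral>z. f z * ?E v z \<partial>lborel) = complex_of_real (sub_weight v) * (\<integral>z. f (v powr (1 / \<alpha>) *\<^sub>R z) * p z \<partial>lborel)"
      using integral_dil[of p f "v powr (1 / \<alpha>)"] by (cases "v > 0") auto
  qed
  finally show "(\<integral>z. f z * q z \<partial>lborel) = (\<integral>v. complex_of_real (sub_weight v) * (\<integral>z. f (v powr (1 / \<alpha>) *\<^sub>R z) * p z \<partial>lborel) \<partial>lborel)" .
qed

section \<open>The kernel of the operator\<close>

text \<open>The translations in \<open>Q_difference\<close> act on the test function; moved to the
  density they change sign.\<close>

definition central_diff :: "('a::euclidean_space \<Rightarrow> complex) \<Rightarrow> 'a \<Rightarrow> 'a \<Rightarrow> complex" where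
  "central_diff q k z = q (z - k /\<^sub>R 2) - q (z + k /\<^sub>R 2)"

text \<open>Carries the minus sign of T together with the cutoff |h| <
  t^(2/\<open>\<alpha>\<close>), which rescaling turns into the unit ball.\<close>

definition diff_weight :: "real \<Rightarrow> 'a::euclidean_space \<Rightarrow> real" where
  "diff_weight \<alpha> k = - (indicator {k. norm k < 1} k * norm k powr (- (real DIM('a) + \<alpha>)))"

text \<open>With \<open>R = t powr (2 / \<alpha>)\<close>, the substitution \<open>h = R k\<close> in the inner integral of \<open>T_op\<close>
  leaves \<open>1 / t\<^sup>2\<close> times the average of \<open>f (x + R z)\<close> against \<open>T_kernel \<alpha> q z\<close>, where \<open>q\<close> is the
  density of \<open>Q\<^sub>1\<close>.\<close>

definition T_kernel :: "real \<Rightarrow> ('a::euclidean_space \<Rightarrow> complex) \<Rightarrow> 'a \<Rightarrow> complex" where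
  "T_kernel \<alpha> q z = (\<integral>k. complex_of_real (diff_weight \<alpha> k) * conv (central_diff q k) (central_diff q k) z \<partial>lborel)"

lemma l1norm_minus_commute: "l1norm (\<lambda>x. f x - g x) = l1norm (\<lambda>x. g x - f x)"
  unfolding l1norm_def by (simp add: norm_minus_commute)

lemma moment_diff_le:
  assumes [measurable]: "f \<in> borel_measurable borel" "g \<in> borel_measurable borel"
  shows "moment e (\<lambda>x. f x - g x) \<le> moment e f + moment e g"
  unfolding moment_def
proof (subst nn_integral_add[symmetric])
  show "(\<integral>\<^sup>+x. ennreal (norm x powr e) * ennreal (norm (f x - g x)) \<partial>lborel)
    \<le> (\<integral>\<^sup>+x. ennreal (norm x powr e) * ennreal (norm (f x)) + ennreal (norm x powr e) * ennreal (norm (g x)) \<partial>lborel)"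
  proof (rule nn_integral_mono)
    fix x
    have "ennreal (norm (f x - g x)) \<le> ennreal (norm (f x)) + ennreal (norm (g x))"
      by (simp add: norm_triangle_ineq4 ennreal_leI flip: ennreal_plus)
    then show "ennreal (norm x powr e) * ennreal (norm (f x - g x)) \<le> ennreal (norm x powr e) * ennreal (norm (f x)) + ennreal (norm x powr e) * ennreal (norm (g x))"
      unfolding distrib_left[symmetric] by (rule mult_left_mono) simp
  qed
qed measurable

text \<open>Averaging against a convolution is averaging twice, which is the form in which the
  composition of two difference operators appears.\<close>

lemma conv_integral_test:
  fixes f a b :: "'a::euclidean_space \<Rightarrow> complex"
  assumes a: "integrable lborel a" and b: "integrable lborel b"
    and [measurable]: "f \<in> borel_measurable borel" and M: "\<And>x. norm (f x) \<le> M"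
  shows "(\<integral>z. f z * conv a b z \<partial>lborel) = (\<integral>y. (\<integral>z. f (z + y) * a z \<partial>lborel) * b y \<partial>lborel)"
proof -
  have [measurable]: "a \<in> borel_measurable borel" "b \<in> borel_measurable borel" using a b by auto
  have M0: "M \<ge> 0" using M[of undefined] norm_ge_zero order_trans by blast
  have "(\<integral>z. f z * conv a b z \<partial>lborel) = (\<integral>z. \<integral>y. f z * (a (z - y) * b y) \<partial>lborel \<partial>lborel)"
    unfolding conv_def by simp
  also have "\<dots> = (\<integral>y. \<integral>z. f z * (a (z - y) * b y) \<partial>lborel \<partial>lborel)"
  proof (rule integral_lborel_fubini)
    have "(\<integral>\<^sup>+z. \<integral>\<^sup>+y. norm (f z * (a (z - y) * b y)) \<partial>lborel \<partial>lborel)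
      \<le> (\<integral>\<^sup>+z. \<integral>\<^sup>+y. ennreal M * norm (a (z - y) * b y) \<partial>lborel \<partial>lborel)"
    proof (intro nn_integral_mono)
      fix z y
      have "norm (f z) * norm (a (z - y) * b y) \<le> M * norm (a (z - y) * b y)" by (intro mult_right_mono M) auto
      then show "ennreal (norm (f z * (a (z - y) * b y))) \<le> ennreal M * norm (a (z - y) * b y)"
        using M0 by (subst ennreal_mult[symmetric]) (auto simp: norm_mult[of "f z"] intro!: ennreal_leI)
    qed
    also have "\<dots> = ennreal M * (\<integral>\<^sup>+z. \<integral>\<^sup>+y. norm (a (z - y) * b y) \<partial>lborel \<partial>lborel)"
      by (simp add: nn_integral_cmult)
    also have "\<dots> < \<infinity>" using conv_prod_fin[OF a b] by (simp add: ennreal_mult_less_top)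
    finally show "(\<integral>\<^sup>+z. \<integral>\<^sup>+y. norm (f z * (a (z - y) * b y)) \<partial>lborel \<partial>lborel) < \<infinity>" .
  qed measurable
  also have "\<dots> = (\<integral>y. (\<integral>z. f (z + y) * a z \<partial>lborel) * b y \<partial>lborel)"
  proof (rule Bochner_Integration.integral_cong[OF refl])
    fix y
    have "(\<integral>z. f z * (a (z - y) * b y) \<partial>lborel) = (\<integral>z. f z * a (z - y) \<partial>lborel) * b y"
      by (subst integral_mult_left_zero[symmetric]) (simp add: mult.assoc)
    also have "(\<integral>z. f z * a (z - y) \<partial>lborel) = (\<integral>z. f (z + y) * a z \<partial>lborel)"
      using lborel_integral_translate(3)[of "\<lambda>z. f (z + y) * a z" y] by simp
    finally show "(\<integral>z. f z * (a (z - y) * b y) \<partial>lborel) = (\<integral>z. f (z + y) * a z \<partial>lborel) * b y" .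
  qed
  finally show ?thesis .
qed

text \<open>The gap \<open>\<alpha>\<close> < g makes the k-singularity integrable, while e \<le> g
  lets a modulus of order g be weakened near 0 to the order \<open>e\<close> of the moment.\<close>

locale hoelder_density =
  fixes q :: "'a::euclidean_space \<Rightarrow> complex" and e g B \<alpha> :: real
  assumes q: "integrable lborel q" and e: "0 < e" "e \<le> g" and g: "\<alpha> < g" "g < 1" and \<alpha>: "0 < \<alpha>"
    and mom: "moment e q < \<infinity>"
    and B: "B \<ge> 0" and hoel: "\<And>h. l1norm (\<lambda>x. q (x + h) - q x) \<le> ennreal (B * norm h powr g)"
begin

abbreviation "D \<equiv> central_diff q"
abbreviation "E \<equiv> \<lambda>k. conv (D k) (D k)"
abbreviation "w \<equiv> diff_weight \<alpha> :: 'a \<Rightarrow> real"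

lemma q_meas [measurable]: "q \<in> borel_measurable borel" using q by auto

lemma D_meas [measurable]: "D k \<in> borel_measurable borel" unfolding central_diff_def[abs_def] by measurable

lemma q_shift: "integrable lborel (\<lambda>z. q (z - a))" "integrable lborel (\<lambda>z. q (z + a))"
  using integrable_lborel_translate(2,3)[OF q] by auto

lemma D_integrable: "integrable lborel (D k)"
  unfolding central_diff_def[abs_def] by (rule Bochner_Integration.integrable_diff[OF q_shift])

lemma D_l1norm: "l1norm (D k) \<le> ennreal (B * norm k powr g)"
proof -
  have eq: "(z - k /\<^sub>R 2) + k = z + k /\<^sub>R 2" for z
  proof -
    have half: "k /\<^sub>R 2 + k /\<^sub>R 2 = k" by (simp flip: scaleR_add_left)
    have "z - k /\<^sub>R 2 + (k /\<^sub>R 2 + k /\<^sub>R 2) = z + k /\<^sub>R 2" by (simp only: add.assoc[symmetric] diff_add_cancel)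
    then show ?thesis unfolding half .
  qed
  have "l1norm (D k) = l1norm (\<lambda>z. q ((z - k /\<^sub>R 2) + k) - q (z - k /\<^sub>R 2))"
    unfolding central_diff_def[abs_def] eq by (rule l1norm_minus_commute)
  also have "\<dots> = l1norm (\<lambda>z. q (z + k) - q z)"
    by (rule l1norm_translate(2)[of "\<lambda>z. q (z + k) - q z"]) measurable
  also have "\<dots> \<le> ennreal (B * norm k powr g)" by (rule hoel)
  finally show ?thesis .
qed

lemma D_translate: "l1norm (\<lambda>z. D k (z + h) - D k z) \<le> ennreal (2 * B * norm h powr g)"
proof -
  let ?u = "\<lambda>z. q (z + h) - q z"
  have "l1norm (\<lambda>z. D k (z + h) - D k z) = l1norm (\<lambda>z. ?u (z - k /\<^sub>R 2) - ?u (z + k /\<^sub>R 2))"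
    unfolding central_diff_def by (simp add: algebra_simps)
  also have "\<dots> \<le> l1norm (\<lambda>z. ?u (z - k /\<^sub>R 2)) + l1norm (\<lambda>z. ?u (z + k /\<^sub>R 2))"
    by (rule l1norm_diff_le) measurable
  also have "\<dots> = l1norm ?u + l1norm ?u"
    using l1norm_translate[of ?u "k /\<^sub>R 2"] by simp
  also have "\<dots> \<le> ennreal (B * norm h powr g) + ennreal (B * norm h powr g)" by (intro add_mono hoel)
  also have "\<dots> = ennreal (2 * B * norm h powr g)" using B by (subst ennreal_plus[symmetric]) auto
  finally show ?thesis .
qed

definition Mq :: real where "Mq = 2 * (enn2real (moment e q) + enn2real (l1norm q))"

lemma Mq_nonneg: "Mq \<ge> 0" by (simp add: Mq_def)

lemma D_moment:
  assumes k: "norm k < 1"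
  shows "moment e (D k) \<le> ennreal Mq"
proof -
  have e1: "e \<le> 1" using e g by simp
  have l1: "l1norm q < \<infinity>" using q by (simp add: integrable_iff_l1norm)
  have one: "moment e (\<lambda>z. q (z + a)) \<le> moment e q + l1norm q" if "norm a < 1" for a
  proof -
    have "norm a powr e \<le> 1 powr e" using that e by (intro powr_mono2) auto
    then have "ennreal (norm a powr e) * l1norm q \<le> 1 * l1norm q" by (intro mult_right_mono) (auto simp: ennreal_le_1)
    then show ?thesis
      using moment_translate_le[OF q_meas e(1) e1, of a] by (auto intro: order_trans add_left_mono)
  qed
  have "norm (k /\<^sub>R 2) < 1" using k by simp
  then have "moment e (\<lambda>z. q (z - k /\<^sub>R 2)) \<le> moment e q + l1norm q" "moment e (\<lambda>z. q (z + k /\<^sub>R 2)) \<le> moment e q + l1norm q"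
    using one[of "- (k /\<^sub>R 2)"] one[of "k /\<^sub>R 2"] by simp_all
  moreover have "moment e (D k) \<le> moment e (\<lambda>z. q (z - k /\<^sub>R 2)) + moment e (\<lambda>z. q (z + k /\<^sub>R 2))"
    unfolding central_diff_def[abs_def] by (rule moment_diff_le) measurable
  ultimately have "moment e (D k) \<le> (moment e q + l1norm q) + (moment e q + l1norm q)"
    by (meson add_mono order_trans)
  also have "\<dots> = ennreal Mq"
  proof -
    have "moment e q = ennreal (enn2real (moment e q))" "l1norm q = ennreal (enn2real (l1norm q))"
      using mom l1 by (auto simp: ennreal_enn2real)
    then have "moment e q + l1norm q = ennreal (enn2real (moment e q) + enn2real (l1norm q))"
      by (subst ennreal_plus) (simp_all only: enn2real_nonneg)
    then show ?thesis by (simp add: Mq_def flip: ennreal_plus)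
  qed
  finally show ?thesis .
qed

lemma FT_D_0: "FT (D k) 0 = 0"
proof -
  have "FT (D k) 0 = (\<integral>z. q (z - k /\<^sub>R 2) - q (z + k /\<^sub>R 2) \<partial>lborel)" by (simp add: FT_def central_diff_def)
  also have "\<dots> = (\<integral>z. q (z - k /\<^sub>R 2) \<partial>lborel) - (\<integral>z. q (z + k /\<^sub>R 2) \<partial>lborel)"
    by (rule Bochner_Integration.integral_diff[OF q_shift])
  also have "\<dots> = 0" using lborel_integral_translate(2,3)[OF q_meas, of "k /\<^sub>R 2"] by simp
  finally show ?thesis .
qed

lemma E_integrable: "integrable lborel (E k)" by (rule integrable_conv[OF D_integrable D_integrable])

text \<open>The two factors together give |k|^(2 g); one power is discarded, as |k| < 1, so that all
  bounds on \<open>E\<close> have the common form needed by \<open>J_bound\<close>.\<close>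

lemma E_l1norm:
  assumes k: "norm k < 1"
  shows "l1norm (E k) \<le> ennreal (B\<^sup>2 * norm k powr g)"
proof -
  have "l1norm (E k) \<le> l1norm (D k) * l1norm (D k)" by (rule l1norm_conv_le) measurable
  also have "\<dots> \<le> ennreal (B * norm k powr g) * ennreal (B * norm k powr g)" by (intro mult_mono D_l1norm) auto
  also have "\<dots> = ennreal (B\<^sup>2 * norm k powr g * norm k powr g)"
    using B by (simp add: power2_eq_square ac_simps flip: ennreal_mult)
  also have "\<dots> \<le> ennreal (B\<^sup>2 * norm k powr g)"
  proof -
    have "norm k powr g \<le> 1 powr g" using k g \<alpha> by (intro powr_mono2) auto
    then have "B\<^sup>2 * norm k powr g * norm k powr g \<le> B\<^sup>2 * norm k powr g * 1"
      by (intro mult_left_mono) auto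
    then show ?thesis by (simp add: ennreal_leI)
  qed
  finally show ?thesis .
qed

text \<open>A translation of a convolution may be loaded on one factor alone. That factor yields
  |h|^g, and the other is left to supply the |k|^g against the singularity. The identity is checked
  on the Fourier side and so holds almost everywhere.\<close>

lemma E_translate: "l1norm (\<lambda>z. E k (z + h) - E k z) \<le> ennreal (2 * B\<^sup>2 * norm h powr g * norm k powr g)"
proof -
  let ?d = "\<lambda>z. D k (z + h) - D k z"
  have Dh: "integrable lborel (\<lambda>z. D k (z + h))" by (rule integrable_lborel_translate(2)[OF D_integrable])
  have di: "integrable lborel ?d" by (rule Bochner_Integration.integrable_diff[OF Dh D_integrable])
  have Eh: "integrable lborel (\<lambda>z. E k (z + h))" by (rule integrable_lborel_translate(2)[OF E_integrable])
  have Em: "E k \<in> borel_measurable borel" by measurable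
  have "AE z in lborel. E k (z + h) - E k z = conv ?d (D k) z"
  proof (rule FT_eq_imp_AE)
    show "integrable lborel (\<lambda>z. E k (z + h) - E k z)" by (rule Bochner_Integration.integrable_diff[OF Eh E_integrable])
    show "integrable lborel (conv ?d (D k))" by (rule integrable_conv[OF di D_integrable])
    fix \<xi>
    have "FT (\<lambda>z. E k (z + h) - E k z) \<xi> = iexp (- (\<xi> \<bullet> h)) * FT (E k) \<xi> - FT (E k) \<xi>"
      by (simp only: FT_diff[OF Eh E_integrable] FT_translate[OF Em])
    also have "\<dots> = (iexp (- (\<xi> \<bullet> h)) * FT (D k) \<xi> - FT (D k) \<xi>) * FT (D k) \<xi>"
      by (simp only: FT_conv[OF D_integrable D_integrable] left_diff_distrib mult.assoc)
    also have "\<dots> = FT (conv ?d (D k)) \<xi>"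
      by (simp only: FT_conv[OF di D_integrable] FT_diff[OF Dh D_integrable] FT_translate[OF D_meas])
    finally show "FT (\<lambda>z. E k (z + h) - E k z) \<xi> = FT (conv ?d (D k)) \<xi>" .
  qed
  then have "l1norm (\<lambda>z. E k (z + h) - E k z) = l1norm (conv ?d (D k))" by (rule l1norm_AE_cong)
  also have "\<dots> \<le> l1norm ?d * l1norm (D k)" by (rule l1norm_conv_le) measurable
  also have "\<dots> \<le> ennreal (2 * B * norm h powr g) * ennreal (B * norm k powr g)" by (intro mult_mono D_translate D_l1norm) auto
  also have "\<dots> = ennreal (2 * B\<^sup>2 * norm h powr g * norm k powr g)"
    using B by (simp add: power2_eq_square ac_simps flip: ennreal_mult)
  finally show ?thesis .
qed

lemma E_moment:
  assumes k: "norm k < 1"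
  shows "moment e (E k) \<le> ennreal (2 * Mq * B * norm k powr g)"
proof -
  have "moment e (E k) \<le> moment e (D k) * l1norm (D k) + l1norm (D k) * moment e (D k)"
    using e g by (intro moment_conv_le) auto
  also have "\<dots> \<le> ennreal Mq * ennreal (B * norm k powr g) + ennreal (B * norm k powr g) * ennreal Mq"
    by (intro add_mono mult_mono D_l1norm D_moment k) auto
  also have "\<dots> = ennreal (2 * Mq * B * norm k powr g)"
  proof -
    have "ennreal Mq * ennreal (B * norm k powr g) = ennreal (Mq * B * norm k powr g)"
      using B Mq_nonneg by (simp add: mult.assoc flip: ennreal_mult)
    moreover have "ennreal (Mq * B * norm k powr g) + ennreal (Mq * B * norm k powr g) = ennreal (2 * Mq * B * norm k powr g)"
      using B Mq_nonneg by (subst ennreal_plus[symmetric]) auto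
    ultimately show ?thesis by (simp only: mult.commute[of _ "ennreal Mq"])
  qed
  finally show ?thesis .
qed

definition J :: real where "J = enn2real (\<integral>\<^sup>+k. ennreal \<bar>w k\<bar> * ennreal (norm k powr g) \<partial>lborel)"

lemma w_meas [measurable]: "w \<in> borel_measurable borel" unfolding diff_weight_def[abs_def] by measurable

text \<open>The combined exponent is (g - \<open>\<alpha>\<close>) - d with 0 < g -
  \<open>\<alpha>\<close> < 1, the range of \<open>nn_integral_ball_powr\<close>.\<close>

lemma J_eq: "ennreal J = (\<integral>\<^sup>+k. ennreal \<bar>w k\<bar> * ennreal (norm k powr g) \<partial>lborel)"
proof -
  have "(\<integral>\<^sup>+k. ennreal \<bar>w k\<bar> * ennreal (norm k powr g) \<partial>lborel)
    = (\<integral>\<^sup>+k. indicator {k. norm k < 1} k * ennreal (norm (k::'a) powr ((g - \<alpha>) - DIM('a))) \<partial>lborel)"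
  proof (rule nn_integral_cong)
    fix k :: 'a
    have "norm k powr (- (real DIM('a) + \<alpha>)) * norm k powr g = norm k powr ((g - \<alpha>) - DIM('a))"
      by (simp flip: powr_add) (simp add: algebra_simps)?
    then show "ennreal \<bar>w k\<bar> * ennreal (norm k powr g) = indicator {k. norm k < 1} k * ennreal (norm k powr ((g - \<alpha>) - DIM('a)))"
      by (simp add: diff_weight_def indicator_def flip: ennreal_mult)
  qed
  also have "\<dots> < \<infinity>" using g \<alpha> by (intro nn_integral_ball_powr) auto
  finally show ?thesis unfolding J_def by (intro ennreal_enn2real) simp
qed

lemma J_nonneg: "J \<ge> 0" by (simp add: J_def)

lemma J_bound:
  assumes "\<And>k. norm k < 1 \<Longrightarrow> N k \<le> ennreal (c * norm k powr g)" and c: "c \<ge> 0"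
  shows "(\<integral>\<^sup>+k. ennreal \<bar>w k\<bar> * N k \<partial>lborel) \<le> ennreal (c * J)"
proof -
  have "(\<integral>\<^sup>+k. ennreal \<bar>w k\<bar> * N k \<partial>lborel) \<le> (\<integral>\<^sup>+k. ennreal c * (ennreal \<bar>w k\<bar> * ennreal (norm k powr g)) \<partial>lborel)"
  proof (rule nn_integral_mono)
    fix k :: 'a
    show "ennreal \<bar>w k\<bar> * N k \<le> ennreal c * (ennreal \<bar>w k\<bar> * ennreal (norm k powr g))"
    proof (cases "norm k < 1")
      case True
      have "ennreal \<bar>w k\<bar> * N k \<le> ennreal \<bar>w k\<bar> * ennreal (c * norm k powr g)"
        by (intro mult_left_mono assms True) auto
      then show ?thesis using c by (simp add: ennreal_mult mult.left_commute)
    qed (simp add: diff_weight_def)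
  qed
  also have "\<dots> = ennreal c * ennreal J" unfolding J_eq by (rule nn_integral_cmult) measurable
  also have "\<dots> = ennreal (c * J)" using c J_nonneg by (simp add: ennreal_mult)
  finally show ?thesis .
qed

sublocale superposition w E
proof
  show "(\<lambda>(k, z). E k z) \<in> borel_measurable (borel \<Otimes>\<^sub>M borel)"
    unfolding conv_def central_diff_def by measurable
  have "(\<integral>\<^sup>+k. ennreal \<bar>w k\<bar> * l1norm (E k) \<partial>lborel) \<le> ennreal (B\<^sup>2 * J)"
    by (rule J_bound[OF E_l1norm]) auto
  then show "(\<integral>\<^sup>+k. ennreal \<bar>w k\<bar> * l1norm (E k) \<partial>lborel) < \<infinity>" by (rule le_less_trans) simp
qed measurable

lemma T_kernel_eq: "T_kernel \<alpha> q = F" unfolding T_kernel_def[abs_def] F_def[abs_def] ..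

text \<open>For |h| \<le> 1 the modulus of order g is weakened to order \<open>e\<close>; for larger
  h twice the norm of the kernel suffices. The mean vanishes because each central difference has
  mean zero.\<close>

lemma T_kernel_profile: "\<exists>C. profile e C (T_kernel \<alpha> q)"
proof -
  define C where "C = 4 * B\<^sup>2 * J + 2 * Mq * B * J"
  have C: "C \<ge> 0" "4 * B\<^sup>2 * J \<le> C" "2 * Mq * B * J \<le> C" using B Mq_nonneg J_nonneg by (auto simp: C_def)
  have N: "l1norm F \<le> ennreal (B\<^sup>2 * J)"
    by (rule order_trans[OF F_l1norm J_bound[OF E_l1norm]]) auto
  have tr: "l1norm (\<lambda>x. F (x + h) - F x) \<le> ennreal (C * norm h powr e)" for h
  proof (cases "norm h \<le> 1")
    case True
    have "l1norm (\<lambda>x. F (x + h) - F x) \<le> ennreal (2 * B\<^sup>2 * norm h powr g * J)"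
      by (rule order_trans[OF F_translate J_bound[OF E_translate]]) auto
    also have "\<dots> \<le> ennreal (C * norm h powr e)"
    proof (rule ennreal_leI)
      have "norm h powr g \<le> norm h powr e"
      proof (cases "h = 0")
        case False
        then show ?thesis using True e by (intro powr_mono') auto
      qed simp
      then have "2 * B\<^sup>2 * J * norm h powr g \<le> 2 * B\<^sup>2 * J * norm h powr e"
        using J_nonneg by (intro mult_left_mono) auto
      also have "\<dots> \<le> C * norm h powr e" using C J_nonneg by (intro mult_right_mono) auto
      finally show "2 * B\<^sup>2 * norm h powr g * J \<le> C * norm h powr e" by (simp add: ac_simps)
    qed
    finally show ?thesis .
  next
    case False
    have "l1norm (\<lambda>x. F (x + h) - F x) \<le> l1norm (\<lambda>x. F (x + h)) + l1norm F" by (rule l1norm_diff_le) measurable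
    also have "\<dots> = l1norm F + l1norm F" using l1norm_translate(1)[OF F_meas] by simp
    also have "\<dots> \<le> ennreal (B\<^sup>2 * J) + ennreal (B\<^sup>2 * J)" by (intro add_mono N)
    also have "\<dots> = ennreal (2 * B\<^sup>2 * J * 1)" using J_nonneg by (subst ennreal_plus[symmetric]) auto
    also have "\<dots> \<le> ennreal (C * norm h powr e)"
    proof (intro ennreal_leI mult_mono)
      show "1 \<le> norm h powr e" using False e by (intro ge_one_powr_ge_zero) auto
      have "0 \<le> B\<^sup>2 * J" using J_nonneg by simp
      then show "2 * B\<^sup>2 * J \<le> C" using C(2) by linarith
    qed (use C in auto)
    finally show ?thesis .
  qed
  have mo: "(\<integral>\<^sup>+x. ennreal (norm x powr e * norm (F x)) \<partial>lborel) \<le> ennreal C"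
  proof -
    have "(\<integral>\<^sup>+x. ennreal (norm x powr e * norm (F x)) \<partial>lborel) = (\<integral>\<^sup>+x. ennreal (norm x powr e) * ennreal (norm (F x)) \<partial>lborel)"
      by (simp add: ennreal_mult)
    also have "\<dots> \<le> (\<integral>\<^sup>+k. ennreal \<bar>w k\<bar> * moment e (E k) \<partial>lborel)"
      unfolding moment_def by (rule F_weighted) measurable
    also have "\<dots> \<le> ennreal (2 * Mq * B * J)" by (rule J_bound[OF E_moment]) (use Mq_nonneg B in auto)
    also have "\<dots> \<le> ennreal C" using C by (intro ennreal_leI) auto
    finally show ?thesis .
  qed
  have "FT F 0 = 0"
  proof -
    have z: "(\<integral>z. 1 * E k z \<partial>lborel) = 0" for k
    proof -
      have "FT (E k) 0 = FT (D k) 0 * FT (D k) 0" by (rule FT_conv[OF D_integrable D_integrable])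
      then have "FT (E k) 0 = 0" by (simp only: FT_D_0 mult_zero_left)
      then show ?thesis unfolding FT_def by simp
    qed
    have "FT F 0 = (\<integral>z. 1 * F z \<partial>lborel)" by (simp add: FT_def)
    also have "\<dots> = (\<integral>k. complex_of_real (w k) * (\<integral>z. 1 * E k z \<partial>lborel) \<partial>lborel)"
      by (rule F_integral[of _ 1]) auto
    also have "\<dots> = 0" unfolding z by simp
    finally show ?thesis .
  qed
  then have "profile e C F"
    using e g C tr mo F_integrable unfolding profile_def by auto
  then show ?thesis unfolding T_kernel_eq by blast
qed

lemma T_kernel_integral:
  assumes [measurable]: "f \<in> borel_measurable borel" and M: "\<And>x. norm (f x) \<le> M"
  shows "(\<integral>z. f z * T_kernel \<alpha> q z \<partial>lborel)
    = (\<integral>k. complex_of_real (w k) * (\<integral>y. (\<integral>z. f (z + y) * D k z \<partial>lborel) * D k y \<partial>lborel) \<partial>lborel)"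
  unfolding T_kernel_eq F_integral[OF assms] conv_integral_test[OF D_integrable D_integrable assms] ..

end

section \<open>The semigroup\<close>

text \<open>The semigroup is an expectation under the law of x + Y s. This change of variables is
  valid for every Borel \<open>f\<close>, integrable or not, so \<open>f\<close> needs no bound
  here.\<close>

lemma heat_semigroup_expectation:
  fixes u :: "real \<Rightarrow> 'a::euclidean_space \<Rightarrow> 'a \<Rightarrow> real"
  assumes u: "transition_density M Y u" and s: "s > 0" and [measurable]: "f \<in> borel_measurable borel"
  shows "heat_semigroup u s f x = (\<integral>\<omega>. f (x + Y s \<omega>) \<partial>M)"
    and "u s x \<in> borel_measurable borel"
    and "density lborel (\<lambda>y. ennreal (u s x y)) = distr M lborel (\<lambda>\<omega>. x + Y s \<omega>)"
    and "(\<lambda>\<omega>. x + Y s \<omega>) \<in> measurable M lborel"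
proof -
  have nn: "\<And>y. 0 \<le> u s x y" and d: "distributed M lborel (\<lambda>\<omega>. x + Y s \<omega>) (\<lambda>y. ennreal (u s x y))"
    using u s by (auto simp: transition_density_def)
  have "(\<lambda>y. enn2real (ennreal (u s x y))) \<in> borel_measurable lborel"
    using distributed_borel_measurable[OF d] by measurable
  then show um [measurable]: "u s x \<in> borel_measurable borel" using nn by simp
  show eq: "density lborel (\<lambda>y. ennreal (u s x y)) = distr M lborel (\<lambda>\<omega>. x + Y s \<omega>)"
    using distributed_distr_eq_density[OF d] by simp
  show m: "(\<lambda>\<omega>. x + Y s \<omega>) \<in> measurable M lborel" using distributed_measurable[OF d] .
  have "heat_semigroup u s f x = (\<integral>y. u s x y *\<^sub>R f y \<partial>lborel)"
    unfolding heat_semigroup_def by (simp add: scaleR_conv_of_real mult.commute)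
  also have "\<dots> = (\<integral>y. f y \<partial>density lborel (\<lambda>y. ennreal (u s x y)))"
    using nn by (subst integral_density) auto
  also have "\<dots> = (\<integral>\<omega>. f (x + Y s \<omega>) \<partial>M)"
    unfolding eq by (rule integral_distr[OF m]) simp
  finally show "heat_semigroup u s f x = (\<integral>\<omega>. f (x + Y s \<omega>) \<partial>M)" .
qed

text \<open>Y s and s^(1/\<open>\<alpha>\<close>) Y 1 have the same characteristic function, hence
  almost everywhere the same density. So a single function \<open>u 1 0\<close> describes the
  semigroup at all times and points, and this also supplies joint measurability, which nothing says
  about \<open>u\<close> itself.\<close>

lemma stable_process_density:
  fixes u :: "real \<Rightarrow> 'a::euclidean_space \<Rightarrow> 'a \<Rightarrow> real"
  assumes Y: "isotropic_stable_process \<alpha> M Y" and u: "transition_density M Y u" and \<alpha>: "\<alpha> > 0"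
  shows "stable_density \<alpha> (u 1 0)"
    and "\<And>s f x. s > 0 \<Longrightarrow> f \<in> borel_measurable borel \<Longrightarrow>
      heat_semigroup u s f x = (\<integral>y. f (x + s powr (1 / \<alpha>) *\<^sub>R y) * complex_of_real (u 1 0 y) \<partial>lborel)"
proof -
  have PM: "prob_space M" and
    cf: "\<And>s \<xi>. s \<ge> 0 \<Longrightarrow> (\<integral>\<omega>. iexp (\<xi> \<bullet> Y s \<omega>) \<partial>M) = complex_of_real (exp (- s * norm \<xi> powr \<alpha>))"
    using Y by (auto simp: isotropic_stable_process_def levy_process_def)
  interpret prob_space M by (rule PM)
  define P where "P s y = complex_of_real (u s 0 y)" for s y
  have nn: "0 \<le> u s x y" if "s > 0" for s x y using u that by (auto simp: transition_density_def)
  have exp_eq: "(\<integral>\<omega>. f (Y s \<omega>) \<partial>M) = (\<integral>y. f y * P s y \<partial>lborel)"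
    if "s > 0" and [measurable]: "f \<in> borel_measurable borel" for s and f :: "'a \<Rightarrow> complex"
    using heat_semigroup_expectation(1)[OF u that, of 0] by (simp add: heat_semigroup_def P_def)
  have ui: "integrable lborel (u s 0)" if s: "s > 0" for s
  proof -
    have [measurable]: "u s 0 \<in> borel_measurable borel"
      by (rule heat_semigroup_expectation(2)[OF u s, of "\<lambda>_. 0"]) simp
    have "(\<integral>\<^sup>+y. ennreal (u s 0 y) \<partial>lborel) = emeasure (density lborel (\<lambda>y. ennreal (u s 0 y))) UNIV"
      by (subst emeasure_density) auto
    also have "\<dots> = emeasure (distr M lborel (\<lambda>\<omega>. 0 + Y s \<omega>)) UNIV"
      by (subst heat_semigroup_expectation(3)[OF u s, of "\<lambda>_. 0"]) simp_all
    also have "\<dots> = emeasure M (space M)"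
      using heat_semigroup_expectation(4)[OF u s, of "\<lambda>_. 0" 0] by (subst emeasure_distr) auto
    also have "\<dots> = 1" by (rule emeasure_space_1)
    finally show ?thesis using nn[OF s, of 0] by (simp add: integrable_iff_bounded)
  qed
  have Pi: "integrable lborel (P s)" if "s > 0" for s
    using ui[OF that] unfolding P_def[abs_def] by (simp add: complex_of_real_integrable_eq)
  then have Pm: "P s \<in> borel_measurable borel" if "s > 0" for s using that by auto
  have FTP: "FT (P s) \<xi> = complex_of_real (exp (- s * norm \<xi> powr \<alpha>))" if "s > 0" for s \<xi>
  proof -
    have "FT (P s) \<xi> = (\<integral>\<omega>. iexp (\<xi> \<bullet> Y s \<omega>) \<partial>M)"
      unfolding FT_def by (rule exp_eq[symmetric, OF that]) measurable
    then show ?thesis using cf[of s \<xi>] that by simp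
  qed
  show "stable_density \<alpha> (u 1 0)"
    unfolding stable_density_def using nn[of 1 0] ui[of 1] FTP[of 1] unfolding P_def by simp
  fix s :: real and f :: "'a \<Rightarrow> complex" and x :: 'a
  assume s: "s > 0" and [measurable]: "f \<in> borel_measurable borel"
  let ?t = "s powr (1 / \<alpha>)"
  have t: "?t > 0" using s by simp
  have P1m [measurable]: "P 1 \<in> borel_measurable borel" by (rule Pm) simp
  have di: "integrable lborel (dil ?t (P 1))"
    unfolding dil_def[abs_def] using integrable_lborel_affine[OF Pi[of 1], of "inverse ?t" 0] t by simp
  have "AE y in lborel. P s y = dil ?t (P 1) y"
  proof (rule FT_eq_imp_AE[OF Pi[OF s] di])
    fix \<xi>
    have "FT (dil ?t (P 1)) \<xi> = FT (P 1) (?t *\<^sub>R \<xi>)"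
      unfolding FT_def by (subst integral_dil[OF P1m _ t]) auto
    also have "\<dots> = complex_of_real (exp (- (norm (?t *\<^sub>R \<xi>) powr \<alpha>)))" using FTP[of 1] by simp
    also have "norm (?t *\<^sub>R \<xi>) powr \<alpha> = s * norm \<xi> powr \<alpha>"
      using s \<alpha> by (simp add: powr_mult powr_powr)
    finally show "FT (P s) \<xi> = FT (dil ?t (P 1)) \<xi>" using FTP[OF s] by simp
  qed
  then have AE: "AE y in lborel. f (x + y) * P s y = f (x + y) * dil ?t (P 1) y" by eventually_elim simp
  have [measurable]: "P s \<in> borel_measurable borel" "dil ?t (P 1) \<in> borel_measurable borel"
    using Pm[OF s] di by auto
  have "heat_semigroup u s f x = (\<integral>\<omega>. f (x + Y s \<omega>) \<partial>M)"
    by (rule heat_semigroup_expectation(1)[OF u s]) measurable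
  also have "\<dots> = (\<integral>y. f (x + y) * P s y \<partial>lborel)"
    by (rule exp_eq[OF s, of "\<lambda>y. f (x + y)"]) measurable
  also have "\<dots> = (\<integral>y. f (x + y) * dil ?t (P 1) y \<partial>lborel)"
    by (rule integral_cong_AE[OF _ _ AE]) measurable
  also have "\<dots> = (\<integral>y. f (x + ?t *\<^sub>R y) * P 1 y \<partial>lborel)"
    by (rule integral_dil[OF P1m _ t]) measurable
  finally show "heat_semigroup u s f x = (\<integral>y. f (x + ?t *\<^sub>R y) * complex_of_real (u 1 0 y) \<partial>lborel)"
    by (simp add: P_def)
qed

text \<open>The substitution s = t^2 v; the leading t^2 is its Jacobian.\<close>

lemma sub_weight_scale:
  assumes t: "t > 0"
  shows "t\<^sup>2 * (indicator {0<..} (t\<^sup>2 * v) * (t / (2 * sqrt pi) * exp (- (t\<^sup>2) / (4 * (t\<^sup>2 * v))) * (t\<^sup>2 * v) powr (- 3 / 2))) = sub_weight v"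
proof (cases "v > 0")
  case True
  have "(t\<^sup>2) powr (- 3 / 2) = t powr (- 3)"
  proof -
    have "t\<^sup>2 = t powr 2" using t by simp
    then show ?thesis by (simp only: powr_powr) simp
  qed
  also have "\<dots> = 1 / t ^ 3" using t by (simp add: powr_minus_divide)
  finally have a: "(t\<^sup>2 * v) powr (- 3 / 2) = 1 / t ^ 3 * v powr (- 3 / 2)" by (simp only: powr_mult)
  have b: "- (t\<^sup>2) / (4 * (t\<^sup>2 * v)) = - (1 / (4 * v))" using t True by (simp add: field_simps)
  have c: "t\<^sup>2 * (t / (2 * sqrt pi) * E * (1 / t ^ 3 * V)) = 1 / (2 * sqrt pi) * E * V" for E V
    using t by (simp add: power2_eq_square power3_eq_cube)
  have "t\<^sup>2 * v > 0" using t True by simp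
  then show ?thesis unfolding sub_weight_def a b using True c by simp
next
  case False
  then have "t\<^sup>2 * v \<le> 0" using t by (simp add: mult_nonneg_nonpos)
  then show ?thesis using False by (simp add: sub_weight_def)
qed

text \<open>With s = t^2 v the spatial scale s^(1/\<open>\<alpha>\<close>) factors as
  t^(2/\<open>\<alpha>\<close>) v^(1/\<open>\<alpha>\<close>); integrating out v leaves the t = 1
  density \<open>q\<close>, dilated by t^(2/\<open>\<alpha>\<close>).\<close>

lemma Q_semigroup_eq:
  fixes u :: "real \<Rightarrow> 'a::euclidean_space \<Rightarrow> 'a \<Rightarrow> real" and p :: "'a \<Rightarrow> complex"
  assumes heat: "\<And>s f x. s > 0 \<Longrightarrow> f \<in> borel_measurable borel \<Longrightarrow>
      heat_semigroup u s f x = (\<integral>y. f (x + s powr (1 / \<alpha>) *\<^sub>R y) * p y \<partial>lborel)"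
    and [measurable]: "p \<in> borel_measurable borel"
    and sub: "\<And>f M. f \<in> borel_measurable borel \<Longrightarrow> (\<And>x. norm (f x) \<le> M) \<Longrightarrow>
      (\<integral>z. f z * q z \<partial>lborel) = (\<integral>v. complex_of_real (sub_weight v) * (\<integral>z. f (v powr (1 / \<alpha>) *\<^sub>R z) * p z \<partial>lborel) \<partial>lborel)"
    and t: "t > 0" and [measurable]: "f \<in> borel_measurable borel" and M: "\<And>x. norm (f x) \<le> M"
  shows "Q_semigroup u t f x = (\<integral>z. f (x + t powr (2 / \<alpha>) *\<^sub>R z) * q z \<partial>lborel)"
proof -
  define H where "H s = (\<integral>y. f (x + s powr (1 / \<alpha>) *\<^sub>R y) * p y \<partial>lborel)" for s
  have [measurable]: "H \<in> borel_measurable borel" unfolding H_def[abs_def] by measurable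
  define G where "G s = indicator {0<..} s * (t / (2 * sqrt pi) * exp (- (t\<^sup>2) / (4 * s)) * s powr (- 3 / 2))" for s :: real
  have [measurable]: "G \<in> borel_measurable borel" unfolding G_def[abs_def] by measurable
  have G0: "G s \<ge> 0" for s using t by (simp add: G_def)
  \<comment> \<open>The measurable function \<open>H\<close> replaces the semigroup, whose values at
    s \<le> 0 are arbitrary and are hidden by the indicator.\<close>
  have hH: "indicator {0<..} s *\<^sub>R heat_semigroup u s f x = indicator {0<..} s *\<^sub>R H s" for s
    using heat[of s f x] by (cases "s > 0") (auto simp: H_def)
  have "Q_semigroup u t f x = (\<integral>s. indicator {0<..} s *\<^sub>R H s \<partial>density lborel (\<lambda>s. ennreal (G s)))"
    unfolding Q_semigroup_def set_lebesgue_integral_def subordinator_measure_def hH G_def ..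
  also have "\<dots> = (\<integral>s. G s *\<^sub>R (indicator {0<..} s *\<^sub>R H s) \<partial>lborel)"
    by (rule integral_density) (auto simp: G0)
  also have "\<dots> = (\<integral>s. G s *\<^sub>R H s \<partial>lborel)"
    by (intro Bochner_Integration.integral_cong refl) (auto simp: G_def indicator_def)
  also have "\<dots> = \<bar>t\<^sup>2\<bar> *\<^sub>R (\<integral>v. G (0 + t\<^sup>2 * v) *\<^sub>R H (0 + t\<^sup>2 * v) \<partial>lborel)"
    using t by (intro lborel_integral_real_affine) simp
  also have "\<dots> = (\<integral>v. (t\<^sup>2 * G (t\<^sup>2 * v)) *\<^sub>R H (t\<^sup>2 * v) \<partial>lborel)"
    by (subst integral_scaleR_right[symmetric]) simp
  also have "\<dots> = (\<integral>v. complex_of_real (sub_weight v) * (\<integral>z. f (x + t powr (2 / \<alpha>) *\<^sub>R (v powr (1 / \<alpha>) *\<^sub>R z)) * p z \<partial>lborel) \<partial>lborel)"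
  proof (intro Bochner_Integration.integral_cong refl)
    fix v
    have "t\<^sup>2 * G (t\<^sup>2 * v) = sub_weight v" unfolding G_def by (rule sub_weight_scale[OF t])
    moreover have "(t\<^sup>2 * v) powr (1 / \<alpha>) = t powr (2 / \<alpha>) * v powr (1 / \<alpha>)"
    proof -
      have "t\<^sup>2 = t powr 2" using t by simp
      then have "(t\<^sup>2) powr (1 / \<alpha>) = t powr (2 / \<alpha>)" by (simp only: powr_powr) simp
      then show ?thesis by (simp only: powr_mult)
    qed
    ultimately show "(t\<^sup>2 * G (t\<^sup>2 * v)) *\<^sub>R H (t\<^sup>2 * v)
      = complex_of_real (sub_weight v) * (\<integral>z. f (x + t powr (2 / \<alpha>) *\<^sub>R (v powr (1 / \<alpha>) *\<^sub>R z)) * p z \<partial>lborel)"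
      by (simp add: H_def scaleR_conv_of_real)
  qed
  also have "\<dots> = (\<integral>z. f (x + t powr (2 / \<alpha>) *\<^sub>R z) * q z \<partial>lborel)"
    by (rule sub[of "\<lambda>z. f (x + t powr (2 / \<alpha>) *\<^sub>R z)" M, symmetric]) (auto intro: M)
  finally show ?thesis .
qed

lemma Q_difference_eq:
  fixes q :: "'a::euclidean_space \<Rightarrow> complex"
  assumes Q: "\<And>f M x. f \<in> borel_measurable borel \<Longrightarrow> (\<And>x. norm (f x) \<le> M) \<Longrightarrow>
      Q_semigroup u t f x = (\<integral>z. f (x + R *\<^sub>R z) * q z \<partial>lborel)"
    and q: "integrable lborel q"
    and [measurable]: "f \<in> borel_measurable borel" and M: "\<And>x. norm (f x) \<le> M"
  shows "Q_difference u t (R *\<^sub>R k) f x = (\<integral>z. f (x + R *\<^sub>R z) * central_diff q k z \<partial>lborel)"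
proof -
  have [measurable]: "q \<in> borel_measurable borel" using q by auto
  have tr: "Q_semigroup u t (translation (R *\<^sub>R a) f) x = (\<integral>z. f (x + R *\<^sub>R z) * q (z - a) \<partial>lborel)" for a
  proof -
    have "Q_semigroup u t (translation (R *\<^sub>R a) f) x = (\<integral>z. f (x + R *\<^sub>R z + R *\<^sub>R a) * q z \<partial>lborel)"
      unfolding translation_def using M by (subst Q[of _ M]) auto
    also have "\<dots> = (\<integral>z. f (x + R *\<^sub>R (z + a)) * q ((z + a) - a) \<partial>lborel)"
      by (simp add: scaleR_add_right add.assoc)
    also have "\<dots> = (\<integral>z. f (x + R *\<^sub>R z) * q (z - a) \<partial>lborel)"
      by (rule lborel_integral_translate(2)[of "\<lambda>z. f (x + R *\<^sub>R z) * q (z - a)"]) measurable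
    finally show ?thesis .
  qed
  have i: "integrable lborel (\<lambda>z. f (x + R *\<^sub>R z) * q (z - a))" for a
    by (rule integrable_mult_bounded(2)[OF integrable_lborel_translate(3)[OF q] _ M]) measurable
  have h: "R *\<^sub>R (k /\<^sub>R 2) = R *\<^sub>R k /\<^sub>R 2" "R *\<^sub>R (- (k /\<^sub>R 2)) = - (R *\<^sub>R k /\<^sub>R 2)" by simp_all
  note t1 = tr[of "k /\<^sub>R 2", unfolded h] and t2 = tr[of "- (k /\<^sub>R 2)", unfolded h]
  have "Q_difference u t (R *\<^sub>R k) f x
    = (\<integral>z. f (x + R *\<^sub>R z) * q (z - k /\<^sub>R 2) \<partial>lborel) - (\<integral>z. f (x + R *\<^sub>R z) * q (z - - (k /\<^sub>R 2)) \<partial>lborel)"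
    unfolding Q_difference_def t1 t2 ..
  also have "\<dots> = (\<integral>z. f (x + R *\<^sub>R z) * q (z - k /\<^sub>R 2) - f (x + R *\<^sub>R z) * q (z - - (k /\<^sub>R 2)) \<partial>lborel)"
    by (rule Bochner_Integration.integral_diff[OF i i, symmetric])
  also have "\<dots> = (\<integral>z. f (x + R *\<^sub>R z) * central_diff q k z \<partial>lborel)"
    by (simp add: central_diff_def right_diff_distrib)
  finally show ?thesis .
qed

context hoelder_density
begin

text \<open>One application of the difference produces a bounded measurable function, which is again
  an admissible input for \<open>Q_difference_eq\<close>.\<close>

lemma Q_difference_square:
  assumes Q: "\<And>f M x. f \<in> borel_measurable borel \<Longrightarrow> (\<And>x. norm (f x) \<le> M) \<Longrightarrow>
      Q_semigroup u t f x = (\<integral>z. f (x + R *\<^sub>R z) * q z \<partial>lborel)"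
    and [measurable]: "f \<in> borel_measurable borel" and M: "\<And>x. norm (f x) \<le> M"
  shows "(Q_difference u t (R *\<^sub>R k) ^^ 2) f x = (\<integral>y. (\<integral>z. f (x + R *\<^sub>R (z + y)) * D k z \<partial>lborel) * D k y \<partial>lborel)"
proof -
  define g where "g = (\<lambda>x. \<integral>z. f (x + R *\<^sub>R z) * D k z \<partial>lborel)"
  have [measurable]: "g \<in> borel_measurable borel" unfolding g_def by measurable
  have Df: "Q_difference u t (R *\<^sub>R k) f = g"
    unfolding g_def by (rule ext) (rule Q_difference_eq[OF Q q _ M], auto)
  have gM: "norm (g x) \<le> M * (\<integral>z. norm (D k z) \<partial>lborel)" for x
  proof -
    have "norm (g x) \<le> (\<integral>z. norm (f (x + R *\<^sub>R z) * D k z) \<partial>lborel)"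
      unfolding g_def by (rule integral_norm_bound)
    also have "\<dots> \<le> (\<integral>z. M * norm (D k z) \<partial>lborel)"
    proof (rule Bochner_Integration.integral_mono)
      show "integrable lborel (\<lambda>z. norm (f (x + R *\<^sub>R z) * D k z))"
        by (intro integrable_norm integrable_mult_bounded(2)[OF D_integrable _ M]) measurable
      show "integrable lborel (\<lambda>z. M * norm (D k z))" using D_integrable by simp
      show "norm (f (x + R *\<^sub>R z) * D k z) \<le> M * norm (D k z)" for z
        using M by (simp add: norm_mult mult_right_mono)
    qed
    finally show ?thesis by simp
  qed
  have "(Q_difference u t (R *\<^sub>R k) ^^ 2) f x = Q_difference u t (R *\<^sub>R k) g x"
    by (simp add: numeral_2_eq_2 Df)
  also have "\<dots> = (\<integral>y. g (x + R *\<^sub>R y) * D k y \<partial>lborel)"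
    by (rule Q_difference_eq[OF Q q _ gM]) auto
  finally show ?thesis unfolding g_def by (simp add: scaleR_add_right ac_simps)
qed

text \<open>Under h = R k the volume gives R^d and the weight gives R^(-d-\<open>\<alpha>\<close>),
  so the factor R^(-\<open>\<alpha>\<close>) remains.\<close>

lemma inner_integral_eq:
  assumes Q: "\<And>f M x. f \<in> borel_measurable borel \<Longrightarrow> (\<And>x. norm (f x) \<le> M) \<Longrightarrow>
      Q_semigroup u t f x = (\<integral>z. f (x + R *\<^sub>R z) * q z \<partial>lborel)"
    and R: "R > 0"
    and [measurable]: "f \<in> borel_measurable borel" and M: "\<And>x. norm (f x) \<le> M"
  shows "set_lebesgue_integral lborel {h. norm h < R} (\<lambda>h.
         (- ((Q_difference u t h ^^ 2) f x)) / complex_of_real (norm h powr (real DIM('a) + \<alpha>)))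
    = complex_of_real (R powr (- \<alpha>)) * (\<integral>z. f (x + R *\<^sub>R z) * T_kernel \<alpha> q z \<partial>lborel)"
proof -
  define X where "X k = (\<integral>y. (\<integral>z. f (x + R *\<^sub>R (z + y)) * D k z \<partial>lborel) * D k y \<partial>lborel)" for k
  have [measurable]: "X \<in> borel_measurable borel" unfolding X_def[abs_def] central_diff_def by measurable
  define G where "G k = complex_of_real (R powr (- (real DIM('a) + \<alpha>))) * (complex_of_real (w k) * X k)" for k
  have [measurable]: "G \<in> borel_measurable borel" unfolding G_def[abs_def] by measurable
  have GX: "indicator {h. norm h < R} h *\<^sub>R ((- ((Q_difference u t h ^^ 2) f x)) / complex_of_real (norm h powr (real DIM('a) + \<alpha>)))
      = G (0 + inverse R *\<^sub>R h)" for h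
  proof -
    let ?k = "inverse R *\<^sub>R h"
    have h: "h = R *\<^sub>R ?k" using R by simp
    have X: "(Q_difference u t h ^^ 2) f x = X ?k"
      unfolding X_def by (subst h) (rule Q_difference_square[OF Q _ M], auto)
    have nh: "norm h = R * norm ?k" using R by simp
    have n: "norm h < R \<longleftrightarrow> norm ?k < 1" unfolding nh using R by simp
    have "1 / norm h powr (real DIM('a) + \<alpha>) = R powr (- (real DIM('a) + \<alpha>)) * norm ?k powr (- (real DIM('a) + \<alpha>))"
      unfolding nh powr_mult powr_minus by (simp only: divide_inverse mult_1_left inverse_mult_distrib)
    then have "complex_of_real (1 / norm h powr (real DIM('a) + \<alpha>))
        = complex_of_real (R powr (- (real DIM('a) + \<alpha>))) * complex_of_real (norm ?k powr (- (real DIM('a) + \<alpha>)))"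
      by (simp only: of_real_mult)
    then have d: "(- X ?k) / complex_of_real (norm h powr (real DIM('a) + \<alpha>))
      = complex_of_real (R powr (- (real DIM('a) + \<alpha>))) * (complex_of_real (- (norm ?k powr (- (real DIM('a) + \<alpha>)))) * X ?k)"
      by (simp add: divide_inverse mult.commute)
    show ?thesis
      unfolding X G_def diff_weight_def add_0
    proof (cases "norm h < R")
      case True
      then show "indicator {h. norm h < R} h *\<^sub>R (- X ?k / complex_of_real (norm h powr (real DIM('a) + \<alpha>)))
        = complex_of_real (R powr (- (real DIM('a) + \<alpha>))) *
          (complex_of_real (- (indicator {k. norm k < 1} ?k * norm ?k powr (- (real DIM('a) + \<alpha>)))) * X ?k)"
        using n unfolding d by (simp only: indicator_simps mem_Collect_eq) simp
    next
      case False
      then show "indicator {h. norm h < R} h *\<^sub>R (- X ?k / complex_of_real (norm h powr (real DIM('a) + \<alpha>)))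
        = complex_of_real (R powr (- (real DIM('a) + \<alpha>))) *
          (complex_of_real (- (indicator {k. norm k < 1} ?k * norm ?k powr (- (real DIM('a) + \<alpha>)))) * X ?k)"
        using n by (simp only: indicator_simps mem_Collect_eq) simp
    qed
  qed
  have "set_lebesgue_integral lborel {h. norm h < R} (\<lambda>h.
         (- ((Q_difference u t h ^^ 2) f x)) / complex_of_real (norm h powr (real DIM('a) + \<alpha>)))
    = (\<integral>h. G (0 + inverse R *\<^sub>R h) \<partial>lborel)"
    unfolding set_lebesgue_integral_def GX ..
  also have "\<dots> = (1 / \<bar>inverse R\<bar> ^ DIM('a)) *\<^sub>R (\<integral>k. G k \<partial>lborel)"
    by (rule lborel_integral_affine) (use R in auto)
  also have "1 / \<bar>inverse R\<bar> ^ DIM('a) = R powr real DIM('a)"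
    using R by (simp add: powr_realpow power_inverse divide_inverse)
  also have "(\<integral>k. G k \<partial>lborel) = complex_of_real (R powr (- (real DIM('a) + \<alpha>))) * (\<integral>k. complex_of_real (w k) * X k \<partial>lborel)"
    unfolding G_def by (rule integral_mult_right_zero)
  also have "(\<integral>k. complex_of_real (w k) * X k \<partial>lborel) = (\<integral>z. f (x + R *\<^sub>R z) * T_kernel \<alpha> q z \<partial>lborel)"
    unfolding X_def by (rule T_kernel_integral[of "\<lambda>z. f (x + R *\<^sub>R z)" M, symmetric]) (auto intro: M)
  also have "R powr real DIM('a) *\<^sub>R (complex_of_real (R powr (- (real DIM('a) + \<alpha>))) * (\<integral>z. f (x + R *\<^sub>R z) * T_kernel \<alpha> q z \<partial>lborel))
    = complex_of_real (R powr (- \<alpha>)) * (\<integral>z. f (x + R *\<^sub>R z) * T_kernel \<alpha> q z \<partial>lborel)"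
  proof -
    have "R powr real DIM('a) * R powr (- (real DIM('a) + \<alpha>)) = R powr (- \<alpha>)" by (simp flip: powr_add)
    then have "complex_of_real (R powr real DIM('a)) * complex_of_real (R powr (- (real DIM('a) + \<alpha>))) = complex_of_real (R powr (- \<alpha>))"
      by (simp only: of_real_mult[symmetric])
    then show ?thesis by (simp only: scaleR_conv_of_real mult.assoc[symmetric])
  qed
  finally show ?thesis .
qed

text \<open>At R = t^(2/\<open>\<alpha>\<close>) the factor R^(-\<open>\<alpha>\<close>) is t^(-2),
  which turns t r(t) dt into r(t) dt / t, a bounded function times the dilation-invariant
  measure.\<close>

lemma T_op_eq:
  assumes Q: "\<And>t f M x. t > 0 \<Longrightarrow> f \<in> borel_measurable borel \<Longrightarrow> (\<And>x. norm (f x) \<le> M) \<Longrightarrow>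
      Q_semigroup u t f x = (\<integral>z. f (x + t powr (2 / \<alpha>) *\<^sub>R z) * q z \<partial>lborel)"
    and [measurable]: "f \<in> borel_measurable borel" and M: "\<And>x. norm (f x) \<le> M"
  shows "T_op \<alpha> u r f x = (\<integral>t. complex_of_real (indicator {0<..} t * r t / t) * (\<integral>z. f (x + t powr (2 / \<alpha>) *\<^sub>R z) * T_kernel \<alpha> q z \<partial>lborel) \<partial>lborel)"
  unfolding T_op_def set_lebesgue_integral_def[of lborel "{0<..}"]
proof (rule Bochner_Integration.integral_cong[OF refl])
  fix t :: real
  let ?A = "set_lebesgue_integral lborel {h. norm h < t powr (2 / \<alpha>)} (\<lambda>h.
         (- ((Q_difference u t h ^^ 2) f x)) / complex_of_real (norm h powr (real DIM('a) + \<alpha>)))"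
  let ?I = "\<integral>z. f (x + t powr (2 / \<alpha>) *\<^sub>R z) * T_kernel \<alpha> q z \<partial>lborel"
  show "indicator {0<..} t *\<^sub>R (complex_of_real (t * r t) * ?A) = complex_of_real (indicator {0<..} t * r t / t) * ?I"
  proof (cases "t > 0")
    case True
    have "?A = complex_of_real ((t powr (2 / \<alpha>)) powr (- \<alpha>)) * ?I"
      by (rule inner_integral_eq[OF Q _ _ M]) (use True in auto)
    also have "(t powr (2 / \<alpha>)) powr (- \<alpha>) = t powr (- 2)" using \<alpha> by (simp add: powr_powr)
    also have "\<dots> = 1 / (t * t)" using True by (simp add: powr_minus_divide power2_eq_square)
    finally have A: "?A = complex_of_real (1 / (t * t)) * ?I" .
    have "t * r t * (1 / (t * t)) = r t / t" using True by simp
    then have "complex_of_real (t * r t) * complex_of_real (1 / (t * t)) = complex_of_real (r t / t)"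
      by (simp only: of_real_mult[symmetric])
    then have "complex_of_real (t * r t) * ?A = complex_of_real (r t / t) * ?I"
      unfolding A by (simp only: mult.assoc[symmetric])
    then show ?thesis using True by simp
  qed simp
qed

end

section \<open>Test functions, norms and the final assembly\<close>

lemma C_c_infinity_facts:
  fixes f :: "'a::euclidean_space \<Rightarrow> complex"
  assumes f: "f \<in> C_c_infinity"
  shows "continuous_on UNIV f" and "\<exists>M. \<forall>x. norm (f x) \<le> M" and "integrable lborel f"
proof -
  have "C_k 0 f" using f unfolding C_c_infinity_def by blast
  then show c: "continuous_on UNIV f" by simp
  define S where "S = closure {x. f x \<noteq> 0}"
  have S: "compact S" using f by (simp add: C_c_infinity_def S_def)
  have out: "f x = 0" if "x \<notin> S" for x using that closure_subset[of "{x. f x \<noteq> 0}"] by (auto simp: S_def)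
  have cS: "continuous_on S f" using c continuous_on_subset by blast
  then have "bounded (f ` S)" using S by (intro compact_imp_bounded compact_continuous_image)
  then obtain M where M: "\<And>x. x \<in> S \<Longrightarrow> norm (f x) \<le> M" by (auto simp: bounded_iff)
  have "norm (f x) \<le> max M 0" for x using M[of x] out[of x] by (cases "x \<in> S") auto
  then show "\<exists>M. \<forall>x. norm (f x) \<le> M" by blast
  have "integrable lborel (\<lambda>x. indicator S x *\<^sub>R f x)" by (rule borel_integrable_compact[OF S cS])
  moreover have "(\<lambda>x. indicator S x *\<^sub>R f x) = f" using out by (auto simp: indicator_def)
  ultimately show "integrable lborel f" by simp
qed

lemma bounded_on_LpI:
  fixes T :: "('a::euclidean_space \<Rightarrow> complex) \<Rightarrow> 'a \<Rightarrow> complex"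
  assumes p: "p > 1" and D: "D \<ge> 0"
    and T: "\<And>f. f \<in> C_c_infinity \<Longrightarrow> T f \<in> borel_measurable borel \<and>
      (\<integral>\<^sup>+x. ennreal (norm (T f x) powr p) \<partial>lborel) \<le> ennreal D * (\<integral>\<^sup>+x. ennreal (norm (f x) powr p) \<partial>lborel)"
  shows "bounded_on_Lp p T"
  unfolding bounded_on_Lp_def
proof (intro exI ballI)
  fix f :: "'a \<Rightarrow> complex" assume f: "f \<in> C_c_infinity"
  have [measurable]: "T f \<in> borel_measurable borel" using T[OF f] by blast
  obtain M where M: "\<And>x. norm (f x) \<le> M" using C_c_infinity_facts(2)[OF f] by blast
  have fi: "integrable lborel f" by (rule C_c_infinity_facts(3)[OF f])
  then have [measurable]: "f \<in> borel_measurable borel" by auto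
  have fp: "integrable lborel (\<lambda>x. norm (f x) powr p)"
  proof (rule Bochner_Integration.integrable_bound)
    show "integrable lborel (\<lambda>x. M powr (p - 1) * norm (f x))" using fi by simp
    show "AE x in lborel. norm (norm (f x) powr p) \<le> norm (M powr (p - 1) * norm (f x))"
    proof (rule AE_I2)
      fix x
      have "norm (f x) powr p = norm (f x) * norm (f x) powr (p - 1)" using p by (simp add: powr_mult_base)
      also have "\<dots> \<le> norm (f x) * M powr (p - 1)" using p M by (intro mult_left_mono powr_mono2) auto
      finally show "norm (norm (f x) powr p) \<le> norm (M powr (p - 1) * norm (f x))" by (simp add: mult.commute)
    qed
  qed measurable
  let ?F = "\<integral>x. norm (f x) powr p \<partial>lborel" and ?T = "\<integral>x. norm (T f x) powr p \<partial>lborel"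
  have F0: "?F \<ge> 0" and T0: "?T \<ge> 0" by (auto intro!: integral_nonneg_AE)
  have "(\<integral>\<^sup>+x. ennreal (norm (f x) powr p) \<partial>lborel) = ennreal ?F"
    by (rule nn_integral_eq_integral[OF fp]) auto
  then have le: "(\<integral>\<^sup>+x. ennreal (norm (T f x) powr p) \<partial>lborel) \<le> ennreal (D * ?F)"
    using T[OF f] D F0 by (simp add: ennreal_mult)
  have Tp: "integrable lborel (\<lambda>x. norm (T f x) powr p)"
    unfolding integrable_iff_bounded using le_less_trans[OF le] by simp
  then have "(\<integral>\<^sup>+x. ennreal (norm (T f x) powr p) \<partial>lborel) = ennreal ?T"
    by (rule nn_integral_eq_integral) auto
  with le have "?T \<le> D * ?F" using D F0 by (simp add: ennreal_le_iff)
  then have "?T powr (1 / p) \<le> (D * ?F) powr (1 / p)" using p T0 by (intro powr_mono2) auto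
  also have "\<dots> = D powr (1 / p) * ?F powr (1 / p)" by (rule powr_mult)
  finally show "in_Lp p (T f) \<and> Lp_norm p (T f) \<le> D powr (1 / p) * Lp_norm p f"
    using Tp by (simp add: in_Lp_def Lp_norm_def)
qed

theorem theorem3p1:
  fixes \<alpha> p :: real
    and M :: "'w measure"
    and Y :: "real \<Rightarrow> 'w \<Rightarrow> 'a::euclidean_space"
    and u :: "real \<Rightarrow> 'a \<Rightarrow> 'a \<Rightarrow> real"
    and r :: "real \<Rightarrow> real"
  assumes "0 < \<alpha>" and "\<alpha> < 1"
    and "1 < p"
    and "isotropic_stable_process \<alpha> M Y"
    and "transition_density M Y u"
    and "r \<in> borel_measurable (restrict_space borel {0<..})"
    and "bounded (r ` {0<..})"
  shows "bounded_on_Lp p (T_op \<alpha> u r)"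
proof -
  define \<rho> where "\<rho> = complex_of_real \<circ> u 1 0"
  have sd: "stable_density \<alpha> (u 1 0)"
    and heat: "\<And>s f x. s > 0 \<Longrightarrow> f \<in> borel_measurable borel \<Longrightarrow>
      heat_semigroup u s f x = (\<integral>y. f (x + s powr (1 / \<alpha>) *\<^sub>R y) * \<rho> y \<partial>lborel)"
    using stable_process_density[OF assms(4,5,1)] by (auto simp: \<rho>_def)
  have u0: "\<And>x. 0 \<le> u 1 0 x" and ui: "integrable lborel (u 1 0)" using sd by (auto simp: stable_density_def)
  have \<rho>i: "integrable lborel \<rho>" using ui by (simp add: \<rho>_def o_def complex_of_real_integrable_eq)
  then have \<rho>m: "\<rho> \<in> borel_measurable borel" by auto
  \<comment> \<open>The midpoint of \<open>\<alpha>\<close> and 1: above \<open>\<alpha>\<close> for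
    the k-singularity, below 1 for \<open>hoelder_bootstrap\<close>.\<close>
  define g where "g = (1 + \<alpha>) / 2"
  \<comment> \<open>Any positive order below \<open>\<alpha>\<close> / 2 gives \<open>q\<close> a
    finite moment; this one is also below \<open>g\<close>.\<close>
  define e where "e = \<alpha> / 4"
  have e: "0 < e" "e < \<alpha>" "e < \<alpha> / 2" "e \<le> 1" "e \<le> g" and g: "\<alpha> < g" "g < 1" "0 < g"
    using assms(1,2) by (auto simp: e_def g_def)
  obtain A where A: "A \<ge> 0" and hoel: "\<And>h. l1norm (\<lambda>x. \<rho> (x + h) - \<rho> x) \<le> ennreal (A * norm h powr g)"
    using stable_density_hoelder[OF sd assms(1) g(3,2)] by (auto simp: \<rho>_def)
  have mom: "moment e \<rho> < \<infinity>"
    using stable_density_moment[OF sd _ e(1,2)] assms(2) u0 by (simp add: moment_def \<rho>_def ennreal_mult)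
  define q where "q = subordinate \<alpha> \<rho>"
  note sub = subordinate_facts[OF \<rho>i assms(1) e(1,3,4) mom g(3) A hoel, folded q_def]
  obtain B where B: "B \<ge> 0" and qh: "\<And>h. l1norm (\<lambda>x. q (x + h) - q x) \<le> ennreal (B * norm h powr g)"
    using sub(3) by blast
  interpret hoelder_density q e g B \<alpha>
    using sub(1,2) e g assms(1) B qh by unfold_locales auto
  have Q: "Q_semigroup u t f x = (\<integral>z. f (x + t powr (2 / \<alpha>) *\<^sub>R z) * q z \<partial>lborel)"
    if "t > 0" "f \<in> borel_measurable borel" "\<And>x. norm (f x) \<le> N" for t f N x
    by (rule Q_semigroup_eq[OF heat \<rho>m sub(4) that])
  obtain C where C: "profile e C (T_kernel \<alpha> q)" using T_kernel_profile by blast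
  \<comment> \<open>\<open>r\<close> is controlled on the positive axis only; extending it by 0
    gives a Borel function on the whole line, as \<open>singular_integral_Lp\<close> requires,
    without changing the operator.\<close>
  define r' where "r' t = indicator {0<..} t * r t" for t
  have r'm: "r' \<in> borel_measurable borel"
    using assms(6) borel_measurable_restrict_space_iff[of "{0<..}" borel r]
    by (simp add: r'_def[abs_def])
  obtain R where R: "\<And>t. t > 0 \<Longrightarrow> \<bar>r t\<bar> \<le> R" using assms(7) by (auto simp: bounded_iff)
  have r'b: "\<bar>r' t\<bar> \<le> max R 0" for t using R[of t] by (auto simp: r'_def indicator_def)
  have "0 < 2 / \<alpha>" using assms(1) by simp
  from singular_integral_Lp[OF C this r'm r'b assms(3)]
  obtain K where K: "K \<ge> 0" and bd: "\<And>f N. integrable lborel f \<Longrightarrow> continuous_on UNIV f \<Longrightarrow> (\<forall>x. norm (f x) \<le> N) \<Longrightarrow>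
    (\<lambda>x. \<integral>t. complex_of_real (indicator {0<..} t * r' t / t) * (\<integral>z. f (x + t powr (2 / \<alpha>) *\<^sub>R z) * T_kernel \<alpha> q z \<partial>lborel) \<partial>lborel) \<in> borel_measurable borel \<and>
    (\<integral>\<^sup>+x. ennreal (norm (\<integral>t. complex_of_real (indicator {0<..} t * r' t / t) * (\<integral>z. f (x + t powr (2 / \<alpha>) *\<^sub>R z) * T_kernel \<alpha> q z \<partial>lborel) \<partial>lborel) powr p) \<partial>lborel)
      \<le> ennreal K * (\<integral>\<^sup>+x. ennreal (norm (f x) powr p) \<partial>lborel)"
    by blast
  show ?thesis
  proof (rule bounded_on_LpI[OF assms(3) K])
    fix f :: "'a \<Rightarrow> complex" assume f: "f \<in> C_c_infinity"
    note ff = C_c_infinity_facts[OF f]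
    obtain N where N: "\<forall>x. norm (f x) \<le> N" using ff(2) by blast
    have fm: "f \<in> borel_measurable borel" using ff(3) by auto
    have rr: "indicator {0<..} t * r' t / t = indicator {0<..} t * r t / t" for t :: real
      by (simp add: r'_def indicator_def)
    have "T_op \<alpha> u r f = (\<lambda>x. \<integral>t. complex_of_real (indicator {0<..} t * r' t / t) * (\<integral>z. f (x + t powr (2 / \<alpha>) *\<^sub>R z) * T_kernel \<alpha> q z \<partial>lborel) \<partial>lborel)"
      unfolding rr by (rule ext, rule T_op_eq[OF Q fm]) (use N in auto)
    then show "T_op \<alpha> u r f \<in> borel_measurable borel \<and>
      (\<integral>\<^sup>+x. ennreal (norm (T_op \<alpha> u r f x) powr p) \<partial>lborel) \<le> ennreal K * (\<integral>\<^sup>+x. ennreal (norm (f x) powr p) \<partial>lborel)"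
      using bd[OF ff(3,1) N] by simp
  qed
qed

end
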